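(* Let $k$ be a perfect field of characteristic different from $3$ and $K=k(x)$. The bi-twists of the cubic extension $K(y)/K$ with $y^3=x$ are in bijective correspondence with the isomorphism classes of pairs $(Q,D)$ consisting of a conic $Q$ over $k$ and an effective divisor $D$ on $Q$ of total degree two defined over $k$. Given $(Q,D)$, a corresponding bi-twist is obtained as follows: let $q$ be the smallest extension of $k$ splitting $D$, with non-trivial automorphism $\sigma$ when $q\ne k$, and let $\iota:\mathbb P^1\to Q$ be an isomorphism over $q$ sending $\{0,\infty\}$ to $D$; then $\sigma(\iota)=\iota\alpha$ where $\alpha(t)=\lambda/t$ for some $\lambda\in k$; let $\varphi_0:\mathbb P^1\to\mathbb P^1$ be $t\mapsto t^3/\lambda$; then $\varphi=\iota\varphi_0\iota^{-1}:Q\to Q$ is defined over $k$, is a twist of $\varphi_0$ and ramifies exactly in $D$, and the bi-twist is the extension $k(Q)/\varphi^*k(Q)$. Among these bi-twists, exactly one is purely cubic, namely the trivial one; and the bi-twists that are Galois are exactly those for which the splitting field of $D$ equals $k(\zeta_3)$.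
   Context: A cubic extension of a function field $K$ over $k$ is a separable geometric (not of the form $K\ell$, $\ell/k$ cubic) degree-three extension; it is purely cubic if generated by a root of some $X^3-\beta$, $\beta\in K$. Two cubic extensions $L_1/K_1$, $L_2/K_2$ are bi-isomorphic if there are field isomorphisms $L_1\to L_2$ and $K_1\to K_2$ compatible with the inclusions (geometrically: a commutative square of $k$-isomorphisms of curves over the base curves). A cubic extension is a bi-twist of $L_1/K$ if it becomes bi-isomorphic to $L_1/K$ after base change to $\overline k$; bi-twists are counted up to bi-isomorphism over $k$. The base of a bi-twist need not be a rational function field.
   Formalization: The effective divisor D of total degree two is required to consist of two distinct geometric points; for D = 2P no isomorphism sends {0,∞} to D, and over algebraically closed k the correspondence would fail (two classes of pairs, one bi-twist). *)

theory Defs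
  imports
    "HOL-Analysis.Analysis"
    "HOL-Library.Multiset"
    "HOL-Computational_Algebra.Polynomial"
begin

text \<open>
  Everything lives, as in Weil's Foundations, inside an algebraically closed field
  \<open>\<Omega>\<close>, given by a type of class \<^class>\<open>alg_closed_field\<close>. The ground field
  \<open>k\<close> is a subfield of \<open>\<Omega>\<close>, and \<open>\<Omega>\<close> will be assumed to contain an element that is
  transcendental over \<open>k\<close>. This loses no generality: an arbitrary field \<open>k\<close> sits in an algebraic
  closure \<open>\<Omega>\<close> of \<open>k(x)\<close>, and every tower \<open>k \<subseteq> K \<subseteq> L\<close> of function fields in one
  variable over \<open>k\<close> is \<open>k\<close>-isomorphic to a tower of subfields of \<open>\<Omega>\<close>.
\<close>

section \<open>Subfields of the universal domain\<close>

definition is_subfield :: "'a::field set \<Rightarrow> bool" where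
  "is_subfield F \<longleftrightarrow> 0 \<in> F \<and> 1 \<in> F \<and>
     (\<forall>a\<in>F. \<forall>b\<in>F. a + b \<in> F \<and> a - b \<in> F \<and> a * b \<in> F \<and> inverse a \<in> F)"

definition adjoin :: "'a::field set \<Rightarrow> 'a set \<Rightarrow> 'a set" where
  "adjoin F S = \<Inter>{E. is_subfield E \<and> F \<union> S \<subseteq> E}"

definition algebraic_over :: "'a::field set \<Rightarrow> 'a \<Rightarrow> bool" where
  "algebraic_over F a \<longleftrightarrow> (\<exists>p. p \<noteq> 0 \<and> set (coeffs p) \<subseteq> F \<and> poly p a = 0)"

text \<open>Since \<open>\<Omega>\<close> is algebraically closed, this is an algebraic closure of \<open>F\<close>.\<close>

definition alg_cl :: "'a::field set \<Rightarrow> 'a set" where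
  "alg_cl F = {a. algebraic_over F a}"

definition perfect_subfield :: "'a::field set \<Rightarrow> bool" where
  "perfect_subfield F \<longleftrightarrow> CHAR('a) = 0 \<or> (\<forall>a\<in>F. \<exists>b\<in>F. b ^ CHAR('a) = a)"

definition has_degree :: "'a::field set \<Rightarrow> 'a set \<Rightarrow> nat \<Rightarrow> bool" where
  "has_degree K L n \<longleftrightarrow> (\<exists>B. finite B \<and> card B = n \<and> B \<subseteq> L \<and>
     (\<forall>a\<in>L. \<exists>c. (\<forall>b\<in>B. c b \<in> K) \<and> a = (\<Sum>b\<in>B. c b * b)) \<and>
     (\<forall>c. (\<forall>b\<in>B. c b \<in> K) \<and> (\<Sum>b\<in>B. c b * b) = 0 \<longrightarrow> (\<forall>b\<in>B. c b = 0)))"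

text \<open>\<^const>\<open>rsquarefree\<close> refers to roots in \<open>\<Omega>\<close>, hence to all roots of the polynomial.\<close>

definition separable_ext :: "'a::field set \<Rightarrow> 'a set \<Rightarrow> bool" where
  "separable_ext K L \<longleftrightarrow>
     (\<forall>a\<in>L. \<exists>p. rsquarefree p \<and> set (coeffs p) \<subseteq> K \<and> poly p a = 0)"

definition field_iso :: "'a::field set \<Rightarrow> 'a set \<Rightarrow> 'a set \<Rightarrow> ('a \<Rightarrow> 'a) \<Rightarrow> bool" where
  "field_iso k E F f \<longleftrightarrow> bij_betw f E F \<and> (\<forall>a\<in>k. f a = a) \<and>
     (\<forall>a\<in>E. \<forall>b\<in>E. f (a + b) = f a + f b \<and> f (a * b) = f a * f b)"

definition galois_ext :: "'a::field set \<Rightarrow> 'a set \<Rightarrow> bool" where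
  "galois_ext K L \<longleftrightarrow> {a\<in>L. \<forall>f. field_iso K L L f \<longrightarrow> f a = a} = K"

section \<open>Cubic extensions and bi-twists\<close>

text \<open>Function fields in one variable with exact field of constants \<open>k\<close>, i.e. function fields of
  geometrically irreducible curves over the perfect field \<open>k\<close>.\<close>

definition function_field :: "'a::field set \<Rightarrow> 'a set \<Rightarrow> bool" where
  "function_field k K \<longleftrightarrow> is_subfield K \<and> k \<subseteq> K \<and>
     (\<exists>t\<in>K. \<not> algebraic_over k t \<and> (\<exists>n. has_degree (adjoin k {t}) K n)) \<and>
     (\<forall>a\<in>K. algebraic_over k a \<longrightarrow> a \<in> k)"

definition geometric_ext :: "'a::field set \<Rightarrow> 'a set \<Rightarrow> 'a set \<Rightarrow> bool" where
  "geometric_ext k K L \<longleftrightarrow>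
     \<not> (\<exists>l. is_subfield l \<and> k \<subseteq> l \<and> has_degree k l 3 \<and> L = adjoin K l)"

definition cubic_extension :: "'a::field set \<Rightarrow> 'a set \<Rightarrow> 'a set \<Rightarrow> bool" where
  "cubic_extension k K L \<longleftrightarrow> function_field k K \<and> is_subfield L \<and> K \<subseteq> L \<and>
     has_degree K L 3 \<and> separable_ext K L \<and> geometric_ext k K L"

definition purely_cubic :: "'a::field set \<Rightarrow> 'a set \<Rightarrow> bool" where
  "purely_cubic K L \<longleftrightarrow> (\<exists>\<beta>\<in>K. \<exists>z. z ^ 3 = \<beta> \<and> L = adjoin K {z})"

text \<open>An extension \<open>L/K\<close> is represented by the pair \<open>(K, L)\<close>.\<close>

definition bi_isomorphic :: "'a::field set \<Rightarrow> 'a set \<times> 'a set \<Rightarrow> 'a set \<times> 'a set \<Rightarrow> bool" where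
  "bi_isomorphic k E1 E2 \<longleftrightarrow> (case (E1, E2) of ((K1, L1), (K2, L2)) \<Rightarrow>
     (\<exists>f g. field_iso k L1 L2 f \<and> field_iso k K1 K2 g \<and> (\<forall>a\<in>K1. f a = g a)))"

text \<open>As \<open>k\<close> is perfect and algebraically closed in the fields concerned, their tensor product over
  \<open>k\<close> with the algebraic closure of \<open>k\<close> is the compositum inside \<open>\<Omega>\<close>.\<close>

definition base_change :: "'a::field set \<Rightarrow> 'a set \<times> 'a set \<Rightarrow> 'a set \<times> 'a set" where
  "base_change k E = (adjoin (fst E) (alg_cl k), adjoin (snd E) (alg_cl k))"

definition bitwists :: "'a::field set \<Rightarrow> 'a set \<times> 'a set \<Rightarrow> ('a set \<times> 'a set) set" where
  "bitwists k E = {(K, L). cubic_extension k K L \<and>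
     bi_isomorphic (alg_cl k) (base_change k (K, L)) (base_change k E)}"

definition bitwist_rel ::
  "'a::field set \<Rightarrow> 'a set \<times> 'a set \<Rightarrow> (('a set \<times> 'a set) \<times> ('a set \<times> 'a set)) set" where
  "bitwist_rel k E = {(E1, E2). E1 \<in> bitwists k E \<and> E2 \<in> bitwists k E \<and> bi_isomorphic k E1 E2}"

section \<open>Projective geometry\<close>

text \<open>The forms of degree \<open>d\<close> in the coordinates \<open>v $ i\<close>; only the coefficients at exponent vectors
  of weight \<open>d\<close> matter.\<close>

definition form :: "nat \<Rightarrow> (('n::finite \<Rightarrow> nat) \<Rightarrow> 'a) \<Rightarrow> 'a::field ^ 'n \<Rightarrow> 'a" where
  "form d c v = (\<Sum>e | (\<Sum>i\<in>UNIV. e i) = d. c e * (\<Prod>i\<in>UNIV. (v $ i) ^ e i))"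

type_synonym ('a, 'n) ppoint = "('a ^ 'n) set"

definition pt :: "'a::field ^ 'n::finite \<Rightarrow> ('a, 'n) ppoint" where
  "pt v = {c *s v | c. c \<noteq> 0}"

definition proj_space :: "('a::field, 'n::finite) ppoint set" where
  "proj_space = pt ` (UNIV - {0})"

abbreviation P1 :: "('a::field, 2) ppoint set" where
  "P1 \<equiv> proj_space"

text \<open>The coordinate on the projective line is \<open>t = v $ 1 / v $ 2\<close>.\<close>

definition pt_zero :: "('a::field, 2) ppoint" where
  "pt_zero = pt (vector [0, 1])"

definition pt_infinity :: "('a::field, 2) ppoint" where
  "pt_infinity = pt (vector [1, 0])"

definition rational_point :: "'a::field set \<Rightarrow> ('a, 'n::finite) ppoint \<Rightarrow> bool" where
  "rational_point F P \<longleftrightarrow> (\<exists>v\<in>P. \<forall>i. v $ i \<in> F)"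

definition forms_map ::
  "nat \<Rightarrow> ('n::finite \<Rightarrow> ('m::finite \<Rightarrow> nat) \<Rightarrow> 'a) \<Rightarrow> 'a::field ^ 'm \<Rightarrow> 'a ^ 'n" where
  "forms_map d G v = (\<chi> j. form d (G j) v)"

definition represents ::
  "('a::field, 'm::finite) ppoint set \<Rightarrow> nat \<Rightarrow> ('n::finite \<Rightarrow> ('m \<Rightarrow> nat) \<Rightarrow> 'a) \<Rightarrow>
   (('a, 'm) ppoint \<Rightarrow> ('a, 'n) ppoint) \<Rightarrow> bool" where
  "represents X d G f \<longleftrightarrow>
     (\<forall>P\<in>X. \<forall>v\<in>P. forms_map d G v \<noteq> 0 \<longrightarrow> f P = pt (forms_map d G v))"

text \<open>Morphisms defined over \<open>F\<close>; to be used for irreducible \<open>X\<close>, where two expressions by forms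
  that agree on a nonempty open set agree wherever both make sense.\<close>

definition regular_map ::
  "'a::field set \<Rightarrow> ('a, 'm::finite) ppoint set \<Rightarrow> ('a, 'n::finite) ppoint set \<Rightarrow>
   (('a, 'm) ppoint \<Rightarrow> ('a, 'n) ppoint) \<Rightarrow> bool" where
  "regular_map F X Y f \<longleftrightarrow> f ` X \<subseteq> Y \<and>
     (\<forall>P\<in>X. \<exists>d G. (\<forall>j e. G j e \<in> F) \<and> represents X d G f \<and> (\<forall>v\<in>P. forms_map d G v \<noteq> 0))"

definition isomorphism ::
  "'a::field set \<Rightarrow> ('a, 'm::finite) ppoint set \<Rightarrow> ('a, 'n::finite) ppoint set \<Rightarrow>
   (('a, 'm) ppoint \<Rightarrow> ('a, 'n) ppoint) \<Rightarrow> bool" where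
  "isomorphism F X Y f \<longleftrightarrow> regular_map F X Y f \<and>
     (\<exists>g. regular_map F Y X g \<and> (\<forall>P\<in>X. g (f P) = P) \<and> (\<forall>P\<in>Y. f (g P) = P))"

text \<open>\<open>g = \<sigma>(f)\<close>: the automorphism \<open>\<sigma>\<close> of \<open>F\<close> is applied to the coefficients of the forms over
  \<open>F\<close> that define \<open>f\<close>. The source \<open>X\<close> is the projective line, hence fixed by \<open>\<sigma>\<close>.\<close>

definition conjugate_map ::
  "'a::field set \<Rightarrow> ('a \<Rightarrow> 'a) \<Rightarrow> ('a, 'm::finite) ppoint set \<Rightarrow>
   (('a, 'm) ppoint \<Rightarrow> ('a, 'n::finite) ppoint) \<Rightarrow> (('a, 'm) ppoint \<Rightarrow> ('a, 'n) ppoint) \<Rightarrow> bool" where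
  "conjugate_map F \<sigma> X f g \<longleftrightarrow>
     (\<forall>d G. (\<forall>j e. G j e \<in> F) \<and> represents X d G f \<longrightarrow> represents X d (\<lambda>j e. \<sigma> (G j e)) g)"

subsection \<open>Ramification\<close>

text \<open>The local ring at \<open>P\<close>, over the algebraically closed field \<open>\<Omega>\<close>, consists of the germs at
  \<open>P\<close> of the functions \<open>h\<close> below.\<close>

definition local_fun :: "('a::field, 'n::finite) ppoint set \<Rightarrow> ('a, 'n) ppoint \<Rightarrow>
    (('a, 'n) ppoint \<Rightarrow> 'a) \<Rightarrow> bool" where
  "local_fun X P h \<longleftrightarrow> (\<exists>d a b. (\<forall>v\<in>P. form d b v \<noteq> 0) \<and>
     (\<forall>R\<in>X. \<forall>v\<in>R. form d b v \<noteq> 0 \<longrightarrow> h R = form d a v / form d b v))"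

definition max_ideal ::
  "('a::field, 'n::finite) ppoint set \<Rightarrow> ('a, 'n) ppoint \<Rightarrow> (('a, 'n) ppoint \<Rightarrow> 'a) set" where
  "max_ideal X P = {h. local_fun X P h \<and> h P = 0}"

definition germ_eq ::
  "('a::field, 'n::finite) ppoint set \<Rightarrow> ('a, 'n) ppoint \<Rightarrow>
   (('a, 'n) ppoint \<Rightarrow> 'a) \<Rightarrow> (('a, 'n) ppoint \<Rightarrow> 'a) \<Rightarrow> bool" where
  "germ_eq X P g h \<longleftrightarrow> (\<exists>d b. (\<forall>v\<in>P. form d b v \<noteq> 0) \<and>
     (\<forall>R\<in>X. \<forall>v\<in>R. form d b v \<noteq> 0 \<longrightarrow> g R = h R))"

text \<open>Ramification index at least two: the maximal ideal at \<open>f P\<close> is pulled back into the square of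
  the maximal ideal at \<open>P\<close>.\<close>

definition ramified_at ::
  "('a::field, 'm::finite) ppoint set \<Rightarrow> ('a, 'n::finite) ppoint set \<Rightarrow>
   (('a, 'm) ppoint \<Rightarrow> ('a, 'n) ppoint) \<Rightarrow> ('a, 'm) ppoint \<Rightarrow> bool" where
  "ramified_at X Y f P \<longleftrightarrow> (\<forall>h\<in>max_ideal Y (f P). \<exists>n::nat. \<exists>u w.
     (\<forall>i<n. u i \<in> max_ideal X P \<and> w i \<in> max_ideal X P) \<and>
     germ_eq X P (h \<circ> f) (\<lambda>R. \<Sum>i<n. u i R * w i R))"

subsection \<open>Function fields via generic points\<close>

definition generic_point :: "'a::field set \<Rightarrow> ('a, 'n::finite) ppoint set \<Rightarrow> ('a, 'n) ppoint \<Rightarrow> bool"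
  where "generic_point k X \<xi> \<longleftrightarrow> \<xi> \<in> X \<and>
     (\<forall>d c. range c \<subseteq> k \<and> (\<forall>v\<in>\<xi>. form d c v = 0) \<longrightarrow> (\<forall>P\<in>X. \<forall>v\<in>P. form d c v = 0))"

text \<open>For a generic point \<open>\<xi>\<close> of \<open>X\<close> over \<open>k\<close>, evaluation at \<open>\<xi>\<close> identifies the function field
  \<open>k(X)\<close> with the following subfield of \<open>\<Omega>\<close>. If \<open>f\<close> is a dominant morphism over \<open>k\<close> from \<open>X\<close> to
  \<open>Y\<close>, it identifies the subfield \<open>f\<^sup>*k(Y)\<close> of \<open>k(X)\<close> with the same field for the point \<open>f \<xi>\<close>.\<close>

definition values_at :: "'a::field set \<Rightarrow> ('a, 'n::finite) ppoint \<Rightarrow> 'a set" where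
  "values_at k P = {form d a v / form d b v | d a b v.
     range a \<subseteq> k \<and> range b \<subseteq> k \<and> v \<in> P \<and> form d b v \<noteq> 0}"

definition pullback_ext :: "'a::field set \<Rightarrow> (('a, 'm::finite) ppoint \<Rightarrow> ('a, 'n::finite) ppoint) \<Rightarrow>
    ('a, 'm) ppoint \<Rightarrow> 'a set \<times> 'a set" where
  "pullback_ext k f \<xi> = (values_at k (f \<xi>), values_at k \<xi>)"

section \<open>Conics with a divisor of degree two\<close>

text \<open>Conics are smooth plane curves of degree two. Such a curve is reduced, so it is given by its
  set of points over \<open>\<Omega>\<close>. The vanishing of the form is part of the singularity condition because
  it does not follow from that of the partial derivatives in characteristic two.\<close>

definition conic :: "'a::field set \<Rightarrow> ('a, 3) ppoint set \<Rightarrow> bool" where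
  "conic k Q \<longleftrightarrow> (\<exists>a b c d e f. {a, b, c, d, e, f} \<subseteq> k \<and>
     (let F = (\<lambda>v :: 'a ^ 3. a * (v$1)^2 + b * (v$2)^2 + c * (v$3)^2
                + d * v$1 * v$2 + e * v$1 * v$3 + f * v$2 * v$3)
      in (\<forall>v. v \<noteq> 0 \<and> F v = 0 \<longrightarrow>
            \<not> (2 * a * v$1 + d * v$2 + e * v$3 = 0 \<and>
               2 * b * v$2 + d * v$1 + f * v$3 = 0 \<and>
               2 * c * v$3 + e * v$1 + f * v$2 = 0)) \<and>
         Q = {pt v | v. v \<noteq> 0 \<and> F v = 0}))"

definition conj_point ::
  "'a::field set \<Rightarrow> ('a \<Rightarrow> 'a) \<Rightarrow> ('a, 'n::finite) ppoint \<Rightarrow> ('a, 'n) ppoint" where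
  "conj_point F \<sigma> P = (\<Union>v\<in>{v\<in>P. \<forall>i. v $ i \<in> F}. pt (\<chi> i. \<sigma> (v $ i)))"

text \<open>Effective divisors are multisets of geometric points; over a perfect field, being defined over
  \<open>k\<close> means being Galois invariant. The divisor has to consist of two distinct points, for otherwise
  it cannot be the image of \<open>{0,\<infinity>}\<close> under an isomorphism.\<close>

definition conic_pairs :: "'a::field set \<Rightarrow> (('a, 3) ppoint set \<times> ('a, 3) ppoint multiset) set" where
  "conic_pairs k = {(Q, D). conic k Q \<and> set_mset D \<subseteq> Q \<and> size D = 2 \<and> (\<forall>P. count D P \<le> 1) \<and>
     (\<forall>P\<in>#D. rational_point (alg_cl k) P) \<and>
     (\<forall>\<sigma>. field_iso k (alg_cl k) (alg_cl k) \<sigma> \<longrightarrow> image_mset (conj_point (alg_cl k) \<sigma>) D = D)}"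

definition conic_pair_rel :: "'a::field set \<Rightarrow>
    ((('a, 3) ppoint set \<times> ('a, 3) ppoint multiset) \<times>
     (('a, 3) ppoint set \<times> ('a, 3) ppoint multiset)) set" where
  "conic_pair_rel k = {((Q, D), (Q', D')). (Q, D) \<in> conic_pairs k \<and> (Q', D') \<in> conic_pairs k \<and>
     (\<exists>f. isomorphism k Q Q' f \<and> image_mset f D = D')}"

definition splitting_field :: "'a::field set \<Rightarrow> ('a, 'n::finite) ppoint multiset \<Rightarrow> 'a set" where
  "splitting_field k D = \<Inter>{F. is_subfield F \<and> k \<subseteq> F \<and> (\<forall>P\<in>#D. rational_point F P)}"

section \<open>The construction of a bi-twist from a pair\<close>

text \<open>The map of projective spaces induced by a map \<open>g\<close> that is homogeneous and does not vanish
  away from zero.\<close>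

definition induced ::
  "('a::field ^ 'm::finite \<Rightarrow> 'a ^ 'n::finite) \<Rightarrow> ('a, 'm) ppoint \<Rightarrow> ('a, 'n) ppoint" where
  "induced g P = (\<Union>v\<in>P. pt (g v))"

text \<open>These are \<open>t \<mapsto> lam/t\<close> and \<open>t \<mapsto> t\<^sup>3/lam\<close> for nonzero \<open>lam\<close>.\<close>

definition alpha :: "'a::field \<Rightarrow> ('a, 2) ppoint \<Rightarrow> ('a, 2) ppoint" where
  "alpha lam = induced (\<lambda>v. vector [lam * v$2, v$1])"

definition phi0 :: "'a::field \<Rightarrow> ('a, 2) ppoint \<Rightarrow> ('a, 2) ppoint" where
  "phi0 lam = induced (\<lambda>v. vector [(v$1)^3, lam * (v$2)^3])"

definition phi :: "(('a::field, 2) ppoint \<Rightarrow> ('a, 3) ppoint) \<Rightarrow> 'a \<Rightarrow>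
    ('a, 3) ppoint \<Rightarrow> ('a, 3) ppoint" where
  "phi \<iota> lam P = \<iota> (phi0 lam (inv_into P1 \<iota> P))"

definition splitting_iso :: "'a::field set \<Rightarrow> ('a, 3) ppoint set \<Rightarrow> ('a, 3) ppoint multiset \<Rightarrow>
    (('a, 2) ppoint \<Rightarrow> ('a, 3) ppoint) \<Rightarrow> bool" where
  "splitting_iso k Q D \<iota> \<longleftrightarrow> isomorphism (splitting_field k D) P1 Q \<iota> \<and>
     \<iota> ` {pt_zero, pt_infinity} = set_mset D"

definition nontrivial_aut :: "'a::field set \<Rightarrow> 'a set \<Rightarrow> ('a \<Rightarrow> 'a) \<Rightarrow> bool" where
  "nontrivial_aut k q \<sigma> \<longleftrightarrow> field_iso k q q \<sigma> \<and> (\<exists>a\<in>q. \<sigma> a \<noteq> a)"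

text \<open>If \<open>D\<close> splits over \<open>k\<close>, there is no \<open>\<sigma>\<close> and \<open>lam\<close> is an arbitrary nonzero element of \<open>k\<close>.\<close>

definition twist_parameter :: "'a::field set \<Rightarrow> ('a, 3) ppoint multiset \<Rightarrow>
    (('a, 2) ppoint \<Rightarrow> ('a, 3) ppoint) \<Rightarrow> 'a \<Rightarrow> bool" where
  "twist_parameter k D \<iota> lam \<longleftrightarrow> lam \<in> k \<and> lam \<noteq> 0 \<and>
     (\<forall>\<sigma>. nontrivial_aut k (splitting_field k D) \<sigma> \<longrightarrow>
        conjugate_map (splitting_field k D) \<sigma> P1 \<iota> (\<iota> \<circ> alpha lam))"

definition conjugate_over :: "'a::field set \<Rightarrow>
    ('a, 'm::finite) ppoint set \<Rightarrow> (('a, 'm) ppoint \<Rightarrow> ('a, 'm) ppoint) \<Rightarrow>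
    ('a, 'n::finite) ppoint set \<Rightarrow> (('a, 'n) ppoint \<Rightarrow> ('a, 'n) ppoint) \<Rightarrow> bool" where
  "conjugate_over F X f Y g \<longleftrightarrow> (\<exists>\<psi>. isomorphism F X Y \<psi> \<and> (\<forall>P\<in>X. g (\<psi> P) = \<psi> (f P)))"

definition constructed_ext :: "'a::field set \<Rightarrow> ('a, 3) ppoint set \<Rightarrow> ('a, 3) ppoint multiset \<Rightarrow>
    'a set \<times> 'a set \<Rightarrow> bool" where
  "constructed_ext k Q D E \<longleftrightarrow> (\<exists>\<iota> lam \<xi>. splitting_iso k Q D \<iota> \<and> twist_parameter k D \<iota> lam \<and>
     generic_point k Q \<xi> \<and> E = pullback_ext k (phi \<iota> lam) \<xi>)"

end

(*
A bi-twist is determined by a quadratic algebra C over k, encoded as the set of pairs (a, a') of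
conjugate elements, and a parameter lam in k modulo norms from C: after base change it is generated
by some u with u^3 = lam w, the Galois action sends u to u or to lam / u according to the action on
C, and Galois descent recovers the extension from the traces a u + a' lam / u. On the geometric side
the two points of D, the dual linear forms and smoothness bring Q into the form U V = lam Z^2 with
(U, V) conjugate over C, and the cubic map becomes (U, V, Z) -> (U^3, V^3, lam Z^3); at a generic
point u = U / Z generates the corresponding extension. Thus pairs and bi-twists have the same
invariant (C, lam), and on both sides two objects are isomorphic iff their invariants agree.
*)

theory Submission
 imports Defs "HOL-Computational_Algebra.Primes"
begin

section \<open>Subfields and polynomials over them\<close>

text \<open>Why the action on u is so restricted: an automorphism preserving both
  \<open>kb(u)\<close> and \<open>kb(u^3)\<close> is a Moebius map of u that is an eigenvector of
  the rotation u -> \<open>zt\<close> u, hence diagonal or antidiagonal, that is u -> c u or u -> c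
  / u. By Hilbert 90 the diagonal part of a cocycle is trivial, so u can be rescaled until only the
  identity and a single inversion u -> \<open>lam\<close> / u remain; the automorphisms that invert
  define the quadratic algebra. A further rescaling of u by c changes \<open>lam\<close> by the norm
  c c', and nothing else is ambiguous. In the split algebra every nonzero element of k is a norm,
  which leaves one class, the trivial one. Two obstacles shape the details. Characteristic two is
  allowed, so quadratic algebras are given by th ~= th' with trace and norm in k instead of by
  square roots, and conics are normalized by tangent lines instead of by completing squares. And
  \<open>zt\<close> need not lie in k, so eigenspace arguments run over the algebraic closure of k
  and come back to k through elements fixed by automorphisms, where perfectness of k enters.\<close>

lemma is_subfieldI:
 assumes "0 : F" "1 : F" "!!a b. a : F ==> b : F ==> a + b : F"
  "!!a b. a : F ==> b : F ==> a - b : F" "!!a b. a : F ==> b : F ==> a * b : F"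
  "!!a. a : F ==> inverse a : F"
 shows "is_subfield F"
 using assms unfolding is_subfield_def by auto

lemma subfield_0: "is_subfield F ==> 0 : F"
 and subfield_1: "is_subfield F ==> 1 : F"
 and subfield_add: "is_subfield F ==> a : F ==> b : F ==> a + b : F"
 and subfield_diff: "is_subfield F ==> a : F ==> b : F ==> a - b : F"
 and subfield_mult: "is_subfield F ==> a : F ==> b : F ==> a * b : F"
 and subfield_inverse: "is_subfield F ==> a : F ==> inverse a : F"
 unfolding is_subfield_def by auto

lemma subfield_uminus: "is_subfield F ==> a : F ==> - a : F"
 using subfield_diff[of F 0 a] subfield_0 by fastforce

lemma subfield_divide: "is_subfield F ==> a : F ==> b : F ==> a / b : F"
 by (simp add: divide_inverse subfield_mult subfield_inverse)

lemma subfield_power: "is_subfield F ==> a : F ==> a ^ n : F"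
 by (induction n) (auto simp: subfield_1 subfield_mult)

lemma subfield_of_nat: "is_subfield F ==> of_nat n : F"
 by (induction n) (auto simp: subfield_0 subfield_1 subfield_add)

lemma subfield_numeral: "is_subfield F ==> numeral n : F"
 using subfield_of_nat[of F "numeral n"] by simp

lemma subfield_sum: "is_subfield F ==> (!!i. i : I ==> f i : F) ==> sum f I : F"
 by (induction I rule: infinite_finite_induct) (auto simp: subfield_0 subfield_add)

lemmas subfield_intros = subfield_0 subfield_1 subfield_add subfield_diff subfield_mult
 subfield_inverse subfield_uminus subfield_divide subfield_power subfield_numeral subfield_sum

lemma subfield_Inter: "(!!E. E : A ==> is_subfield E) ==> is_subfield (\<Inter>A)"
 by (rule is_subfieldI) (auto intro: subfield_intros)

lemma subfield_UNIV: "is_subfield UNIV"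
 by (rule is_subfieldI) auto

lemma subfield_Int: "is_subfield E ==> is_subfield F ==> is_subfield (E \<inter> F)"
 by (rule is_subfieldI) (auto intro: subfield_intros)

lemma subfield_adjoin: "is_subfield (adjoin F S)"
 unfolding adjoin_def by (rule subfield_Inter) auto

lemma adjoin_subset: "F \<subseteq> adjoin F S" and adjoin_gen: "S \<subseteq> adjoin F S"
 unfolding adjoin_def by auto

lemma adjoin_least: "is_subfield E ==> F \<subseteq> E ==> S \<subseteq> E ==> adjoin F S \<subseteq> E"
 unfolding adjoin_def by auto

lemma adjoin_mono: "F \<subseteq> F' ==> S \<subseteq> adjoin F' S' ==> adjoin F S \<subseteq> adjoin F' S'"
 by (meson adjoin_least subfield_adjoin adjoin_subset order_trans)

lemma adjoin_adjoin: "adjoin (adjoin F S) T = adjoin F (S \<union> T)"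
proof
 show "adjoin (adjoin F S) T \<subseteq> adjoin F (S \<union> T)"
  using adjoin_subset[of F "S \<union> T"] adjoin_gen[of "S \<union> T" F]
  by (intro adjoin_least subfield_adjoin) auto
 have "F \<subseteq> adjoin (adjoin F S) T" "S \<subseteq> adjoin (adjoin F S) T" "T \<subseteq> adjoin (adjoin F S) T"
  using adjoin_subset[of F S] adjoin_gen[of S F] adjoin_subset[of "adjoin F S" T] adjoin_gen[of T "adjoin F S"]
  by auto
 then show "adjoin F (S \<union> T) \<subseteq> adjoin (adjoin F S) T"
  by (intro adjoin_least subfield_adjoin) auto
qed

definition polys_over :: "'a::zero set => 'a poly set" where
 "polys_over F = {p. \<forall>i. coeff p i : F}"

lemma coeff_polys_over: "p : polys_over F ==> coeff p i : F"
 by (simp add: polys_over_def)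

lemma polys_overI: "(!!i. coeff p i : F) ==> p : polys_over F"
 by (simp add: polys_over_def)

lemma polys_over_coeffs: "0 : F ==> set (coeffs p) \<subseteq> F \<longleftrightarrow> p : polys_over F"
 using range_coeff[of p] by (auto simp: polys_over_def image_subset_iff[of _ UNIV, simplified, symmetric])

lemma polys_over_mono: "E \<subseteq> F ==> p : polys_over E ==> p : polys_over F"
 by (auto simp: polys_over_def)

context
 fixes F :: "'a::field set"
 assumes F: "is_subfield F"
begin

lemma polys_over_0: "0 : polys_over F"
 and polys_over_1: "1 : polys_over F"
 using F by (auto simp: polys_over_def subfield_intros one_pCons coeff_pCons split: nat.splits)

lemma polys_over_pCons_iff: "pCons a p : polys_over F \<longleftrightarrow> a : F & p : polys_over F"
 unfolding polys_over_def by (auto simp: coeff_pCons split: nat.splits)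

lemma polys_over_add: "p : polys_over F ==> q : polys_over F ==> p + q : polys_over F"
 and polys_over_diff: "p : polys_over F ==> q : polys_over F ==> p - q : polys_over F"
 and polys_over_uminus: "p : polys_over F ==> - p : polys_over F"
 and polys_over_smult: "a : F ==> p : polys_over F ==> smult a p : polys_over F"
 and polys_over_mult: "p : polys_over F ==> q : polys_over F ==> p * q : polys_over F"
 and polys_over_monom: "a : F ==> monom a n : polys_over F"
 using F by (auto simp: polys_over_def coeff_mult intro!: subfield_intros)

lemma polys_over_sum: "(!!i. i : I ==> f i : polys_over F) ==> sum f I : polys_over F"
 by (induction I rule: infinite_finite_induct) (auto simp: polys_over_0 polys_over_add)

lemma polys_over_power: "p : polys_over F ==> p ^ n : polys_over F"
 by (induction n) (auto simp: polys_over_1 polys_over_mult)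

lemma polys_over_pcompose: "p : polys_over F ==> q : polys_over F ==> pcompose p q : polys_over F"
 by (induction p) (auto simp: polys_over_pCons_iff pcompose_pCons polys_over_0 polys_over_add polys_over_mult)

lemma poly_in_subfield: "p : polys_over F ==> a : F ==> poly p a : F"
 using F by (auto simp: poly_altdef polys_over_def intro!: subfield_intros)

lemmas polys_over_intros = polys_over_0 polys_over_1 polys_over_add polys_over_diff polys_over_uminus
 polys_over_smult polys_over_mult polys_over_monom polys_over_sum polys_over_power polys_over_pcompose

text \<open>Each step of long division inverts only the leading coefficient of \<open>g\<close>, so
  quotient and remainder keep coefficients in \<open>F\<close>. All divisibility over
  \<open>F\<close> rests on this.\<close>

lemma polys_over_div:
 assumes "g : polys_over F" "g ~= 0" "p : polys_over F"
 shows "\<exists>s\<in>polys_over F. \<exists>t\<in>polys_over F. p = g * s + t & (t = 0 \<or> degree t < degree g)"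
 using assms(3)
proof (induction "degree p" arbitrary: p rule: less_induct)
 case less
 show ?case
 proof (cases "p = 0 \<or> degree p < degree g")
  case True
  then show ?thesis using less polys_over_0 by (intro bexI[of _ 0] bexI[of _ p]) auto
 next
  case False
  define m where "m = monom (lead_coeff p / lead_coeff g) (degree p - degree g)"
  have m: "m : polys_over F" unfolding m_def
   using F less assms(1) by (auto intro!: polys_over_monom subfield_intros coeff_polys_over)
  define p' where "p' = p - g * m"
  have p': "p' : polys_over F" using m assms less by (auto simp: p'_def intro!: polys_over_intros)
  have lm: "m ~= 0" "degree m = degree p - degree g" "lead_coeff m = lead_coeff p / lead_coeff g"
   using False assms(2) by (auto simp: m_def degree_monom_eq)
  have dm: "degree (g * m) = degree p" "coeff (g * m) (degree p) = lead_coeff p"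
   using lm False assms(2) lead_coeff_mult[of g m] by (auto simp: degree_mult_eq)
  have "p' = 0 \<or> degree p' < degree p"
  proof (cases "degree p = 0")
   case True
   then have "coeff p' i = 0" for i
    using dm by (cases i) (auto simp: p'_def coeff_eq_0)
   then show ?thesis by (simp add: poly_eq_iff)
  next
   case False
   have "coeff p' i = 0" if "i \<ge> degree p" for i
    using dm that by (cases "i = degree p") (auto simp: p'_def coeff_eq_0)
   then have "degree p' < degree p"
    using False by (intro degree_lessI) auto
   then show ?thesis by simp
  qed
  then have "\<exists>s\<in>polys_over F. \<exists>t\<in>polys_over F. p' = g * s + t & (t = 0 \<or> degree t < degree g)"
   using less.hyps[of p'] p' polys_over_0 by (cases "p' = 0") (auto intro!: bexI[of _ 0])
  then obtain s t where "s : polys_over F" "t : polys_over F" "p' = g * s + t"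
   "t = 0 \<or> degree t < degree g" by blast
  then show ?thesis using m
   by (intro bexI[of _ "s + m"] bexI[of _ t]) (auto simp: p'_def algebra_simps intro!: polys_over_intros)
 qed
qed

text \<open>A nonzero element of least degree generates: the remainder on division by it stays in
  \<open>I\<close> and would have smaller degree.\<close>

lemma polys_over_ideal:
 assumes I: "I \<subseteq> polys_over F" "p0 : I" "p0 ~= 0"
  and cl: "!!p q. p : I ==> q : I ==> p - q : I" "!!p q. p : I ==> q : polys_over F ==> p * q : I"
 obtains g where "g : I" "g ~= 0" "!!p. p : I ==> \<exists>s\<in>polys_over F. p = g * s"
proof -
 have "\<exists>g. (g \<in> I & g ~= 0) & (\<forall>p. p \<in> I & p ~= 0 --> degree g \<le> degree p)"
  by (rule ex_has_least_nat) (use I(2,3) in simp)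
 then obtain g where g: "g : I" "g ~= 0" "!!p. p : I ==> p ~= 0 ==> degree g \<le> degree p" by blast
 have "\<exists>s\<in>polys_over F. p = g * s" if "p : I" for p
 proof -
  obtain s t where st: "s : polys_over F" "t : polys_over F" "p = g * s + t" "t = 0 \<or> degree t < degree g"
   using polys_over_div[OF subsetD[OF I(1) g(1)] g(2) subsetD[OF I(1) \<open>p : I\<close>]] by auto
  have "p - g * s : I" by (intro cl \<open>p : I\<close> g st(1))
  then have "t : I" using st(3) by simp
  then have "t = 0" using g st(4) by (metis not_le)
  then show ?thesis using st by auto
 qed
 then show thesis using that g by blast
qed

lemma polys_over_gcd:
 assumes "p : polys_over F" "r : polys_over F" "r ~= 0"
 obtains g p1 r1 a b where "g : polys_over F" "g ~= 0" "p1 : polys_over F" "r1 : polys_over F"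
  "a : polys_over F" "b : polys_over F" "p = g * p1" "r = g * r1" "a * p1 + b * r1 = 1"
proof -
 define I where "I = {a * p + b * r | a b. a : polys_over F & b : polys_over F}"
 have 1: "I \<subseteq> polys_over F" unfolding I_def using assms by (auto intro!: polys_over_intros)
 have pI: "p : I" unfolding I_def using polys_over_0 polys_over_1 by force
 have rI: "r : I" unfolding I_def using polys_over_0 polys_over_1 by force
 have d: "x - y : I" if xy: "x : I" "y : I" for x y
 proof -
  obtain a b c d where "x = a * p + b * r" "y = c * p + d * r" "a : polys_over F"
   "b : polys_over F" "c : polys_over F" "d : polys_over F" using xy unfolding I_def by blast
  then have "x - y = (a - c) * p + (b - d) * r" "a - c : polys_over F" "b - d : polys_over F"
   by (auto simp: algebra_simps intro!: polys_over_intros)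
  then show ?thesis unfolding I_def by blast
 qed
 have m: "x * y : I" if xy: "x : I" "y : polys_over F" for x y
 proof -
  obtain a b where "x = a * p + b * r" "a : polys_over F" "b : polys_over F"
   using xy unfolding I_def by blast
  then have "x * y = (a * y) * p + (b * y) * r" "a * y : polys_over F" "b * y : polys_over F"
   using xy by (auto simp: algebra_simps intro!: polys_over_intros)
  then show ?thesis unfolding I_def by blast
 qed
 obtain g where g: "g : I" "g ~= 0" "!!p. p : I ==> \<exists>s\<in>polys_over F. p = g * s"
  using polys_over_ideal[OF 1 rI assms(3) d m] by blast
 obtain p1 where p1: "p1 : polys_over F" "p = g * p1" using g pI by blast
 obtain r1 where r1: "r1 : polys_over F" "r = g * r1" using g rI by blast
 obtain a b where ab: "g = a * p + b * r" "a : polys_over F" "b : polys_over F"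
  using g unfolding I_def by blast
 have "g * (a * p1 + b * r1) = g * 1"
  using ab(1) unfolding p1(2) r1(2) by (simp add: algebra_simps)
 then have "a * p1 + b * r1 = 1" using g(2) by (simp only: mult_cancel_left) simp
 then show thesis using that g 1 p1 r1 ab by blast
qed

lemma algebraic_over_iff: "algebraic_over F a \<longleftrightarrow> (\<exists>p\<in>polys_over F. p ~= 0 & poly p a = 0)"
 unfolding algebraic_over_def using polys_over_coeffs[of F] F by (auto simp: subfield_0)

text \<open>The polynomials over \<open>F\<close> that vanish at \<open>a\<close> form an ideal, and
  its generator is the minimal polynomial. Here and later minimality is used in the form of
  divisibility with a cofactor over \<open>F\<close>.\<close>

lemma min_poly_exists:
 assumes "algebraic_over F a"
 obtains g where "g : polys_over F" "g ~= 0" "poly g a = 0"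
  "!!p. p : polys_over F ==> poly p a = 0 ==> \<exists>s\<in>polys_over F. p = g * s"
proof -
 define I where "I = {p : polys_over F. poly p a = 0}"
 obtain p0 where p0: "p0 : I" "p0 ~= 0" using assms unfolding algebraic_over_iff I_def by auto
 obtain g where "g : I" "g ~= 0" "!!p. p : I ==> \<exists>s\<in>polys_over F. p = g * s"
  by (rule polys_over_ideal[OF _ p0]) (auto simp: I_def intro!: polys_over_intros)
 then show thesis using that unfolding I_def by blast
qed

lemma algebraic_self: "a : F ==> algebraic_over F a"
 unfolding algebraic_over_iff using F
 by (intro bexI[of _ "[:-a, 1:]"]) (auto simp: polys_over_pCons_iff polys_over_0 subfield_intros)

text \<open>The minimal polynomial is c + X h with c ~= 0, since otherwise h would be an annihilator
  of smaller degree; then - h(b) / c is the inverse of b.\<close>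

lemma algebraic_inverse_poly:
 assumes "algebraic_over F b" "b ~= 0"
 shows "\<exists>s\<in>polys_over F. b * poly s b = 1"
proof -
 obtain g where g: "g : polys_over F" "g ~= 0" "poly g b = 0"
  "!!p. p : polys_over F ==> poly p b = 0 ==> \<exists>s\<in>polys_over F. p = g * s"
  using min_poly_exists[OF assms(1)] by blast
 obtain c h where ch: "g = pCons c h" by (cases g)
 have c: "c : F" and h: "h : polys_over F" using g(1) ch polys_over_pCons_iff by auto
 have "c ~= 0"
 proof
  assume c0: "c = 0"
  then have "poly h b = 0" using g(3) ch assms(2) by simp
  then obtain s where s: "h = g * s" using g(4) h by blast
  have "h ~= 0" using g(2) ch c0 by auto
  then have "degree h \<ge> degree g" using s by (auto simp: degree_mult_eq)
  then show False using ch \<open>h ~= 0\<close> by simp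
 qed
 then have "b * poly (smult (- inverse c) h) b = 1"
  using g(3) ch by (auto simp: field_simps add_eq_0_iff)
 moreover have "smult (- inverse c) h : polys_over F"
  using c h F by (intro polys_over_intros subfield_intros)
 ultimately show ?thesis by blast
qed

text \<open>For infinite \<^term>\<open>F\<close>-subalgebras this replaces a dimension count.\<close>

lemma subring_algebraic_subfield:
 assumes "F \<subseteq> R" "!!a b. a : R ==> b : R ==> a + b : R" "!!a b. a : R ==> b : R ==> a * b : R"
  "!!a. a : R ==> algebraic_over F a"
 shows "is_subfield R"
proof -
 have um: "- a : R" if "a : R" for a
  using assms(1) assms(3)[of "-1" a] that F subfield_intros(7,2) by auto
 have pow: "a ^ n : R" if "a : R" for a n
  by (induction n) (use assms that subfield_1[OF F] in auto)
 have pl: "poly s a : R" if "a : R" "s : polys_over F" for s a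
  using that(2)
 proof (induction s)
  case 0 then show ?case using assms(1) F subfield_0 by auto
 next
  case (pCons c s)
  then show ?case using assms that polys_over_pCons_iff by auto
 qed
 show ?thesis
 proof (rule is_subfieldI)
  fix a assume a: "a : R"
  show "inverse a : R"
  proof (cases "a = 0")
   case False
   then obtain s where "s : polys_over F" "a * poly s a = 1"
    using algebraic_inverse_poly assms(4) a by blast
   then show ?thesis using pl[OF a] by (metis inverse_unique)
  qed (use a in auto)
 qed (use assms um subfield_0[OF F] subfield_1[OF F] in \<open>auto simp: diff_conv_add_uminus simp del: add_uminus_conv_diff\<close>)
qed

end

subsection \<open>Algebraic closures\<close>

text \<open>Gaussian elimination on the equations \<open>J\<close>: a pivot for one equation removes
  one unknown and one equation at a time.\<close>

lemma linear_system_solution: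
 fixes m :: "'i => 'j => 'a::field"
 assumes F: "is_subfield F" and "finite J" "finite I" "card J < card I" "!!i j. i : I ==> j : J ==> m i j : F"
 shows "\<exists>c. (\<forall>i\<in>I. c i : F) & (\<exists>i\<in>I. c i ~= 0) & (\<forall>j\<in>J. (\<Sum>i\<in>I. c i * m i j) = 0)"
 using assms(2-)
proof (induction J arbitrary: I m rule: finite_induct)
 case empty
 then have "I ~= {}" by auto
 then show ?case using F by (intro exI[of _ "%_. 1"]) (auto simp: subfield_1)
next
 case (insert j0 J)
 show ?case
 proof (cases "\<forall>i\<in>I. m i j0 = 0")
  case True
  have "\<exists>c. (\<forall>i\<in>I. c i : F) & (\<exists>i\<in>I. c i ~= 0) & (\<forall>j\<in>J. (\<Sum>i\<in>I. c i * m i j) = 0)"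
   using insert by (intro insert.IH) auto
  then show ?thesis using True by auto
 next
  case False
  then obtain i0 where i0: "i0 : I" "m i0 j0 ~= 0" by blast
  define I' where "I' = I - {i0}"
  define m' where "m' i j = m i j - m i j0 / m i0 j0 * m i0 j" for i j
  have "\<exists>c. (\<forall>i\<in>I'. c i : F) & (\<exists>i\<in>I'. c i ~= 0) & (\<forall>j\<in>J. (\<Sum>i\<in>I'. c i * m' i j) = 0)"
   using insert i0 F by (intro insert.IH) (auto simp: I'_def m'_def intro!: subfield_intros)
  then obtain c where c: "\<forall>i\<in>I'. c i : F" "\<exists>i\<in>I'. c i ~= 0" "\<forall>j\<in>J. (\<Sum>i\<in>I'. c i * m' i j) = 0" by blast
  \<comment> \<open>The value at the pivot \<open>i0\<close> that equation \<open>j0\<close> forces.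
    Substituting it turns each remaining equation into one of the reduced system
    \<open>m'\<close>.\<close>
  define e where "e = - (\<Sum>i\<in>I'. c i * (m i j0 / m i0 j0))"
  define d where "d = c(i0 := e)"
  have fI: "finite I'" "i0 \<notin> I'" "I = insert i0 I'" using insert i0 by (auto simp: I'_def)
  have sum: "(\<Sum>i\<in>I. d i * m i j) = e * m i0 j + (\<Sum>i\<in>I'. c i * m i j)" for j
  proof -
   have "(\<Sum>i\<in>I'. d i * m i j) = (\<Sum>i\<in>I'. c i * m i j)"
    using fI by (intro sum.cong) (auto simp: d_def)
   then show ?thesis using fI by (simp add: d_def)
  qed
  have z: "(\<Sum>i\<in>I. d i * m i j) = (\<Sum>i\<in>I'. c i * m' i j)" for j
   unfolding sum m'_def e_def by (simp add: algebra_simps sum_subtractf sum_distrib_left)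
  have "\<forall>j\<in>insert j0 J. (\<Sum>i\<in>I. d i * m i j) = 0"
   using c(3) i0(2) unfolding z by (auto simp: m'_def)
  moreover have "e : F" unfolding e_def using c(1) insert i0 F by (auto intro!: subfield_intros simp: I'_def)
  then have "\<forall>i\<in>I. d i : F" using c(1) fI by (auto simp: d_def)
  moreover have "\<exists>i\<in>I. d i ~= 0" using c(2) fI by (auto simp: d_def)
  ultimately show ?thesis by blast
 qed
qed

definition span_over :: "'a::field set => 'a set => 'a set" where
 "span_over F B = {\<Sum>b\<in>B. c b * b | c. \<forall>b\<in>B. c b : F}"

lemma span_overI: "(!!b. b : B ==> c b : F) ==> (\<Sum>b\<in>B. c b * b) : span_over F B"
 unfolding span_over_def by auto

text \<open>The \<open>card B + 1\<close> powers of \<open>a\<close> from exponent 0 to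
  \<open>card B\<close> have coordinate vectors of length \<open>card B\<close>; a nontrivial
  relation among these vectors is an annihilating polynomial.\<close>

lemma powers_in_span_algebraic:
 assumes F: "is_subfield F" and B: "finite B" and p: "!!n. a ^ n : span_over F B"
 shows "algebraic_over F a"
proof -
 have "\<exists>c. (\<forall>b\<in>B. c b : F) & a ^ n = (\<Sum>b\<in>B. c b * b)" for n
  using p[of n] unfolding span_over_def by auto
 then obtain m where m: "!!n. \<forall>b\<in>B. m n b : F" "!!n. a ^ n = (\<Sum>b\<in>B. m n b * b)" by metis
 obtain c where c: "\<forall>i\<in>{..card B}. c i : F" "\<exists>i\<in>{..card B}. c i ~= 0"
  "\<forall>b\<in>B. (\<Sum>i\<le>card B. c i * m i b) = 0"
  using linear_system_solution[OF F B, of "{..card B}" m] m by auto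
 define q where "q = (\<Sum>i\<le>card B. monom (c i) i)"
 have "coeff q i = (if i \<le> card B then c i else 0)" for i
  unfolding q_def by (auto simp: coeff_sum)
 note q = this
 have "q ~= 0" using q c(2) by (auto simp: poly_eq_iff)
 moreover have "q : polys_over F" using q c(1) F by (auto simp: subfield_0 intro!: polys_overI)
 moreover have "poly q a = 0"
 proof -
  have "poly q a = (\<Sum>i\<le>card B. \<Sum>b\<in>B. c i * m i b * b)"
   unfolding q_def by (simp add: poly_sum poly_monom m(2) sum_distrib_left mult.assoc)
  also have "\<dots> = (\<Sum>b\<in>B. (\<Sum>i\<le>card B. c i * m i b) * b)"
   by (subst sum.swap) (simp add: sum_distrib_right)
  also have "\<dots> = 0" using c(3) by simp
  finally show ?thesis .
 qed
 ultimately show ?thesis using algebraic_over_iff[OF F] by blast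
qed

lemma span_over_add: "is_subfield F ==> x : span_over F B ==> y : span_over F B ==> x + y : span_over F B"
proof -
 assume F: "is_subfield F" "x : span_over F B" "y : span_over F B"
 then obtain c d where "x = (\<Sum>b\<in>B. c b * b)" "\<forall>b\<in>B. c b : F" "y = (\<Sum>b\<in>B. d b * b)" "\<forall>b\<in>B. d b : F"
  unfolding span_over_def by blast
 then show ?thesis using F span_overI[of B "%b. c b + d b" F]
  by (simp add: distrib_right sum.distrib subfield_add)
qed

lemma span_over_0: "is_subfield F ==> 0 : span_over F B"
 using span_overI[of B "%_. 0" F] by (simp add: subfield_0)

lemma span_over_sum: "is_subfield F ==> (!!i. i : I ==> f i : span_over F B) ==> sum f I : span_over F B"
 by (induction I rule: infinite_finite_induct) (auto simp: span_over_0 span_over_add)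

lemma span_over_scale:
 assumes "is_subfield F" "a : F" "x : span_over F B" shows "a * x : span_over F B"
proof -
 obtain c where "x = (\<Sum>b\<in>B. c b * b)" "\<forall>b\<in>B. c b : F"
  using assms unfolding span_over_def by blast
 then show ?thesis using assms span_overI[of B "%b. a * c b" F]
  by (simp add: sum_distrib_left mult.assoc subfield_mult)
qed

lemma span_over_base: "is_subfield F ==> finite B ==> b : B ==> b : span_over F B"
 using span_overI[of B "%x. if x = b then 1 else 0" F]
 by (auto simp: subfield_0 subfield_1 if_distrib[of "%x. x * _"] cong: if_cong)

lemma span_over_le:
 assumes "is_subfield F" "x : span_over F B" "!!b. b : B ==> y * b : span_over F B'"
 shows "y * x : span_over F B'"
proof -
 obtain c where c: "x = (\<Sum>b\<in>B. c b * b)" "\<forall>b\<in>B. c b : F"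
  using assms unfolding span_over_def by blast
 have "y * x = (\<Sum>b\<in>B. c b * (y * b))" unfolding c by (simp add: sum_distrib_left mult.left_commute)
 also have "\<dots> : span_over F B'"
  by (rule span_over_sum[OF assms(1)]) (use assms(3) c(2) span_over_scale[OF assms(1)] in blast)
 finally show ?thesis .
qed

lemma span_over_mono:
 assumes "is_subfield F" "finite B'" "B \<subseteq> B'" shows "span_over F B \<subseteq> span_over F B'"
 using span_over_le[OF assms(1), of _ B 1 B'] span_over_base[OF assms(1,2)] assms by auto

lemma span_over_mult:
 assumes "is_subfield F" "finite B" "finite B'" "x : span_over F B" "y : span_over F B'"
 shows "x * y : span_over F ((%(b, b'). b * b') ` (B \<times> B'))"
proof -
 have 1: "b * y : span_over F ((%(b, b'). b * b') ` (B \<times> B'))" if "b : B" for b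
  by (rule span_over_le[OF assms(1,5)]) (use that assms in \<open>auto intro!: span_over_base\<close>)
 show ?thesis
  using span_over_le[OF assms(1,4), of y] 1 by (simp add: mult.commute)
qed

text \<open>Stand-in for a finite extension. The spanning set \<open>B\<close> may lie outside
  \<open>R\<close>, so bounding the rank asks for no choice of basis in \<open>R\<close>.\<close>

definition finite_subring :: "'a::field set => 'a set => bool" where
 "finite_subring F R \<longleftrightarrow> F \<subseteq> R & (\<forall>a\<in>R. \<forall>b\<in>R. a + b : R & a * b : R) &
   (\<exists>B. finite B & R \<subseteq> span_over F B)"

lemma finite_subring_algebraic:
 assumes "is_subfield F" "finite_subring F R" "a : R"
 shows "algebraic_over F a"
proof -
 obtain B where B: "finite B" "R \<subseteq> span_over F B" using assms unfolding finite_subring_def by blast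
 have "a ^ n : R" for n
  using assms by (induction n) (auto simp: finite_subring_def subset_iff subfield_1)
 then show ?thesis using B by (intro powers_in_span_algebraic[OF assms(1) B(1)]) auto
qed

text \<open>As \<open>p\<close> is monic, the power of \<open>a\<close> with exponent
  \<open>degree p\<close> is a combination of lower powers with coefficients in \<open>R\<close>,
  without any division. Hence \<open>T\<close> is a ring, spanned by products of a spanning set of
  \<open>R\<close> with powers of \<open>a\<close>.\<close>

lemma finite_subring_adjoin_root:
 assumes F: "is_subfield F" and R: "finite_subring F R" and p: "p : polys_over R" "lead_coeff p = 1"
  "poly p a = 0"
 shows "\<exists>R'. finite_subring F R' & R \<subseteq> R' & a : R'"
proof -
 define n where "n = degree p"
 define T where "T = {\<Sum>i<n. r i * a ^ i | r. \<forall>i<n. r i : R}"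
 have Rc: "x + y : R" "x * y : R" if "x : R" "y : R" for x y
  using R that unfolding finite_subring_def by auto
 have F0: "F \<subseteq> R" using R unfolding finite_subring_def by auto
 have R0: "0 : R" "1 : R" "-1 : R"
  using F0 subfield_0[OF F] subfield_1[OF F] subfield_uminus[OF F, of 1] by auto
 have Rm: "- x : R" if "x : R" for x using Rc(2)[OF R0(3) that] by simp
 have n: "n > 0" unfolding n_def
 proof (rule ccontr)
  assume "\<not> degree p > 0"
  then obtain c where "p = [:c:]" using degree_eq_zeroE[of p] by auto
  then show False using p by auto
 qed
 have TI: "(\<Sum>i<n. r i * a ^ i) : T" if "\<forall>i<n. r i : R" for r unfolding T_def using that by auto
 have Tadd: "x + y : T" if xy: "x : T" "y : T" for x y
 proof -
  obtain r s where rs: "x = (\<Sum>i<n. r i * a ^ i)" "\<forall>i<n. r i : R" "y = (\<Sum>i<n. s i * a ^ i)" "\<forall>i<n. s i : R"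
   using xy unfolding T_def by blast
  then have "x + y = (\<Sum>i<n. (r i + s i) * a ^ i)" by (simp add: distrib_right sum.distrib)
  then show ?thesis using rs TI[of "%i. r i + s i"] Rc by simp
 qed
 have Tscale: "c * x : T" if cx: "c : R" "x : T" for c x
 proof -
  obtain r where rs: "x = (\<Sum>i<n. r i * a ^ i)" "\<forall>i<n. r i : R" using cx unfolding T_def by blast
  then have "c * x = (\<Sum>i<n. (c * r i) * a ^ i)" by (simp add: sum_distrib_left mult.assoc)
  then show ?thesis using rs TI[of "%i. c * r i"] Rc cx by simp
 qed
 have T0: "0 : T" using TI[of "%_. 0"] R0 by simp
 have Tsum: "sum f I : T" if "!!i. i : I ==> f i : T" for f and I :: "nat set"
  using that by (induction I rule: infinite_finite_induct) (auto simp: T0 Tadd)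
 have Tpow: "a ^ i : T" if "i < n" for i
 proof -
  have "(\<Sum>j<n. (if j = i then 1 else 0) * a ^ j) = (\<Sum>j<n. if j = i then a ^ j else 0)"
   by (intro sum.cong) auto
  also have "\<dots> = a ^ i" using that by (simp add: sum.delta')
  finally show ?thesis using TI[of "%j. if j = i then 1 else 0"] R0 by auto
 qed
 have Ta: "a * x : T" if xT: "x : T" for x
 proof -
  obtain r where rs: "x = (\<Sum>i<n. r i * a ^ i)" "\<forall>i<n. r i : R" using xT unfolding T_def by blast
  have an: "a ^ n = (\<Sum>i<n. - coeff p i * a ^ i)"
  proof -
   have "0 = (\<Sum>i\<le>n. coeff p i * a ^ i)" using p(3) by (simp add: poly_altdef n_def)
   also have "\<dots> = (\<Sum>i<n. coeff p i * a ^ i) + a ^ n"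
    using p(2) by (simp add: lessThan_Suc_atMost[symmetric] n_def)
   finally show ?thesis by (simp add: sum_negf eq_neg_iff_add_eq_0 add.commute)
  qed
  have anT: "a ^ n : T" unfolding an
   using p(1) Rm coeff_polys_over[OF p(1)] by (intro TI) auto
  have "a * x = (\<Sum>i<n. r i * a ^ Suc i)" unfolding rs by (simp add: sum_distrib_left mult.left_commute)
  moreover have "r i * a ^ Suc i : T" if "i < n" for i
   using that rs anT Tpow[of "Suc i"] by (intro Tscale) (cases "Suc i = n", auto simp del: power_Suc dest: Suc_lessI)
  ultimately show ?thesis by (auto intro!: Tsum simp del: power_Suc)
 qed
 have Tan: "a ^ i * x : T" if "x : T" for i x
  by (induction i) (use that Ta in \<open>auto simp: mult.assoc\<close>)
 have Tmult: "x * y : T" if xy: "x : T" "y : T" for x y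
 proof -
  obtain r where rs: "x = (\<Sum>i<n. r i * a ^ i)" "\<forall>i<n. r i : R" using xy unfolding T_def by blast
  have "x * y = (\<Sum>i<n. r i * (a ^ i * y))" unfolding rs by (simp add: sum_distrib_right mult.assoc)
  then show ?thesis using rs xy by (auto intro!: Tsum Tscale Tan)
 qed
 have RT: "R \<subseteq> T" using Tscale[OF _ Tpow[of 0]] n by auto
 have aT: "a : T" using Ta[of 1] RT R0 by auto
 obtain B where B: "finite B" "R \<subseteq> span_over F B" using R unfolding finite_subring_def by blast
 let ?A = "(%i. a ^ i) ` {..<n}"
 have "T \<subseteq> span_over F ((%(b, b'). b * b') ` (B \<times> ?A))"
 proof
  fix x assume "x : T"
  then obtain r where rs: "x = (\<Sum>i<n. r i * a ^ i)" "\<forall>i<n. r i : R" unfolding T_def by blast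
  show "x : span_over F ((%(b, b'). b * b') ` (B \<times> ?A))" unfolding rs(1)
   by (intro span_over_sum span_over_mult span_over_base[OF F] F B(1) subsetD[OF B(2)]) (use rs(2) in auto)
 qed
 then have "finite_subring F T" unfolding finite_subring_def
  using B Tadd Tmult RT F0 by (intro conjI exI[of _ "(%(b, b'). b * b') ` (B \<times> ?A)"]) auto
 then show ?thesis using RT aT by blast
qed

context
 fixes F :: "'a::field set"
 assumes F: "is_subfield F"
begin

lemma monic_polys_over:
 assumes "p : polys_over F" "p ~= 0" "poly p a = 0"
 shows "\<exists>q\<in>polys_over F. lead_coeff q = 1 & poly q a = 0 & degree q = degree p"
 using assms F by (intro bexI[of _ "smult (inverse (lead_coeff p)) p"])
  (auto intro!: polys_over_intros subfield_intros coeff_polys_over)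

text \<open>Roots are adjoined one at a time. Closure of the algebraic elements under sums and
  products, and later under taking roots, comes from placing the finitely many elements involved in
  one such ring.\<close>

lemma finite_subring_algebraics:
 assumes "finite S" "S \<subseteq> alg_cl F"
 shows "\<exists>R. finite_subring F R & S \<subseteq> R"
 using assms
proof (induction S rule: finite_induct)
 case empty
 have "x : span_over F {1}" if "x : F" for x
  using span_over_scale[OF F that span_over_base[OF F, of "{1}" 1]] by simp
 then have "finite_subring F F" unfolding finite_subring_def
  by (intro conjI exI[of _ "{1}"]) (auto simp: subfield_add[OF F] subfield_mult[OF F])
 then show ?case by auto
next
 case (insert a S)
 then obtain R where R: "finite_subring F R" "S \<subseteq> R" by auto
 obtain p where "p : polys_over F" "lead_coeff p = 1" "poly p a = 0"
  using insert(4) monic_polys_over unfolding alg_cl_def algebraic_over_iff[OF F] insert_subset mem_Collect_eq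
  by metis
 moreover have "F \<subseteq> R" using R unfolding finite_subring_def by blast
 ultimately obtain R' where "finite_subring F R'" "R \<subseteq> R'" "a : R'"
  using finite_subring_adjoin_root[OF F R(1), of p a] polys_over_mono[of F R p] by auto
 then show ?case using R(2) by blast
qed

lemma alg_cl_subset: "F \<subseteq> alg_cl F"
 unfolding alg_cl_def using algebraic_self[OF F] by auto

lemma subfield_alg_cl: "is_subfield (alg_cl F)"
proof (rule subring_algebraic_subfield[OF F alg_cl_subset])
 fix a b assume "a : alg_cl F" "b : alg_cl F"
 then obtain R where R: "finite_subring F R" "{a, b} \<subseteq> R" using finite_subring_algebraics[of "{a, b}"] by auto
 then have "a + b : R" "a * b : R" unfolding finite_subring_def by auto
 then show "a + b : alg_cl F" "a * b : alg_cl F"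
  unfolding alg_cl_def using finite_subring_algebraic[OF F R(1)] by auto
qed (simp add: alg_cl_def)

end

text \<open>Only the finitely many coefficients of a monic polynomial for \<open>a\<close> matter:
  they lie in a ring of finite rank over \<open>F\<close>, and adjoining \<open>a\<close> to that
  ring keeps the rank finite.\<close>

lemma alg_cl_closed:
 assumes F: "is_subfield F" and "p : polys_over (alg_cl F)" "p ~= 0" "poly p a = 0"
 shows "a : alg_cl F"
proof -
 obtain q where q: "q : polys_over (alg_cl F)" "lead_coeff q = 1" "poly q a = 0"
  using monic_polys_over[OF subfield_alg_cl[OF F]] assms by blast
 have "set (coeffs q) \<subseteq> alg_cl F"
  using polys_over_coeffs[of "alg_cl F" q] q subfield_alg_cl[OF F] by (simp add: subfield_0)
 then obtain R where R: "finite_subring F R" "set (coeffs q) \<subseteq> R"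
  using finite_subring_algebraics[OF F, of "set (coeffs q)"] by auto
 have "q : polys_over R"
  using polys_over_coeffs[of R q] R F unfolding finite_subring_def by (auto simp: subset_iff subfield_0)
 then obtain R' where "finite_subring F R'" "a : R'"
  using finite_subring_adjoin_root[OF F R(1)] q by blast
 then show ?thesis using finite_subring_algebraic[OF F] unfolding alg_cl_def by blast
qed

lemma alg_cl_mono: "E \<subseteq> F ==> alg_cl E \<subseteq> alg_cl F"
 unfolding alg_cl_def algebraic_over_def by blast

lemma alg_cl_idem: "is_subfield F ==> alg_cl (alg_cl F) = alg_cl F"
 using alg_cl_closed[of F] alg_cl_subset[OF subfield_alg_cl, of F]
 by (auto simp: alg_cl_def algebraic_over_iff[OF subfield_alg_cl, unfolded alg_cl_def])

lemma alg_cl_between: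
 assumes "is_subfield F" "F \<subseteq> E" "E \<subseteq> alg_cl F" shows "alg_cl E = alg_cl F"
 using assms alg_cl_mono alg_cl_idem by (metis subset_antisym)

lemma has_degree_algebraic:
 assumes "is_subfield K" "is_subfield L" "has_degree K L n"
 shows "L \<subseteq> alg_cl K"
proof
 fix a assume a: "a : L"
 obtain B where B: "finite B" "!!a. a : L ==> \<exists>c. (\<forall>b\<in>B. c b : K) & a = (\<Sum>b\<in>B. c b * b)"
  using assms unfolding has_degree_def by blast
 have "a ^ n : span_over K B" for n
  using B(2)[of "a ^ n"] a assms subfield_power[of L a n] span_overI by metis
 then show "a : alg_cl K" using powers_in_span_algebraic[OF assms(1) B(1)] by (simp add: alg_cl_def)
qed

lemma adjoin_algebraic:
 assumes F: "is_subfield F" and a: "a : alg_cl F"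
 shows "adjoin F {a} = {poly p a | p. p : polys_over F}" (is "_ = ?R")
proof
 have cl: "poly p a : alg_cl F" if "p : polys_over F" for p
  using poly_in_subfield[OF subfield_alg_cl[OF F]] a that polys_over_mono alg_cl_subset[OF F] by blast
 have FR: "F \<subseteq> ?R"
 proof
  fix c assume "c : F"
  then show "c : ?R" using F by (intro CollectI exI[of _ "[:c:]"])
   (auto simp: polys_over_pCons_iff polys_over_0)
 qed
 have "is_subfield ?R"
 proof (rule subring_algebraic_subfield[OF F FR])
  fix x y assume "x : ?R" "y : ?R"
  then obtain p q where pq: "x = poly p a" "p : polys_over F" "y = poly q a" "q : polys_over F" by auto
  show "x + y : ?R" by (rule CollectI, rule exI[of _ "p + q"]) (use pq F in \<open>auto intro: polys_over_intros\<close>)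
  show "x * y : ?R" by (rule CollectI, rule exI[of _ "p * q"]) (use pq F in \<open>auto intro: polys_over_intros\<close>)
 qed (use cl in \<open>auto simp: alg_cl_def\<close>)
 moreover have "a : ?R"
  using F by (intro CollectI exI[of _ "[:0, 1:]"]) (auto simp: polys_over_pCons_iff polys_over_0 subfield_intros)
 ultimately show "adjoin F {a} \<subseteq> ?R" using FR by (intro adjoin_least) auto
 show "?R \<subseteq> adjoin F {a}"
  using adjoin_subset[of F "{a}"] adjoin_gen[of "{a}" F] subfield_adjoin[of F "{a}"]
  by (auto intro!: poly_in_subfield polys_over_mono[of F "adjoin F {a}"])
qed

lemma adjoin_simple:
 assumes F: "is_subfield F"
 shows "adjoin F {a} = {poly p a / poly r a | p r. p : polys_over F & r : polys_over F & poly r a ~= 0}"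
  (is "_ = ?R")
proof
 have FR: "F \<subseteq> ?R"
 proof
  fix c assume "c : F"
  then show "c : ?R" using F by (intro CollectI exI[of _ "[:c:]"] exI[of _ 1])
   (auto simp: polys_over_pCons_iff polys_over_0 polys_over_1)
 qed
 have "is_subfield ?R"
 proof (rule is_subfieldI)
  fix x y assume "x : ?R" "y : ?R"
  then obtain p r q s where pq: "x = poly p a / poly r a" "p : polys_over F" "r : polys_over F" "poly r a ~= 0"
   "y = poly q a / poly s a" "q : polys_over F" "s : polys_over F" "poly s a ~= 0" by auto
  show "x + y : ?R"
   by (rule CollectI, rule exI[of _ "p * s + q * r"], rule exI[of _ "r * s"])
    (use pq(2-4,6-8) F in \<open>auto intro!: polys_over_intros simp: pq(1,5) field_simps\<close>)
  show "x - y : ?R"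
   by (rule CollectI, rule exI[of _ "p * s - q * r"], rule exI[of _ "r * s"])
    (use pq(2-4,6-8) F in \<open>auto intro!: polys_over_intros simp: pq(1,5) field_simps\<close>)
  show "x * y : ?R"
   by (rule CollectI, rule exI[of _ "p * q"], rule exI[of _ "r * s"])
    (use pq(2-4,6-8) F in \<open>auto intro!: polys_over_intros simp: pq(1,5) field_simps\<close>)
  show "inverse x : ?R"
  proof (cases "poly p a = 0")
   case True then show ?thesis using pq FR F by (auto simp: subfield_0)
  next
   case False then show ?thesis
    by (intro CollectI, intro exI[of _ r] exI[of _ p]) (use pq in auto)
  qed
 qed (use subsetD[OF FR subfield_0[OF F]] subsetD[OF FR subfield_1[OF F]] in blast)+
 moreover have "a : ?R"
  using F by (intro CollectI exI[of _ "[:0, 1:]"] exI[of _ 1])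
   (auto simp: polys_over_pCons_iff polys_over_0 polys_over_1 subfield_intros)
 ultimately show "adjoin F {a} \<subseteq> ?R" using FR by (intro adjoin_least) auto
 have "poly p a : adjoin F {a}" if "p : polys_over F" for p
  using adjoin_subset[of F "{a}"] adjoin_gen[of "{a}" F] subfield_adjoin[of F "{a}"] that
  by (auto intro!: poly_in_subfield polys_over_mono[of F "adjoin F {a}"])
 then show "?R \<subseteq> adjoin F {a}" using subfield_adjoin by (auto intro!: subfield_divide)
qed

text \<open>Finite \<open>M\<close>-linear combinations of elements of \<open>L\<close> already form
  a ring, and this ring is a field because it is algebraic over \<open>L\<close>. This gives
  elements of the compositum coordinates in \<open>M\<close>.\<close>

lemma compositum_eq:
 assumes L: "is_subfield L" and M: "is_subfield M" and alg: "M \<subseteq> alg_cl L"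
 shows "adjoin L M = (\<Union>B\<in>{B. finite B & B \<subseteq> L}. span_over M B)" (is "_ = ?R")
proof
 have LR: "L \<subseteq> ?R"
 proof
  fix x assume "x : L"
  then show "x : ?R" using span_over_base[OF M, of "{x}" x] by (intro UN_I[of "{x}"]) auto
 qed
 have MR: "M \<subseteq> ?R"
 proof
  fix x assume "x : M"
  then show "x : ?R" using span_over_scale[OF M, of x 1 "{1}"] span_over_base[OF M, of "{1}" 1] L
   by (intro UN_I[of "{1}"]) (auto simp: subfield_1)
 qed
 have sub: "?R \<subseteq> adjoin L M"
 proof
  fix x assume "x : ?R"
  then obtain B c where B: "B \<subseteq> L" "finite B" "x = (\<Sum>b\<in>B. c b * b)" "\<forall>b\<in>B. c b : M"
   unfolding span_over_def by blast
  then show "x : adjoin L M" unfolding B(3)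
   using adjoin_subset[of L M] adjoin_gen[of M L] by (auto intro!: subfield_intros subfield_adjoin)
 qed
 have "is_subfield ?R"
 proof (rule subring_algebraic_subfield[OF L LR])
  fix x y assume "x : ?R" "y : ?R"
  then obtain B B' where B: "B \<subseteq> L" "finite B" "B' \<subseteq> L" "finite B'" "x : span_over M B" "y : span_over M B'"
   by blast
  then have "x : span_over M (B \<union> B')" "y : span_over M (B \<union> B')"
   using span_over_mono[OF M, of "B \<union> B'"] by blast+
  then show "x + y : ?R" using B span_over_add[OF M] by (intro UN_I[of "B \<union> B'"]) auto
  show "x * y : ?R"
   using B span_over_mult[OF M B(2,4)] L
   by (intro UN_I[of "(%(b, b'). b * b') ` (B \<times> B')"]) (auto intro!: subfield_intros)
 next
  fix x assume x: "x : ?R"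
  have "adjoin L M \<subseteq> alg_cl L" by (intro adjoin_least subfield_alg_cl L alg_cl_subset alg)
  then show "algebraic_over L x" using sub x by (auto simp: alg_cl_def)
 qed
 then show "adjoin L M \<subseteq> ?R" using LR MR by (intro adjoin_least) auto
 show "?R \<subseteq> adjoin L M" by (rule sub)
qed

text \<open>A shortest expression of \<open>z\<close> uses an independent family: a relation would
  let one member be eliminated.\<close>

lemma compositum_independent:
 assumes L: "is_subfield L" and M: "is_subfield M" and alg: "M \<subseteq> alg_cl L" and z: "z : adjoin L M"
 obtains B c where "finite B" "B \<subseteq> L" "\<forall>b\<in>B. c b : M" "z = (\<Sum>b\<in>B. c b * b)"
  "!!e. (\<forall>b\<in>B. e b : M) ==> (\<Sum>b\<in>B. e b * b) = 0 ==> \<forall>b\<in>B. e b = 0"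
proof -
 define P where "P B = (finite B & B \<subseteq> L & z : span_over M B)" for B
 have "\<exists>B. P B" using z unfolding compositum_eq[OF L M alg] P_def by auto
 then obtain B where B: "P B" and min: "!!B'. P B' ==> card B \<le> card B'"
  using ex_has_least_nat[of P _ card] by blast
 obtain c where c: "\<forall>b\<in>B. c b : M" "z = (\<Sum>b\<in>B. c b * b)"
  using B unfolding P_def span_over_def by blast
 have fB: "finite B" "B \<subseteq> L" using B unfolding P_def by auto
 have "\<forall>b\<in>B. e b = 0" if e: "\<forall>b\<in>B. e b : M" "(\<Sum>b\<in>B. e b * b) = 0" for e
 proof (rule ccontr)
  assume "\<not> (\<forall>b\<in>B. e b = 0)"
  then obtain b0 where b0: "b0 : B" "e b0 ~= 0" by blast
  define B' where "B' = B - {b0}"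
  have BB: "B = insert b0 B'" "b0 \<notin> B'" "finite B'" using b0 fB by (auto simp: B'_def)
  have e0: "e b0 * b0 + (\<Sum>b\<in>B'. e b * b) = 0" using e(2) BB by simp
  have "z = c b0 * b0 + (\<Sum>b\<in>B'. c b * b)" using c(2) BB by simp
  moreover have "b0 = (\<Sum>b\<in>B'. - (e b / e b0) * b)"
  proof -
   have "e b0 * (\<Sum>b\<in>B'. - (e b / e b0) * b) = - (\<Sum>b\<in>B'. e b * b)"
    using b0(2) by (simp add: sum_distrib_left sum_negf[symmetric])
   also have "\<dots> = e b0 * b0" using minus_unique[OF e0] by (metis minus_minus)
   finally show ?thesis using b0(2) by simp
  qed
  then have "b0 : span_over M B'"
   using span_overI[of B' "%b. - (e b / e b0)" M] e(1) b0 M BB by (auto intro!: subfield_intros)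
  ultimately have "z : span_over M B'"
   using M c(1) BB span_overI[of B' c M] by (auto intro!: span_over_add span_over_scale)
  then have "P B'" using fB BB unfolding P_def by auto
  then have "card B \<le> card B'" by (rule min)
  then show False using BB by simp
 qed
 then show thesis using that fB c by blast
qed

section \<open>Isomorphisms of subfields\<close>

text \<open>Isomorphisms of subfields as relations: unions of chains and converses need no choice of
  functions, so Zorn and the symmetry between source and target come cheaply. Through differences,
  the condition on zero makes the relation single-valued in both directions.\<close>

definition field_graph :: "('a::field \<times> 'a) set => bool" where
 "field_graph R \<longleftrightarrow> (0, 0) : R & (1, 1) : R &
   (\<forall>a a' b b'. (a, a') : R --> (b, b') : R --> (a + b, a' + b') : R & (a - b, a' - b') : R &
    (a * b, a' * b') : R & (inverse a, inverse a') : R) &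
   (\<forall>a a'. (a, a') : R --> (a = 0 \<longleftrightarrow> a' = 0))"

lemma field_graph_unique:
 "field_graph R ==> (a, b) : R ==> (a, c) : R ==> b = c"
 "field_graph R ==> (b, a) : R ==> (c, a) : R ==> b = c"
 unfolding field_graph_def by (metis eq_iff_diff_eq_0)+

lemma field_graph_converse: "field_graph R ==> field_graph (R\<inverse>)"
 unfolding field_graph_def by simp

lemma subfield_Domain: "field_graph R ==> is_subfield (Domain R)"
 unfolding field_graph_def by (intro is_subfieldI) blast+

lemma subfield_Range: "field_graph R ==> is_subfield (Range R)"
 unfolding field_graph_def by (intro is_subfieldI) blast+

definition poly_pair :: "('a::field \<times> 'a) set => 'a poly => 'a poly => bool" where
 "poly_pair R p p' \<longleftrightarrow> (\<forall>i. (coeff p i, coeff p' i) : R)"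

lemma poly_pair_converse: "poly_pair (R\<inverse>) p p' \<longleftrightarrow> poly_pair R p' p"
 by (simp add: poly_pair_def)

context
 fixes R :: "('a::field \<times> 'a) set"
 assumes R: "field_graph R"
begin

lemma field_graph_closed:
 "(0, 0) : R" "(1, 1) : R"
 "(a, a') : R ==> (b, b') : R ==> (a + b, a' + b') : R"
 "(a, a') : R ==> (b, b') : R ==> (a - b, a' - b') : R"
 "(a, a') : R ==> (b, b') : R ==> (a * b, a' * b') : R"
 "(a, a') : R ==> (inverse a, inverse a') : R"
 "(a, a') : R ==> a = 0 \<longleftrightarrow> a' = 0"
 using R unfolding field_graph_def by blast+

lemma field_graph_sum: "(!!i. i : I ==> (f i, f' i) : R) ==> (sum f I, sum f' I) : R"
 by (induction I rule: infinite_finite_induct) (auto intro: field_graph_closed)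

lemma poly_pair_closed:
 "poly_pair R 0 0" "poly_pair R 1 1"
 "poly_pair R p p' ==> poly_pair R q q' ==> poly_pair R (p + q) (p' + q')"
 "poly_pair R p p' ==> poly_pair R q q' ==> poly_pair R (p - q) (p' - q')"
 "poly_pair R p p' ==> poly_pair R q q' ==> poly_pair R (p * q) (p' * q')"
 "(a, a') : R ==> poly_pair R [:a:] [:a':]"
 "poly_pair R [:0, 1:] [:0, 1:]"
 unfolding poly_pair_def
 by (auto simp: coeff_mult one_pCons coeff_pCons split: nat.splits intro!: field_graph_sum intro: field_graph_closed)

lemma poly_pair_unique: "poly_pair R p p' ==> poly_pair R p p'' ==> p' = p''"
 unfolding poly_pair_def poly_eq_iff using field_graph_unique(1)[OF R] by blast

lemma poly_pair_degree: "poly_pair R p p' ==> degree p = degree p'"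
 unfolding poly_pair_def degree_def using field_graph_closed(7) by metis

lemma poly_pair_0_iff: "poly_pair R p p' ==> p = 0 \<longleftrightarrow> p' = 0"
 unfolding poly_pair_def poly_eq_iff using field_graph_closed(7) by (metis coeff_0)

lemma poly_pair_exists:
 assumes "p : polys_over (Domain R)" shows "\<exists>p'. poly_pair R p p'"
proof -
 define f where "f c = (SOME d. (c, d) : R)" for c
 have f: "(c, f c) : R" if "c : Domain R" for c
  using that unfolding f_def by (auto intro: someI)
 have "f 0 = 0" using f[of 0] field_graph_closed(1) field_graph_closed(7)[of 0 "f 0"] by blast
 then have "poly_pair R p (map_poly f p)"
  using assms f by (auto simp: poly_pair_def coeff_map_poly polys_over_def)
 then show ?thesis by blast
qed

lemma poly_pair_Domain: "poly_pair R p p' ==> p : polys_over (Domain R)"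
 unfolding poly_pair_def polys_over_def by blast

end

text \<open>Sending p(a) / r(a) to p'(a') / r'(a') is consistent as soon as corresponding
  polynomials vanish at \<open>a\<close> and \<open>a'\<close> together. The transcendental and the
  algebraic extension steps are both instances.\<close>

lemma field_graph_extend:
 assumes R: "field_graph R" and z: "!!p p'. poly_pair R p p' ==> poly p a = 0 \<longleftrightarrow> poly p' a' = 0"
 obtains R' where "field_graph R'" "R \<subseteq> R'" "(a, a') : R'" "Domain R' = adjoin (Domain R) {a}"
  "Range R' = adjoin (Range R) {a'}"
proof -
 define R' where "R' = {(poly p a / poly r a, poly p' a' / poly r' a') | p p' r r'.
  poly_pair R p p' & poly_pair R r r' & poly r a ~= 0}"
 note cl = poly_pair_closed[OF R]
 have I: "(x, x') : R'" if "poly_pair R p p'" "poly_pair R r r'" "poly r a ~= 0"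
  "x = poly p a / poly r a" "x' = poly p' a' / poly r' a'" for p p' r r' x x'
  using that unfolding R'_def by blast
 have E: "\<exists>p p' r r'. poly_pair R p p' & poly_pair R r r' & poly r a ~= 0 & poly r' a' ~= 0 &
  x = poly p a / poly r a & x' = poly p' a' / poly r' a'" if "(x, x') : R'" for x x'
  using that z unfolding R'_def by blast
 have 1: "(x + y, x' + y') : R' & (x - y, x' - y') : R' & (x * y, x' * y') : R' & (inverse x, inverse x') : R'"
  if xy: "(x, x') : R'" "(y, y') : R'" for x x' y y'
 proof -
  obtain p p' r r' where p: "poly_pair R p p'" "poly_pair R r r'" "poly r a ~= 0" "poly r' a' ~= 0"
   "x = poly p a / poly r a" "x' = poly p' a' / poly r' a'" using E[OF xy(1)] by blast
  obtain q q' s s' where q: "poly_pair R q q'" "poly_pair R s s'" "poly s a ~= 0" "poly s' a' ~= 0"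
   "y = poly q a / poly s a" "y' = poly q' a' / poly s' a'" using E[OF xy(2)] by blast
  have rs: "poly_pair R (r * s) (r' * s')" "poly (r * s) a ~= 0" using p q cl by auto
  have a: "(x + y, x' + y') : R'"
   by (rule I[OF _ rs, of "p * s + q * r" "p' * s' + q' * r'"]) (use p(1-4) q(1-4) cl in \<open>auto simp: p(5,6) q(5,6) field_simps\<close>)
  have b: "(x - y, x' - y') : R'"
   by (rule I[OF _ rs, of "p * s - q * r" "p' * s' - q' * r'"]) (use p(1-4) q(1-4) cl in \<open>auto simp: p(5,6) q(5,6) field_simps\<close>)
  have c: "(x * y, x' * y') : R'"
   by (rule I[OF _ rs, of "p * q" "p' * q'"]) (use p(1-4) q(1-4) cl in \<open>auto simp: p(5,6) q(5,6) field_simps\<close>)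
  have d: "(inverse x, inverse x') : R'"
  proof (cases "poly p a = 0")
   case True
   then have "inverse x = 0" "inverse x' = 0" using p z by auto
   then show ?thesis by (intro I[of 0 0 1 1]) (use cl in auto)
  next
   case False
   then show ?thesis by (intro I[of r r' p p']) (use p in auto)
  qed
  show ?thesis using a b c d by blast
 qed
 have 2: "x = 0 \<longleftrightarrow> x' = 0" if xx: "(x, x') : R'" for x x'
  using E[OF xx] z by auto
 have RR': "R \<subseteq> R'"
 proof safe
  fix x x' assume "(x, x') : R"
  then show "(x, x') : R'" using cl by (intro I[of "[:x:]" "[:x':]" 1 1]) auto
 qed
 have a: "(a, a') : R'" by (rule I[of "[:0, 1:]" "[:0, 1:]" 1 1]) (use cl in auto)
 have fg: "field_graph R'"
  unfolding field_graph_def using 1 2 RR' field_graph_closed(1,2)[OF R] by blast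
 have D: "Domain R' = adjoin (Domain R) {a}" if R: "field_graph R"
  and R': "R' = {(poly p a / poly r a, poly p' a' / poly r' a') | p p' r r'.
    poly_pair R p p' & poly_pair R r r' & poly r a ~= 0}" for R R' :: "('a \<times> 'a) set" and a a'
 proof -
  have "x : Domain R' \<longleftrightarrow> (\<exists>p r. p : polys_over (Domain R) & r : polys_over (Domain R) & poly r a ~= 0 &
   x = poly p a / poly r a)" (is "_ \<longleftrightarrow> ?rhs") for x
  proof
   assume "x : Domain R'"
   then show ?rhs unfolding R' using poly_pair_Domain[OF R] by blast
  next
   assume ?rhs
   then obtain p r where pr: "p : polys_over (Domain R)" "r : polys_over (Domain R)" "poly r a ~= 0"
    "x = poly p a / poly r a" by blast
   moreover obtain p' r' where "poly_pair R p p'" "poly_pair R r r'"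
    using poly_pair_exists[OF R pr(1)] poly_pair_exists[OF R pr(2)] by blast
   ultimately show "x : Domain R'" unfolding R' by blast
  qed
  then show ?thesis unfolding adjoin_simple[OF subfield_Domain[OF R]] by blast
 qed
 \<comment> \<open>The converse relation is the same construction with \<open>a\<close> and
   \<open>a'\<close> exchanged, so the description of the domain also yields that of the
   range.\<close>
 have "R'\<inverse> = {(poly p a' / poly r a', poly p' a / poly r' a) | p p' r r'.
  poly_pair (R\<inverse>) p p' & poly_pair (R\<inverse>) r r' & poly r a' ~= 0}"
  unfolding R'_def poly_pair_converse using z by blast
 from D[OF field_graph_converse[OF R] this] have "Range R' = adjoin (Range R) {a'}" by simp
 then show thesis using that[OF fg RR' a] D[OF R R'_def] by blast
qed

lemma field_graph_extend_transcendental: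
 assumes R: "field_graph R" and "\<not> algebraic_over (Domain R) a" "\<not> algebraic_over (Range R) a'"
 obtains R' where "field_graph R'" "R \<subseteq> R'" "(a, a') : R'" "Domain R' = adjoin (Domain R) {a}"
  "Range R' = adjoin (Range R) {a'}"
proof (rule field_graph_extend[OF R])
 fix p p' assume pp: "poly_pair R p p'"
 have "p : polys_over (Domain R)" "p' : polys_over (Range R)"
  using pp unfolding poly_pair_def polys_over_def by blast+
 then show "poly p a = 0 \<longleftrightarrow> poly p' a' = 0"
  using assms poly_pair_0_iff[OF R pp] algebraic_over_iff[OF subfield_Domain[OF R]]
   algebraic_over_iff[OF subfield_Range[OF R]] by auto
qed (use that in blast)

text \<open>Vanishing at \<open>a\<close> is transferred by divisibility by \<open>g\<close>.
  Nonvanishing is transferred through inverses: if p(a) ~= 0 then p t - 1 vanishes at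
  \<open>a\<close> for some polynomial t, so p' t' - 1 vanishes at \<open>a'\<close> and p'(a') ~=
  0.\<close>

lemma field_graph_extend_algebraic:
 assumes R: "field_graph R" and g: "g : polys_over (Domain R)" "g ~= 0" "poly g a = 0"
  "!!p. p : polys_over (Domain R) ==> poly p a = 0 ==> \<exists>s\<in>polys_over (Domain R). p = g * s"
  and g': "poly_pair R g g'" "poly g' a' = 0"
 obtains R' where "field_graph R'" "R \<subseteq> R'" "(a, a') : R'" "Domain R' = adjoin (Domain R) {a}"
  "Range R' = adjoin (Range R) {a'}"
proof (rule field_graph_extend[OF R])
 have D: "is_subfield (Domain R)" by (rule subfield_Domain[OF R])
 have 1: "poly p' a' = 0" if pp: "poly_pair R p p'" "poly p a = 0" for p p'
 proof -
  obtain s where s: "s : polys_over (Domain R)" "p = g * s" using g(4) pp poly_pair_Domain[OF R] by blast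
  then obtain s' where "poly_pair R s s'" using poly_pair_exists[OF R] by blast
  then have "poly_pair R p (g' * s')" using s g' poly_pair_closed[OF R] by auto
  then have "p' = g' * s'" using poly_pair_unique[OF R] pp by blast
  then show ?thesis using g' by simp
 qed
 fix p p' assume pp: "poly_pair R p p'"
 have "poly p' a' ~= 0" if nz: "poly p a ~= 0"
 proof -
  have a: "a : alg_cl (Domain R)" unfolding alg_cl_def algebraic_over_iff[OF D] using g by auto
  have "poly p a : adjoin (Domain R) {a}" unfolding adjoin_algebraic[OF D a]
   using poly_pair_Domain[OF R pp] by auto
  then have "inverse (poly p a) : adjoin (Domain R) {a}" by (intro subfield_inverse subfield_adjoin)
  then obtain t where t: "t : polys_over (Domain R)" "inverse (poly p a) = poly t a"
   unfolding adjoin_algebraic[OF D a] by blast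
  obtain t' where t': "poly_pair R t t'" using poly_pair_exists[OF R t(1)] by blast
  have "poly_pair R (p * t - 1) (p' * t' - 1)" using pp t' poly_pair_closed[OF R] by blast
  moreover have "poly (p * t - 1) a = 0" using nz t(2)[symmetric] by simp
  ultimately have "poly (p' * t' - 1) a' = 0" by (rule 1)
  then show ?thesis by auto
 qed
 then show "poly p a = 0 \<longleftrightarrow> poly p' a' = 0" using 1[OF pp] by blast
qed (use that in blast)

text \<open>A maximal graph inside the two algebraic closures has full domain: a missing element
  could be sent to a root of the transferred minimal polynomial, which exists in the algebraically
  closed universe. The same argument for the converse graph gives the full range.\<close>

theorem field_graph_extend_alg_cl:
 fixes R0 :: "('a::alg_closed_field \<times> 'a) set"
 assumes R0: "field_graph R0"
 obtains R where "field_graph R" "R0 \<subseteq> R" "Domain R = alg_cl (Domain R0)" "Range R = alg_cl (Range R0)"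
proof -
 define good where "good R0 = {R. field_graph R & R0 \<subseteq> R & Domain R \<subseteq> alg_cl (Domain R0) &
  Range R \<subseteq> alg_cl (Range R0)}" for R0 :: "('a \<times> 'a) set"
 have "\<exists>M\<in>good R0. \<forall>X\<in>good R0. M \<subseteq> X --> X = M"
 proof (rule subset_Zorn_nonempty)
  show "good R0 ~= {}" using R0 alg_cl_subset[OF subfield_Domain[OF R0]] alg_cl_subset[OF subfield_Range[OF R0]]
   unfolding good_def by blast
 next
  fix C assume C: "C ~= {}" "subset.chain (good R0) C"
  have two: "\<exists>X\<in>C. x \<in> X & y \<in> X" if "x \<in> \<Union>C" "y \<in> \<Union>C" for x y
   using C that unfolding subset.chain_def by blast
  have g: "field_graph X" "R0 \<subseteq> X" "Domain X \<subseteq> alg_cl (Domain R0)" "Range X \<subseteq> alg_cl (Range R0)"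
   if "X : C" for X using C that unfolding subset.chain_def good_def by blast+
  have cl: "(a + b, a' + b') : \<Union>C & (a - b, a' - b') : \<Union>C &
    (a * b, a' * b') : \<Union>C & (inverse a, inverse a') : \<Union>C" if ab: "(a, a') : \<Union>C" "(b, b') : \<Union>C" for a a' b b'
  proof -
   obtain X where X: "X : C" "(a, a') : X" "(b, b') : X" using two[OF ab] by blast
   have fX: "field_graph X" by (rule g(1)[OF X(1)])
   show ?thesis using X(1) field_graph_closed(3-5)[OF fX X(2,3)] field_graph_closed(6)[OF fX X(2)] by blast
  qed
  have "field_graph (\<Union>C)" unfolding field_graph_def
  proof (intro conjI allI impI)
   fix a a' b b' assume ab: "(a, a') : \<Union>C" "(b, b') : \<Union>C"
   show "(a + b, a' + b') : \<Union>C" "(a - b, a' - b') : \<Union>C" "(a * b, a' * b') : \<Union>C" "(inverse a, inverse a') : \<Union>C"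
    using cl[OF ab] by blast+
  next
   show "(0, 0) : \<Union>C" "(1, 1) : \<Union>C" using C(1) field_graph_closed(1,2)[OF g(1)] by blast+
  next
   fix a a' assume "(a, a') : \<Union>C"
   then show "a = 0 \<longleftrightarrow> a' = 0" using field_graph_closed(7)[OF g(1)] by blast
  qed
  moreover have "R0 \<subseteq> \<Union>C" "Domain (\<Union>C) \<subseteq> alg_cl (Domain R0)" "Range (\<Union>C) \<subseteq> alg_cl (Range R0)"
   using C(1) g by blast+
  ultimately show "\<Union>C \<in> good R0" unfolding good_def by blast
 qed
 then obtain M where M: "M : good R0" "!!X. X : good R0 ==> M \<subseteq> X ==> X = M" by blast
 have full: "alg_cl (Domain R0) \<subseteq> Domain M"
  if R0: "field_graph R0" and M: "M : good R0" "!!X. X : good R0 ==> M \<subseteq> X ==> X = M"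
  for R0 M :: "('a \<times> 'a) set"
 proof
  fix a assume a: "a : alg_cl (Domain R0)"
  have fM: "field_graph M" "R0 \<subseteq> M" "Domain M \<subseteq> alg_cl (Domain R0)" "Range M \<subseteq> alg_cl (Range R0)"
   using M(1) unfolding good_def by blast+
  note D = subfield_Domain[OF fM(1)] and Rg = subfield_Range[OF fM(1)]
  have D0: "Domain R0 \<subseteq> Domain M" "Range R0 \<subseteq> Range M" using fM(2) by blast+
  then have "algebraic_over (Domain M) a" using a alg_cl_mono unfolding alg_cl_def by blast
  then obtain g where g: "g : polys_over (Domain M)" "g ~= 0" "poly g a = 0"
   "!!p. p : polys_over (Domain M) ==> poly p a = 0 ==> \<exists>s\<in>polys_over (Domain M). p = g * s"
   using min_poly_exists[OF D] by blast
  obtain g' where g': "poly_pair M g g'" using poly_pair_exists[OF fM(1) g(1)] by blast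
  have "degree g > 0"
  proof (rule ccontr)
   assume "\<not> degree g > 0"
   then obtain c where "g = [:c:]" using degree_eq_zeroE[of g] by auto
   then show False using g by auto
  qed
  then obtain a' where a': "poly g' a' = 0"
   using alg_closed_imp_poly_has_root[of g'] poly_pair_degree[OF fM(1) g'] by auto
  obtain M' where M': "field_graph M'" "M \<subseteq> M'" "(a, a') : M'" "Domain M' = adjoin (Domain M) {a}"
   "Range M' = adjoin (Range M) {a'}"
   using field_graph_extend_algebraic[OF fM(1) g g' a'] by blast
  have sR0: "is_subfield (Range R0)" "is_subfield (Domain R0)"
   by (rule subfield_Range[OF R0], rule subfield_Domain[OF R0])
  have "g' : polys_over (alg_cl (Range R0))" using g' fM(4) unfolding poly_pair_def polys_over_def by blast
  moreover have "g' ~= 0" using poly_pair_0_iff[OF fM(1) g'] g(2) by blast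
  ultimately have "a' : alg_cl (Range R0)" using alg_cl_closed[OF sR0(1) _ _ a'] by blast
  then have "Range M' \<subseteq> alg_cl (Range R0)" unfolding M'(5) using fM(4)
   by (intro adjoin_least subfield_alg_cl sR0) auto
  moreover have "Domain M' \<subseteq> alg_cl (Domain R0)" unfolding M'(4) using fM(3) a
   by (intro adjoin_least subfield_alg_cl sR0) auto
  ultimately have "M' = M" using M' fM M(2)[of M'] unfolding good_def by blast
  then show "a : Domain M" using M'(3) by blast
 qed
 have gc: "X\<inverse> : good (R0\<inverse>) \<longleftrightarrow> X : good R0" for X
  unfolding good_def using field_graph_converse[of X] field_graph_converse[of "X\<inverse>"] by auto
 have "alg_cl (Range R0) \<subseteq> Range M"
 proof -
  have "X = M\<inverse>" if "X : good (R0\<inverse>)" "M\<inverse> \<subseteq> X" for X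
   using M(2)[of "X\<inverse>"] gc[of "X\<inverse>"] that by (metis converse_converse converse_subset_swap)
  then have "alg_cl (Domain (R0\<inverse>)) \<subseteq> Domain (M\<inverse>)"
   using full[OF field_graph_converse[OF R0], of "M\<inverse>"] M(1) gc[of M] by blast
  then show ?thesis by simp
 qed
 then show thesis using that[of M] M full[OF R0 M] unfolding good_def by blast
qed

subsection \<open>Isomorphisms as functions\<close>

lemma Domain_graph: "Domain {(a, f a) | a. a : E} = E" and Range_graph: "Range {(a, f a) | a. a : E} = f ` E"
 by auto

lemma field_isoD:
 assumes "field_iso k E F f"
 shows "bij_betw f E F" "!!a. a : k ==> f a = a" "!!a b. a : E ==> b : E ==> f (a + b) = f a + f b"
  "!!a b. a : E ==> b : E ==> f (a * b) = f a * f b" "inj_on f E" "f ` E = F"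
 using assms unfolding field_iso_def bij_betw_def by auto

context
 fixes k E F :: "'a::field set" and f
 assumes f: "field_iso k E F f" and E: "is_subfield E"
begin

lemma iso_0: "f 0 = 0"
 using field_isoD(3)[OF f, of 0 0] subfield_0[OF E] by (metis add.right_neutral add_left_cancel)

lemma iso_eq_0_iff: "a : E ==> f a = 0 \<longleftrightarrow> a = 0"
 using iso_0 field_isoD(5)[OF f] subfield_0[OF E] by (metis inj_onD)

lemma iso_1: "f 1 = 1"
 using field_isoD(4)[OF f, of 1 1] iso_eq_0_iff[of 1] subfield_1[OF E] by simp

lemma iso_diff: "a : E ==> b : E ==> f (a - b) = f a - f b"
 using field_isoD(3)[OF f, of "a - b" b] subfield_diff[OF E] by (simp add: algebra_simps)

lemma iso_inverse: "a : E ==> f (inverse a) = inverse (f a)"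
proof (cases "a = 0")
 case False
 assume a: "a : E"
 have "f (a * inverse a) = f a * f (inverse a)" by (rule field_isoD(4)[OF f a subfield_inverse[OF E a]])
 then show ?thesis using False iso_1 by (simp add: inverse_unique)
qed (simp add: iso_0)

lemma iso_divide: "a : E ==> b : E ==> f (a / b) = f a / f b"
 using field_isoD(4)[OF f, of a "inverse b"] iso_inverse[of b] subfield_inverse[OF E, of b]
 by (simp add: divide_inverse)

lemma iso_power: "a : E ==> f (a ^ n) = f a ^ n"
 by (induction n) (auto simp: iso_1 field_isoD(4)[OF f] subfield_power[OF E])

lemma iso_sum: "(!!i. i : I ==> g i : E) ==> f (sum g I) = (\<Sum>i\<in>I. f (g i))"
 by (induction I rule: infinite_finite_induct)
  (auto simp: iso_0 field_isoD(3)[OF f] subfield_sum[OF E])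

lemma iso_in: "a : E ==> f a : F"
 using field_isoD(6)[OF f] by auto

lemma iso_field_graph: "field_graph {(a, f a) | a. a : E}"
 unfolding field_graph_def using E iso_0 iso_1
 by (auto simp: subfield_intros field_isoD(3,4)[OF f] iso_diff iso_inverse iso_eq_0_iff)

lemma iso_subfield: "is_subfield F"
 using subfield_Range[OF iso_field_graph] unfolding Range_graph field_isoD(6)[OF f] .

lemma iso_restrict: "E0 \<subseteq> E ==> field_iso k E0 (f ` E0) f"
 using f unfolding field_iso_def bij_betw_def by (auto intro: inj_on_subset)

lemma iso_map_poly:
 assumes "p : polys_over E" "a : E"
 shows "f (poly p a) = poly (map_poly f p) (f a)"
 using assms
proof (induction p)
 case 0 then show ?case by (simp add: iso_0)
next
 case (pCons c p)
 have "c : E" "p : polys_over E" using pCons.prems polys_over_pCons_iff[OF E] by auto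
 then show ?case using pCons.IH pCons.prems E poly_in_subfield[OF E]
  by (simp add: map_poly_pCons iso_0 field_isoD(3,4)[OF f] subfield_intros)
qed

end

lemma iso_image_subfield:
 assumes f: "field_iso k E F f" and E: "is_subfield E" and E0: "is_subfield E0" "E0 \<subseteq> E"
 shows "is_subfield (f ` E0)"
 using iso_subfield[OF iso_restrict[OF f E E0(2)] E0(1)] .

lemma iso_inv:
 assumes f: "field_iso k E F f" and E: "is_subfield E" and "k \<subseteq> E"
 shows "field_iso k F E (inv_into E f)"
proof -
 have b: "bij_betw (inv_into E f) F E" by (rule bij_betw_inv_into[OF field_isoD(1)[OF f]])
 have i: "inv_into E f (f a) = a" if "a : E" for a by (rule inv_into_f_f[OF field_isoD(5)[OF f] that])
 have "inv_into E f a = a" if "a : k" for a using i[of a] field_isoD(2)[OF f that] assms(3) that by auto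
 moreover have "inv_into E f (a + b) = inv_into E f a + inv_into E f b &
  inv_into E f (a * b) = inv_into E f a * inv_into E f b" if ab: "a : F" "b : F" for a b
 proof -
  obtain x y where "x : E" "y : E" "a = f x" "b = f y" using ab field_isoD(6)[OF f] by blast
  then show ?thesis using i field_isoD(3,4)[OF f, of x y, symmetric] E by (auto simp: subfield_intros)
 qed
 ultimately show ?thesis unfolding field_iso_def using b by blast
qed

lemma iso_comp:
 assumes "field_iso k E F f" "field_iso k F G g"
 shows "field_iso k E G (g \<circ> f)"
 using assms bij_betw_trans[of f E F g G] unfolding field_iso_def by (auto simp: bij_betwE)

lemma iso_id: "field_iso k E E id"
 unfolding field_iso_def by (auto simp: bij_betw_def)

lemma iso_weaken: "field_iso k E F f ==> k' \<subseteq> k ==> field_iso k' E F f"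
 unfolding field_iso_def by auto

lemma iso_adjoin:
 assumes f: "field_iso k E F f" and E: "is_subfield E" and S: "G \<subseteq> E" "S \<subseteq> E"
 shows "f ` adjoin G S = adjoin (f ` G) (f ` S)"
proof
 have GE: "adjoin G S \<subseteq> E" by (intro adjoin_least E S)
 have f': "field_iso {} E F f" by (rule iso_weaken[OF f]) simp
 have sub: "adjoin G S \<subseteq> inv_into E f ` adjoin (f ` G) (f ` S)"
 proof (rule adjoin_least)
  have FF: "adjoin (f ` G) (f ` S) \<subseteq> F"
   using S field_isoD(6)[OF f] by (intro adjoin_least iso_subfield[OF f E]) auto
  show "is_subfield (inv_into E f ` adjoin (f ` G) (f ` S))"
   using iso_image_subfield[OF iso_inv[OF f' E] iso_subfield[OF f E] subfield_adjoin FF] by simp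
  have i: "inv_into E f (f a) = a" if "a : E" for a by (rule inv_into_f_f[OF field_isoD(5)[OF f] that])
  show "G \<subseteq> inv_into E f ` adjoin (f ` G) (f ` S)" 
  proof
   fix a assume a: "a : G"
   then have "a = inv_into E f (f a)" using i S by auto
   then show "a : inv_into E f ` adjoin (f ` G) (f ` S)" using adjoin_subset[of "f ` G" "f ` S"] a by blast
  qed
  show "S \<subseteq> inv_into E f ` adjoin (f ` G) (f ` S)" 
  proof
   fix a assume a: "a : S"
   then have "a = inv_into E f (f a)" using i S by auto
   then show "a : inv_into E f ` adjoin (f ` G) (f ` S)" using adjoin_gen[of "f ` S" "f ` G"] a by blast
  qed
 qed
 show "f ` adjoin G S \<subseteq> adjoin (f ` G) (f ` S)"
 proof
  fix y assume "y : f ` adjoin G S"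
  then obtain z where z: "z : adjoin (f ` G) (f ` S)" "y = f (inv_into E f z)" using sub by blast
  have "adjoin (f ` G) (f ` S) \<subseteq> F"
   using S field_isoD(6)[OF f] by (intro adjoin_least iso_subfield[OF f E]) auto
  then show "y : adjoin (f ` G) (f ` S)" using z f_inv_into_f[of z f E] field_isoD(6)[OF f] by auto
 qed
 show "adjoin (f ` G) (f ` S) \<subseteq> f ` adjoin G S"
  using adjoin_subset[of G S] adjoin_gen[of S G]
  by (intro adjoin_least iso_image_subfield[OF f E subfield_adjoin GE]) auto
qed

lemma field_graph_iso:
 assumes R: "field_graph R"
 obtains f where "field_iso {} (Domain R) (Range R) f" "!!a b. (a, b) : R ==> f a = b"
proof -
 define f where "f a = (THE b. (a, b) : R)" for a
 have f: "f a = b" if "(a, b) : R" for a b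
  unfolding f_def using that field_graph_unique(1)[OF R] by blast
 have "bij_betw f (Domain R) (Range R)" unfolding bij_betw_def inj_on_def
  using f field_graph_unique(2)[OF R] by (auto simp: image_iff)
 then have "field_iso {} (Domain R) (Range R) f" unfolding field_iso_def
  using f field_graph_closed(3,5)[OF R] by auto
 then show thesis using that f by blast
qed

lemma iso_extend_alg_cl:
 fixes E :: "'a::alg_closed_field set"
 assumes f: "field_iso {} E F f" and E: "is_subfield E"
 obtains g where "field_iso {} (alg_cl E) (alg_cl F) g" "!!a. a : E ==> g a = f a"
proof -
 obtain R where R: "field_graph R" "{(a, f a) | a. a : E} \<subseteq> R" "Domain R = alg_cl E" "Range R = alg_cl F"
  by (rule field_graph_extend_alg_cl[OF iso_field_graph[OF f E]])
   (simp only: Domain_graph Range_graph field_isoD(6)[OF f])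
 obtain g where "field_iso {} (Domain R) (Range R) g" "!!a b. (a, b) : R ==> g a = b"
  using field_graph_iso[OF R(1)] by blast
 then show thesis using that[of g] R(2-4) by auto
qed

lemma iso_extend_transcendental:
 fixes E :: "'a::field set"
 assumes f: "field_iso {} E F f" and E: "is_subfield E"
  and t: "\<not> algebraic_over E a" "\<not> algebraic_over F a'"
 obtains g where "field_iso {} (adjoin E {a}) (adjoin F {a'}) g" "!!c. c : E ==> g c = f c" "g a = a'"
proof -
 obtain R where R: "field_graph R" "{(a, f a) | a. a : E} \<subseteq> R" "(a, a') : R"
  "Domain R = adjoin E {a}" "Range R = adjoin F {a'}"
  by (rule field_graph_extend_transcendental[OF iso_field_graph[OF f E], of a a'])
   (use t in \<open>simp_all only: Domain_graph Range_graph field_isoD(6)[OF f] not_False_eq_True\<close>)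
 obtain g where "field_iso {} (Domain R) (Range R) g" "!!a b. (a, b) : R ==> g a = b"
  using field_graph_iso[OF R(1)] by blast
 then show thesis using that[of g] R(2-5) by auto
qed

lemma iso_alg_cl:
 assumes f: "field_iso {} E F f" and E: "is_subfield E" and k: "is_subfield k" "k \<subseteq> E"
  and a: "a : E" "a : alg_cl k"
 shows "f a : alg_cl (f ` k)"
proof -
 obtain p where p: "p : polys_over k" "p ~= 0" "poly p a = 0"
  using a algebraic_over_iff[OF k(1)] unfolding alg_cl_def by blast
 have "p : polys_over E" using p k polys_over_mono by blast
 then have "poly (map_poly f p) (f a) = 0" using iso_map_poly[OF f E] a p iso_0[OF f E] by metis
 moreover have "map_poly f p ~= 0"
 proof -
  have "coeff (map_poly f p) (degree p) ~= 0"
   using p k iso_eq_0_iff[OF f E, of "lead_coeff p"] coeff_polys_over[OF p(1)]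
   by (auto simp: coeff_map_poly iso_0[OF f E])
  then show ?thesis by auto
 qed
 moreover have "map_poly f p : polys_over (f ` k)"
  using p coeff_polys_over[OF p(1)] by (auto intro!: polys_overI simp: coeff_map_poly iso_0[OF f E])
 ultimately show ?thesis unfolding alg_cl_def
  using algebraic_over_iff[OF iso_image_subfield[OF f E k]] by blast
qed

text \<open>The minimal polynomial of \<open>a\<close> is not linear, as \<open>a\<close> is outside
  \<open>F\<close>, and it divides the squarefree \<open>p\<close>; so it has a second root b ~= a.
  The isomorphism sending \<open>a\<close> to b extends to the algebraic closure.\<close>

lemma exists_moving_automorphism:
 fixes F :: "'a::alg_closed_field set"
 assumes F: "is_subfield F" and p: "rsquarefree p" "p : polys_over F" "poly p a = 0" and a: "a \<notin> F"
 obtains f where "field_iso F (alg_cl F) (alg_cl F) f" "f a ~= a"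
proof -
 have "p ~= 0" using p by (simp add: rsquarefree_def)
 then have "algebraic_over F a" using p algebraic_over_iff[OF F] by blast
 then obtain g where g: "g : polys_over F" "g ~= 0" "poly g a = 0"
  "!!p. p : polys_over F ==> poly p a = 0 ==> \<exists>s\<in>polys_over F. p = g * s"
  using min_poly_exists[OF F] by blast
 obtain h where h: "g = [:-a, 1:] * h" using g(3) by (auto simp: poly_eq_0_iff_dvd dvd_def)
 have "degree h > 0"
 proof (rule ccontr)
  assume "\<not> degree h > 0"
  then obtain c where c: "h = [:c:]" using degree_eq_zeroE[of h] by auto
  then have "coeff g 0 = - a * c" "coeff g 1 = c" "c ~= 0" using h g(2) by auto
  then have "a = - coeff g 0 / coeff g 1" by simp
  also have "\<dots> : F" using F g(1) by (intro subfield_intros coeff_polys_over)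
  finally show False using a by blast
 qed
 then obtain b where b: "poly h b = 0" using alg_closed_imp_poly_has_root by blast
 have "b ~= a"
 proof
  assume "b = a"
  then obtain h' where "h = [:-a, 1:] * h'" using b by (auto simp: poly_eq_0_iff_dvd dvd_def)
  then have "g = [:-a, 1:] ^ 2 * h'" using h by (simp only: power2_eq_square mult.assoc)
  then have "[:-a, 1:] ^ 2 dvd g" by simp
  moreover have "g dvd p" using g(4) p by (metis dvd_triv_left)
  ultimately have "[:-a, 1:] ^ 2 dvd p" by (rule dvd_trans)
  then have "2 \<le> order a p" using \<open>p ~= 0\<close> order_divides by blast
  then show False using p(1) unfolding rsquarefree_def by (metis Suc_1 not_less_eq_eq numeral_2_eq_2 le_zero_eq zero_neq_numeral One_nat_def order_refl)
 qed
 have R: "field_graph (Id_on F)" unfolding field_graph_def using F by (auto simp: subfield_intros)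
 have "poly_pair (Id_on F) g g" unfolding poly_pair_def using g(1) by (auto simp: polys_over_def)
 moreover have "poly g b = 0" using h b by simp
 ultimately obtain R' where R': "field_graph R'" "Id_on F \<subseteq> R'" "(a, b) : R'" "Domain R' = adjoin F {a}"
   "Range R' = adjoin F {b}"
  using field_graph_extend_algebraic[OF R, of g a g b] g unfolding Domain_Id_on Range_Id_on by metis
 obtain R'' where R'': "field_graph R''" "R' \<subseteq> R''" "Domain R'' = alg_cl (adjoin F {a})"
   "Range R'' = alg_cl (adjoin F {b})"
  using field_graph_extend_alg_cl[OF R'(1)] R' by metis
 obtain f where f: "field_iso {} (Domain R'') (Range R'') f" "!!a b. (a, b) : R'' ==> f a = b"
  using field_graph_iso[OF R''(1)] by blast
 have al: "alg_cl (adjoin F {c}) = alg_cl F" if "poly g c = 0" for c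
 proof (rule alg_cl_between[OF F adjoin_subset])
  show "adjoin F {c} \<subseteq> alg_cl F"
   using that g algebraic_over_iff[OF F] by (intro adjoin_least subfield_alg_cl F alg_cl_subset) (auto simp: alg_cl_def)
 qed
 have "f c = c" if "c : F" for c using f(2)[of c c] that R'(2) R''(2) by blast
 then have "field_iso F (alg_cl F) (alg_cl F) f"
  using f(1) R''(3,4) al[of a] al[of b] \<open>poly g b = 0\<close> g(3) unfolding field_iso_def by simp
 moreover have "f a = b" using f(2) R'(3) R''(2) by blast
 ultimately show thesis using that \<open>b ~= a\<close> by blast
qed

section \<open>Galois descent over perfect fields\<close>

text \<open>If \<open>g\<close> and a nonzero derivative share a root b, the minimal polynomial h of
  b divides both and so is a proper divisor of \<open>g\<close>. Then h or its cofactor vanishes at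
  \<open>a\<close> and has smaller degree than \<open>g\<close>.\<close>

lemma min_poly_derivative_0:
 assumes k: "is_subfield k" and g: "g : polys_over k" "g ~= 0" "poly g a = 0"
  "!!p. p : polys_over k ==> poly p a = 0 ==> \<exists>s\<in>polys_over k. p = g * s"
  and b: "poly g b = 0" "poly (pderiv g) b = 0"
 shows "pderiv g = 0"
proof (rule ccontr)
 assume nz: "pderiv g ~= 0"
 have dk: "pderiv g : polys_over k"
  using g(1) k by (auto simp: polys_over_def coeff_pderiv intro!: subfield_mult subfield_of_nat simp del: of_nat_Suc)
 have "algebraic_over k b" using g b algebraic_over_iff[OF k] by blast
 then obtain h where h: "h : polys_over k" "h ~= 0" "poly h b = 0"
  "!!p. p : polys_over k ==> poly p b = 0 ==> \<exists>s\<in>polys_over k. p = h * s"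
  using min_poly_exists[OF k] by blast
 obtain s where s: "s : polys_over k" "g = h * s" using h(4) g(1) b(1) by blast
 obtain t where t: "pderiv g = h * t" using h(4) dk b(2) by blast
 have dg: "degree g > 0"
  using g(2,3) by (metis degree_eq_zeroE gr0I mult_zero_right pCons_0_0 poly_pCons poly_0 add.right_neutral)
 have "degree h \<le> degree (pderiv g)" using t nz by (auto simp: degree_mult_eq)
 moreover have "degree (pderiv g) < degree g"
  using dg by (intro degree_lessI) (auto simp: coeff_pderiv coeff_eq_0)
 ultimately have lt: "degree h < degree g" by linarith
 have dh: "degree h > 0"
  using h(2,3) by (metis degree_eq_zeroE gr0I mult_zero_right pCons_0_0 poly_pCons poly_0 add.right_neutral)
 have "s ~= 0" using s g(2) by auto
 consider "poly h a = 0" | "poly s a = 0" using g(3) s by auto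
 then show False
 proof cases
  case 1
  then obtain s' where "h = g * s'" using g(4) h(1) by blast
  then show False using h(2) lt by (auto simp: degree_mult_eq)
 next
  case 2
  then obtain s' where "s = g * s'" using g(4) s(1) by blast
  then have "degree g \<le> degree s" using \<open>s ~= 0\<close> by (auto simp: degree_mult_eq)
  then show False using s(2) \<open>s ~= 0\<close> h(2) dh by (auto simp: degree_mult_eq)
 qed
qed

lemma rsquarefreeI:
 fixes p :: "'a::idom poly"
 assumes "p ~= 0" and d: "!!b. poly p b = 0 ==> poly (pderiv p) b ~= 0"
 shows "rsquarefree p"
 unfolding rsquarefree_def
proof (intro conjI allI assms(1))
 fix b
 show "order b p = 0 \<or> order b p = 1"
 proof (rule ccontr)
  assume "\<not> (order b p = 0 \<or> order b p = 1)"
  then have "[:-b, 1:] ^ 2 dvd p" using order_divides[of b 2 p] by simp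
  then obtain h where h: "p = [:-b, 1:] ^ 2 * h" by (auto simp: dvd_def)
  have "poly p b = 0" unfolding h by simp
  moreover have "poly (pderiv p) b = 0"
   unfolding h power2_eq_square mult.assoc pderiv_mult poly_add poly_mult by simp
  ultimately show False using d by blast
 qed
qed

text \<open>A minimal polynomial with zero derivative involves only exponents divisible by the
  characteristic. Extracting roots of its coefficients, possible in a perfect field, yields an
  annihilator of smaller degree.\<close>

lemma perfect_separable:
 fixes k :: "'a::field set"
 assumes k: "is_subfield k" and perf: "perfect_subfield k" and a: "a : alg_cl k"
 shows "\<exists>p. rsquarefree p & p : polys_over k & poly p a = 0"
proof -
 obtain g where g: "g : polys_over k" "g ~= 0" "poly g a = 0"
  "!!p. p : polys_over k ==> poly p a = 0 ==> \<exists>s\<in>polys_over k. p = g * s"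
  using min_poly_exists[OF k] a unfolding alg_cl_def by blast
 have dg: "degree g > 0"
  using g(2,3) by (metis degree_eq_zeroE gr0I mult_zero_right pCons_0_0 poly_pCons poly_0 add.right_neutral)
 have dnz: "pderiv g ~= 0"
 proof
  assume z: "pderiv g = 0"
  have c: "CHAR('a) dvd i" if "coeff g i ~= 0" for i
  proof (cases i)
   case (Suc j)
   have "of_nat (Suc j) * coeff g (Suc j) = 0" using z coeff_pderiv[of g j] by simp
   then have "of_nat i = (0::'a)" using that Suc by simp
   then show ?thesis by (simp add: of_nat_eq_0_iff_char_dvd)
  qed auto
  let ?l = "CHAR('a)"
  have l0: "?l ~= 0" using c[of "degree g"] dg g(2) by (metis dvd_0_left_iff gr_implies_not0 leading_coeff_0_iff)
  then have pl: "prime ?l" using prime_CHAR_semidom[where ?'a = 'a] by simp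
  have ex: "\<forall>i. \<exists>b. b \<in> k & b ^ ?l = coeff g (i * ?l)"
   using perf l0 coeff_polys_over[OF g(1)] unfolding perfect_subfield_def by blast
  obtain b where b: "!!i. b i : k" "!!i. b i ^ ?l = coeff g (i * ?l)" using choice[OF ex] by blast
  define n where "n = degree g"
  define r where "r = (\<Sum>i\<le>n. monom (b i) i)"
  have cr: "coeff r i = (if i \<le> n then b i else 0)" for i unfolding r_def by (auto simp: coeff_sum)
  have rk: "r : polys_over k" unfolding r_def using k b by (auto intro!: polys_over_intros)
  \<comment> \<open>Only values at \<open>a\<close> are compared: the power of r(a) is g(a) by
    additivity of Frobenius, which avoids an identity between polynomials.\<close>
  have "poly r a ^ ?l = (\<Sum>i\<le>n. (b i * a ^ i) ^ ?l)"
   unfolding r_def poly_sum poly_monom using pl by (intro freshmans_dream_sum) auto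
  also have "\<dots> = (\<Sum>i\<le>n. coeff g (i * ?l) * a ^ (i * ?l))"
   by (simp add: power_mult_distrib b(2) power_mult)
  also have "\<dots> = (\<Sum>j\<in>(%i. i * ?l) ` {..n}. coeff g j * a ^ j)"
   using l0 by (subst sum.reindex) (auto simp: inj_on_def)
  also have "\<dots> = (\<Sum>j\<in>((%i. i * ?l) ` {..n}) \<union> {..n}. coeff g j * a ^ j)"
  proof (rule sum.mono_neutral_left)
   show "\<forall>j\<in>(%i. i * ?l) ` {..n} \<union> {..n} - (%i. i * ?l) ` {..n}. coeff g j * a ^ j = 0"
   proof
    fix j assume j: "j : (%i. i * ?l) ` {..n} \<union> {..n} - (%i. i * ?l) ` {..n}"
    have "coeff g j = 0"
    proof (rule ccontr)
     assume "coeff g j ~= 0"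
     then obtain i where i: "j = i * ?l" using c[of j] by (metis dvd_div_mult_self)
     have "i \<le> j" using i l0 by simp
     have "j \<le> n" using j by blast
     then have "i : {..n}" using \<open>i \<le> j\<close> by simp
     then show False using j i by blast
    qed
    then show "coeff g j * a ^ j = 0" by simp
   qed
  qed auto
  also have "\<dots> = (\<Sum>j\<in>{..n}. coeff g j * a ^ j)"
   by (rule sum.mono_neutral_right) (auto simp: n_def intro!: coeff_eq_0)
  also have "\<dots> = 0" using g(3) by (simp add: poly_altdef n_def)
  finally have "poly r a = 0" using l0 by simp
  then obtain s where s: "r = g * s" using g(4) rk by blast
  obtain i0 where i0: "n = i0 * ?l" using c[of n] g(2) by (metis dvd_div_mult_self leading_coeff_0_iff n_def)
  have "i0 \<le> n" using i0 l0 by simp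
  have "b i0 ^ ?l = lead_coeff g" using b(2)[of i0] i0 by (simp add: n_def)
  then have "b i0 ~= 0" using g(2) l0 by (auto simp: zero_power)
  then have "r ~= 0" using cr[of i0] \<open>i0 \<le> n\<close> by auto
  then have "degree g \<le> degree r" using s by (auto simp: degree_mult_eq)
  \<comment> \<open>The exponent \<open>i * ?l\<close> is at least 2 n and so beyond the degree of
    \<open>g\<close>; hence \<open>r\<close> has smaller degree than \<open>g\<close>, which was
    shown to divide it.\<close>
  moreover have "coeff r i = 0" if "i \<ge> n" for i
  proof -
   have "i * 2 \<le> i * ?l" using prime_ge_2_nat[OF pl] by (rule mult_le_mono2)
   then have "n < i * ?l" using that dg unfolding n_def by linarith
   then have "coeff g (i * ?l) = 0" by (intro coeff_eq_0) (simp add: n_def)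
   then show ?thesis using b(2)[of i] cr l0 by (auto simp: zero_power)
  qed
  then have "degree r < n" using dg by (intro degree_lessI) (auto simp: n_def)
  ultimately show False by (simp add: n_def)
 qed
 have "rsquarefree g"
  using min_poly_derivative_0[OF k g] dnz g(2) by (intro rsquarefreeI) blast+
 then show ?thesis using g by blast
qed

text \<open>In positive characteristic a function field \<open>L\<close> is not perfect, and these
  automorphisms also fix inseparable elements. Fixed elements are therefore only taken from
  \<open>adjoin L (alg_cl k)\<close>, where perfectness of k supplies separability.\<close>

abbreviation galois_aut :: "'a::field set => ('a => 'a) => bool" where
 "galois_aut L ta \<equiv> field_iso L (alg_cl L) (alg_cl L) ta"

lemma galois_aut_inv:
 assumes "is_subfield L" "galois_aut L ta"
 shows "galois_aut L (inv_into (alg_cl L) ta)"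
 using iso_inv[OF assms(2) subfield_alg_cl] alg_cl_subset assms by blast

lemma galois_aut_alg_cl:
 assumes L: "is_subfield L" and k: "is_subfield k" "k \<subseteq> L" and t: "galois_aut L ta"
 shows "ta ` alg_cl k = alg_cl k"
proof -
 have sub: "ta ` alg_cl k \<subseteq> alg_cl k" if t: "galois_aut L ta" for ta
 proof
  fix b assume "b : ta ` alg_cl k"
  then obtain a where a: "a : alg_cl k" "b = ta a" by blast
  have "ta a : alg_cl (ta ` k)"
   using iso_alg_cl[OF iso_weaken[OF t] subfield_alg_cl[OF L] k(1)] a k alg_cl_mono[OF k(2)] alg_cl_subset[OF L] by blast
  moreover have "ta ` k = k" using field_isoD(2)[OF t] k(2) by force
  ultimately show "b : alg_cl k" using a by simp
 qed
 have "alg_cl k \<subseteq> ta ` alg_cl k"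
 proof
  fix a assume a: "a : alg_cl k"
  then have aL: "a : alg_cl L" using alg_cl_mono[OF k(2)] by blast
  have "inv_into (alg_cl L) ta a : alg_cl k" using sub[OF galois_aut_inv[OF L t]] a by blast
  moreover have "ta (inv_into (alg_cl L) ta a) = a"
   using field_isoD(6)[OF t] aL by (intro f_inv_into_f) auto
  ultimately show "a : ta ` alg_cl k" by (metis image_eqI)
 qed
 then show ?thesis using sub[OF t] by blast
qed

lemma compositum_in_alg_cl:
 assumes L: "is_subfield L" and k: "k \<subseteq> L" and K: "K \<subseteq> alg_cl L"
 shows "adjoin K (alg_cl k) \<subseteq> alg_cl L"
 using alg_cl_mono[OF k] by (intro adjoin_least subfield_alg_cl L K)

lemma galois_aut_compositum:
 assumes L: "is_subfield L" and k: "is_subfield k" "k \<subseteq> L" and K: "K \<subseteq> L" and t: "galois_aut L ta"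
 shows "ta ` adjoin K (alg_cl k) = adjoin K (alg_cl k)"
proof -
 have "ta ` K = K" using field_isoD(2)[OF t] K by force
 then show ?thesis
  using iso_adjoin[OF t subfield_alg_cl[OF L], of K "alg_cl k"] galois_aut_alg_cl[OF L k t]
   alg_cl_subset[OF L] K alg_cl_mono[OF k(2)] by auto
qed

context
 fixes k L :: "'a::alg_closed_field set"
 assumes k: "is_subfield k" and L: "is_subfield L" and kL: "k \<subseteq> L" and perf: "perfect_subfield k"
begin

text \<open>A squarefree polynomial over k for \<open>a\<close> is also one over \<open>L\<close>,
  so an \<open>a\<close> outside \<open>L\<close> would be moved by some automorphism.\<close>

lemma constants_fixed:
 assumes a: "a : alg_cl k" "!!ta. galois_aut L ta ==> ta a = a"
 shows "a : L"
proof (rule ccontr)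
 assume n: "a \<notin> L"
 obtain p where p: "rsquarefree p" "p : polys_over k" "poly p a = 0"
  using perfect_separable[OF k perf a(1)] by blast
 then show False
  using exists_moving_automorphism[OF L p(1) _ p(3) n] polys_over_mono[OF kL] a(2) by blast
qed

text \<open>Expanding over a family in \<^term>\<open>L\<close> that is independent over the algebraic closure of
 \<^term>\<open>k\<close> reduces statements about fixed elements to their coefficients.\<close>

lemma independent_expansion:
 assumes L0: "is_subfield L0" "k \<subseteq> L0" "L0 \<subseteq> L" and z: "z : adjoin L0 (alg_cl k)"
 obtains B c where "finite B" "B \<subseteq> L0" "\<forall>b\<in>B. c b : alg_cl k" "z = (\<Sum>b\<in>B. c b * b)"
  "!!ta d. galois_aut L ta ==> d : alg_cl k ==> ta z = d * z ==> \<forall>b\<in>B. ta (c b) = d * c b"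
proof -
 obtain B c where B: "finite B" "B \<subseteq> L0" "\<forall>b\<in>B. c b : alg_cl k" "z = (\<Sum>b\<in>B. c b * b)"
  "!!e. (\<forall>b\<in>B. e b : alg_cl k) ==> (\<Sum>b\<in>B. e b * b) = 0 ==> \<forall>b\<in>B. e b = 0"
  using compositum_independent[OF L0(1) subfield_alg_cl[OF k] alg_cl_mono[OF L0(2)] z] by blast
 have "\<forall>b\<in>B. ta (c b) = d * c b" if t: "galois_aut L ta" and d: "d : alg_cl k" "ta z = d * z" for ta d
 proof -
  have cL: "c b : alg_cl L" "b : alg_cl L" if "b : B" for b
   using B that alg_cl_mono[OF kL] alg_cl_subset[OF L] L0(3) by blast+
  have "ta z = (\<Sum>b\<in>B. ta (c b * b))"
   unfolding B(4) using cL by (intro iso_sum[OF t subfield_alg_cl[OF L]] subfield_mult[OF subfield_alg_cl[OF L]]) auto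
  also have "\<dots> = (\<Sum>b\<in>B. ta (c b) * b)"
   using cL field_isoD(2,4)[OF t] B(2) L0(3) by (intro sum.cong) (auto simp: subset_iff)
  finally have "(\<Sum>b\<in>B. (ta (c b) - d * c b) * b) = 0"
   using d(2) B(4) by (simp add: left_diff_distrib sum_subtractf sum_distrib_left mult.assoc)
  moreover have "ta (c b) - d * c b : alg_cl k" if "b : B" for b
   using galois_aut_alg_cl[OF L k kL t] B(3) that d(1) subfield_alg_cl[OF k]
   by (intro subfield_diff subfield_mult) auto
  ultimately have "\<forall>b\<in>B. ta (c b) - d * c b = 0" using B(5)[of "%b. ta (c b) - d * c b"] by blast
  then show ?thesis by simp
 qed
 then show thesis using that B by blast
qed

text \<open>Coefficients over an independent family in \<open>L\<close> inherit the invariance, and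
  as constants they then lie in \<open>L\<close>.\<close>

lemma compositum_fixed:
 assumes a: "a : adjoin L (alg_cl k)" and fixed: "!!ta. galois_aut L ta ==> ta a = a"
 shows "a : L"
proof -
 obtain B c where B: "finite B" "B \<subseteq> L" "\<forall>b\<in>B. c b : alg_cl k" "a = (\<Sum>b\<in>B. c b * b)"
  "!!ta d. galois_aut L ta ==> d : alg_cl k ==> ta a = d * a ==> \<forall>b\<in>B. ta (c b) = d * c b"
  using independent_expansion[OF L kL order_refl a] by blast
 have "c b : L" if "b : B" for b
 proof (rule constants_fixed)
  show "ta (c b) = c b" if "galois_aut L ta" for ta
   using B(5)[OF that, of 1] fixed[OF that] subfield_1[OF subfield_alg_cl[OF k]] \<open>b : B\<close> by simp
 qed (use B that in auto)
 then show ?thesis unfolding B(4) using B(2) by (auto intro!: subfield_intros L)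
qed

text \<open>Expand an element of \<open>L\<close> over a family in \<open>L0\<close>: its
  coefficients are fixed by all automorphisms over \<open>L\<close>, so they lie in
  \<open>L\<close>, and as constants they lie in k. Thus the field is recovered from its compositum
  with the closure of k.\<close>

lemma descent:
 assumes const: "!!a. a : L ==> a : alg_cl k ==> a : k"
  and L0: "is_subfield L0" "k \<subseteq> L0" "L0 \<subseteq> L" "L \<subseteq> adjoin L0 (alg_cl k)"
 shows "L = L0"
proof -
 have "a : L0" if a: "a : L" for a
 proof -
  obtain B c where B: "finite B" "B \<subseteq> L0" "\<forall>b\<in>B. c b : alg_cl k" "a = (\<Sum>b\<in>B. c b * b)"
   "!!ta d. galois_aut L ta ==> d : alg_cl k ==> ta a = d * a ==> \<forall>b\<in>B. ta (c b) = d * c b"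
   using independent_expansion[OF L0(1,2,3), of a] L0(4) a by blast
  have "c b : L" if b: "b : B" for b
  proof (rule constants_fixed)
   show "ta (c b) = c b" if t: "galois_aut L ta" for ta
    using B(5)[OF t, of 1] field_isoD(2)[OF t a] subfield_1[OF subfield_alg_cl[OF k]] b by simp
  qed (use B b in auto)
  then have "c b : L0" if "b : B" for b using const B(3) that L0(2) by blast
  then show ?thesis unfolding B(4) using B(2) by (auto intro!: subfield_intros L0)
 qed
 then show ?thesis using L0(3) by blast
qed

end

section \<open>Rational function fields\<close>

lemma transcendental_iff: "\<not> algebraic_over F u \<longleftrightarrow> u \<notin> alg_cl F"
 by (simp add: alg_cl_def)

lemma transcendental_poly:
 assumes "is_subfield F" "u \<notin> alg_cl F" "p : polys_over F" "poly p u = 0"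
 shows "p = 0"
 using assms algebraic_over_iff[OF assms(1)] by (auto simp: alg_cl_def)

lemma transcendental_nonzero: "is_subfield F ==> u \<notin> alg_cl F ==> u ~= 0"
 using alg_cl_subset[of F] subfield_0 by blast

lemma transcendental_over_alg_cl: "is_subfield F ==> u \<notin> alg_cl F ==> u \<notin> alg_cl (alg_cl F)"
 by (simp add: alg_cl_idem)

lemma transcendental_power:
 assumes F: "is_subfield F" and u: "u \<notin> alg_cl F" and n: "n > 0"
 shows "u ^ n \<notin> alg_cl F"
proof
 assume a: "u ^ n : alg_cl F"
 let ?p = "monom 1 n - [:u ^ n:]"
 have "?p : polys_over (alg_cl F)"
  using a subfield_alg_cl[OF F] by (intro polys_over_diff polys_over_monom)
   (auto simp: polys_over_pCons_iff polys_over_0 subfield_1)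
 moreover have "coeff ?p n = 1" using n by (simp add: coeff_pCons split: nat.splits)
 then have "?p ~= 0" by (metis coeff_0 zero_neq_one)
 moreover have "poly ?p u = 0" by (simp add: poly_monom)
 ultimately show False using alg_cl_closed[OF F] u by blast
qed

lemma transcendental_scale:
 assumes F: "is_subfield F" and u: "u \<notin> alg_cl F" and c: "c : alg_cl F" "c ~= 0"
 shows "c * u \<notin> alg_cl F" "c / u \<notin> alg_cl F" "u / c \<notin> alg_cl F"
proof -
 note [intro] = subfield_divide[OF subfield_alg_cl[OF F]] subfield_mult[OF subfield_alg_cl[OF F]]
 have u0: "u ~= 0" by (rule transcendental_nonzero[OF F u])
 have "u = (c * u) / c" "u = c / (c / u)" "u = (u / c) * c" using c u0 by auto
 then show "c * u \<notin> alg_cl F" "c / u \<notin> alg_cl F" "u / c \<notin> alg_cl F" using u c by (metis subfield_alg_cl[OF F] subfield_divide subfield_mult)+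
qed

text \<open>If a = p(u) / r(u), then p - a r has algebraic coefficients and a transcendental zero,
  so it vanishes and \<open>a\<close> is the quotient of the leading coefficients.\<close>

lemma constants_rational_function_field:
 assumes F: "is_subfield F" and u: "u \<notin> alg_cl F" and a: "a : adjoin F {u}" "a : alg_cl F"
 shows "a : F"
proof -
 obtain p r where pr: "p : polys_over F" "r : polys_over F" "poly r u ~= 0" "a = poly p u / poly r u"
  using a(1) unfolding adjoin_simple[OF F] by blast
 note A = subfield_alg_cl[OF F]
 have "p - smult a r : polys_over (alg_cl F)"
  using pr a(2) polys_over_mono[OF alg_cl_subset[OF F]] A by (intro polys_over_intros) auto
 moreover have "poly (p - smult a r) u = 0" using pr by simp
 ultimately have "p - smult a r = 0" using transcendental_poly[OF A transcendental_over_alg_cl[OF F u]] by blast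
 then have p: "p = smult a r" by simp
 have "r ~= 0" using pr by auto
 then have "a = lead_coeff p / lead_coeff r" by (simp add: p)
 then show ?thesis using pr coeff_polys_over F by (auto intro!: subfield_divide)
qed

lemma bezout_power:
 fixes p r :: "'a::field poly"
 assumes "al * p + bt * r = 1"
 shows "\<exists>al' bt'. al' * p + bt' * r ^ n = 1"
proof (induction n)
 case 0
 show ?case by (intro exI[of _ 0] exI[of _ 1]) simp
next
 case (Suc n)
 then obtain a b where ab: "a * p + b * r ^ n = 1" by blast
 have "(a + b * r ^ n * al) * p + (b * bt) * r ^ Suc n = a * p + b * r ^ n * (al * p + bt * r)"
  by (simp add: algebra_simps)
 also have "\<dots> = 1" using ab assms by simp
 finally show ?case by blast
qed

text \<open>Modulo \<open>p\<close> only the term with j = 0 survives, and \<open>r\<close> is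
  invertible there; so \<open>p\<close> divides \<open>l 0\<close>, whose degree is too small.
  Cancelling one factor \<open>p\<close> gives the same situation with smaller
  \<open>m\<close>.\<close>

lemma expansion_unique:
 fixes p r :: "'a::field poly"
 assumes b: "al * p + bt * r = 1" and p: "degree p \<ge> 2" and l: "!!j. degree (l j) \<le> 1"
  and z: "(\<Sum>j\<le>m. l j * p ^ j * r ^ (m - j)) = 0"
 shows "\<forall>j\<le>m. l j = 0"
 using l z
proof (induction m arbitrary: l)
 case 0
 then show ?case by simp
next
 case (Suc m)
 have "0 = l 0 * r ^ Suc m + (\<Sum>j\<le>m. l (Suc j) * p ^ Suc j * r ^ (m - j))"
  using Suc.prems(2) by (simp only: sum.atMost_Suc_shift) simp
 also have "(\<Sum>j\<le>m. l (Suc j) * p ^ Suc j * r ^ (m - j)) = p * (\<Sum>j\<le>m. l (Suc j) * p ^ j * r ^ (m - j))"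
  by (simp add: sum_distrib_left mult_ac)
 finally have eq: "l 0 * r ^ Suc m + p * (\<Sum>j\<le>m. l (Suc j) * p ^ j * r ^ (m - j)) = 0" by simp
 obtain a c where ac: "a * p + c * r ^ Suc m = 1" using bezout_power[OF b, of "Suc m"] by blast
 let ?S = "\<Sum>j\<le>m. l (Suc j) * p ^ j * r ^ (m - j)"
 have "l 0 = l 0 * (a * p + c * r ^ Suc m)" using ac by simp
 also have "\<dots> = p * (l 0 * a) + c * (l 0 * r ^ Suc m)" by (simp only: distrib_left mult_ac)
 also have "l 0 * r ^ Suc m = - (p * ?S)"
  using eq by (simp only: add_eq_0_iff2)
 also have "p * (l 0 * a) + c * - (p * ?S) = p * (l 0 * a - c * ?S)"
  by (simp only: right_diff_distrib mult_minus_right mult.left_commute[of c] add_uminus_conv_diff)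
 finally have "p dvd l 0" by (rule dvdI)
 then have l0: "l 0 = 0" using p Suc.prems(1)[of 0] dvd_imp_degree_le[of p "l 0"] by linarith
 have "p ~= 0" using p by auto
 then have "(\<Sum>j\<le>m. l (Suc j) * p ^ j * r ^ (m - j)) = 0" using eq l0 by simp
 then have "\<forall>j\<le>m. l (Suc j) = 0" using Suc.IH[of "%j. l (Suc j)"] Suc.prems(1) by blast
 then show ?case using l0 by (metis Suc_le_mono not0_implies_Suc)
qed

text \<open>The degree count behind this avoids field degrees: with w = p / r in lowest terms and u
  a rational function of w, clearing denominators produces a vanishing homogeneous expansion in p
  and r with linear coefficients, which \<open>expansion_unique\<close> forbids if p or r has degree
  at least two.\<close>

theorem rational_generator_moebius:
 fixes u :: "'a::field"
 assumes F: "is_subfield F" and u: "u \<notin> alg_cl F" and w: "w : adjoin F {u}" "u : adjoin F {w}"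
 obtains a b c d where "a : F" "b : F" "c : F" "d : F" "a * d - b * c ~= 0" "c * u + d ~= 0"
  "w = (a * u + b) / (c * u + d)"
proof -
 have wF: "w \<notin> F"
 proof
  assume "w : F"
  then have "adjoin F {w} \<subseteq> F" using F by (intro adjoin_least) auto
  then show False using w(2) u alg_cl_subset[OF F] by blast
 qed
 obtain p0 r0 where pr0: "p0 : polys_over F" "r0 : polys_over F" "poly r0 u ~= 0" "w = poly p0 u / poly r0 u"
  using w(1) unfolding adjoin_simple[OF F] by blast
 have "r0 ~= 0" using pr0 by auto
 then obtain g p r al bt where pr: "g : polys_over F" "g ~= 0" "p : polys_over F" "r : polys_over F"
  "p0 = g * p" "r0 = g * r" "al * p + bt * r = 1"
  using polys_over_gcd[OF F pr0(1,2)] by metis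
 have ru: "poly r u ~= 0" "w = poly p u / poly r u" using pr0 pr by auto
 obtain A B where AB: "A : polys_over F" "B : polys_over F" "poly B w ~= 0" "u = poly A w / poly B w"
  using w(2) unfolding adjoin_simple[OF F] by blast
 define m where "m = max (degree A) (degree B)"
 \<comment> \<open>Coefficients of A(w) - X B(w) as a polynomial in w; substituting X = u makes the
   sum vanish because u = A(w) / B(w).\<close>
 define l where "l j = [:coeff A j, - coeff B j:]" for j
 have lF: "l j : polys_over F" for j
  unfolding l_def using F AB coeff_polys_over by (auto simp: polys_over_pCons_iff polys_over_0 subfield_uminus)
 have poly_eq: "poly C w = (\<Sum>j\<le>m. coeff C j * w ^ j)" if "degree C \<le> m" for C
  unfolding poly_altdef by (rule sum.mono_neutral_left) (use that in \<open>auto intro: coeff_eq_0\<close>)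
 let ?S = "\<Sum>j\<le>m. l j * p ^ j * r ^ (m - j)"
 have "poly ?S u = (\<Sum>j\<le>m. (coeff A j - u * coeff B j) * (poly r u ^ m * w ^ j))"
 proof -
  have "poly p u ^ j * poly r u ^ (m - j) = poly r u ^ m * w ^ j" if "j \<le> m" for j
  proof -
   have "poly r u ^ m = poly r u ^ j * poly r u ^ (m - j)" using that by (simp add: power_add[symmetric])
   then show ?thesis using ru by (simp add: power_divide)
  qed
  moreover have "poly (l j * p ^ j * r ^ (m - j)) u = (coeff A j - u * coeff B j) * (poly p u ^ j * poly r u ^ (m - j))" for j
   unfolding l_def poly_mult poly_power mult.assoc by simp
  ultimately show ?thesis unfolding poly_sum by (metis (mono_tags, lifting) atMost_iff sum.cong)
 qed
 also have "\<dots> = poly r u ^ m * (poly A w - u * poly B w)"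
  unfolding poly_eq[of A, unfolded m_def, OF max.cobounded1, folded m_def]
   poly_eq[of B, unfolded m_def, OF max.cobounded2, folded m_def]
  by (simp add: sum_distrib_left sum_subtractf algebra_simps)
 also have "\<dots> = 0" using AB by simp
 finally have "poly ?S u = 0" .
 moreover have "?S : polys_over F" using F lF pr by (intro polys_over_intros)
 ultimately have S: "?S = 0" using transcendental_poly[OF F u] by blast
 have dl: "degree (l j) \<le> 1" for j unfolding l_def by simp
 have nz: "\<not> (\<forall>j\<le>m. l j = 0)"
 proof
  assume z: "\<forall>j\<le>m. l j = 0"
  have "coeff B j = 0" for j
   using z by (cases "j \<le> m") (auto simp: l_def m_def coeff_eq_0)
  then show False using AB(3) by (metis coeff_0 poly_0 poly_eqI)
 qed
 have dp: "degree p \<le> 1" 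
 proof (rule ccontr)
  assume "\<not> degree p \<le> 1"
  then have "2 \<le> degree p" by simp
  then show False using expansion_unique[OF pr(7) _ dl S] nz by blast
 qed
 have dr: "degree r \<le> 1"
 proof (rule ccontr)
  assume "\<not> degree r \<le> 1"
  then have d: "degree r \<ge> 2" by simp
  have b: "bt * r + al * p = 1" using pr(7) by (simp add: add.commute)
  \<comment> \<open>Reading the sum backwards exchanges the roles of \<open>p\<close> and
    \<open>r\<close>, so the same uniqueness bounds the degree of \<open>r\<close>.\<close>
  have "(\<Sum>j\<le>m. l (m - j) * r ^ j * p ^ (m - j)) = ?S"
   by (subst sum.nat_diff_reindex[of _ "Suc m", simplified lessThan_Suc_atMost, symmetric])
    (auto intro!: sum.cong simp: mult_ac)
  then have "\<forall>j\<le>m. l (m - j) = 0" using S dl by (intro expansion_unique[OF b d]) simp_all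
  then have "\<forall>j\<le>m. l j = 0" by (metis diff_diff_cancel diff_le_self)
  then show False using nz by blast
 qed
 define a b c d where "a = coeff p 1" and "b = coeff p 0" and "c = coeff r 1" and "d = coeff r 0"
 have lin: "poly q u = coeff q 1 * u + coeff q 0" if "degree q \<le> 1" for q
 proof -
  have "poly q u = (\<Sum>i\<le>1. coeff q i * u ^ i)"
   unfolding poly_altdef by (rule sum.mono_neutral_left) (use that in \<open>auto intro: coeff_eq_0\<close>)
  then show ?thesis by (simp add: add.commute)
 qed
 have F4: "a : F" "b : F" "c : F" "d : F" using pr coeff_polys_over unfolding a_def b_def c_def d_def by blast+
 have cd: "c * u + d ~= 0" "w = (a * u + b) / (c * u + d)"
  using ru lin[OF dp] lin[OF dr] by (auto simp: a_def b_def c_def d_def)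
 have "a * d - b * c ~= 0"
 proof
  assume e: "a * d - b * c = 0"
  show False
  proof (cases "c = 0")
   case True
   then have "d ~= 0" "a = 0" using e cd by auto
   then have "w = b / d" using cd True by simp
   then show False using wF F4 F subfield_divide by blast
  next
   case False
   have "c * (a * u + b) = a * (c * u + d)" using e by (simp add: algebra_simps)
   then have "c * w = a" unfolding cd(2) times_divide_eq_right using cd(1) by simp
   then have "w = a / c" using False by (simp add: field_simps)
   then show False using wF F4 F subfield_divide by blast
  qed
 qed
 then show thesis using that F4 cd by blast
qed

section \<open>The cubic map on a rational function field\<close>

lemma fixed_subfield:
 assumes E: "is_subfield E" and f: "field_iso k E F f"
 shows "is_subfield {a : E. f a = a}"
 by (rule is_subfieldI) (auto simp: subfield_intros[OF E] field_isoD(3,4)[OF f] iso_0[OF f E] iso_1[OF f E]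
   iso_diff[OF f E] iso_inverse[OF f E])

lemma adjoin_transform:
 assumes "u : adjoin F {w}" "w : adjoin F {u}" shows "adjoin F {w} = adjoin F {u}"
 using assms by (intro subset_antisym adjoin_mono order_refl) auto

lemma adjoin_scale:
 assumes F: "is_subfield F" and "c : F" "c ~= 0"
 shows "adjoin F {c * u} = adjoin F {u}" "adjoin F {c / u} = adjoin F {u}" "adjoin F {u / c} = adjoin F {u}"
proof -
 have u: "u : adjoin F {u}" "c : adjoin F {w}" for w using adjoin_gen[of "{u}" F] adjoin_subset[of F] assms by auto
 note cl = subfield_mult[OF subfield_adjoin] subfield_divide[OF subfield_adjoin]
 have 1: "w / c : adjoin F {w}" "c * w : adjoin F {w}" "c / w : adjoin F {w}" for w
  using cl(2)[of w F "{w}" c] cl(1)[of c F "{w}" w] cl(2)[of c F "{w}" w] adjoin_gen[of "{w}" F] u(2) by auto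
 show "adjoin F {c * u} = adjoin F {u}" using 1(1)[of "c * u"] 1(2)[of u] assms by (intro adjoin_transform) auto
 show "adjoin F {c / u} = adjoin F {u}" using 1(3)[of "c / u"] 1(3)[of u] assms by (intro adjoin_transform) auto
 show "adjoin F {u / c} = adjoin F {u}" using 1(2)[of "u / c"] 1(1)[of u] assms by (intro adjoin_transform) auto
qed

lemma subst_iso:
 assumes F: "is_subfield F" and "u \<notin> alg_cl F" "v \<notin> alg_cl F"
 obtains g where "field_iso F (adjoin F {u}) (adjoin F {v}) g" "g u = v"
proof -
 obtain g where g: "field_iso {} (adjoin F {u}) (adjoin F {v}) g" "!!c. c : F ==> g c = id c" "g u = v"
  using iso_extend_transcendental[OF iso_id F, of u v] assms by (auto simp: alg_cl_def)
 then have "field_iso F (adjoin F {u}) (adjoin F {v}) g" unfolding field_iso_def by auto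
 then show thesis using that g(3) by blast
qed

text \<open>The cyclic cubic extension F(u) / F(u^3), with the rotation \<open>rot\<close> as
  generator. It is applied with the algebraic closure of k as \<open>F\<close>.\<close>

locale kummer =
 fixes F :: "'a::field set" and u zt :: 'a
 assumes F: "is_subfield F" and u: "u \<notin> alg_cl F" and zF: "zt : F" and z3: "zt ^ 3 = 1" and z1: "zt ~= 1"
  and three: "(3::'a) ~= 0"
begin

lemma zeta_sum: "zt ^ 2 + zt + 1 = 0"
proof -
 have "(zt - 1) * (zt ^ 2 + zt + 1) = zt ^ 3 - 1" by (simp add: power2_eq_square power3_eq_cube algebra_simps)
 then show ?thesis using z3 z1 by simp
qed

lemma zeta_sq: "zt * zt = - 1 - zt"
 using zeta_sum by (simp add: power2_eq_square algebra_simps eq_neg_iff_add_eq_0)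

lemma zeta_nz: "zt ~= 0" using z3 by auto

lemma zeta_sq_ne: "zt ^ 2 ~= 1" "zt ^ 2 ~= zt"
proof -
 show "zt ^ 2 ~= 1"
 proof
  assume "zt ^ 2 = 1"
  then have "zt ^ 3 = zt" by (simp add: power3_eq_cube power2_eq_square)
  then show False using z3 z1 by simp
 qed
 show "zt ^ 2 ~= zt" using zeta_nz z1 by (simp add: power2_eq_square)
qed

lemma u_nz: "u ~= 0" by (rule transcendental_nonzero[OF F u])

lemma cube_roots: "a ^ 3 = b ^ 3 ==> a = b \<or> a = zt * b \<or> a = zt ^ 2 * b"
proof -
 assume a: "a ^ 3 = b ^ 3"
 have "(a - b) * (a - zt * b) * (a - zt ^ 2 * b) = a ^ 3 - b ^ 3 - (zt ^ 2 + zt + 1) * (a ^ 2 * b - zt * (a * b ^ 2))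
   - (zt ^ 3 - 1) * b ^ 3"
  unfolding power2_eq_square power3_eq_cube by algebra
 also have "\<dots> = 0" using a zeta_sum z3 by simp
 finally show ?thesis by auto
qed

definition rot where
 "rot = (SOME g. field_iso F (adjoin F {u}) (adjoin F {u}) g & g u = zt * u)"

lemma rot: "field_iso F (adjoin F {u}) (adjoin F {u}) rot" "rot u = zt * u"
proof -
 have zz: "zt : alg_cl F" using zF alg_cl_subset[OF F] by blast
 obtain g where "field_iso F (adjoin F {u}) (adjoin F {zt * u}) g" "g u = zt * u"
  using subst_iso[OF F u transcendental_scale(1)[OF F u zz zeta_nz]] by blast
 then have "\<exists>g. field_iso F (adjoin F {u}) (adjoin F {u}) g & g u = zt * u"
  using adjoin_scale(1)[OF F zF zeta_nz, of u] by auto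
 then show "field_iso F (adjoin F {u}) (adjoin F {u}) rot" "rot u = zt * u"
  unfolding rot_def by (metis (mono_tags, lifting) someI_ex)+
qed

abbreviation Fu where "Fu \<equiv> adjoin F {u}"
abbreviation F3 where "F3 \<equiv> adjoin F {u ^ 3}"

lemma Fu: "is_subfield Fu" and F3: "is_subfield F3" by (rule subfield_adjoin)+

lemma u_in: "u : Fu" and F_Fu: "F \<subseteq> Fu" and F_F3: "F \<subseteq> F3" and u3_in: "u ^ 3 : F3"
 using adjoin_gen adjoin_subset by blast+

lemma F3_Fu: "F3 \<subseteq> Fu"
 using F_Fu u_in by (intro adjoin_least Fu) (auto intro: subfield_power Fu)

lemma rot_fixed: "a : F3 ==> rot a = a"
proof -
 have "F3 \<subseteq> {a : Fu. rot a = a}"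
 proof (rule adjoin_least[OF fixed_subfield[OF Fu rot(1)]])
  show "F \<subseteq> {a : Fu. rot a = a}" using F_Fu field_isoD(2)[OF rot(1)] by auto
  have "rot (u ^ 3) = u ^ 3" using iso_power[OF rot(1) Fu u_in, of 3] rot(2) z3 by (simp add: power_mult_distrib)
  then show "{u ^ 3} \<subseteq> {a : Fu. rot a = a}" using u_in Fu subfield_power by auto
 qed
 then show "a : F3 ==> rot a = a" by blast
qed

text \<open>The basis 1, u, 1 / u consists of eigenvectors of \<open>rot\<close>, and unlike 1, u,
  u^2 it is permuted up to constants by inversions u -> c / u.\<close>

lemma decompose:
 assumes z: "z : Fu"
 obtains A B C where "A : F3" "B : F3" "C : F3" "z = A + B * u + C / u"
proof -
 let ?g = "[: - (u ^ 3), 0, 0, 1:]"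
 have gF: "?g : polys_over F3"
  using u3_in F3 by (auto simp: polys_over_pCons_iff polys_over_0 subfield_intros)
 have g0: "poly ?g u = 0" by (simp add: power3_eq_cube)
 have gn: "?g ~= 0" by simp
 have ua: "u : alg_cl F3" unfolding alg_cl_def mem_Collect_eq algebraic_over_iff[OF F3] using gF gn g0 by blast
 have "Fu = adjoin F3 {u}"
  using F3_Fu u_in subfield_power[OF Fu u_in, of 3] adjoin_subset[of F3 "{u}"] F_F3 adjoin_gen[of "{u}" F3]
  by (intro subset_antisym adjoin_least subfield_adjoin) auto
 then obtain p where p: "p : polys_over F3" "z = poly p u"
  using z unfolding adjoin_algebraic[OF F3 ua] by auto
 obtain s t where st: "s : polys_over F3" "t : polys_over F3" "p = ?g * s + t" "t = 0 \<or> degree t < degree ?g"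
  using polys_over_div[OF F3 gF _ p(1)] by auto
 have "degree t < 3" using st(4) by (auto simp: eval_nat_numeral)
 have "poly t u = (\<Sum>i\<le>2. coeff t i * u ^ i)"
  unfolding poly_altdef by (rule sum.mono_neutral_left) (use \<open>degree t < 3\<close> in \<open>auto intro: coeff_eq_0\<close>)
 then have "z = coeff t 0 + coeff t 1 * u + coeff t 2 * u ^ 2"
  using p st g0 by (simp add: eval_nat_numeral)
 also have "coeff t 2 * u ^ 2 = coeff t 2 * u ^ 3 / u" using u_nz by (simp add: power2_eq_square power3_eq_cube)
 finally have "z = coeff t 0 + coeff t 1 * u + coeff t 2 * u ^ 3 / u" .
 moreover have "coeff t 2 * u ^ 3 : F3" using coeff_polys_over[OF st(2)] u3_in F3 by (auto intro: subfield_mult)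
 ultimately show thesis using that coeff_polys_over[OF st(2)] by blast
qed

lemma rot_decomp:
 assumes "A : F3" "B : F3" "C : F3"
 shows "rot (A + B * u + C / u) = A + zt * B * u + zt ^ 2 * C / u"
proof -
 have in_Fu: "A : Fu" "B : Fu" "C : Fu" using assms F3_Fu by auto
 have "rot (A + B * u + C / u) = rot A + rot B * rot u + rot C / rot u"
  using in_Fu u_in by (simp add: field_isoD(3,4)[OF rot(1)] iso_divide[OF rot(1) Fu] subfield_intros[OF Fu])
 also have "\<dots> = A + zt * B * u + C / (zt * u)" using rot_fixed assms rot(2) by simp
 also have "C / (zt * u) = zt ^ 2 * C / u"
 proof -
  have "inverse zt = zt ^ 2"
   by (rule inverse_unique) (use z3 in \<open>simp add: power3_eq_cube power2_eq_square mult_ac\<close>)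
  then show ?thesis by (simp add: divide_inverse mult_ac)
 qed
 finally show ?thesis .
qed

text \<open>Applying \<open>rot\<close> twice gives three equations. Their sum is 3 A because 1 +
  \<open>zt\<close> + \<open>zt\<close>^2 = 0, and eliminating between the first two then isolates
  B.\<close>

lemma decompose_zero:
 assumes "A : F3" "B : F3" "C : F3" and z: "A + B * u + C / u = 0"
 shows "A = 0 & B = 0 & C = 0"
proof -
 have z': "A + zt * B * u + zt ^ 2 * C / u = 0"
  using rot_decomp[OF assms(1-3)] z iso_0[OF rot(1) Fu] by simp
 have zc: "zt * B : F3" "zt ^ 2 * C : F3" using assms zF F_F3 F3 by (auto intro!: subfield_intros)
 have "zt ^ 2 * (zt ^ 2) = zt ^ 3 * zt" by (simp add: power2_eq_square power3_eq_cube)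
 then have z4: "zt ^ 2 * (zt ^ 2) = zt" using z3 by simp
 have z'': "A + zt ^ 2 * B * u + zt * C / u = 0"
 proof -
  have "zt ^ 2 * (zt ^ 2 * C) = zt * C" using z4 by (metis mult.assoc)
  moreover have "zt * (zt * B) = zt ^ 2 * B" by (simp add: power2_eq_square mult.assoc)
  ultimately show ?thesis using rot_decomp[OF assms(1) zc] unfolding z' iso_0[OF rot(1) Fu] by metis
 qed
 have "3 * A = (A + B * u + C / u) + (A + zt * B * u + zt ^ 2 * C / u) + (A + zt ^ 2 * B * u + zt * C / u)
  - (zt ^ 2 + zt + 1) * (B * u) - (zt ^ 2 + zt + 1) * (C / u)" by (simp add: algebra_simps)
 then have A: "A = 0" using z z' z'' zeta_sum three by simp
 have "(zt - zt ^ 2) * (B * u) = zt * B * u + zt ^ 2 * C / u - zt ^ 2 * (B * u + C / u)" by (simp add: algebra_simps)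
 then have "(zt - zt ^ 2) * (B * u) = 0" using z z' A by simp
 then have B: "B = 0" using zeta_sq_ne u_nz by simp
 then show ?thesis using A z u_nz by simp
qed

lemma decompose_unique:
 assumes "A : F3" "B : F3" "C : F3" "A' : F3" "B' : F3" "C' : F3"
  and "A + B * u + C / u = A' + B' * u + C' / u"
 shows "A = A' & B = B' & C = C'"
proof -
 have "(A - A') + (B - B') * u + (C - C') / u = 0" using assms(7) by (simp add: algebra_simps diff_divide_distrib)
 then have "A - A' = 0 & B - B' = 0 & C - C' = 0"
  by (intro decompose_zero subfield_diff[OF F3] assms)
 then show ?thesis by simp
qed

text \<open>Since \<open>rot\<close> fixes the cube of \<open>z\<close>, it multiplies
  \<open>z\<close> by a cube root of unity; comparing eigencomponents leaves only one of the
  three.\<close>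

lemma eigenvector:
 assumes z: "z : Fu" and c: "z ^ 3 : F3"
 obtains "z : F3" | B where "B : F3" "z = B * u" | C where "C : F3" "z = C / u"
proof -
 obtain A B C where ABC: "A : F3" "B : F3" "C : F3" "z = A + B * u + C / u" using decompose[OF z] by blast
 have r: "rot z = A + zt * B * u + zt ^ 2 * C / u" using rot_decomp ABC by simp
 have "rot z ^ 3 = z ^ 3" using iso_power[OF rot(1) Fu z, of 3] rot_fixed[OF c] by simp
 then consider "rot z = z" | "rot z = zt * z" | "rot z = zt ^ 2 * z" using cube_roots by blast
 then show thesis
 proof cases
  case 1
  then have "A + (zt * B) * u + (zt ^ 2 * C) / u = A + B * u + C / u" using r ABC by simp
  then have "zt * B = B & zt ^ 2 * C = C"
   using ABC zF F_F3 F3 by (intro decompose_unique[THEN conjunct2]) (auto intro!: subfield_intros)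
  then have "B = 0 & C = 0" using z1 zeta_sq_ne by simp
  then show thesis using that(1) ABC by simp
 next
  case 2
  then have "A + (zt * B) * u + (zt ^ 2 * C) / u = zt * A + (zt * B) * u + (zt * C) / u"
   using r ABC by (simp add: algebra_simps)
  then have "A = zt * A & zt * B = zt * B & zt ^ 2 * C = zt * C"
   using ABC zF F_F3 F3 by (intro decompose_unique) (auto intro!: subfield_intros)
  then have "A = 0 & C = 0" using z1 zeta_sq_ne by simp
  then show thesis using that(2) ABC by simp
 next
  case 3
  then have "A + (zt * B) * u + (zt ^ 2 * C) / u = zt ^ 2 * A + (zt ^ 2 * B) * u + (zt ^ 2 * C) / u"
   using r ABC by (simp add: algebra_simps)
  then have "A = zt ^ 2 * A & zt * B = zt ^ 2 * B & zt ^ 2 * C = zt ^ 2 * C"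
   using ABC zF F_F3 F3 by (intro decompose_unique) (auto intro!: subfield_intros)
  then have "A = 0 & B = 0" using z1 zeta_sq_ne by simp
  then show thesis using that(3) ABC by simp
 qed
qed

text \<open>Write w as a Moebius function of u. The rotation multiplies w by some \<omega>, and
  comparing coefficients gives b d = \<omega> b d and a c = \<omega> a c. Here \<omega> ~= 1, since
  \<omega> = 1 makes the determinant vanish, so the matrix is diagonal or antidiagonal.\<close>

lemma cubic_coordinate:
 assumes w: "w : Fu" "u : adjoin F {w}" and c: "w ^ 3 : F3"
 shows "\<exists>c\<in>F. c ~= 0 & (w = c * u \<or> w = c / u)"
proof -
 obtain a b c d where m: "a : F" "b : F" "c : F" "d : F" "a * d - b * c ~= 0" "c * u + d ~= 0"
  "w = (a * u + b) / (c * u + d)"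
  using rational_generator_moebius[OF F u w] by blast
 have in_Fu: "a : Fu" "b : Fu" "c : Fu" "d : Fu" using m F_Fu by auto
 have "rot (c * u + d) ~= 0" using iso_eq_0_iff[OF rot(1) Fu, of "c * u + d"] m in_Fu u_in by (simp add: subfield_intros[OF Fu])
 moreover have rc: "rot (c * u + d) = c * zt * u + d" "rot (a * u + b) = a * zt * u + b"
  using in_Fu u_in field_isoD(2)[OF rot(1)] m rot(2)
  by (simp_all add: field_isoD(3,4)[OF rot(1)] subfield_intros[OF Fu] mult.assoc)
 ultimately have cz: "c * zt * u + d ~= 0" by simp
 have rw: "rot w = (a * zt * u + b) / (c * zt * u + d)" unfolding m(7)
  using in_Fu u_in by (subst iso_divide[OF rot(1) Fu]) (auto simp: rc subfield_intros[OF Fu])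
 have "rot w ^ 3 = w ^ 3" using iso_power[OF rot(1) Fu w(1), of 3] rot_fixed[OF c] by simp
 then obtain \<omega> where om: "rot w = \<omega> * w" "\<omega> = 1 \<or> \<omega> = zt \<or> \<omega> = zt ^ 2" using cube_roots by force
 have omF: "\<omega> : F" using om zF F by (auto intro: subfield_intros)
 have "(a * zt * u + b) * (c * u + d) = \<omega> * (a * u + b) * (c * zt * u + d)"
  using om(1) rw m(6,7) cz by (simp add: field_simps)
 then have "poly [:b * d - \<omega> * b * d, a * zt * d + b * c - \<omega> * (a * d + b * c * zt), a * zt * c - \<omega> * a * c * zt:] u = 0"
  by (simp add: algebra_simps)
 then have "[:b * d - \<omega> * b * d, a * zt * d + b * c - \<omega> * (a * d + b * c * zt), a * zt * c - \<omega> * a * c * zt:] = 0"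
  using m zF omF F by (intro transcendental_poly[OF F u])
   (auto simp: polys_over_pCons_iff[OF F] polys_over_0 intro!: subfield_intros)
 then have e: "b * d = \<omega> * b * d" "a * zt * d + b * c = \<omega> * (a * d + b * c * zt)" "a * zt * c = \<omega> * a * c * zt" by simp_all
 have om1: "\<omega> ~= 1"
 proof
  assume "\<omega> = 1"
  then have "(zt - 1) * (a * d - b * c) = 0" using e(2) by (simp add: algebra_simps)
  then show False using z1 m(5) by simp
 qed
 have bd: "b = 0 \<or> d = 0" and ac: "a = 0 \<or> c = 0" using e(1,3) om1 zeta_nz by auto
 show ?thesis
 proof (cases "b = 0")
  case True
  then have "a ~= 0" "d ~= 0" "c = 0" using m(5) ac by auto
  then have "w = (a / d) * u" "a / d : F" "a / d ~= 0" using m True F by (auto intro: subfield_divide)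
  then show ?thesis by blast
 next
  case False
  then have "d = 0" "c ~= 0" "a = 0" using m(5) bd ac by auto
  then have "w = (b / c) / u" "b / c : F" "b / c ~= 0" using m False F by (auto intro: subfield_divide)
  then show ?thesis by blast
 qed
qed

end

section \<open>Quadratic pairs\<close>

text \<open>For \<^term>\<open>th\<close> in \<^term>\<open>k\<close> these are all pairs of elements of \<^term>\<open>k\<close>; otherwise they are the
 pairs of conjugate elements of the quadratic extension generated by \<^term>\<open>th\<close>.\<close>

definition quad_pairs :: "'a::field set => 'a => 'a => ('a \<times> 'a) set" where
 "quad_pairs k th th' = {(al + bt * th, al + bt * th') | al bt. al : k & bt : k}"

text \<open>The algebra k[T] / ((T - th)(T - th')) inside two copies of the universe, via its two
  evaluations. The condition th ~= th' makes it etale, in characteristic two as well, and the split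
  case is included.\<close>

locale quad =
 fixes k :: "'a::field set" and th th' :: 'a
 assumes k: "is_subfield k" and ne: "th ~= th'" and tr: "th + th' : k" and nm: "th * th' : k"
begin

lemmas k_closed = subfield_0[OF k] subfield_1[OF k] subfield_add[OF k] subfield_diff[OF k] subfield_mult[OF k]
 subfield_inverse[OF k] subfield_uminus[OF k] subfield_divide[OF k] tr nm

abbreviation C where "C \<equiv> quad_pairs k th th'"

lemma C_I: "al : k ==> bt : k ==> a = al + bt * th ==> a' = al + bt * th' ==> (a, a') : C"
 unfolding quad_pairs_def by blast

lemma C_E:
 assumes "(a, a') : C" obtains al bt where "al : k" "bt : k" "a = al + bt * th" "a' = al + bt * th'"
 using assms unfolding quad_pairs_def by blast

lemma C_const: "a : k ==> (a, a) : C"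
 by (rule C_I[of a 0]) (auto simp: subfield_0[OF k])

lemma C_gen: "(th, th') : C"
 by (rule C_I[of 0 1]) (auto simp: subfield_0[OF k] subfield_1[OF k])

lemma C_add: "(a, a') : C ==> (b, b') : C ==> (a + b, a' + b') : C"
 and C_diff: "(a, a') : C ==> (b, b') : C ==> (a - b, a' - b') : C"
proof -
 assume "(a, a') : C" "(b, b') : C"
 then obtain al bt gm \<delta> where "al : k" "bt : k" "a = al + bt * th" "a' = al + bt * th'"
  "gm : k" "\<delta> : k" "b = gm + \<delta> * th" "b' = gm + \<delta> * th'" by (elim C_E)
 note ab = this
 show "(a + b, a' + b') : C"
  by (rule C_I[of "al + gm" "bt + \<delta>"]) (use ab in \<open>simp_all add: k_closed algebra_simps\<close>)
 show "(a - b, a' - b') : C"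
  by (rule C_I[of "al - gm" "bt - \<delta>"]) (use ab in \<open>simp_all add: k_closed algebra_simps\<close>)
qed

lemma C_mult: "(a, a') : C ==> (b, b') : C ==> (a * b, a' * b') : C"
proof -
 assume "(a, a') : C" "(b, b') : C"
 then obtain al bt gm \<delta> where "al : k" "bt : k" "a = al + bt * th" "a' = al + bt * th'"
  "gm : k" "\<delta> : k" "b = gm + \<delta> * th" "b' = gm + \<delta> * th'" by (elim C_E)
 note ab = this
 have "al * gm - bt * \<delta> * (th * th') : k" "al * \<delta> + bt * gm + bt * \<delta> * (th + th') : k" using ab by (simp_all add: k_closed)
 then show "(a * b, a' * b') : C" by (rule C_I) (simp_all add: ab algebra_simps)
qed

lemma C_swap: "(a, a') : C ==> (a', a) : C"
proof -
 assume "(a, a') : C"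
 then obtain al bt where ab: "al : k" "bt : k" "a = al + bt * th" "a' = al + bt * th'" by (elim C_E)
 have "al + bt * (th + th') : k" "- bt : k" using ab by (simp_all add: k_closed)
 then show ?thesis by (rule C_I) (simp_all add: ab algebra_simps)
qed

lemma C_const_iff: "(a, a) : C \<longleftrightarrow> a : k"
 using ne C_const by (auto elim!: C_E)

lemma C_trace: "(a, a') : C ==> a + a' : k" and C_norm: "(a, a') : C ==> a * a' : k"
proof -
 assume a: "(a, a') : C"
 show "a + a' : k" "a * a' : k"
  using C_add[OF a C_swap[OF a]] C_mult[OF a C_swap[OF a]] C_const_iff
  by (simp_all add: add.commute mult.commute)
qed

lemma C_scale: "c : k ==> (a, a') : C ==> (c * a, c * a') : C"
 using C_mult[OF C_const] by blast

lemma C_split_I: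
 assumes "th : k" "x : k" "y : k" shows "(x, y) : C"
proof -
 define bt where "bt = (x - y) / (th - th')"
 have "(th + th') - th : k" by (intro subfield_diff[OF k] tr assms)
 then have "th' : k" by simp
 then have "bt : k" "x - bt * th : k" using assms by (simp_all add: bt_def k_closed)
 moreover have "bt * (th - th') = x - y" using ne by (simp add: bt_def)
 then have "y = x - bt * th + bt * th'" by (simp add: algebra_simps)
 ultimately show ?thesis by (intro C_I[of "x - bt * th" bt]) auto
qed

lemma C_inverse:
 assumes "(a, a') : C" shows "(inverse a, inverse a') : C"
proof (cases "a = 0 \<or> a' = 0")
 case False
 have "(inverse (a * a') * a', inverse (a * a') * a) : C"
  by (rule C_scale[OF subfield_inverse[OF k C_norm[OF assms]] C_swap[OF assms]])
 moreover have "inverse (a * a') * a' = inverse a" "inverse (a * a') * a = inverse a'" using False by auto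
 ultimately show ?thesis by metis
next
 case True
 \<comment> \<open>With a zero component the norm is useless. Either both components vanish, or th
   lies in k and every pair over k is allowed, so componentwise inversion, with
   \<open>inverse 0 = 0\<close>, stays inside.\<close>
 then obtain al bt where ab: "al : k" "bt : k" "a = al + bt * th" "a' = al + bt * th'" using assms by (elim C_E)
 show ?thesis
 proof (cases "bt = 0")
  case True
  then have "(a, a') = (0, 0)" using ab \<open>a = 0 \<or> a' = 0\<close> by auto
  then show ?thesis using C_const[OF subfield_0[OF k]] by simp
 next
  case False
  have "th : k"
  proof (cases "a = 0")
   case True
   then have "th = - al / bt" using ab False by (simp add: field_simps add_eq_0_iff)
   then show ?thesis using ab k by (auto intro!: subfield_intros)
  next
   case False
   then have "th' = - al / bt" using ab \<open>bt ~= 0\<close> \<open>a = 0 \<or> a' = 0\<close> by (simp add: field_simps add_eq_0_iff)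
   then have "(th + th') - th' : k" using ab by (intro subfield_diff[OF k] tr) (auto intro!: subfield_intros k)
   then show ?thesis by simp
  qed
  then have "(th + th') - th : k" by (intro subfield_diff[OF k] tr)
  then have "th' : k" by simp
  have "a : k" "a' : k" using ab \<open>th : k\<close> \<open>th' : k\<close> k by (auto intro: subfield_intros)
  then show ?thesis by (intro C_split_I \<open>th : k\<close> subfield_inverse k)
 qed
qed

lemma C_divide: "(a, a') : C ==> (b, b') : C ==> (a / b, a' / b') : C"
 unfolding divide_inverse by (intro C_mult C_inverse)

lemma C_split: "th : k ==> C = k \<times> k"
proof
 assume t: "th : k"
 then have "(th + th') - th : k" by (intro subfield_diff[OF k] tr)
 then have t': "th' : k" by simp
 show "C \<subseteq> k \<times> k" using t t' k by (auto elim!: C_E intro: subfield_intros)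
 show "k \<times> k \<subseteq> C" using C_split_I[OF t] by auto
qed

lemma fst_C: "fst ` C = adjoin k {th}"
proof
 have I: "a : fst ` C" if "(a, a') : C" for a a' using that by (rule image_eqI[rotated]) simp
 have sub: "is_subfield (fst ` C)"
 proof (rule is_subfieldI)
  show "0 : fst ` C" "1 : fst ` C" using I[OF C_const] subfield_0[OF k] subfield_1[OF k] by blast+
  fix a assume "a : fst ` C"
  then obtain a' where a: "(a, a') : C" by auto
  then show "inverse a : fst ` C" using I[OF C_inverse] by blast
  fix b assume "b : fst ` C"
  then obtain b' where b: "(b, b') : C" by auto
  show "a + b : fst ` C" "a - b : fst ` C" "a * b : fst ` C" using I[OF C_add[OF a b]] I[OF C_diff[OF a b]] I[OF C_mult[OF a b]] .
 qed
 have "k \<subseteq> fst ` C" "th : fst ` C" using I[OF C_const] I[OF C_gen] by blast+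
 then show "adjoin k {th} \<subseteq> fst ` C" using sub by (intro adjoin_least) auto
 show "fst ` C \<subseteq> adjoin k {th}"
  using adjoin_subset[of k "{th}"] adjoin_gen[of "{th}" k]
  by (auto elim!: C_E intro!: subfield_intros subfield_adjoin)
qed

text \<open>A zero component of a pair with nonzero \<open>bt\<close> would put th or th' into k. So
  in the nonsplit case the pairs form the graph of the conjugation of k(th).\<close>

lemma C_graph: "th \<notin> k ==> field_graph C"
proof -
 assume t: "th \<notin> k"
 have t': "th' \<notin> k"
 proof
  assume "th' : k"
  then have "(th + th') - th' : k" by (intro subfield_diff[OF k] tr)
  then show False using t by simp
 qed
 have z: "a = 0 & a' = 0" if az: "(a, a') : C" "a = 0 \<or> a' = 0" for a a'
 proof -
  obtain al bt where ab: "al : k" "bt : k" "a = al + bt * th" "a' = al + bt * th'" using az by (elim C_E)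
  have "bt = 0"
  proof (rule ccontr)
   assume b: "bt ~= 0"
   have "- al / bt : k" using ab k by (auto intro!: subfield_intros)
   moreover have "th = - al / bt \<or> th' = - al / bt" using az(2) ab b by (auto simp: field_simps add_eq_0_iff)
   ultimately show False using t t' by auto
  qed
  then show ?thesis using az ab by auto
 qed
 have z': "a = 0 \<longleftrightarrow> a' = 0" if "(a, a') : C" for a a' using z[OF that] by blast
 show ?thesis unfolding field_graph_def
  by (intro conjI allI impI C_const subfield_0 subfield_1 k z' C_add C_diff C_mult C_inverse)
qed

lemma C_alg: "(a, a') : C ==> a : alg_cl k" "(a, a') : C ==> a' : alg_cl k"
proof -
 have 1: "a : alg_cl k" if a: "(a, a') : C" for a a'
 proof -
  define n t where "n = a * a'" and "t = a + a'"
  have "n : k" "t : k" using C_trace[OF a] C_norm[OF a] by (simp_all add: n_def t_def)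
  then have p: "[:n, - t, 1:] : polys_over k"
   by (simp add: polys_over_pCons_iff[OF k] polys_over_0[OF k] k_closed)
  have "poly [:n, - t, 1:] a = 0" "[:n, - t, 1:] ~= 0" by (simp_all add: algebra_simps n_def t_def)
  then show ?thesis unfolding alg_cl_def mem_Collect_eq algebraic_over_iff[OF k] using p by blast
 qed
 show "(a, a') : C ==> a : alg_cl k" by (rule 1)
 show "(a, a') : C ==> a' : alg_cl k" by (rule 1[OF C_swap])
qed

lemma quad_root: "x * x - (th + th') * x + th * th' = 0 ==> x = th \<or> x = th'"
proof -
 assume "x * x - (th + th') * x + th * th' = 0"
 then have "(x - th) * (x - th') = 0" by (simp add: algebra_simps)
 then show ?thesis by auto
qed

lemma iso_quad:
 assumes f: "field_iso k E F f" and E: "is_subfield E" "th : E" "th' : E"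
 shows "(f th = th & f th' = th') \<or> (f th = th' & f th' = th)"
proof -
 have s: "f th + f th' = th + th'" using field_isoD(3)[OF f E(2,3)] field_isoD(2)[OF f tr] by simp
 have p: "f th * f th' = th * th'" using field_isoD(4)[OF f E(2,3)] field_isoD(2)[OF f nm] by simp
 have "f th * f th - (th + th') * f th + th * th' = 0" unfolding s[symmetric] p[symmetric] by (simp add: algebra_simps)
 then have "f th = th \<or> f th = th'" by (rule quad_root)
 then show ?thesis using s by (auto simp: algebra_simps)
qed

lemma iso_C:
 assumes f: "field_iso k E F f" and E: "is_subfield E" "th : E" "th' : E" "k \<subseteq> E" and a: "(a, a') : C"
 shows "f th = th ==> f a = a & f a' = a'" "f th = th' ==> f a = a' & f a' = a"
proof -
 obtain al bt where ab: "al : k" "bt : k" "a = al + bt * th" "a' = al + bt * th'" using a by (elim C_E)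
 have "f (al + bt * t) = al + bt * f t" if "t : E" "al : E" "bt : E" for t
  using that ab field_isoD(2)[OF f] by (simp add: field_isoD(3,4)[OF f] subfield_intros[OF E(1)])
 moreover have "al : E & bt : E"
  using ab E(4) by blast
 ultimately show "f th = th ==> f a = a & f a' = a'" "f th = th' ==> f a = a' & f a' = a"
  using ab iso_quad[OF f E(1-3)] ne E by auto
qed

end

section \<open>Twisted function fields\<close>

text \<open>Taking all pairs as generators, instead of those from one \<open>th\<close>, makes the
  field depend only on the algebra and removes any preferred generator.\<close>

definition twist_field :: "'a::field set => ('a \<times> 'a) set => 'a => 'a => 'a set" where
 "twist_field k C lam u = adjoin k {a * u + a' * lam / u | a a'. (a, a') : C}"

locale base =
 fixes k :: "'a::alg_closed_field set" and zt :: 'a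
 assumes k: "is_subfield k" and perf: "perfect_subfield k" and three: "(3::'a) ~= 0"
  and z3: "zt ^ 3 = 1" and z1: "zt ~= 1"
begin

abbreviation kb where "kb \<equiv> alg_cl k"

lemma kb: "is_subfield kb" by (rule subfield_alg_cl[OF k])
lemma k_kb: "k \<subseteq> kb" by (rule alg_cl_subset[OF k])

lemma zeta_kb: "zt : kb"
 using transcendental_power[OF k, of zt 3] z3 k_kb subfield_1[OF k] by auto

lemma kummer: "u \<notin> kb ==> kummer kb u zt"
 unfolding kummer_def using kb zeta_kb three z3 z1 by (simp add: alg_cl_idem[OF k])

end

locale twist = base k zt + quad k th th' for k :: "'a::alg_closed_field set" and zt th th' +
 fixes lam u :: 'a
 assumes lam: "lam : k" "lam ~= 0" and u: "u \<notin> alg_cl k"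
begin

sublocale K: kummer "alg_cl k" u zt by (rule kummer[OF u])

abbreviation L where "L \<equiv> twist_field k C lam u"
abbreviation s where "s \<equiv> u + lam / u"
abbreviation r where "r \<equiv> th * u + th' * lam / u"

lemma L: "is_subfield L" and k_L: "k \<subseteq> L"
 unfolding twist_field_def by (rule subfield_adjoin, rule adjoin_subset)

lemma L_gen: "(a, a') : C ==> a * u + a' * lam / u : L"
 unfolding twist_field_def using adjoin_gen[of "{a * u + a' * lam / u | a a'. (a, a') : C}" k] by blast

lemma s_L: "s : L" and r_L: "r : L"
 using L_gen[OF C_const[OF subfield_1[OF k]]] L_gen[OF C_gen] by simp_all

lemma L_least:
 assumes E: "is_subfield E" "k \<subseteq> E" and "!!a a'. (a, a') : C ==> a * u + a' * lam / u : E"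
 shows "L \<subseteq> E"
 unfolding twist_field_def using assms by (intro adjoin_least) auto

lemma L_eq: "L = adjoin k {s, r}"
proof
 show "adjoin k {s, r} \<subseteq> L" using k_L s_L r_L by (intro adjoin_least L) auto
 show "L \<subseteq> adjoin k {s, r}"
 proof (rule L_least[OF subfield_adjoin adjoin_subset])
  fix a a' assume "(a, a') : C"
  then obtain al bt where ab: "al : k" "bt : k" "a = al + bt * th" "a' = al + bt * th'" by (elim C_E)
  have "a * u + a' * lam / u = al * s + bt * r" unfolding ab by (simp add: algebra_simps add_divide_distrib)
  also have "\<dots> : adjoin k {s, r}"
  proof -
   have i: "al : adjoin k {s, r}" "bt : adjoin k {s, r}" "s : adjoin k {s, r}" "r : adjoin k {s, r}"
    using ab(1,2) adjoin_subset[of k "{s, r}"] adjoin_gen[of "{s, r}" k] by blast+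
   show ?thesis
    by (rule subfield_add[OF subfield_adjoin subfield_mult[OF subfield_adjoin i(1,3)] subfield_mult[OF subfield_adjoin i(2,4)]])
  qed
  finally show "a * u + a' * lam / u : adjoin k {s, r}" .
 qed
qed

lemma u_nz: "u ~= 0" by (rule K.u_nz)

text \<open>The generators solved for u and lam / u; the determinant is th - th'. This recovers
  kb(u) from \<open>L\<close> and determines the action on u from that on th.\<close>

lemma sr_u: "(th - th') * u = r - th' * s" "(th - th') * (lam / u) = th * s - r"
 by (simp_all add: algebra_simps diff_divide_distrib)

lemma th_kb: "th : kb" "th' : kb"
 using C_alg[OF C_gen] by auto

lemma lam_kb: "lam : kb" using lam k_kb by auto

lemma L_kbu: "L \<subseteq> adjoin kb {u}"
proof (rule L_least[OF K.Fu])
 show "k \<subseteq> adjoin kb {u}" using k_kb K.F_Fu by blast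
 fix a a' assume "(a, a') : C"
 then have "a : kb" "a' : kb" using C_alg by auto
 then have "a : K.Fu" "a' : K.Fu" "lam : K.Fu" using lam_kb K.F_Fu by auto
 then show "a * u + a' * lam / u : K.Fu" using K.u_in by (simp add: subfield_intros[OF K.Fu])
qed

lemma L_kb: "adjoin L kb = adjoin kb {u}"
proof
 show "adjoin L kb \<subseteq> adjoin kb {u}" using L_kbu K.F_Fu by (intro adjoin_least K.Fu)
 have in_L: "L \<subseteq> adjoin L kb" "kb \<subseteq> adjoin L kb" by (rule adjoin_subset, rule adjoin_gen)
 have "u = (r - th' * s) / (th - th')" using sr_u(1) ne by (simp add: field_simps)
 also have "\<dots> : adjoin L kb"
 proof -
  have "s : adjoin L kb" "r : adjoin L kb" "th : adjoin L kb" "th' : adjoin L kb"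
   using in_L s_L r_L th_kb by blast+
  then show ?thesis by (intro subfield_divide subfield_diff subfield_mult subfield_adjoin)
 qed
 finally show "adjoin kb {u} \<subseteq> adjoin L kb" using in_L by (intro adjoin_least subfield_adjoin) auto
qed

text \<open>If th lies in k, then \<open>L\<close> is inside k(u). Otherwise extend the conjugation
  of k(th) by u -> lam / u: the extension fixes \<open>L\<close> pointwise, while a constant of
  \<open>L\<close> lies in k(th)(u), hence in k(th), and there only elements of k are fixed.\<close>

lemma const: assumes a: "a : L" "a : kb" shows "a : k"
proof (cases "th : k")
 case True
 have "L \<subseteq> adjoin k {u}"
 proof (rule L_least[OF subfield_adjoin adjoin_subset])
  fix a a' assume "(a, a') : C"
  then have "a : k" "a' : k" using C_split[OF True] by auto
  then have "a : adjoin k {u}" "a' : adjoin k {u}" "lam : adjoin k {u}" "u : adjoin k {u}"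
   using adjoin_subset[of k "{u}"] adjoin_gen[of "{u}" k] lam by auto
  then show "a * u + a' * lam / u : adjoin k {u}" by (simp add: subfield_intros[OF subfield_adjoin])
 qed
 then show ?thesis using constants_rational_function_field[OF k u] a by blast
next
 case False
 note G = C_graph[OF False]
 have D: "Domain C = fst ` C" "Range C = fst ` C" using C_swap by (auto simp: Domain_fst[symmetric])
 have alg: "alg_cl (fst ` C) = kb"
  unfolding fst_C using th_kb(1) k_kb by (intro alg_cl_between k adjoin_subset adjoin_least kb) auto
 obtain R where R: "field_graph R" "C \<subseteq> R" "(u, lam / u) : R" "Domain R = adjoin (fst ` C) {u}"
  by (rule field_graph_extend_transcendental[OF G, of u "lam / u"])
   (use u transcendental_scale(2)[OF k u lam_kb lam(2)] in \<open>auto simp: D transcendental_iff alg\<close>)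
 have "L \<subseteq> {z. (z, z) : R}"
 proof (rule L_least)
  show "is_subfield {z. (z, z) : R}"
   by (rule is_subfieldI) (auto intro: field_graph_closed[OF R(1)])
  show "k \<subseteq> {z. (z, z) : R}" using C_const R(2) by blast
  fix a a' assume a: "(a, a') : C"
  have aR: "(a, a') : R" "(a', a) : R" "(lam, lam) : R" using a C_swap[OF a] C_const[OF lam(1)] R(2) by blast+
  have "(a * u + a' * lam * inverse u, a' * (lam / u) + a * lam * inverse (lam / u)) : R"
   using aR R(3) by (intro field_graph_closed[OF R(1)])
  moreover have "a' * (lam / u) + a * lam * inverse (lam / u) = a * u + a' * lam * inverse u"
   using lam(2) u_nz by (simp add: field_simps)
  ultimately have "(a * u + a' * lam * inverse u, a * u + a' * lam * inverse u) : R" by (simp only:)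
  then show "a * u + a' * lam / u : {z. (z, z) : R}" unfolding divide_inverse by blast
 qed
 then have aR: "(a, a) : R" using a by blast
 then have "a : adjoin (fst ` C) {u}" using R(4) by blast
 moreover have "is_subfield (fst ` C)" unfolding fst_C by (rule subfield_adjoin)
 ultimately have "a : fst ` C" using constants_rational_function_field[of "fst ` C" u a] u a by (simp add: alg)
 then obtain a' where a': "(a, a') : C" by auto
 then have "a = a'" using field_graph_unique(1)[OF R(1) aR] R(2) by blast
 then show ?thesis using a' C_const_iff by simp
qed

lemma kbu_alg: "adjoin kb {u} \<subseteq> alg_cl L"
 using compositum_in_alg_cl[OF L k_L alg_cl_subset[OF L]] unfolding L_kb .

lemma in_alg: "u : alg_cl L" "th : alg_cl L" "th' : alg_cl L" "lam : alg_cl L" "k \<subseteq> alg_cl L"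
 using kbu_alg K.u_in K.F_Fu th_kb lam_kb k_kb by blast+

text \<open>The automorphism fixes \<open>s\<close> and \<open>r\<close> and permutes th and th', so
  the equations \<open>sr_u\<close> leave no choice for the image of u.\<close>

lemma galois_aut_cases:
 assumes t: "galois_aut L ta"
 obtains "ta th = th" "ta th' = th'" "ta u = u" | "ta th = th'" "ta th' = th" "ta u = lam / u"
proof -
 note A = subfield_alg_cl[OF L]
 have fx: "ta s = s" "ta r = r" "!!c. c : k ==> ta c = c" using field_isoD(2)[OF t] s_L r_L k_L by blast+
 have in_A: "s : alg_cl L" "r : alg_cl L" using s_L r_L alg_cl_subset[OF L] by blast+
 have "ta (r - th' * s) = ta r - ta th' * ta s"
  using in_A in_alg by (simp only: iso_diff[OF t A] field_isoD(4)[OF t] subfield_mult[OF A])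
 then have "(ta th - ta th') * ta u = r - ta th' * s"
  using in_alg fx sr_u(1) by (simp add: iso_diff[OF t A, symmetric] field_isoD(4)[OF t, symmetric] subfield_diff[OF A])
 moreover have "field_iso k (alg_cl L) (alg_cl L) ta" by (rule iso_weaken[OF t k_L])
 then have "(ta th = th & ta th' = th') \<or> (ta th = th' & ta th' = th)" by (rule iso_quad[OF _ A in_alg(2,3)])
 ultimately consider "ta th = th" "ta th' = th'" "(th - th') * ta u = r - th' * s"
  | "ta th = th'" "ta th' = th" "(th' - th) * ta u = r - th * s" by force
 then show thesis
 proof cases
  case 1
  then have "(th - th') * ta u = (th - th') * u" using sr_u(1) by simp
  then show thesis using 1 that(1) ne by simp
 next
  case 2
  then have "(th - th') * ta u = (th - th') * (lam / u)" unfolding sr_u(2) by (simp add: algebra_simps)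
  then have "ta u = lam / u" using ne by (simp only: mult_cancel_left) simp
  then show thesis using 2 that(2) by blast
 qed
qed

lemma galois_aut_C:
 assumes t: "galois_aut L ta" and a: "(a, a') : C"
 shows "ta th = th ==> ta a = a & ta a' = a'" "ta th = th' ==> ta a = a' & ta a' = a"
 using iso_C[OF iso_weaken[OF t k_L] subfield_alg_cl[OF L] in_alg(2,3,5) a] by auto

text \<open>The factor 1 / lam is chosen so that u -> lam / u induces w -> lam / w. Hence the base
  field is a twist field for the same algebra and parameter, and every result on \<open>L\<close>
  also applies to \<open>K\<close>.\<close>

abbreviation w where "w \<equiv> u ^ 3 / lam"

lemma w: "w \<notin> kb"
 using transcendental_scale(3)[OF k transcendental_power[OF k u] lam_kb lam(2)] by simp

lemma twist_w: "twist k zt th th' lam w"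
 by (rule twist.intro[OF base_axioms quad_axioms]) (use w lam in \<open>unfold_locales, auto\<close>)

abbreviation K where "K \<equiv> twist_field k C lam w"

lemma K: "is_subfield K" and k_K: "k \<subseteq> K"
 using twist.L[OF twist_w] twist.k_L[OF twist_w] by auto

lemma w_kbu: "w : adjoin kb {u}"
 using K.u_in K.F_Fu lam_kb by (auto intro!: subfield_divide subfield_power K.Fu)

lemma kb_w: "adjoin kb {w} = K.F3"
 by (rule adjoin_scale(3)[OF kb lam_kb lam(2)])

lemma K_kb: "adjoin K kb = K.F3"
 using twist.L_kb[OF twist_w] kb_w by simp

lemma K_F3: "K \<subseteq> K.F3"
 using twist.L_kbu[OF twist_w] kb_w by simp

lemma lam_w: "lam / w = (lam / u) ^ 3 / lam"
 using lam(2) u_nz by (simp add: field_simps power2_eq_square power3_eq_cube)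

lemma galois_aut_w:
 assumes t: "galois_aut L ta"
 shows "ta u = u ==> ta w = w" "ta u = lam / u ==> ta w = lam / w"
proof -
 note A = subfield_alg_cl[OF L]
 have "ta lam = lam" using field_isoD(2)[OF t] lam k_L by blast
 then have "ta w = ta u ^ 3 / lam"
  using in_alg by (simp add: iso_divide[OF t A] iso_power[OF t A] subfield_power[OF A])
 then show "ta u = u ==> ta w = w" "ta u = lam / u ==> ta w = lam / w" using lam_w by simp_all
qed

lemma K_L: "K \<subseteq> L"
proof (rule twist.L_least[OF twist_w L k_L])
 fix a a' assume a: "(a, a') : C"
 have ain: "a : K.Fu" "a' : K.Fu" "lam : K.Fu" using C_alg[OF a] lam_kb K.F_Fu by auto
 let ?z = "a * w + a' * lam / w"
 have zin: "?z : adjoin L kb" unfolding L_kb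
  by (rule subfield_add[OF K.Fu subfield_mult[OF K.Fu ain(1) w_kbu] subfield_divide[OF K.Fu subfield_mult[OF K.Fu ain(2,3)] w_kbu]])
 show "?z : L"
 proof (rule compositum_fixed[OF k L k_L perf zin])
  fix ta assume t: "galois_aut L ta"
  note A = subfield_alg_cl[OF L]
  have inA: "a : alg_cl L" "a' : alg_cl L" "lam : alg_cl L" "w : alg_cl L" using ain w_kbu kbu_alg by blast+
  have tl: "ta lam = lam" using field_isoD(2)[OF t] lam k_L by blast
  have tz: "ta ?z = ta a * ta w + ta a' * ta lam / ta w"
   using inA by (simp only: field_isoD(3,4)[OF t] iso_divide[OF t A] subfield_mult[OF A] subfield_divide[OF A])
  show "ta ?z = ?z"
  proof (rule galois_aut_cases[OF t])
   assume c: "ta th = th" "ta u = u"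
   show ?thesis unfolding tz galois_aut_w(1)[OF t c(2)] tl using galois_aut_C(1)[OF t a c(1)] by simp
  next
   assume c: "ta th = th'" "ta u = lam / u"
   show ?thesis unfolding tz galois_aut_w(2)[OF t c(2)] tl
    using galois_aut_C(2)[OF t a c(1)] lam(2) u_nz by (simp add: algebra_simps)
  qed
 qed
qed

text \<open>The intersection of \<open>L\<close> with kb(u^3) contains \<open>K\<close> and has the
  same compositum with kb, so descent identifies the two.\<close>

lemma K_char:
 assumes z: "z : L" "z : K.F3" shows "z : K"
proof -
 let ?L1 = "L \<inter> K.F3"
 have "?L1 = K"
 proof (rule descent[OF k _ _ perf])
  show "is_subfield ?L1" by (intro subfield_Int L K.F3)
  show "k \<subseteq> ?L1" using k_L k_kb K.F_F3 by blast
  show "is_subfield K" "k \<subseteq> K" by (rule K, rule k_K)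
  show "K \<subseteq> ?L1" using K_L K_F3 by blast
  show "?L1 \<subseteq> adjoin K kb" unfolding K_kb by blast
 qed (use const in auto)
 then show ?thesis using z by blast
qed

lemma F3_L: "z : K.F3 ==> (!!ta. galois_aut L ta ==> ta z = z) ==> z : K"
 using compositum_fixed[OF k L k_L perf, of z] K.F3_Fu K_char unfolding L_kb by blast

text \<open>Interpolation through (th, B) and (th', D): slope and intercept do not change when both
  nodes and both values are exchanged, so they are fixed by every automorphism and descend to
  \<open>K\<close>.\<close>

lemma pair_descent:
 assumes BD: "B : K.F3" "D : K.F3"
  and t: "!!ta. galois_aut L ta ==> ta th = th ==> ta B = B & ta D = D"
   "!!ta. galois_aut L ta ==> ta th = th' ==> ta B = D & ta D = B"
 obtains bt gm where "bt : K" "gm : K" "B = bt + gm * th" "D = bt + gm * th'"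
proof -
 define gm where "gm = (B - D) / (th - th')"
 define bt where "bt = B - gm * th"
 have th: "th : K.F3" "th' : K.F3" using th_kb K.F_F3 by auto
 have g3: "gm : K.F3" and b3: "bt : K.F3" unfolding bt_def gm_def using BD th by (simp_all add: subfield_intros[OF K.F3])
 have gd: "gm * (th - th') = B - D" using ne by (simp add: gm_def)
 have D: "D = bt + gm * th'" using gd by (simp add: bt_def algebra_simps)
 have fx: "ta gm = gm & ta bt = bt" if ta: "galois_aut L ta" for ta
 proof -
  note A = subfield_alg_cl[OF L]
  have inA: "B : alg_cl L" "D : alg_cl L" "gm : alg_cl L" "th : alg_cl L" "th' : alg_cl L"
   using BD g3 K.F3_Fu kbu_alg in_alg by blast+
  have tg: "ta gm = (ta B - ta D) / (ta th - ta th')" unfolding gm_def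
   using inA by (simp only: iso_divide[OF ta A] iso_diff[OF ta A] subfield_diff[OF A])
  have tb: "ta bt = ta B - ta gm * ta th" unfolding bt_def
   using inA by (simp only: iso_diff[OF ta A] field_isoD(4)[OF ta] subfield_mult[OF A])
  show ?thesis
  proof (rule galois_aut_cases[OF ta])
   assume c: "ta th = th" "ta th' = th'"
   have "ta B = B" "ta D = D" using t(1)[OF ta c(1)] by auto
   then show ?thesis using tg tb c gm_def bt_def by simp
  next
   assume c: "ta th = th'" "ta th' = th"
   have BD': "ta B = D" "ta D = B" using t(2)[OF ta c(1)] by auto
   have "ta gm = gm" unfolding tg BD' c unfolding gm_def
    by (rule minus_divide_divide[of "B - D" "th - th'", unfolded minus_diff_eq])
   then show ?thesis using tb BD' c D by simp
  qed
 qed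
 have "bt : K" "gm : K" using F3_L[OF g3] F3_L[OF b3] fx by blast+
 moreover have "B = bt + gm * th" by (simp add: bt_def)
 ultimately show thesis using that D by blast
qed

text \<open>Expand \<open>z\<close> in 1, u, 1 / u over kb(u^3). Applying an automorphism and using
  uniqueness shows that the constant term is fixed and that the other two coefficients form a
  conjugate pair.\<close>

lemma L_decompose:
 assumes z: "z : L"
 obtains A bt gm where "A : K" "bt : K" "gm : K" "z = A + bt * s + gm * r"
  "z = A + (bt + gm * th) * u + (bt + gm * th') * lam / u"
proof -
 obtain A B E where ABE: "A : K.F3" "B : K.F3" "E : K.F3" "z = A + B * u + E / u"
  using K.decompose L_kbu z by blast
 \<comment> \<open>The coefficient with respect to lam / u instead of 1 / u; an inverting
   automorphism then exchanges \<open>B\<close> and \<open>D\<close> exactly.\<close>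
 define D where "D = E / lam"
 have D: "D : K.F3" unfolding D_def using ABE lam_kb K.F_F3 by (auto intro!: subfield_divide K.F3)
 have E: "E = D * lam" using lam(2) by (simp add: D_def)
 have im: "ta A : K.F3" "ta B : K.F3" "ta D : K.F3" if t: "galois_aut L ta" for ta
  using galois_aut_compositum[OF L k k_L K_L t] ABE D unfolding K_kb by blast+
 have tz: "z = ta A + ta B * ta u + ta D * lam / ta u" if t: "galois_aut L ta" for ta
 proof -
  note A = subfield_alg_cl[OF L]
  have inA: "A : alg_cl L" "B : alg_cl L" "D : alg_cl L" using ABE D K.F3_Fu kbu_alg by blast+
  have "ta lam = lam" using field_isoD(2)[OF t] lam k_L by blast
  moreover have "ta z = z" using field_isoD(2)[OF t z] .
  moreover have "ta (A + B * u + D * lam / u) = ta A + ta B * ta u + ta D * ta lam / ta u"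
   using inA in_alg by (simp only: field_isoD(3,4)[OF t] iso_divide[OF t A] subfield_mult[OF A] subfield_divide[OF A] subfield_add[OF A])
  ultimately show ?thesis using ABE(4) E by simp
 qed
 have lF: "lam : K.F3" using lam_kb K.F_F3 by blast
 have c1: "ta A = A & ta B = B & ta D = D" if t: "galois_aut L ta" "ta u = u" for ta
 proof -
  have "ta A + ta B * u + (ta D * lam) / u = A + B * u + (D * lam) / u" using tz[OF t(1)] t(2) ABE(4) E by simp
  then have "ta A = A & ta B = B & ta D * lam = D * lam"
   using ABE D im[OF t(1)] lF by (intro K.decompose_unique) (auto intro: subfield_mult K.F3)
  then show ?thesis using lam(2) by simp
 qed
 have c2: "ta A = A & ta B = D & ta D = B" if t: "galois_aut L ta" "ta u = lam / u" for ta
 proof -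
  have "ta A + ta D * u + (ta B * lam) / u = A + B * u + (D * lam) / u"
   using tz[OF t(1)] t(2) ABE(4) E lam(2) u_nz by simp
  then have "ta A = A & ta D = B & ta B * lam = D * lam"
   using ABE D im[OF t(1)] lF by (intro K.decompose_unique) (auto intro: subfield_mult K.F3)
  then show ?thesis using lam(2) by simp
 qed
 have A: "A : K"
 proof (rule F3_L[OF ABE(1)])
  fix ta assume t: "galois_aut L ta"
  show "ta A = A" by (rule galois_aut_cases[OF t]) (use c1[OF t] c2[OF t] in auto)
 qed
 obtain bt gm where bg: "bt : K" "gm : K" "B = bt + gm * th" "D = bt + gm * th'"
 proof (rule pair_descent[OF ABE(2) D])
  fix ta assume t: "galois_aut L ta"
  show "ta B = B & ta D = D" if "ta th = th" using galois_aut_cases[OF t] c1[OF t] that ne by metis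
  show "ta B = D & ta D = B" if "ta th = th'" using galois_aut_cases[OF t] c2[OF t] that ne by metis
 qed
 have z1: "z = A + (bt + gm * th) * u + (bt + gm * th') * lam / u" using ABE(4) E bg by simp
 then have "z = A + bt * s + gm * r" by (simp add: algebra_simps add_divide_distrib)
 then show thesis using that A bg z1 by blast
qed

lemma L_independent:
 assumes "A : K" "bt : K" "gm : K" and z: "A + bt * s + gm * r = 0"
 shows "A = 0 & bt = 0 & gm = 0"
proof -
 have th: "th : K.F3" "th' : K.F3" "lam : K.F3" using th_kb lam_kb K.F_F3 by auto
 have in3: "A : K.F3" "bt : K.F3" "gm : K.F3" using assms K_F3 by auto
 have "A + (bt + gm * th) * u + ((bt + gm * th') * lam) / u = 0" using z by (simp add: algebra_simps add_divide_distrib)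
 then have "A = 0 & bt + gm * th = 0 & (bt + gm * th') * lam = 0"
  using in3 th by (intro K.decompose_zero) (auto intro!: subfield_intros K.F3)
 then have "A = 0" "bt + gm * th = 0" "bt + gm * th' = 0" using lam(2) by auto
 moreover have "gm * (th - th') = (bt + gm * th) - (bt + gm * th')" by (simp add: algebra_simps)
 ultimately show ?thesis using ne by simp
qed

end

section \<open>Effect of isomorphisms and of rescaling on twisted fields\<close>

context quad
begin

lemma iso_C_pair:
 assumes f: "field_iso k E F f" and E: "is_subfield E" "th : E" "th' : E" "k \<subseteq> E"
 shows "(%(a, a'). (f a, f a')) ` C = C"
proof -
 have c: "f th = th \<or> f th = th'" using iso_quad[OF f E(1-3)] by blast
 have 1: "(f a, f a') = (a, a') \<or> (f a, f a') = (a', a)" if "(a, a') : C" for a a'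
  using iso_C[OF f E that] c by auto
 have 2: "f th = th ==> (f a, f a') = (a, a')" "f th = th' ==> (f a', f a) = (a, a')" if "(a, a') : C" for a a'
  using iso_C[OF f E that] by auto
 show ?thesis
 proof
  show "(%(a, a'). (f a, f a')) ` C \<subseteq> C" using 1 C_swap by force
  show "C \<subseteq> (%(a, a'). (f a, f a')) ` C"
  proof clarify
   fix a a' assume a: "(a, a') : C"
   show "(a, a') : (%(a, a'). (f a, f a')) ` C"
    using c
   proof
    assume "f th = th"
    from 2(1)[OF a this] a show ?thesis by (intro image_eqI[of _ _ "(a, a')"]) auto
   next
    assume "f th = th'"
    from 2(2)[OF a this] C_swap[OF a] show ?thesis by (intro image_eqI[of _ _ "(a', a)"]) auto
   qed
  qed
 qed
qed

text \<open>An isomorphism over k may exchange th and th', but the set of pairs is closed under this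
  exchange, so only the image of \<open>v\<close> matters.\<close>

lemma iso_twist_field:
 assumes f: "field_iso k E F f" and E: "is_subfield E" "th : E" "th' : E" "k \<subseteq> E" and lam: "lam : k" and v: "v : E"
 shows "f ` twist_field k C lam v = twist_field k C lam (f v)"
proof -
 have aE: "a : E" "a' : E" if "(a, a') : C" for a a'
  using that E by (auto elim!: C_E intro!: subfield_intros)
 have lE: "lam : E" "f lam = lam" using lam E field_isoD(2)[OF f] by auto
 let ?S = "%v. {a * v + a' * lam / v | a a'. (a, a') : C}"
 have fS: "f (a * v + a' * lam / v) = f a * f v + f a' * lam / f v" if "(a, a') : C" for a a'
  using aE[OF that] lE v
  by (simp add: field_isoD(3,4)[OF f] iso_divide[OF f E(1)] subfield_intros[OF E(1)])
 have "f ` ?S v = ?S (f v)"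
 proof
  show "f ` ?S v \<subseteq> ?S (f v)"
  proof clarify
   fix a a' assume a: "(a, a') : C"
   then have "(f a, f a') : C" using iso_C_pair[OF f E] by (metis (mono_tags, lifting) case_prod_conv image_eqI)
   then show "\<exists>b b'. f (a * v + a' * lam / v) = b * f v + b' * lam / f v & (b, b') : C"
    using fS[OF a] by blast
  qed
  show "?S (f v) \<subseteq> f ` ?S v"
  proof clarify
   fix b b' assume "(b, b') : C"
   then have "(b, b') : (%(a, a'). (f a, f a')) ` C" using iso_C_pair[OF f E] by simp
   then obtain a a' where a: "(a, a') : C" "b = f a" "b' = f a'" by auto
   then have "b * f v + b' * lam / f v = f (a * v + a' * lam / v)" using fS by simp
   then show "b * f v + b' * lam / f v : f ` ?S v" using a(1) by blast
  qed
 qed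
 moreover have "f ` k = k" using field_isoD(2)[OF f] by force
 moreover have "?S v \<subseteq> E" using aE lE v by (auto intro!: subfield_intros E)
 ultimately show ?thesis unfolding twist_field_def using iso_adjoin[OF f E(1,4), of "?S v"] by simp
qed

text \<open>Multiplying pairs by (c, c') permutes the generators: it moves c from the coefficient to
  the coordinate, and the conjugate term then needs the norm c c' in the parameter.\<close>

lemma twist_field_scale:
 assumes c: "(c, c') : C" "c ~= 0" "c' ~= 0"
 shows "twist_field k C (c * c' * lam) (c * v) = twist_field k C lam v"
proof -
 have "{a * (c * v) + a' * (c * c' * lam) / (c * v) | a a'. (a, a') : C} = {a * v + a' * lam / v | a a'. (a, a') : C}"
  (is "?S = ?T")
 proof
  show "?S \<subseteq> ?T"
  proof clarify
   fix a a' assume "(a, a') : C"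
   then have "(a * c, a' * c') : C" using c C_mult by blast
   moreover have "a * (c * v) + a' * (c * c' * lam) / (c * v) = (a * c) * v + (a' * c') * lam / v"
    using c by (simp add: mult_ac)
   ultimately show "\<exists>b b'. a * (c * v) + a' * (c * c' * lam) / (c * v) = b * v + b' * lam / v & (b, b') : C" by blast
  qed
  show "?T \<subseteq> ?S"
  proof clarify
   fix a a' assume "(a, a') : C"
   then have "(a / c, a' / c') : C" using c C_divide by blast
   moreover have "a * v + a' * lam / v = (a / c) * (c * v) + (a' / c') * (c * c' * lam) / (c * v)"
    using c by simp
   ultimately show "\<exists>b b'. a * v + a' * lam / v = b * (c * v) + b' * (c * c' * lam) / (c * v) & (b, b') : C" by blast
  qed
 qed
 then show ?thesis unfolding twist_field_def by simp
qed

end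

subsection \<open>The cubic extension\<close>

context twist
begin

lemma degree3: "has_degree K L 3"
proof -
 have K01: "0 : K" "1 : K" "-1 : K" using K by (auto intro: subfield_0 subfield_1 subfield_uminus)
 define S R where SR: "S = s" "R = r"
 have ind: "A = 0 & bt = 0 & gm = 0" if "A : K" "bt : K" "gm : K" "A + bt * S + gm * R = 0" for A bt gm
  using L_independent[of A bt gm] that unfolding SR by blast
 have d: "1 ~= S" "1 ~= R" "S ~= R"
  using ind[of 1 "-1" 0] ind[of 1 0 "-1"] ind[of 0 1 "-1"] K01 by auto
 have sum: "(\<Sum>b\<in>{1, S, R}. c b * b) = c 1 + c S * S + c R * R" for c
  using d by (simp add: add.assoc)
 show ?thesis unfolding has_degree_def
 proof (rule exI[of _ "{1, S, R}"], intro conjI ballI allI impI)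
  show "finite {1, S, R}" "card {1, S, R} = 3" using d by auto
  show "{1, S, R} \<subseteq> L" using s_L r_L subfield_1[OF L] by (auto simp: SR)
  fix z assume "z : L"
  then obtain A bt gm where A: "A : K" "bt : K" "gm : K" "z = A + bt * S + gm * R"
   using L_decompose unfolding SR by blast
  let ?c = "%b. if b = 1 then A else if b = S then bt else gm"
  show "\<exists>c. (\<forall>b\<in>{1, S, R}. c b : K) & z = (\<Sum>b\<in>{1, S, R}. c b * b)"
  proof (rule exI[where x = ?c], rule conjI)
   show "\<forall>b\<in>{1, S, R}. ?c b : K" using A by simp
   show "z = (\<Sum>b\<in>{1, S, R}. ?c b * b)" unfolding sum A(4) using d by simp
  qed
 next
  fix c b assume c: "(\<forall>b\<in>{1, S, R}. c b : K) & (\<Sum>b\<in>{1, S, R}. c b * b) = 0" and b: "b : {1, S, R}"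
  then have "c 1 = 0 & c S = 0 & c R = 0" unfolding sum by (intro ind) auto
  then show "c b = 0" using b by auto
 qed
qed

text \<open>These are the nontrivial ingredients of the characteristic polynomial of an element of
  \<open>L\<close>. The product is a norm; the second expression is a trace once the cubes are
  expanded, as each power of th gives a generator of \<open>K\<close>.\<close>

lemma cubic_poly_over_K:
 assumes "bt : K" "gm : K"
 defines "m \<equiv> bt + gm * th" and "m' \<equiv> bt + gm * th'"
 shows "m * m' : K" "m ^ 3 * w + m' ^ 3 * lam / w : K"
proof -
 note cl = subfield_intros[OF K]
 have kK: "th + th' : K" "th * th' : K" using tr nm k_K by auto
 have "m * m' = bt ^ 2 + bt * gm * (th + th') + gm ^ 2 * (th * th')" unfolding m_def m'_def
  by (simp add: power2_eq_square algebra_simps)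
 then show "m * m' : K" using kK assms(1,2) by (simp add: cl)
 have g: "a * w + a' * lam / w : K" if "(a, a') : C" for a a' using twist.L_gen[OF twist_w that] .
 have c: "(th ^ 2, th' ^ 2) : C" "(th ^ 3, th' ^ 3) : C"
  using C_mult[OF C_gen C_gen] C_mult[OF C_gen C_mult[OF C_gen C_gen]]
  by (simp_all add: power2_eq_square power3_eq_cube mult.assoc)
 note i = g[OF C_const[OF subfield_1[OF k]]] g[OF C_gen] g[OF c(1)] g[OF c(2)]
 have ex: "(bt + gm * th) ^ 3 * W + (bt + gm * th') ^ 3 * lam / V = bt ^ 3 * (1 * W + 1 * lam / V) + 3 * bt ^ 2 * gm * (th * W + th' * lam / V)
   + 3 * bt * gm ^ 2 * (th ^ 2 * W + th' ^ 2 * lam / V) + gm ^ 3 * (th ^ 3 * W + th' ^ 3 * lam / V)" for W V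
  by (simp add: power2_eq_square power3_eq_cube algebra_simps add_divide_distrib)
 have bc: "bt ^ 3 : K" "3 * bt ^ 2 * gm : K" "3 * bt * gm ^ 2 : K" "gm ^ 3 : K" using assms(1,2) by (simp_all add: cl)
 show "m ^ 3 * w + m' ^ 3 * lam / w : K" unfolding m_def m'_def ex
  by (rule subfield_add[OF K subfield_add[OF K subfield_add[OF K subfield_mult[OF K bc(1) i(1)]
    subfield_mult[OF K bc(2) i(2)]] subfield_mult[OF K bc(3) i(3)]] subfield_mult[OF K bc(4) i(4)]])
qed

text \<open>For z = A + a + b with a and b the parts along u and 1 / u, the conjugates under the
  rotation are A + zt a + zt^2 b and A + zt^2 a + zt b. Their symmetric functions involve only A, a
  b and a^3 + b^3, all in \<open>K\<close>, and the conjugates are distinct unless z = A.\<close>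

lemma separable: "separable_ext K L"
 unfolding separable_ext_def
proof
 fix z assume "z : L"
 then obtain A bt gm where A: "A : K" "bt : K" "gm : K" "z = A + (bt + gm * th) * u + (bt + gm * th') * lam / u"
  using L_decompose by metis
 define m m' where "m = bt + gm * th" and "m' = bt + gm * th'"
 define a b where "a = m * u" and "b = m' * lam / u"
 have z: "z = A + a + b" using A by (simp add: a_def b_def m_def m'_def)
 have e: "a * b = m * m' * lam" using u_nz by (simp add: a_def b_def)
 have f: "a ^ 3 + b ^ 3 = lam * (m ^ 3 * w + m' ^ 3 * lam / w)"
 proof -
  have 1: "lam * (m ^ 3 * w) = a ^ 3" using lam(2) by (simp add: a_def power_mult_distrib)
  have "lam * (m' ^ 3 * (lam / w)) = b ^ 3" unfolding lam_w b_def times_divide_eq_right[symmetric]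
   using lam(2) by (simp only: power_mult_distrib) simp
  with 1 show ?thesis by (simp only: distrib_left times_divide_eq_right[symmetric])
 qed
 have mm: "m * m' : K" "m ^ 3 * w + m' ^ 3 * lam / w : K"
  unfolding m_def m'_def by (rule cubic_poly_over_K[OF A(2,3)])+
 have lK: "lam : K" using lam k_K by auto
 have eK: "a * b : K" and fK: "a ^ 3 + b ^ 3 : K" unfolding e f
  by (rule subfield_mult[OF K mm(1) lK], rule subfield_mult[OF K lK mm(2)])
 show "\<exists>p. rsquarefree p & set (coeffs p) \<subseteq> K & poly p z = 0"
 proof (cases "m = 0 & m' = 0")
  case True
  then have zA: "z = A" using z by (simp add: a_def b_def)
  have "rsquarefree [:-A, 1:]" by (rule rsquarefreeI) (auto simp: pderiv_pCons)
  moreover have "[:-A, 1:] : polys_over K"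
   using A by (simp add: polys_over_pCons_iff[OF K] polys_over_0[OF K] subfield_uminus[OF K] subfield_1[OF K])
  then have "set (coeffs [:-A, 1:]) \<subseteq> K" by (rule iffD2[OF polys_over_coeffs[OF subfield_0[OF K]]])
  ultimately show ?thesis using zA by (intro exI[of _ "[:-A, 1:]"] conjI) simp_all
 next
  case False
  define z1 z2 where "z1 = A + zt * a + zt ^ 2 * b" and "z2 = A + zt ^ 2 * a + zt * b"
  \<comment> \<open>Differences of conjugates have the form c a + d b with nonzero constants c and
    d; independence of u and 1 / u lets this vanish only if both parts of \<open>z\<close>
    do.\<close>
  have uniq: "c = 0 \<or> d = 0 \<or> c * a + d * b ~= 0" if "c : kb" "d : kb" for c d
  proof (rule ccontr)
   assume n: "\<not> ?thesis"
   have inF: "bt : K.F3" "gm : K.F3" "th : K.F3" "th' : K.F3" "c : K.F3" "d : K.F3" "lam : K.F3"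
    using A K_F3 th_kb lam_kb K.F_F3 that by auto
   have "0 + (c * m) * u + (d * m' * lam) / u = 0" using n by (simp add: a_def b_def mult.assoc)
   then have "c * m = 0 & d * m' * lam = 0"
    using inF by (intro K.decompose_zero[of 0, THEN conjunct2]) (auto intro!: subfield_intros K.F3 simp: m_def m'_def)
   then show False using n False lam(2) by auto
  qed
  have zk: "zt - 1 : kb" "zt ^ 2 - 1 : kb" "zt ^ 2 - zt : kb" "zt - zt ^ 2 : kb"
   using zeta_kb kb by (auto intro!: subfield_intros)
  have znz: "zt - 1 ~= 0" "zt ^ 2 - 1 ~= 0" "zt ^ 2 - zt ~= 0" "zt - zt ^ 2 ~= 0" using z1 K.zeta_sq_ne by auto
  have d: "z1 ~= z" "z2 ~= z" "z2 ~= z1"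
  proof -
   have "z1 - z = (zt - 1) * a + (zt ^ 2 - 1) * b" "z2 - z = (zt ^ 2 - 1) * a + (zt - 1) * b"
    "z2 - z1 = (zt ^ 2 - zt) * a + (zt - zt ^ 2) * b"
    by (simp_all add: z1_def z2_def z algebra_simps)
   then have "z1 - z ~= 0" "z2 - z ~= 0" "z2 - z1 ~= 0"
    using uniq[OF zk(1,2)] uniq[OF zk(2,1)] uniq[OF zk(3,4)] znz by simp_all
   then show "z1 ~= z" "z2 ~= z" "z2 ~= z1" by auto
  qed
  define p where "p = [:-z, 1:] * ([:-z1, 1:] * [:-z2, 1:])"
  have "rsquarefree p"
  proof (rule rsquarefreeI)
   show "p ~= 0" unfolding p_def by (intro mult_not_zero no_zero_divisors) auto
   fix c assume "poly p c = 0"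
   then have "c = z \<or> c = z1 \<or> c = z2" unfolding p_def poly_mult by auto
   moreover have "poly (pderiv p) c = (c - z) * ((c - z1) + (c - z2)) + (c - z1) * (c - z2)"
    unfolding p_def pderiv_mult by (simp add: pderiv_pCons algebra_simps)
   ultimately show "poly (pderiv p) c ~= 0" using d by auto
  qed
  moreover have "p : polys_over K"
  proof -
   have zsq: "zt ^ 2 = - 1 - zt" using K.zeta_sq by (simp add: power2_eq_square)
   have zz: "zt * zt = - 1 - zt" by (rule K.zeta_sq)
   have s1: "z + z1 + z2 = 3 * A" unfolding z z1_def z2_def zsq by (simp add: algebra_simps)
   have s2: "z * z1 + z * z2 + z1 * z2 = 3 * A ^ 2 - 3 * (a * b)"
    unfolding z z1_def z2_def zsq using zz by algebra
   have s3: "z * z1 * z2 = A ^ 3 - 3 * (a * b) * A + (a ^ 3 + b ^ 3)"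
    unfolding z z1_def z2_def zsq using zz by algebra
   have "p = [:- (z * z1 * z2), z * z1 + z * z2 + z1 * z2, - (z + z1 + z2), 1:]"
    unfolding p_def by (simp add: algebra_simps)
   moreover have "- (z * z1 * z2) : K" "z * z1 + z * z2 + z1 * z2 : K" "- (z + z1 + z2) : K"
   proof -
    have "- (A ^ 3 - 3 * e * A + f) : K" "3 * A ^ 2 - 3 * e : K" "- (3 * A) : K"
     if "e : K" "f : K" for e f
     by (intro subfield_intros K that A(1))+
    from this[OF eK fK] show "- (z * z1 * z2) : K" "z * z1 + z * z2 + z1 * z2 : K" "- (z + z1 + z2) : K"
     unfolding s1 s2 s3 .
   qed
   ultimately show ?thesis
    by (simp only: polys_over_pCons_iff[OF K] polys_over_0[OF K] subfield_1[OF K] simp_thms)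
  qed
  then have "set (coeffs p) \<subseteq> K" by (rule iffD2[OF polys_over_coeffs[OF subfield_0[OF K]]])
  moreover have "poly p z = 0" by (simp add: p_def)
  ultimately show ?thesis by blast
 qed
qed

text \<open>The transcendental \<open>s\<close> serves as base: \<open>L\<close> is quadratic over
  k(s), generated by \<open>r\<close> with conjugate \<open>r'\<close>, and the locale of quadratic
  pairs is reused over k(s).\<close>

lemma function_field_L: "function_field k L"
proof -
 let ?M = "adjoin k {s}"
 define r' where "r' = th' * u + th * lam / u"
 note M = subfield_adjoin[of k "{s}"]
 have sM: "s : ?M" using adjoin_gen[of "{s}" k] by auto
 have kM: "k \<subseteq> ?M" by (rule adjoin_subset)
 have ul: "u * (lam / u) = lam" using u_nz by simp
 have une: "u ~= lam / u"
 proof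
  assume "u = lam / u"
  then have "u ^ 2 = lam" using ul by (simp add: power2_eq_square)
  then show False using transcendental_power[OF k u, of 2] lam_kb by simp
 qed
 have rr: "r ~= r'"
 proof
  assume "r = r'"
  moreover have "r - r' = (th - th') * (u - lam / u)" by (simp add: r'_def algebra_simps diff_divide_distrib)
  ultimately show False using ne une by simp
 qed
 have "r + r' = (th + th') * s" by (simp add: r'_def algebra_simps add_divide_distrib)
 then have 1: "r + r' : ?M" using sM tr kM by (auto intro!: subfield_mult[OF M])
 have "r * r' = th * th' * (u * u + (lam / u) * (lam / u)) + (th * th + th' * th') * (u * (lam / u))"
  unfolding r'_def times_divide_eq_right[symmetric] by algebra
 also have "\<dots> = th * th' * (s * s - 2 * lam) + ((th + th') * (th + th') - 2 * (th * th')) * lam"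
 proof -
  have "th * th' * (u * u + v * v) + (th * th + th' * th') * (u * v) = th * th' * ((u + v) * (u + v) - 2 * l) +
   ((th + th') * (th + th') - 2 * (th * th')) * l" if "u * v = l" for v l
   unfolding that[symmetric] by (simp add: algebra_simps)
  from this[OF ul] show ?thesis .
 qed
 finally have rr2: "r * r' = th * th' * (s * s - 2 * lam) + ((th + th') * (th + th') - 2 * (th * th')) * lam" .
 have kk: "th * th' : ?M" "th + th' : ?M" "lam : ?M" "2 * lam : ?M" "2 * (th * th') : ?M"
  using tr nm lam kM subfield_mult[OF M subfield_numeral[OF M, of "num.Bit0 num.One"]] by auto
 have 2: "r * r' : ?M" unfolding rr2
  by (intro subfield_add[OF M] subfield_mult[OF M kk(1)] subfield_mult[OF M _ kk(3)] subfield_diff[OF M]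
    subfield_mult[OF M sM sM] kk subfield_mult[OF M kk(2,2)])
 interpret Q: quad ?M r r' by unfold_locales (use M rr 1 2 in auto)
 have LQ: "L = fst ` quad_pairs ?M r r'"
  unfolding Q.fst_C L_eq adjoin_adjoin by (simp add: insert_commute)
 \<comment> \<open>The substitution u -> lam / u over kb fixes k(s) pointwise but carries
   \<open>r\<close> to \<open>r'\<close>.\<close>
 have rM: "r \<notin> ?M"
 proof
  assume rM: "r : ?M"
  have lu: "lam / u \<notin> kb" by (rule transcendental_scale(2)[OF k u lam_kb lam(2)])
  obtain h where h: "field_iso kb (adjoin kb {u}) (adjoin kb {lam / u}) h" "h u = lam / u"
   using subst_iso[OF kb, of u "lam / u"] u lu by (metis alg_cl_idem[OF k])
  note Fu = K.Fu and ui = K.u_in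
  have inn: "lam : K.Fu" "th : K.Fu" "th' : K.Fu" using lam_kb th_kb K.F_Fu by auto
  have hc: "h lam = lam" "h th = th" "h th' = th'" using field_isoD(2)[OF h(1)] lam_kb th_kb by auto
  have hl: "lam / (lam / u) = u" using lam(2) u_nz by simp
  have "h s = h u + h lam / h u" using inn ui
   by (simp add: field_isoD(3)[OF h(1)] iso_divide[OF h(1) Fu] subfield_intros[OF Fu])
  then have hs: "h s = s" using hl h(2) hc by simp
  have "h r = h th * h u + h th' * h lam / h u" using inn ui
   by (simp add: field_isoD(3,4)[OF h(1)] iso_divide[OF h(1) Fu] subfield_intros[OF Fu])
  then have hr: "h r = r'" using hl h(2) hc lam(2) by (simp add: r'_def)
  have "?M \<subseteq> {a : K.Fu. h a = a}"
  proof (rule adjoin_least[OF fixed_subfield[OF Fu]])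
   show "field_iso kb K.Fu (adjoin kb {lam / u}) h" by (rule h)
   show "k \<subseteq> {a : K.Fu. h a = a}" using k_kb K.F_Fu field_isoD(2)[OF h(1)] by auto
   show "{s} \<subseteq> {a : K.Fu. h a = a}" using hs s_L L_kbu by auto
  qed
  then have "h r = r" using rM by blast
  then show False using hr rr by simp
 qed
 have st: "\<not> algebraic_over k s"
 proof
  assume "algebraic_over k s"
  then have sk: "s : kb" by (simp add: alg_cl_def)
  have "[:lam, - s, 1:] : polys_over kb"
   using sk lam_kb by (simp add: polys_over_pCons_iff[OF kb] polys_over_0[OF kb] subfield_uminus[OF kb] subfield_1[OF kb] del: minus_add_distrib)
  moreover have "poly [:lam, - s, 1:] u = 0" using ul by (simp add: algebra_simps)
  moreover have "[:lam, - s, 1:] ~= 0" by simp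
  ultimately show False using alg_cl_closed[OF k] u by blast
 qed
 have "has_degree ?M L 2" unfolding has_degree_def
 proof (rule exI[of _ "{1, r}"], intro conjI ballI allI impI)
  have r1: "1 ~= r" using rM subfield_1[OF M] by auto
  show "finite {1, r}" "card {1, r} = 2" using r1 by auto
  show "{1, r} \<subseteq> L" using r_L subfield_1[OF L] by auto
  have sum: "(\<Sum>b\<in>{1, r}. c b * b) = c 1 + c r * r" for c using r1 by simp
  fix z assume "z : L"
  then obtain z' where "(z, z') : quad_pairs ?M r r'" unfolding LQ by auto
  then obtain al bt where ab: "al : ?M" "bt : ?M" "z = al + bt * r" by (elim Q.C_E)
  let ?c = "%b. if b = 1 then al else bt"
  show "\<exists>c. (\<forall>b\<in>{1, r}. c b : ?M) & z = (\<Sum>b\<in>{1, r}. c b * b)"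
  proof (rule exI[where x = ?c], rule conjI)
   show "\<forall>b\<in>{1, r}. ?c b : ?M" using ab by simp
   show "z = (\<Sum>b\<in>{1, r}. ?c b * b)" unfolding sum ab(3) using r1 by simp
  qed
 next
  have r1: "1 ~= r" using rM subfield_1[OF M] by auto
  fix c b assume c: "(\<forall>b\<in>{1, r}. c b : ?M) & (\<Sum>b\<in>{1, r}. c b * b) = 0" and b: "b : {1, r}"
  then have e: "c 1 + c r * r = 0" "c 1 : ?M" "c r : ?M" using r1 by auto
  have "c r = 0"
  proof (rule ccontr)
   assume n: "c r ~= 0"
   have h: "c r * r = - c 1" using e(1) by (simp only: add_eq_0_iff)
   have "r * c r = - c 1" by (rule trans[OF mult.commute h])
   then have "r = - c 1 / c r" by (simp only: nonzero_eq_divide_eq[OF n])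
   then show False using rM subfield_divide[OF M subfield_uminus[OF M e(2)] e(3)] by metis
  qed
  then show "c b = 0" using e(1) b by auto
 qed
 then show ?thesis unfolding function_field_def
  using L k_L s_L st const by (auto simp: alg_cl_def)
qed

text \<open>A cubic constant extension inside \<open>L\<close> would consist of algebraic elements
  of \<open>L\<close>, so it would be k itself, and k does not contain three elements independent
  over k.\<close>

lemma geometric: "geometric_ext k K L"
 unfolding geometric_ext_def
proof
 assume "\<exists>l. is_subfield l & k \<subseteq> l & has_degree k l 3 & L = adjoin K l"
 then obtain l where l: "is_subfield l" "k \<subseteq> l" "has_degree k l 3" "L = adjoin K l" by blast
 have "l \<subseteq> kb" by (rule has_degree_algebraic[OF k l(1,3)])
 moreover have "l \<subseteq> L" using l(4) adjoin_gen by blast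
 ultimately have lk: "l = k" using const l(2) by blast
 obtain B where B: "finite B" "card B = 3" "B \<subseteq> k"
  "\<forall>c. (\<forall>b\<in>B. c b : k) & (\<Sum>b\<in>B. c b * b) = 0 --> (\<forall>b\<in>B. c b = 0)"
  using l(3) unfolding has_degree_def lk by (elim exE conjE)
 obtain b1 b2 b3 where b: "B = {b1, b2, b3}" "b1 ~= b2" "b2 ~= b3" "b1 ~= b3" using B(2) unfolding card_3_iff by blast
 define c where "c b = (if b = b1 then b2 else if b = b2 then - b1 else 0)" for b
 have "(\<Sum>b\<in>B. c b * b) = 0" unfolding b(1) using b(2-4) by (simp add: c_def)
 moreover have "\<forall>b\<in>B. c b : k" using B(3) b by (auto simp: c_def subfield_0[OF k] subfield_uminus[OF k])
 ultimately have "\<forall>b\<in>B. c b = 0" using B(4) by blast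
 then have "b2 = 0" "b1 = 0" using b by (auto simp: c_def split: if_splits)
 then show False using b by simp
qed

theorem cubic: "cubic_extension k K L"
 unfolding cubic_extension_def
 using twist.function_field_L[OF twist_w] L K_L degree3 separable geometric by blast

lemma bitwist:
 assumes y: "y \<notin> kb" "y ^ 3 = x"
 shows "(K, L) : bitwists k (adjoin k {x}, adjoin (adjoin k {x}) {y})"
proof -
 have sets: "adjoin (adjoin k {x}) kb = adjoin kb {y ^ 3}" "adjoin (adjoin (adjoin k {x}) {y}) kb = adjoin kb {y}"
 proof -
  have e: "adjoin (adjoin k S) kb = adjoin kb S" for S
  proof -
   have "k \<subseteq> adjoin kb S" using k_kb adjoin_subset[of kb S] by blast
   then show ?thesis unfolding adjoin_adjoin using adjoin_subset[of kb S] adjoin_gen[of S kb] adjoin_gen[of "S \<union> kb" k]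
    by (intro subset_antisym adjoin_least subfield_adjoin) auto
  qed
  have "adjoin kb {x, y} = adjoin kb {y}"
   using adjoin_gen[of "{y}" kb] subfield_power[OF subfield_adjoin[of kb "{y}"], of y 3] y(2) adjoin_gen[of "{x, y}" kb]
   by (intro subset_antisym adjoin_mono) auto
  then show "adjoin (adjoin k {x}) kb = adjoin kb {y ^ 3}" "adjoin (adjoin (adjoin k {x}) {y}) kb = adjoin kb {y}"
   using e[of "{x}"] e[of "{x, y}"] y(2) unfolding adjoin_adjoin by (auto simp: insert_commute)
 qed
 obtain f where f: "field_iso kb (adjoin kb {u}) (adjoin kb {y}) f" "f u = y"
  using subst_iso[OF kb, of u y] u y(1) by (metis alg_cl_idem[OF k])
 have "f ` adjoin kb {u ^ 3} = adjoin (f ` kb) (f ` {u ^ 3})"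
  using K.F_Fu K.F3_Fu K.u3_in by (intro iso_adjoin[OF f(1) K.Fu]) auto
 also have "f ` kb = kb" using field_isoD(2)[OF f(1)] by force
 also have "f ` {u ^ 3} = {y ^ 3}" using iso_power[OF f(1) K.Fu K.u_in] f(2) by simp
 finally have f3: "f ` K.F3 = adjoin kb {y ^ 3}" .
 have "field_iso kb K.F3 (adjoin kb {y ^ 3}) f" using iso_restrict[OF f(1) K.Fu K.F3_Fu] f3 by simp
 then have "bi_isomorphic kb (K.F3, K.Fu) (adjoin kb {y ^ 3}, adjoin kb {y})"
  unfolding bi_isomorphic_def using f(1) by auto
 then show ?thesis unfolding bitwists_def base_change_def using cubic L_kb K_kb sets by simp
qed

end

section \<open>Classification of the bi-twists\<close>

definition twist_data :: "'a::field set => ('a \<times> 'a) set => 'a => bool" where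
 "twist_data k C lam \<longleftrightarrow> (\<exists>th th'. quad k th th' & C = quad_pairs k th th') & lam : k & lam ~= 0"

text \<open>The invariant is a relation and not a function, because \<open>lam\<close> is determined
  only up to norms from \<open>C\<close>.\<close>

definition ext_type :: "'a::field set => ('a \<times> 'a) set => 'a => 'a set \<times> 'a set => bool" where
 "ext_type k C lam E \<longleftrightarrow> twist_data k C lam &
   (\<exists>u. u \<notin> alg_cl k & E = (twist_field k C lam (u ^ 3 / lam), twist_field k C lam u))"

lemma degree_dependent:
 fixes K :: "'a::field set"
 assumes K: "is_subfield K" and d: "has_degree K L n" and x: "!!i. i \<le> n ==> x i : L"
 shows "\<exists>c. (\<forall>i\<le>n. c i : K) & (\<exists>i\<le>n. c i ~= 0) & (\<Sum>i\<le>n. c i * x i) = 0"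
proof -
 obtain B where B: "finite B" "card B = n" "!!a. a : L ==> \<exists>c. (\<forall>b\<in>B. c b : K) & a = (\<Sum>b\<in>B. c b * b)"
  using d unfolding has_degree_def by blast
 have "\<forall>i. \<exists>c. i \<le> n --> (\<forall>b\<in>B. c b : K) & x i = (\<Sum>b\<in>B. c b * b)" using B(3) x by blast
 then obtain m where m: "!!i. i \<le> n ==> (\<forall>b\<in>B. m i b : K) & x i = (\<Sum>b\<in>B. m i b * b)" by metis
 obtain c where c: "\<forall>i\<in>{..n}. c i : K" "\<exists>i\<in>{..n}. c i ~= 0" "\<forall>b\<in>B. (\<Sum>i\<le>n. c i * m i b) = 0"
  using linear_system_solution[OF K B(1), of "{..n}" m] B(2) m by auto
 have "(\<Sum>i\<le>n. c i * x i) = (\<Sum>i\<le>n. \<Sum>b\<in>B. c i * m i b * b)"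
  using m by (intro sum.cong) (auto simp: sum_distrib_left mult.assoc)
 also have "\<dots> = (\<Sum>b\<in>B. (\<Sum>i\<le>n. c i * m i b) * b)" by (subst sum.swap) (simp add: sum_distrib_right)
 also have "\<dots> = 0" using c(3) by simp
 finally show ?thesis using c by (intro exI[of _ c]) auto
qed

text \<open>In dimension three the elements 1, a, b, a b are dependent, and the relation can be
  solved for b as a quotient of linear expressions in a. This replaces the multiplicativity of
  degrees.\<close>

lemma cubic_no_intermediate:
 assumes K: "is_subfield K" and d: "has_degree K L 3" and L: "is_subfield L" "K \<subseteq> L"
  and a: "a : L" "a \<notin> K"
 shows "L = adjoin K {a}"
proof
 note M = subfield_adjoin[of K "{a}"]
 have KM: "K \<subseteq> adjoin K {a}" and aM: "a : adjoin K {a}" using adjoin_subset adjoin_gen by blast+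
 show "adjoin K {a} \<subseteq> L" using a L by (intro adjoin_least) auto
 show "L \<subseteq> adjoin K {a}"
 proof
  fix b assume b: "b : L"
  define x where "x i = (if i = 0 then 1 else if i = 1 then a else if i = 2 then b else a * b)" for i :: nat
  have "x i : L" for i using a b L by (auto simp: x_def intro: subfield_1 subfield_mult)
  then obtain c where c: "\<forall>i\<le>3. c i : K" "\<exists>i\<le>3. c i ~= 0" "(\<Sum>i\<le>3. c i * x i) = 0"
   using degree_dependent[OF K d] by blast
  have e: "c 0 + c 1 * a + c 2 * b + c 3 * (a * b) = 0"
   using c(3) by (simp add: x_def eval_nat_numeral)
  have cK: "c 0 : K" "c 1 : K" "c 2 : K" "c 3 : K" using c(1) by auto
  have lin: "p = 0 & q = 0" if "p + q * a = 0" "p : K" "q : K" for p q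
  proof -
   have "q = 0"
   proof (rule ccontr)
    assume q: "q ~= 0"
    have "q * a = - p" using that(1) by (simp add: add_eq_0_iff)
    then have "a = - p / q" using q by (simp add: field_simps)
    then show False using that a(2) K by (simp add: subfield_divide subfield_uminus)
   qed
   then show ?thesis using that by simp
  qed
  have nz: "c 2 + c 3 * a ~= 0"
  proof
   assume z: "c 2 + c 3 * a = 0"
   then have z2: "c 2 = 0 & c 3 = 0" using lin cK by blast
   then have "c 0 = 0 & c 1 = 0" using lin[of "c 0" "c 1"] e cK by simp
   moreover have "i = 0 \<or> i = 1 \<or> i = 2 \<or> i = 3" if "i \<le> 3" for i :: nat using that by linarith
   ultimately show False using c(2) z2 by blast
  qed
  have "(c 2 + c 3 * a) * b = - (c 0 + c 1 * a)" using e by (simp add: algebra_simps add_eq_0_iff)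
  then have "b = - (c 0 + c 1 * a) / (c 2 + c 3 * a)" using nz by (simp add: eq_divide_eq mult.commute)
  moreover have "- (c 0 + c 1 * a) / (c 2 + c 3 * a) : adjoin K {a}"
   using cK KM aM by (intro subfield_divide[OF M] subfield_uminus[OF M] subfield_add[OF M] subfield_mult[OF M]) auto
  ultimately show "b : adjoin K {a}" by simp
 qed
qed

lemma galois_aut_comp:
 assumes "galois_aut L ta" "galois_aut L \<sigma>" shows "galois_aut L (ta \<circ> \<sigma>)"
 using iso_comp assms by blast

context twist
begin

lemma s_notin_K: "s \<notin> K"
proof
 assume "s : K"
 then have "- s : K" by (rule subfield_uminus[OF K])
 moreover have "- s + 1 * s + 0 * r = 0" by simp
 ultimately have "(1::'a) = 0" using L_independent[of "- s" 1 0] subfield_0[OF K] subfield_1[OF K] by blast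
 then show False by simp
qed

lemma K_const: "a : K ==> a : kb ==> a : k"
 using K_L const by blast

lemma pair_coeffs:
 assumes "bt : K" "gm : K" "bt + gm * th : kb" "bt + gm * th' : kb"
 shows "(bt + gm * th, bt + gm * th') : C"
proof -
 have "gm = ((bt + gm * th) - (bt + gm * th')) / (th - th')" using ne by (simp add: field_simps)
 also have "\<dots> : kb" using assms th_kb by (intro subfield_divide[OF kb] subfield_diff[OF kb])
 finally have g: "gm : kb" .
 have "bt = (bt + gm * th) - gm * th" by simp
 also have "\<dots> : kb" using assms(3) g th_kb by (intro subfield_diff[OF kb] subfield_mult[OF kb])
 finally have "bt : kb" .
 then show ?thesis using g assms(1,2) K_const by (intro C_I[of bt gm]) auto
qed

lemma pair_in_C:
 assumes a: "a : kb" "a' : kb"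
  and t: "!!ta. galois_aut L ta ==> ta th = th ==> ta a = a & ta a' = a'"
   "!!ta. galois_aut L ta ==> ta th = th' ==> ta a = a' & ta a' = a"
 shows "(a, a') : C"
proof -
 have "a : K.F3" "a' : K.F3" using a K.F_F3 by auto
 then obtain bt gm where "bt : K" "gm : K" "a = bt + gm * th" "a' = bt + gm * th'"
  by (rule pair_descent[of a a']) (use t in blast)+
 then show ?thesis using pair_coeffs a by auto
qed

lemma data: "twist_data k C lam"
 unfolding twist_data_def using quad_axioms lam by blast

lemma type: "ext_type k C lam (K, L)"
 unfolding ext_type_def using data u by blast

text \<open>Two uses of \<open>descent\<close>: first for the large field, which contains the twist
  field and has the same compositum, then for the base field, which \<open>K_char\<close> places
  inside \<open>K\<close>.\<close>

lemma recognize: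
 assumes L': "is_subfield L'" "L \<subseteq> L'" "adjoin L' kb = adjoin kb {u}" "!!a. a : L' ==> a : kb ==> a : k"
  and K': "is_subfield K'" "k \<subseteq> K'" "K' \<subseteq> L'" "adjoin K' kb = adjoin kb {u ^ 3}"
 shows "(K', L') = (K, L)"
proof -
 have "L' = L"
 proof (rule descent[OF k L'(1) _ perf L'(4) L k_L L'(2)])
  show "k \<subseteq> L'" using k_L L'(2) by blast
  show "L' \<subseteq> adjoin L kb" unfolding L_kb L'(3)[symmetric] by (rule adjoin_subset)
 qed
 moreover have "K = K'"
 proof (rule descent[OF k K k_K perf K_const K'(1,2)])
  show "K' \<subseteq> K" using K_char K'(3,4) \<open>L' = L\<close> adjoin_subset[of K' kb] by blast
  show "K \<subseteq> adjoin K' kb" unfolding K'(4) by (rule K_F3)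
 qed
 ultimately show ?thesis by simp
qed

lemma u_sq: "u * u \<notin> kb"
 using transcendental_power[OF k u, of 2] by (simp add: power2_eq_square)

end

lemma ext_type_twist:
 assumes b: "base k zt" and t: "ext_type k C lam E"
 obtains th th' u where "twist k zt th th' lam u" "C = quad_pairs k th th'"
  "E = (twist_field k C lam (u ^ 3 / lam), twist_field k C lam u)"
proof -
 obtain th th' u where "quad k th th'" "C = quad_pairs k th th'" "lam : k" "lam ~= 0" "u \<notin> alg_cl k"
  "E = (twist_field k C lam (u ^ 3 / lam), twist_field k C lam u)"
  using t unfolding ext_type_def twist_data_def by blast
 moreover from this have "twist k zt th th' lam u" using b by (simp add: twist_def twist_axioms_def)
 ultimately show thesis using that by blast
qed

section \<open>Invariance and uniqueness of the type of an extension\<close>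

context base
begin

lemma ext_type_scale:
 assumes t: "ext_type k C lam E" and c: "(c, c') : C" "c ~= 0" "c' ~= 0"
 shows "ext_type k C (c * c' * lam) E"
proof -
 obtain th th' u where T: "twist k zt th th' lam u" and C: "C = quad_pairs k th th'"
  and E: "E = (twist_field k C lam (u ^ 3 / lam), twist_field k C lam u)"
  using ext_type_twist[OF base_axioms t] by blast
 interpret twist k zt th th' lam u by (rule T)
 \<comment> \<open>Replacing u by c u and lam by c c' lam multiplies w by c^2 / c', whose norm is
   again c c'. So the base field stays the same together with the large field.\<close>
 have c1: "(c ^ 2 / c', c' ^ 2 / c) : quad_pairs k th th'"
  using c(1) C_mult C_divide C_swap unfolding C power2_eq_square by (meson)
 have ckb: "c : kb" using C_alg(1) c(1) C by blast
 have 1: "twist_field k C (c * c' * lam) (c * u) = twist_field k C lam u"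
  unfolding C using c C by (intro twist_field_scale) auto
 have "c ^ 2 / c' * (c' ^ 2 / c) = c * c'" using c by (simp add: power2_eq_square)
 moreover have "(c * u) ^ 3 / (c * c' * lam) = c ^ 2 / c' * (u ^ 3 / lam)"
  using c lam by (simp add: power_mult_distrib power2_eq_square power3_eq_cube)
 ultimately have 2: "twist_field k C (c * c' * lam) ((c * u) ^ 3 / (c * c' * lam)) = twist_field k C lam (u ^ 3 / lam)"
  using twist_field_scale[OF c1, of lam "u ^ 3 / lam"] c unfolding C by simp
 have "c * c' : k" using C_norm c(1) C by blast
 then have "twist_data k C (c * c' * lam)" using c lam quad_axioms C unfolding twist_data_def
  by (auto intro: subfield_mult k)
 moreover have "c * u \<notin> kb" by (rule transcendental_scale(1)[OF k u ckb c(2)])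
 ultimately show ?thesis unfolding ext_type_def E using 1 2 by metis
qed

lemma ext_type_bi_isomorphic:
 assumes t: "ext_type k C lam E" "ext_type k C lam E'"
 shows "bi_isomorphic k E E'"
proof -
 obtain th th' u where T: "twist k zt th th' lam u" and C: "C = quad_pairs k th th'"
  and E: "E = (twist_field k C lam (u ^ 3 / lam), twist_field k C lam u)"
  using ext_type_twist[OF base_axioms t(1)] by blast
 obtain u' where u': "u' \<notin> kb" "E' = (twist_field k C lam (u' ^ 3 / lam), twist_field k C lam u')"
  using t(2) unfolding ext_type_def by blast
 interpret twist k zt th th' lam u by (rule T)
 obtain f where f: "field_iso kb (adjoin kb {u}) (adjoin kb {u'}) f" "f u = u'"
  using subst_iso[OF kb, of u u'] u u'(1) by (metis alg_cl_idem[OF k])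
 have fk: "field_iso k K.Fu (adjoin kb {u'}) f" by (rule iso_weaken[OF f(1) k_kb])
 have inF: "th : K.Fu" "th' : K.Fu" "k \<subseteq> K.Fu" using th_kb k_kb K.F_Fu by auto
 have lF: "lam : K.Fu" using lam_kb K.F_Fu by auto
 have "f (u ^ 3 / lam) = u' ^ 3 / lam"
  using iso_divide[OF f(1) K.Fu _ lF, of "u ^ 3"] iso_power[OF f(1) K.Fu K.u_in, of 3] f(2)
   field_isoD(2)[OF f(1) lam_kb] subfield_power[OF K.Fu K.u_in] by simp
 then have fK: "f ` K = twist_field k C lam (u' ^ 3 / lam)"
  using iso_twist_field[OF fk K.Fu inF lam(1) w_kbu] C by simp
 have fL: "f ` L = twist_field k C lam u'"
  using iso_twist_field[OF fk K.Fu inF lam(1) K.u_in] C f(2) by simp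
 have "field_iso k L (twist_field k C lam u') f" using iso_restrict[OF fk K.Fu L_kbu] fL by simp
 moreover have "field_iso k K (twist_field k C lam (u' ^ 3 / lam)) f"
  using iso_restrict[OF fk K.Fu, of K] K_L L_kbu fK by auto
 ultimately show ?thesis unfolding bi_isomorphic_def E u'(2) using C by auto
qed

text \<open>After extension to the algebraic closures, the image of u is a coordinate for the other
  extension. It is transcendental because the inverse isomorphism carries algebraic elements to
  algebraic elements.\<close>

lemma ext_type_transport:
 assumes t: "ext_type k C lam E" and iso: "bi_isomorphic k E E'"
 shows "ext_type k C lam E'"
proof -
 obtain th th' u where T: "twist k zt th th' lam u" and C: "C = quad_pairs k th th'"
  and E: "E = (twist_field k C lam (u ^ 3 / lam), twist_field k C lam u)"
  using ext_type_twist[OF base_axioms t] by blast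
 interpret twist k zt th th' lam u by (rule T)
 obtain K' L' f g where E': "E' = (K', L')" and f: "field_iso k L L' f" and g: "field_iso k K K' g"
  and fg: "!!a. a : K ==> f a = g a"
  using iso unfolding bi_isomorphic_def E C by (cases E') auto
 obtain h where h: "field_iso {} (alg_cl L) (alg_cl L') h" "!!a. a : L ==> h a = f a"
  using iso_extend_alg_cl[OF iso_weaken[OF f] L] by auto
 note A = subfield_alg_cl[OF L]
 have hk: "h a = a" if "a : k" for a using h(2)[of a] field_isoD(2)[OF f that] that k_L by auto
 then have hk': "field_iso k (alg_cl L) (alg_cl L') h" using h(1) unfolding field_iso_def by auto
 have "h u \<notin> kb"
 proof
  assume a: "h u : kb"
  have inv: "field_iso k (alg_cl L') (alg_cl L) (inv_into (alg_cl L) h)" by (rule iso_inv[OF hk' A in_alg(5)])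
  have hu: "h u : alg_cl L'" using iso_in[OF hk' A in_alg(1)] .
  have "k \<subseteq> alg_cl L'"
  proof
   fix a assume "a : k"
   then show "a : alg_cl L'" using iso_in[OF hk' A subsetD[OF in_alg(5)], of a] hk[of a] by simp
  qed
  then have "inv_into (alg_cl L) h (h u) : alg_cl (inv_into (alg_cl L) h ` k)"
   using iso_alg_cl[OF iso_weaken[OF inv] iso_subfield[OF hk' A] k _ hu a] by auto
  moreover have "inv_into (alg_cl L) h ` k = k" using field_isoD(2)[OF inv] by force
  moreover have "inv_into (alg_cl L) h (h u) = u" by (rule inv_into_f_f[OF field_isoD(5)[OF h(1)] in_alg(1)])
  ultimately show False using u by simp
 qed
 moreover have "L' = twist_field k C lam (h u)"
 proof -
  have "L' = h ` L" using field_isoD(6)[OF f] h(2) by (metis image_cong)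
  then show ?thesis using iso_twist_field[OF hk' A in_alg(2,3,5) lam(1) in_alg(1)] C by simp
 qed
 moreover have "K' = twist_field k C lam (h u ^ 3 / lam)"
 proof -
  have "K' = g ` K" using field_isoD(6)[OF g] by simp
  also have "\<dots> = h ` K" using K_L h(2) fg by (intro image_cong) auto
  also have "\<dots> = twist_field k (quad_pairs k th th') lam (h w)"
   using w_kbu kbu_alg by (intro iso_twist_field[OF hk' A in_alg(2,3,5) lam(1)]) blast
  also have "h w = h u ^ 3 / lam"
   using iso_divide[OF hk' A subfield_power[OF A in_alg(1)] in_alg(4)] iso_power[OF hk' A in_alg(1), of 3] hk[OF lam(1)] by simp
  finally show ?thesis using C by simp
 qed
 ultimately show ?thesis using t unfolding ext_type_def E' by blast
qed

text \<open>Two coordinates of one extension are related by v = c u or v = c / u. If an automorphism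
  fixed one and inverted the other, u^2 would be algebraic; so both algebras are conjugated by the
  same automorphisms, and the constant relating the coordinates has norm lam' / lam.\<close>

lemma ext_type_unique:
 assumes t: "ext_type k C lam E" "ext_type k C' lam' E"
 shows "C' = C & (\<exists>(c, c')\<in>C. c ~= 0 & c' ~= 0 & lam' = c * c' * lam)"
proof -
 have key: "C' \<subseteq> C & (\<exists>(c, c')\<in>C. c ~= 0 & c' ~= 0 & lam' = c * c' * lam)"
  if t: "ext_type k C lam E" "ext_type k C' lam' E" for C C' lam lam'
 proof -
  obtain th th' u where T: "twist k zt th th' lam u" and C: "C = quad_pairs k th th'"
   and E: "E = (twist_field k C lam (u ^ 3 / lam), twist_field k C lam u)"
   using ext_type_twist[OF base_axioms t(1)] by blast
  obtain \<eta> \<eta>' v where T': "twist k zt \<eta> \<eta>' lam' v" and C': "C' = quad_pairs k \<eta> \<eta>'"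
   and E': "E = (twist_field k C' lam' (v ^ 3 / lam'), twist_field k C' lam' v)"
   using ext_type_twist[OF base_axioms t(2)] by blast
  interpret X: twist k zt th th' lam u by (rule T)
  interpret Y: twist k zt \<eta> \<eta>' lam' v by (rule T')
  have L: "Y.L = X.L" "Y.K = X.K" using E E' C C' by auto
  have kbv: "adjoin kb {v} = adjoin kb {u}" "adjoin kb {v ^ 3} = adjoin kb {u ^ 3}"
   using X.L_kb Y.L_kb X.K_kb Y.K_kb L by auto
  have "v : adjoin kb {u}" "u : adjoin kb {v}" "v ^ 3 : adjoin kb {u ^ 3}"
   using kbv Y.K.u_in X.K.u_in Y.K.u3_in by auto
  then obtain c where c: "c : kb" "c ~= 0" "v = c * u \<or> v = c / u" using X.K.cubic_coordinate by blast
  have tau: "(ta th = th & ta th' = th' & ta u = u & ta v = v & ta \<eta> = \<eta> & ta \<eta>' = \<eta>') \<or>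
   (ta th = th' & ta th' = th & ta u = lam / u & ta v = lam' / v & ta \<eta> = \<eta>' & ta \<eta>' = \<eta>)"
   if t: "galois_aut X.L ta" for ta
  proof -
   have tY: "galois_aut Y.L ta" using t L by simp
   note A = subfield_alg_cl[OF X.L]
   have tc: "ta c : kb" using galois_aut_alg_cl[OF X.L k X.k_L t] c(1) by blast
   have cA: "c : alg_cl X.L" using alg_cl_mono[OF X.k_L] c(1) by blast
   have tv: "ta v = ta c * ta u \<or> ta v = ta c / ta u"
    using c(3) by (auto simp: field_isoD(4)[OF t cA X.in_alg(1)] iso_divide[OF t A cA X.in_alg(1)])
   have nn: "d * u ~= e / u" if "d : kb" "e : kb" "d ~= 0" for d e
   proof
    assume "d * u = e / u"
    then have "u * u = e / d" using that(3) X.u_nz by (simp add: field_simps)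
    then show False using X.u_sq that subfield_divide[OF kb] by metis
   qed
   have tc0: "ta c ~= 0" using iso_eq_0_iff[OF t A cA] c(2) by simp
   have ll: "lam / c : kb" "lam' / c : kb" "lam * ta c : kb" "lam' / c ~= 0" "ta c / lam : kb" "ta c / lam ~= 0" "c / lam : kb"
    using X.lam_kb Y.lam_kb c tc kb tc0 X.lam Y.lam by (auto intro: subfield_divide subfield_mult)
   show ?thesis
   proof (rule X.galois_aut_cases[OF t])
    assume x: "ta th = th" "ta th' = th'" "ta u = u"
    have "ta v ~= lam' / v"
    proof
     assume e: "ta v = lam' / v"
     from c(3) show False
     proof
      assume v: "v = c * u"
      then have "ta v = ta c * u" using field_isoD(4)[OF t cA X.in_alg(1)] x by simp
      then have "ta c * u = (lam' / c) / u" using e v by simp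
      then show False using nn[OF tc ll(2) tc0] by simp
     next
      assume v: "v = c / u"
      then have "ta v = ta c / u" using iso_divide[OF t A cA X.in_alg(1)] x by simp
      then have "(lam' / c) * u = ta c / u" using e v by simp
      then show False using nn[OF ll(2) tc ll(4)] by simp
     qed
    qed
    then show ?thesis using Y.galois_aut_cases[OF tY] x by metis
   next
    assume x: "ta th = th'" "ta th' = th" "ta u = lam / u"
    have "ta v ~= v"
    proof
     assume e: "ta v = v"
     from c(3) show False
     proof
      assume v: "v = c * u"
      then have "ta v = ta c * (lam / u)" using field_isoD(4)[OF t cA X.in_alg(1)] x by simp
      then have "c * u = (lam * ta c) / u" using e v by (simp add: mult.commute)
      then show False using nn[OF c(1) ll(3) c(2)] by simp
     next
      assume v: "v = c / u"
      then have "ta v = ta c / (lam / u)" using iso_divide[OF t A cA X.in_alg(1)] x by simp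
      then have "(ta c / lam) * u = c / u" using e v by simp
      then show False using nn[OF ll(5) c(1) ll(6)] by simp
     qed
    qed
    then show ?thesis using Y.galois_aut_cases[OF tY] x by metis
   qed
  qed
  have ee: "(\<eta>, \<eta>') : X.C" using tau X.ne by (intro X.pair_in_C Y.th_kb) metis+
  have "C' \<subseteq> C"
  proof
   fix p assume p: "p : C'"
   then obtain al bt where "al : k" "bt : k" "p = (al + bt * \<eta>, al + bt * \<eta>')" unfolding C' quad_pairs_def by blast
   then show "p : C" unfolding C using X.C_add[OF X.C_const X.C_scale[OF _ ee]] by blast
  qed
  moreover have "\<exists>(c, c')\<in>C. c ~= 0 & c' ~= 0 & lam' = c * c' * lam"
  proof -
   note A = subfield_alg_cl[OF X.L]
   have vA: "v : alg_cl X.L" "lam' : alg_cl X.L" using Y.in_alg L by auto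
   have tl: "ta lam = lam" "ta lam' = lam'" if "galois_aut X.L ta" for ta
    using field_isoD(2)[OF that] X.k_L X.lam Y.lam by blast+
   \<comment> \<open>The quotient of v by u or by lam / u, whichever is constant. An inverting
     automorphism sends it to lam' / (d lam), which dictates the conjugate
     \<open>d'\<close>.\<close>
   define d where "d = (if v = c * u then v / u else v * u / lam)"
   have dc: "d = (if v = c * u then c else c / lam)" unfolding d_def using c(3) X.u_nz by auto
   define d' where "d' = lam' / (d * lam)"
   have dk: "d : kb" "d ~= 0" unfolding dc using c X.lam_kb X.lam subfield_divide[OF kb] by auto
   have d'k: "d' : kb" "d' ~= 0" unfolding d'_def using dk X.lam_kb Y.lam_kb X.lam Y.lam
    by (auto intro!: subfield_divide kb subfield_mult)
   have dA: "d : alg_cl X.L" using dk alg_cl_mono[OF X.k_L] by blast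
   have lamd: "lam' = d * d' * lam" using dk X.lam by (simp add: d'_def)
   have td: "ta d = (if v = c * u then ta v / ta u else ta v * ta u / lam)" if t: "galois_aut X.L ta" for ta
   proof (cases "v = c * u")
    case True
    show ?thesis unfolding d_def if_P[OF True] by (rule iso_divide[OF t A vA(1) X.in_alg(1)])
   next
    case False
    have "ta (v * u / lam) = ta (v * u) / ta lam"
     by (rule iso_divide[OF t A subfield_mult[OF A vA(1) X.in_alg(1)] X.in_alg(4)])
    then show ?thesis unfolding d_def if_not_P[OF False] field_isoD(4)[OF t vA(1) X.in_alg(1)] tl(1)[OF t] .
   qed
   have td': "ta d' = lam' / (ta d * lam)" if t: "galois_aut X.L ta" for ta
    unfolding d'_def using vA X.in_alg tl[OF t] dA
    by (simp add: iso_divide[OF t A] field_isoD(4)[OF t] subfield_mult[OF A])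
   have "(d, d') : X.C"
   proof (rule X.pair_in_C[OF dk(1) d'k(1)])
    fix ta assume t: "galois_aut X.L ta"
    show "ta d = d & ta d' = d'" if "ta th = th"
    proof -
     have uv: "ta u = u" "ta v = v" using tau[OF t] that X.ne by auto
     have "ta d = d" unfolding td[OF t] uv unfolding d_def by (rule refl)
     then show ?thesis using td'[OF t] d'_def by simp
    qed
    show "ta d = d' & ta d' = d" if "ta th = th'"
    proof -
     have e: "ta u = lam / u" "ta v = lam' / v" using tau[OF t] that X.ne by auto
     have "ta d = d'"
     proof (cases "v = c * u")
      case True
      have d: "d = c" unfolding dc if_P[OF True] by (rule refl)
      have "ta d = (lam' / v) / (lam / u)" unfolding td[OF t] if_P[OF True] e by (rule refl)
      also have "\<dots> = lam' / (c * lam)" unfolding True using X.u_nz c by simp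
      finally show ?thesis unfolding d'_def d .
     next
      case False
      then have v: "v = c / u" using c(3) by blast
      have d: "d = c / lam" unfolding dc if_not_P[OF False] by (rule refl)
      have "ta d = (lam' / v) * (lam / u) / lam" unfolding td[OF t] if_not_P[OF False] e by (rule refl)
      also have "\<dots> = lam' / c" unfolding v using X.u_nz c X.lam by simp
      also have "\<dots> = lam' / (c / lam * lam)" using X.lam by simp
      finally show ?thesis unfolding d'_def d .
     qed
     moreover have "lam' / (d' * lam) = d" using lamd d'k X.lam by simp
     ultimately show ?thesis using td'[OF t] by simp
    qed
   qed
   then show ?thesis using lamd dk d'k unfolding C by blast
  qed
  ultimately show ?thesis by blast
 qed
 show ?thesis using key[OF t] key[OF t(2,1)] by blast
qed

end

section \<open>From a bi-twist to its type\<close>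

context base
begin

lemma expansion:
 assumes L: "is_subfield L" "k \<subseteq> L" and z: "z : adjoin L kb"
 shows "\<exists>B c. finite B & B \<subseteq> L & (\<forall>b\<in>B. c b : kb) & z = (\<Sum>b\<in>B. c b * b) &
  (\<forall>ta d. galois_aut L ta --> d : kb --> ta z = d * z --> (\<forall>b\<in>B. ta (c b) = d * c b))"
proof (rule independent_expansion[OF k L perf L order_refl z])
 fix B c
 assume B: "finite B" "B \<subseteq> L" "\<forall>b\<in>B. c b : kb" "z = (\<Sum>b\<in>B. c b * b)"
  and g: "!!ta d. galois_aut L ta ==> d : kb ==> ta z = d * z ==> \<forall>b\<in>B. ta (c b) = d * c b"
 show ?thesis by (intro exI[of _ B] exI[of _ c] conjI allI impI B g)
qed

text \<open>Pull y back to u, so that the two composita are kb(u) and kb(u^3). The automorphisms act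
  by scalings and inversions of u; normalizing away the scalings exposes the algebra and the
  parameter, and \<open>recognize\<close> identifies the extension.\<close>

lemma bitwist_ext_type:
 assumes y: "y \<notin> kb" "y ^ 3 = x"
  and E: "E : bitwists k (adjoin k {x}, adjoin (adjoin k {x}) {y})"
 shows "\<exists>C lam. ext_type k C lam E"
proof -
 obtain K L where EKL: "E = (K, L)" by (cases E)
 have cub: "cubic_extension k K L"
  and bi: "bi_isomorphic kb (base_change k (K, L)) (base_change k (adjoin k {x}, adjoin (adjoin k {x}) {y}))"
  using E unfolding bitwists_def EKL by auto
 have KL: "is_subfield K" "k \<subseteq> K" "is_subfield L" "K \<subseteq> L" "has_degree K L 3"
  "!!a. a : K ==> a : kb ==> a : k"
  using cub unfolding cubic_extension_def function_field_def alg_cl_def by auto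
 have kL: "k \<subseteq> L" using KL by blast
 have e: "adjoin (adjoin k S) kb = adjoin kb S" for S
 proof -
  have "k \<subseteq> adjoin kb S" using k_kb adjoin_subset[of kb S] by blast
  then show ?thesis unfolding adjoin_adjoin using adjoin_subset[of kb S] adjoin_gen[of S kb] adjoin_gen[of "S \<union> kb" k]
   by (intro subset_antisym adjoin_least subfield_adjoin) auto
 qed
 define KB LB where "KB = adjoin K kb" and "LB = adjoin L kb"
 have LB: "is_subfield LB" "kb \<subseteq> LB" "L \<subseteq> LB" "KB \<subseteq> LB"
  unfolding KB_def LB_def
  by (rule subfield_adjoin, rule adjoin_gen, rule adjoin_subset, rule adjoin_mono[OF KL(4) adjoin_gen])
 have "base_change k (K, L) = (KB, LB)" by (simp add: base_change_def KB_def LB_def)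
 moreover have "adjoin (adjoin (adjoin k {x}) {y}) kb = adjoin kb {x, y}"
  unfolding adjoin_adjoin[of k "{x}" "{y}"] e by (simp add: insert_commute)
 then have "base_change k (adjoin k {x}, adjoin (adjoin k {x}) {y}) = (adjoin kb {x}, adjoin kb {x, y})"
  by (simp add: base_change_def e)
 ultimately have "bi_isomorphic kb (KB, LB) (adjoin kb {x}, adjoin kb {x, y})" using bi by simp
 then obtain f g where f: "field_iso kb LB (adjoin kb {x, y}) f" and g: "field_iso kb KB (adjoin kb {x}) g"
  and fg: "!!a. a : KB ==> f a = g a"
  unfolding bi_isomorphic_def prod.case by blast
 have xy: "adjoin kb {x, y} = adjoin kb {y}"
  using adjoin_gen[of "{y}" kb] subfield_power[OF subfield_adjoin[of kb "{y}"], of y 3] y(2) adjoin_gen[of "{x, y}" kb]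
  by (intro subset_antisym adjoin_mono) auto
 have "y : f ` LB" using field_isoD(6)[OF f] xy adjoin_gen[of "{y}" kb] by auto
 then obtain u where u: "u : LB" "f u = y" by auto
 have f3: "f (u ^ 3) = x" using iso_power[OF f LB(1) u(1)] u(2) y(2) by simp
 have fkb: "f ` kb = kb" using field_isoD(2)[OF f] by force
 have "f ` adjoin kb {u} = adjoin kb {y}" using iso_adjoin[OF f LB(1,2), of "{u}"] u fkb by simp
 then have "f ` adjoin kb {u} = f ` LB" using field_isoD(6)[OF f] xy by simp
 moreover have "adjoin kb {u} \<subseteq> LB" using LB u by (intro adjoin_least) auto
 ultimately have LBu: "LB = adjoin kb {u}" using field_isoD(5)[OF f] by (metis inj_on_image_eq_iff order_refl)
 have u3: "u ^ 3 : LB" using LB(1) u(1) by (rule subfield_power)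
 have "f ` adjoin kb {u ^ 3} = adjoin kb {x}" using iso_adjoin[OF f LB(1,2), of "{u ^ 3}"] u3 f3 fkb by simp
 moreover have "f ` KB = adjoin kb {x}" using field_isoD(6)[OF g] fg by (metis image_cong)
 moreover have "adjoin kb {u ^ 3} \<subseteq> LB" using LB u3 by (intro adjoin_least) auto
 ultimately have KBu: "KB = adjoin kb {u ^ 3}" using field_isoD(5)[OF f] LB(4) by (metis inj_on_image_eq_iff)
 have ukb: "u \<notin> kb"
 proof
  assume "u : kb"
  then have "f u = u" using field_isoD(2)[OF f] by blast
  then show False using u(2) y(1) \<open>u : kb\<close> by simp
 qed
 interpret U: kummer kb u zt by (rule kummer[OF ukb])
 have uK: "u \<notin> KB"
 proof
  assume "u : KB"
  then have "U.rot u = u" using U.rot_fixed KBu by blast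
  then show False using U.rot(2) U.u_nz z1 by simp
 qed
 \<comment> \<open>Exactness of constants is given only for \<open>K\<close>. A constant of
   \<open>L\<close> outside \<open>K\<close> would generate \<open>L\<close> over \<open>K\<close>
   and make the two composita equal, although u is outside \<open>KB\<close>.\<close>
 have const: "a : k" if a: "a : L" "a : kb" for a
 proof (cases "a : K")
  case True then show ?thesis using KL(6) a by blast
 next
  case False
  then have "L = adjoin K {a}" using cubic_no_intermediate[OF KL(1,5,3,4)] a by blast
  moreover have "{a} \<subseteq> adjoin K kb" using a(2) adjoin_gen[of kb K] by blast
  ultimately have "L \<subseteq> KB" unfolding KB_def using adjoin_mono[OF order_refl] by blast
  moreover have "kb \<subseteq> KB" unfolding KB_def by (rule adjoin_gen)
  ultimately have "LB \<subseteq> KB" unfolding LB_def KB_def by (intro adjoin_least subfield_adjoin) auto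
  then show ?thesis using uK u(1) by blast
 qed
 note A = subfield_alg_cl[OF KL(3)]
 have LBA: "LB \<subseteq> alg_cl L" unfolding LB_def by (intro compositum_in_alg_cl KL kL alg_cl_subset)
 have kbA: "kb \<subseteq> alg_cl L" using LB(2) LBA by blast
 have taukb: "ta c : kb" if "galois_aut L ta" "c : kb" for ta c
  using galois_aut_alg_cl[OF KL(3) k kL that(1)] that(2) by blast
 have tauinj: "ta c ~= 0" if "galois_aut L ta" "c : kb" "c ~= 0" for ta c
  using iso_eq_0_iff[OF that(1) A] that(2,3) kbA by blast
 have tau: "\<exists>c\<in>kb. c ~= 0 & (ta u = c * u \<or> ta u = c / u)" if t: "galois_aut L ta" for ta
 proof (rule U.cubic_coordinate)
  have im: "ta ` LB = LB" "ta ` KB = KB"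
   unfolding LB_def KB_def using galois_aut_compositum[OF KL(3) k kL _ t] KL(4) by auto
  show "ta u : adjoin kb {u}" using im(1) u(1) LBu by auto
  have "u ^ 3 : KB" unfolding KBu using U.u3_in .
  then have "ta (u ^ 3) : KB" using im(2) by blast
  then show "ta u ^ 3 : adjoin kb {u ^ 3}" using iso_power[OF t A, of u 3] u(1) LBA KBu by auto
  have "ta ` adjoin kb {u} = adjoin kb {ta u}"
   using iso_adjoin[OF t A kbA, of "{u}"] u(1) LBA galois_aut_alg_cl[OF KL(3) k kL t] by auto
  then show "u : adjoin kb {ta u}" using im(1) LBu u(1) by auto
 qed
 obtain B c where B: "finite B" "B \<subseteq> L" "\<forall>b\<in>B. c b : kb" "u = (\<Sum>b\<in>B. c b * b)"
  and B_all: "\<forall>ta d. galois_aut L ta --> d : kb --> ta u = d * u --> (\<forall>b\<in>B. ta (c b) = d * c b)"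
  using expansion[OF KL(3) kL u(1)[unfolded LB_def]] by (elim exE conjE) (rule that)
 have B5: "\<forall>b\<in>B. ta (c b) = d * c b" if "galois_aut L ta" "d : kb" "ta u = d * u" for ta d
  by (rule ballI) (rule B_all[rule_format, OF that])
 have "\<exists>b\<in>B. c b ~= 0"
 proof (rule ccontr)
  assume "\<not> (\<exists>b\<in>B. c b ~= 0)"
  then have "(\<Sum>b\<in>B. c b * b) = 0" by (intro sum.neutral) auto
  then show False using B(4) U.u_nz by simp
 qed
 then obtain b0 where b0: "b0 : B" "c b0 ~= 0" by blast
 \<comment> \<open>Hilbert 90 made explicit: an automorphism with ta u = a u multiplies the nonzero
   coordinate \<open>c b0\<close> of u by the same a. Dividing by it turns all scalings into
   automorphisms fixing v and leaves inversions as inversions.\<close>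
 define v where "v = u / c b0"
 have cb0: "c b0 : kb" "c b0 : alg_cl L" using B(3) b0 kbA by auto
 have vkb: "v \<notin> kb" unfolding v_def by (rule transcendental_scale(3)[OF k ukb cb0(1) b0(2)])
 have v0: "v ~= 0" using vkb kb subfield_0 by blast
 have LBv: "LB = adjoin kb {v}" unfolding v_def LBu by (rule adjoin_scale(3)[OF kb cb0(1) b0(2), symmetric])
 have KBv: "KB = adjoin kb {v ^ 3}" unfolding v_def KBu power_divide
  by (rule adjoin_scale(3)[OF kb subfield_power[OF kb cb0(1)], symmetric]) (use b0 in simp)
 have vLB: "v : LB" unfolding LBv using adjoin_gen by blast
 have vA: "v : alg_cl L" using vLB LBA by blast
 have vsq: "v * v \<notin> kb" using transcendental_power[OF k vkb, of 2] by (simp add: power2_eq_square)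
 have tv: "ta v = v \<or> (\<exists>e\<in>kb. e ~= 0 & ta v = e / v)" if t: "galois_aut L ta" for ta
 proof -
  have d: "ta v = ta u / ta (c b0)" unfolding v_def using iso_divide[OF t A _ cb0(2)] u(1) LBA by blast
  obtain a where a: "a : kb" "a ~= 0" "ta u = a * u \<or> ta u = a / u" using tau[OF t] by blast
  from a(3) show ?thesis
  proof
   assume au: "ta u = a * u"
   then have "ta (c b0) = a * c b0" using B5[OF t a(1)] b0 by blast
   then show ?thesis using d au a(2) b0(2) by (simp add: v_def)
  next
   assume au: "ta u = a / u"
   have "ta v = (a / u) / ta (c b0)" unfolding d au by (rule refl)
   also have "\<dots> = (a / (ta (c b0) * c b0)) / v"
    unfolding v_def using b0(2) U.u_nz by simp
   finally have "ta v = (a / (ta (c b0) * c b0)) / v" .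
   moreover have "a / (ta (c b0) * c b0) : kb"
    using a(1) taukb[OF t cb0(1)] cb0(1) by (intro subfield_divide[OF kb] subfield_mult[OF kb])
   moreover have "a / (ta (c b0) * c b0) ~= 0" using a(2) tauinj[OF t cb0(1) b0(2)] b0(2) by simp
   ultimately show ?thesis by blast
  qed
 qed
 have vne: "v ~= e / v" if "e : kb" for e
 proof
  assume "v = e / v"
  then have "v * v = e" using v0 by (metis nonzero_eq_divide_eq)
  then show False using vsq that by simp
 qed
 have finish: "\<exists>C lam. ext_type k C lam E" if T: "twist k zt th th' lam v"
  and fx: "!!ta a a'. galois_aut L ta ==> (a, a') : quad_pairs k th th' ==>
   ta (a * v + a' * lam / v) = a * v + a' * lam / v" for th th' lam
 proof -
  interpret V: twist k zt th th' lam v by (rule T)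
  have "V.L \<subseteq> L"
  proof (rule V.L_least[OF KL(3) kL])
   fix a a' assume a: "(a, a') : V.C"
   show "a * v + a' * lam / v : L"
   proof (rule compositum_fixed[OF k KL(3) kL perf])
    show "a * v + a' * lam / v : adjoin L kb"
     using V.L_gen[OF a] V.L_kbu LBv unfolding LB_def by blast
   qed (rule fx[OF _ a])
  qed
  moreover have "adjoin L kb = adjoin kb {v}" "adjoin K kb = adjoin kb {v ^ 3}"
   using LBv KBv unfolding LB_def KB_def by simp_all
  ultimately have "(K, L) = (V.K, V.L)" using V.recognize[OF KL(3) _ _ const KL(1,2,4)] by blast
  then show ?thesis using V.type EKL by auto
 qed
 show ?thesis
 proof (cases "\<forall>ta. galois_aut L ta --> ta v = v")
  case True
  \<comment> \<open>Without inversions the algebra is split, generated by the pair (1, 0), and v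
    itself lies in \<open>L\<close>.\<close>
  have q: "quad k 1 0" using k by unfold_locales (auto intro: subfield_0 subfield_1)
  have T: "twist k zt 1 0 1 v"
   by (intro twist.intro base_axioms q) (use vkb k in \<open>unfold_locales, auto intro: subfield_1\<close>)
  have vL: "v : L" using compositum_fixed[OF k KL(3) kL perf, of v] True vLB unfolding LB_def by blast
  show ?thesis
  proof (rule finish[OF T])
   fix ta a a' assume t: "galois_aut L ta" and a: "(a, a') : quad_pairs k 1 0"
   have "a : k" "a' : k" using a k unfolding quad_pairs_def by (auto intro: subfield_add)
   then have "a * v + a' * 1 / v : L" using vL kL KL(3) by (auto intro!: subfield_add subfield_mult subfield_divide)
   then show "ta (a * v + a' * 1 / v) = a * v + a' * 1 / v" using field_isoD(2)[OF t] by blast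
  qed
 next
  case False
  then obtain ta0 where t0: "galois_aut L ta0" "ta0 v ~= v" by blast
  obtain lam where lam: "lam : kb" "lam ~= 0" "ta0 v = lam / v" using tv[OF t0(1)] t0(2) by blast
  have lA: "lam : alg_cl L" using lam kbA by blast
  \<comment> \<open>Compare an automorphism with the fixed inversion \<open>ta0\<close>: composing
    with the inverse of \<open>ta0\<close> must not turn v into another inversion, since v^2 would
    become algebraic.\<close>
  have two: "ta v = v \<or> ta v = lam / v" if t: "galois_aut L ta" for ta
  proof (rule ccontr)
   assume n: "\<not> ?thesis"
   obtain e where e: "e : kb" "e ~= 0" "ta v = e / v" using tv[OF t] n by blast
   have eA: "e : alg_cl L" using e kbA by blast
   let ?r = "inv_into (alg_cl L) ta0 \<circ> ta"
   have r: "galois_aut L ?r" using galois_aut_comp[OF galois_aut_inv[OF KL(3) t0(1)] t] .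
   have tr: "ta0 (?r a) = ta a" if "a : alg_cl L" for a
    using field_isoD(6)[OF t0(1)] iso_in[OF t A that] by (simp add: f_inv_into_f)
   from tv[OF r] show False
   proof
    assume "?r v = v"
    then have "ta v = ta0 v" using tr[OF vA] by simp
    then show False using n lam by simp
   next
    assume "\<exists>e\<in>kb. e ~= 0 & ?r v = e / v"
    then obtain e' where e': "e' : kb" "e' ~= 0" "?r v = e' / v" by blast
    then have "ta v = ta0 (e' / v)" using tr[OF vA] by metis
    also have "\<dots> = ta0 e' / (lam / v)" using iso_divide[OF t0(1) A _ vA] e'(1) kbA lam(3) by auto
    finally have "e / v = ta0 e' / (lam / v)" using e(3) by simp
    then have "v * v = e * lam / ta0 e'"
     using v0 lam(2) tauinj[OF t0(1) e'(1,2)] by (simp add: field_simps)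
    then show False using vsq e(1) lam(1) taukb[OF t0(1) e'(1)] kb by (metis subfield_divide subfield_mult)
   qed
  qed
  have comp0: "(ta \<circ> ta0) v = ta lam / ta v" if t: "galois_aut L ta" for ta
   using iso_divide[OF t A lA vA] lam(3) by simp
  \<comment> \<open>The composite with \<open>ta0\<close> again satisfies \<open>two\<close>. Its
    value at v is ta lam / ta v, and in either case for ta v the only admissible possibility forces
    ta lam = lam.\<close>
  have lamfix: "ta lam = lam" if t: "galois_aut L ta" for ta
  proof -
   have c: "ta lam / ta v = v \<or> ta lam / ta v = lam / v"
    using two[OF galois_aut_comp[OF t t0(1)]] comp0[OF t] by simp
   from two[OF t] show ?thesis
   proof
    assume v: "ta v = v"
    then have "ta lam / v = lam / v" using c vne[OF taukb[OF t lam(1)]] by metis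
    then show ?thesis using v0 by simp
   next
    assume v: "ta v = lam / v"
    have e: "ta lam / ta v = (ta lam / lam) * v" using v v0 lam(2) by simp
    have "ta lam / ta v ~= lam / v"
    proof
     assume "ta lam / ta v = lam / v"
     then have "v = (lam * lam / ta lam) / v"
      using e v0 lam(2) tauinj[OF t lam(1,2)] by (simp add: field_simps)
     moreover have "lam * lam / ta lam : kb"
      using lam(1) taukb[OF t lam(1)] by (intro subfield_divide[OF kb] subfield_mult[OF kb])
     ultimately show False using vne by blast
    qed
    then have "(ta lam / lam) * v = v" using c e by simp
    then show ?thesis using v0 lam(2) by (simp add: field_simps)
   qed
  qed
  have "lam : L" by (rule constants_fixed[OF k KL(3) kL perf lam(1)]) (rule lamfix)
  then have lamk: "lam : k" using const lam(1) by blast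
  obtain D d where D: "finite D" "D \<subseteq> L" "\<forall>b\<in>D. d b : kb" "v = (\<Sum>b\<in>D. d b * b)"
   and D_all: "\<forall>ta e. galois_aut L ta --> e : kb --> ta v = e * v --> (\<forall>b\<in>D. ta (d b) = e * d b)"
   using expansion[OF KL(3) kL vLB[unfolded LB_def]] by (elim exE conjE) (rule that)
  have D5: "\<forall>b\<in>D. ta (d b) = e * d b" if "galois_aut L ta" "e : kb" "ta v = e * v" for ta e
   by (rule ballI) (rule D_all[rule_format, OF that])
  have dfix: "ta (d b) = d b" if "galois_aut L ta" "ta v = v" "b : D" for ta b
   using D5[OF that(1), of 1] that subfield_1[OF kb] by simp
  have dA: "d b : alg_cl L" "b : alg_cl L" if "b : D" for b
   using D(2,3) that kbA alg_cl_subset[OF KL(3)] by blast+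
  obtain b1 where b1: "b1 : D" "ta0 (d b1) ~= d b1"
  proof -
   have "\<exists>b\<in>D. ta0 (d b) ~= d b"
   proof (rule ccontr)
    assume n: "\<not> ?thesis"
    have "ta0 v = (\<Sum>b\<in>D. ta0 (d b * b))" unfolding D(4)
     using dA by (intro iso_sum[OF t0(1) A] subfield_mult[OF A]) auto
    also have "\<dots> = (\<Sum>b\<in>D. d b * b)"
    proof (rule sum.cong[OF refl])
     fix b assume b: "b : D"
     have "ta0 b = b" using field_isoD(2)[OF t0(1)] D(2) b by blast
     then show "ta0 (d b * b) = d b * b" using field_isoD(4)[OF t0(1) dA[OF b]] n b by simp
    qed
    finally show False using t0(2) D(4) by simp
   qed
   then show thesis using that by blast
  qed
  \<comment> \<open>A coordinate of v moved by \<open>ta0\<close> but fixed by every automorphism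
    fixing v. It therefore has exactly two conjugates, exchanged by the inversions, and generates
    the algebra.\<close>
  define th th' where "th = d b1" and "th' = ta0 th"
  have thkb: "th : kb" "th' : kb" using D(3) b1 taukb[OF t0(1)] by (auto simp: th_def th'_def)
  have thA: "th : alg_cl L" "th' : alg_cl L" using thkb kbA by auto
  have ne: "th ~= th'" using b1 by (auto simp: th_def th'_def)
  have fix1: "ta th = th" if "galois_aut L ta" "ta v = v" for ta using dfix[OF that b1(1)] by (simp add: th_def)
  have swap1: "ta th = th'" if t: "galois_aut L ta" "ta v = lam / v" for ta
  proof -
   let ?r = "inv_into (alg_cl L) ta0 \<circ> ta"
   have r: "galois_aut L ?r" using galois_aut_comp[OF galois_aut_inv[OF KL(3) t0(1)] t(1)] .
   have tr: "ta0 (?r a) = ta a" if "a : alg_cl L" for a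
    using field_isoD(6)[OF t0(1)] iso_in[OF t(1) A that] by (simp add: f_inv_into_f)
   have "?r v = inv_into (alg_cl L) ta0 (ta0 v)" using t(2) lam(3) by simp
   also have "\<dots> = v" by (rule inv_into_f_f[OF field_isoD(5)[OF t0(1)] vA])
   finally have "?r th = th" using fix1[OF r] by blast
   then show ?thesis using tr[OF thA(1)] by (simp add: th'_def)
  qed
  have fix2: "ta th' = th'" if t: "galois_aut L ta" "ta v = v" for ta
  proof -
   have "(ta \<circ> ta0) v = lam / v" using comp0[OF t(1)] lamfix[OF t(1)] t(2) by simp
   then have "(ta \<circ> ta0) th = th'" by (rule swap1[OF galois_aut_comp[OF t(1) t0(1)]])
   then show ?thesis by (simp add: th'_def)
  qed
  have swap2: "ta th' = th" if t: "galois_aut L ta" "ta v = lam / v" for ta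
  proof -
   have "(ta \<circ> ta0) v = v" using comp0[OF t(1)] lamfix[OF t(1)] t(2) lam(2) v0 by simp
   then have "(ta \<circ> ta0) th = th" by (rule fix1[OF galois_aut_comp[OF t(1) t0(1)]])
   then show ?thesis by (simp add: th'_def)
  qed
  have cases: "(ta v = v & ta th = th & ta th' = th') \<or> (ta v = lam / v & ta th = th' & ta th' = th)"
   if t: "galois_aut L ta" for ta
   using two[OF t] fix1[OF t] fix2[OF t] swap1[OF t] swap2[OF t] by blast
  have k_of: "a : k" if "a : kb" "!!ta. galois_aut L ta ==> ta a = a" for a
   by (rule const[OF constants_fixed[OF k KL(3) kL perf that(1)] that(1)]) (rule that(2))
  have tr: "th + th' : k"
  proof (rule k_of)
   show "th + th' : kb" using thkb by (intro subfield_add kb)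
   show "ta (th + th') = th + th'" if t: "galois_aut L ta" for ta
    using cases[OF t] field_isoD(3)[OF t thA] by (auto simp: add.commute)
  qed
  have nm: "th * th' : k"
  proof (rule k_of)
   show "th * th' : kb" using thkb by (intro subfield_mult kb)
   show "ta (th * th') = th * th'" if t: "galois_aut L ta" for ta
    using cases[OF t] field_isoD(4)[OF t thA] by (auto simp: mult.commute)
  qed
  have q: "quad k th th'" using k ne tr nm by unfold_locales
  have T: "twist k zt th th' lam v"
   by (intro twist.intro base_axioms q) (use vkb lamk lam(2) in \<open>unfold_locales\<close>)
  show ?thesis
  proof (rule finish[OF T])
   fix ta a a' assume t: "galois_aut L ta" and a: "(a, a') : quad_pairs k th th'"
   have aA: "a : alg_cl L" "a' : alg_cl L" using quad.C_alg[OF q a] kbA by auto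
   have kA: "k \<subseteq> alg_cl L" using kL alg_cl_subset[OF KL(3)] by blast
   note aa = quad.iso_C[OF q iso_weaken[OF t kL] A thA kA a]
   have tz: "ta (a * v + a' * lam / v) = ta a * ta v + ta a' * lam / ta v"
    using aA vA lA lamfix[OF t]
    by (simp add: field_isoD(3,4)[OF t] iso_divide[OF t A] subfield_mult[OF A] subfield_divide[OF A])
   show "ta (a * v + a' * lam / v) = a * v + a' * lam / v"
    using cases[OF t] aa unfolding tz using lam(2) v0 by auto
  qed
 qed
qed

end

subsection \<open>Galois and pure bi-twists\<close>

context twist
begin

lemma zeta_inv: "zt * zt ^ 2 = 1" "inverse zt = zt ^ 2"
 using z3 by (simp_all add: power2_eq_square power3_eq_cube inverse_unique mult.assoc)

text \<open>The pair (zt, zt^2) has norm 1, so scaling u by zt preserves the twist field and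
  \<open>rot\<close> restricts to \<open>L\<close>. Its fixed elements in \<open>L\<close> lie in
  kb(u^3), hence in \<open>K\<close>.\<close>

lemma galois_if:
 assumes z: "(zt, zt ^ 2) : C" shows "galois_ext K L"
proof -
 have rk: "field_iso k K.Fu K.Fu K.rot" by (rule iso_weaken[OF K.rot(1) k_kb])
 have inF: "th : K.Fu" "th' : K.Fu" "k \<subseteq> K.Fu" using th_kb k_kb K.F_Fu by auto
 have "K.rot ` L = twist_field k C (zt * zt ^ 2 * lam) (zt * u)"
  using iso_twist_field[OF rk K.Fu inF lam(1) K.u_in] K.rot(2) zeta_inv by simp
 also have "\<dots> = L" using z K.zeta_nz by (intro twist_field_scale) auto
 finally have rL: "K.rot ` L = L" .
 have rot: "field_iso K L L K.rot"
  using iso_restrict[OF rk K.Fu L_kbu] rL K.rot_fixed K_F3 unfolding field_iso_def by auto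
 show ?thesis unfolding galois_ext_def
 proof
  show "K \<subseteq> {a : L. \<forall>f. field_iso K L L f --> f a = a}" using K_L field_isoD(2) by blast
  show "{a : L. \<forall>f. field_iso K L L f --> f a = a} \<subseteq> K"
  proof clarify
   fix a assume a: "a : L" "\<forall>f. field_iso K L L f --> f a = a"
   then have ra: "K.rot a = a" using rot by blast
   obtain A B D where ABD: "A : K.F3" "B : K.F3" "D : K.F3" "a = A + B * u + D / u"
    using K.decompose L_kbu a(1) by blast
   have "A + (zt * B) * u + (zt ^ 2 * D) / u = A + B * u + D / u"
    using K.rot_decomp[OF ABD(1-3)] ra ABD(4) by simp
   then have "zt * B = B & zt ^ 2 * D = D"
    using ABD zeta_kb K.F_F3 K.F3 by (intro K.decompose_unique[THEN conjunct2]) (auto intro!: subfield_mult subfield_power)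
   then have "B = 0" "D = 0" using z1 K.zeta_sq_ne by auto
   then show "a : K" using K_char[OF a(1)] ABD by simp
  qed
 qed
qed

lemma coefficients_in_C:
 assumes z: "c * u + c' * lam / u : L" and c: "c : kb" "c' : kb"
 shows "(c, c') : C"
proof -
 obtain A bt gm where A: "A : K" "bt : K" "gm : K"
  "c * u + c' * lam / u = A + (bt + gm * th) * u + (bt + gm * th') * lam / u"
  using L_decompose[OF z] by metis
 have inF: "A : K.F3" "bt : K.F3" "gm : K.F3" "c : K.F3" "c' : K.F3" "lam : K.F3" "th : K.F3" "th' : K.F3"
  using A K_F3 c lam_kb th_kb K.F_F3 by auto
 have "0 + c * u + (c' * lam) / u = A + (bt + gm * th) * u + ((bt + gm * th') * lam) / u" using A(4) by simp
 then have "0 = A & c = bt + gm * th & c' * lam = (bt + gm * th') * lam"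
  using inF by (intro K.decompose_unique) (auto intro!: subfield_add[OF K.F3] subfield_mult[OF K.F3] subfield_0[OF K.F3])
 then have "c = bt + gm * th" "c' = bt + gm * th'" using lam(2) by auto
 then show ?thesis using pair_coeffs[OF A(2,3)] c by simp
qed

text \<open>A nontrivial automorphism extends to the closure and can be arranged to fix th. Then it
  fixes w and u^3, so it multiplies u by zt or zt^2; the coefficients of the image of
  \<open>s\<close> form the required pair, up to exchange.\<close>

lemma galois_only_if:
 assumes g: "galois_ext K L" shows "(zt, zt ^ 2) : C"
proof -
 note A = subfield_alg_cl[OF L]
 have "s \<notin> {a : L. \<forall>f. field_iso K L L f --> f a = a}" using g s_notin_K unfolding galois_ext_def by simp
 then obtain f where f: "field_iso K L L f" "f s ~= s" using s_L by blast
 obtain h0 where h0: "field_iso {} (alg_cl L) (alg_cl L) h0" "!!a. a : L ==> h0 a = f a"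
  using iso_extend_alg_cl[OF iso_weaken[OF f(1)] L] by auto
 have h0k: "h0 a = a" if "a : K" for a using h0(2) field_isoD(2)[OF f(1)] K_L that by auto
 have h0K: "field_iso K (alg_cl L) (alg_cl L) h0" using h0(1) h0k unfolding field_iso_def by auto
 have h0t: "(h0 th = th & h0 th' = th') \<or> (h0 th = th' & h0 th' = th)"
  by (rule iso_quad[OF iso_weaken[OF h0K k_K] A in_alg(2,3)])
 \<comment> \<open>If the extension exchanges th and th', compose it with an automorphism over
   \<open>L\<close> that does the same; this does not change the restriction to
   \<open>L\<close>.\<close>
 obtain h where h: "field_iso K (alg_cl L) (alg_cl L) h" "!!a. a : L ==> h a = f a" "h th = th" "h th' = th'"
 proof (cases "h0 th = th")
  case True
  then show thesis using that[of h0] h0K h0(2) h0t ne by auto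
 next
  case False
  then have sw: "h0 th = th'" "h0 th' = th" using h0t by auto
  have "th \<notin> k"
  proof
   assume "th : k"
   then have "h0 th = th" using h0k k_K by blast
   then show False using False by simp
  qed
  then have "th \<notin> L" using const th_kb by blast
  then obtain ta where t: "galois_aut L ta" "ta th ~= th"
   using constants_fixed[OF k L k_L perf th_kb(1)] by blast
  then have t2: "ta th = th'" "ta th' = th" using galois_aut_cases[OF t(1)] by metis+
  have "field_iso K (alg_cl L) (alg_cl L) (h0 \<circ> ta)" by (rule iso_comp[OF iso_weaken[OF t(1) K_L] h0K])
  moreover have "(h0 \<circ> ta) a = f a" if "a : L" for a using field_isoD(2)[OF t(1) that] h0(2)[OF that] by simp
  ultimately show thesis using that[of "h0 \<circ> ta"] t2 sw by simp
 qed
 have in_A: "w : alg_cl L" "lam / w : alg_cl L"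
  using w_kbu kbu_alg subfield_divide[OF A in_alg(4)] by blast+
 have KW: "th * w + th' * lam / w : K" "w + lam / w : K"
  using twist.r_L[OF twist_w] twist.s_L[OF twist_w] by auto
 have hw: "h w = w"
 proof -
  have e: "(th - th') * w = (th * w + th' * lam / w) - th' * (w + lam / w)" using twist.sr_u(1)[OF twist_w] .
  have i: "th * w + th' * lam / w : alg_cl L" "w + lam / w : alg_cl L" using KW K_L alg_cl_subset[OF L] by blast+
  have "h ((th - th') * w) = (th - th') * h w"
   using field_isoD(4)[OF h(1) subfield_diff[OF A in_alg(2,3)] in_A(1)] iso_diff[OF h(1) A in_alg(2,3)] h(3,4) by simp
  moreover have "h ((th - th') * w) = (th - th') * w" unfolding e
   using iso_diff[OF h(1) A i(1) subfield_mult[OF A in_alg(3) i(2)]] field_isoD(4)[OF h(1) in_alg(3) i(2)]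
    field_isoD(2)[OF h(1) KW(1)] field_isoD(2)[OF h(1) KW(2)] h(4) by simp
  ultimately have "(th - th') * h w = (th - th') * w" by (simp only:)
  then show ?thesis using ne by (metis mult_cancel_left right_minus_eq)
 qed
 have hlam: "h lam = lam" using field_isoD(2)[OF h(1)] lam k_K by blast
 have "h u ^ 3 = u ^ 3"
 proof -
  have "u ^ 3 = lam * w" using lam(2) by simp
  then have "h (u ^ 3) = lam * w" using field_isoD(4)[OF h(1) in_alg(4) in_A(1)] hw hlam by simp
  then show ?thesis using iso_power[OF h(1) A in_alg(1), of 3] \<open>u ^ 3 = lam * w\<close> by simp
 qed
 then consider "h u = u" | "h u = zt * u" | "h u = zt ^ 2 * u" using K.cube_roots by blast
 note hu = this
 have hs: "h s = h u + lam / h u"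
  using field_isoD(3)[OF h(1) in_alg(1) subfield_divide[OF A in_alg(4,1)]] iso_divide[OF h(1) A in_alg(4,1)] hlam by simp
 have fL: "h s : L" using h(2)[OF s_L] iso_in[OF f(1) L s_L] by simp
 have z2kb: "zt ^ 2 : kb" using zeta_kb kb by (rule subfield_power[rotated])
 have i: "lam / (zt * u) = zt ^ 2 * lam / u" "lam / (zt ^ 2 * u) = zt * lam / u"
 proof -
  have z: "inverse (zt ^ 2) = zt" using zeta_inv(1) by (intro inverse_unique) (simp add: mult.commute)
  show "lam / (zt * u) = zt ^ 2 * lam / u" "lam / (zt ^ 2 * u) = zt * lam / u"
   unfolding divide_inverse inverse_mult_distrib z zeta_inv(2) by (simp_all only: mult_ac)
 qed
 from hu show ?thesis
 proof cases
  case 1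
  then have "h s = s" using hs by simp
  then show ?thesis using h(2)[OF s_L] f(2) by simp
 next
  case 2
  then have "zt * u + zt ^ 2 * lam / u : L" using fL hs i by simp
  then show ?thesis by (rule coefficients_in_C[OF _ zeta_kb z2kb])
 next
  case 3
  then have "zt ^ 2 * u + zt * lam / u : L" using fL hs i by simp
  from C_swap[OF coefficients_in_C[OF this z2kb zeta_kb]] show ?thesis .
 qed
qed

text \<open>A generator with cube in \<open>K\<close> is an eigenvector of the rotation, so one of
  its two conjugate coefficients bt + gm th and bt + gm th' vanishes. This puts th or th' into
  \<open>K\<close>, hence into k.\<close>

lemma purely_cubic_split:
 assumes p: "purely_cubic K L" shows "C = k \<times> k"
proof -
 obtain z where z: "z ^ 3 : K" "L = adjoin K {z}" using p unfolding purely_cubic_def by auto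
 have zL: "z : L" using z(2) adjoin_gen by blast
 have zK: "z \<notin> K"
 proof
  assume "z : K"
  then have "L \<subseteq> K" using z(2) K by (simp add: adjoin_least)
  then show False using s_L s_notin_K by blast
 qed
 obtain A bt gm where A: "A : K" "bt : K" "gm : K" "z = A + (bt + gm * th) * u + (bt + gm * th') * lam / u"
  using L_decompose[OF zL] by metis
 have inF: "A : K.F3" "bt : K.F3" "gm : K.F3" "lam : K.F3" "th : K.F3" "th' : K.F3"
  using A K_F3 lam_kb th_kb K.F_F3 by auto
 have uni: "A = A' & bt + gm * th = B' & (bt + gm * th') * lam = D'"
  if "z = A' + B' * u + D' / u" "A' : K.F3" "B' : K.F3" "D' : K.F3" for A' B' D'
  using A(4) that inF by (intro K.decompose_unique) (auto intro!: subfield_add[OF K.F3] subfield_mult[OF K.F3])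
 have "bt + gm * th = 0 \<or> bt + gm * th' = 0"
 proof (rule K.eigenvector[of z])
  show "z : K.Fu" using zL L_kbu by blast
  show "z ^ 3 : K.F3" using z(1) K_F3 by blast
  show ?thesis if "z : K.F3" using K_char[OF zL that] zK by blast
  show ?thesis if "B : K.F3" "z = B * u" for B
   using uni[of 0 B 0] that subfield_0[OF K.F3] lam(2) by simp
  show ?thesis if "D : K.F3" "z = D / u" for D
   using uni[of 0 0 D] that subfield_0[OF K.F3] by simp
 qed
 moreover have "gm ~= 0"
 proof
  assume "gm = 0"
  then have "bt = 0" using calculation by simp
  then show False using A zK \<open>gm = 0\<close> by simp
 qed
 ultimately have "th = - bt / gm \<or> th' = - bt / gm" by (auto simp: field_simps add_eq_0_iff)
 moreover have "- bt / gm : K" using A by (intro subfield_divide[OF K] subfield_uminus[OF K])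
 ultimately have "th : k \<or> th' : k" using K_const th_kb by metis
 then have "th : k"
 proof
  assume "th' : k"
  then have "(th + th') - th' : k" by (intro subfield_diff[OF k] tr)
  then show ?thesis by simp
 qed
 then show ?thesis by (rule C_split)
qed

end

context base
begin

lemma trivial_type:
 assumes y: "y \<notin> kb" "y ^ 3 = x"
 shows "ext_type k (k \<times> k) 1 (adjoin k {x}, adjoin (adjoin k {x}) {y})"
proof -
 interpret q: quad k 1 0 using k by unfold_locales (auto intro: subfield_0 subfield_1)
 have C: "q.C = k \<times> k" by (rule q.C_split[OF subfield_1[OF k]])
 have T: "twist_field k (k \<times> k) 1 v = adjoin k {v}" for v
 proof
  show "twist_field k (k \<times> k) 1 v \<subseteq> adjoin k {v}"
   unfolding twist_field_def using adjoin_subset[of k "{v}"] adjoin_gen[of "{v}" k]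
   by (intro adjoin_least subfield_adjoin) (auto intro!: subfield_add subfield_mult subfield_divide subfield_adjoin)
  have "v : {a * v + a' * 1 / v | a a'. (a, a') : k \<times> k}"
   using subfield_0[OF k] subfield_1[OF k] by (intro CollectI exI[of _ 1] exI[of _ 0]) auto
  then have "{v} \<subseteq> twist_field k (k \<times> k) 1 v"
   unfolding twist_field_def using adjoin_gen[of "{a * v + a' * 1 / v | a a'. (a, a') : k \<times> k}" k] by blast
  moreover have "k \<subseteq> twist_field k (k \<times> k) 1 v" unfolding twist_field_def by (rule adjoin_subset)
  moreover have "is_subfield (twist_field k (k \<times> k) 1 v)" unfolding twist_field_def by (rule subfield_adjoin)
  ultimately show "adjoin k {v} \<subseteq> twist_field k (k \<times> k) 1 v" by (intro adjoin_least)
 qed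
 have xy: "adjoin (adjoin k {x}) {y} = adjoin k {y}"
  unfolding adjoin_adjoin
  using adjoin_gen[of "{y}" k] subfield_power[OF subfield_adjoin[of k "{y}"], of y 3] y(2) adjoin_gen[of "{x} \<union> {y}" k]
  by (intro subset_antisym adjoin_mono) auto
 have "twist_data k (k \<times> k) 1" unfolding twist_data_def
  using q.quad_axioms C subfield_1[OF k] by (metis zero_neq_one)
 then show ?thesis unfolding ext_type_def xy using y T by (intro conjI exI[of _ y]) simp_all
qed

lemma purely_cubic_iff:
 assumes y: "y \<notin> kb" "y ^ 3 = x" and t: "ext_type k C lam (K, L)"
 shows "purely_cubic K L \<longleftrightarrow> bi_isomorphic k (K, L) (adjoin k {x}, adjoin (adjoin k {x}) {y})"
proof
 assume p: "purely_cubic K L"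
 obtain th th' u where T: "twist k zt th th' lam u" and C: "C = quad_pairs k th th'"
  and E: "(K, L) = (twist_field k C lam (u ^ 3 / lam), twist_field k C lam u)"
  using ext_type_twist[OF base_axioms t] by blast
 have Ck: "C = k \<times> k" using twist.purely_cubic_split[OF T] p E C by auto
 have lam: "lam : k" "lam ~= 0" using t unfolding ext_type_def twist_data_def by auto
 \<comment> \<open>In the split algebra components are independent, so 1 / lam is a norm and the
   parameter can be normalized to 1.\<close>
 have "(inverse lam, 1) : C" using Ck lam k by (auto intro: subfield_inverse subfield_1)
 then have "ext_type k C (inverse lam * 1 * lam) (K, L)" using lam by (intro ext_type_scale[OF t]) auto
 then have "ext_type k (k \<times> k) 1 (K, L)" using lam Ck by simp
 then show "bi_isomorphic k (K, L) (adjoin k {x}, adjoin (adjoin k {x}) {y})"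
  using ext_type_bi_isomorphic trivial_type[OF y] by blast
next
 assume "bi_isomorphic k (K, L) (adjoin k {x}, adjoin (adjoin k {x}) {y})"
 then obtain f g where f: "field_iso k L (adjoin (adjoin k {x}) {y}) f" and g: "field_iso k K (adjoin k {x}) g"
  and fg: "!!a. a : K ==> f a = g a" unfolding bi_isomorphic_def by auto
 obtain th th' u where T: "twist k zt th th' lam u" and C: "C = quad_pairs k th th'"
  and E: "(K, L) = (twist_field k C lam (u ^ 3 / lam), twist_field k C lam u)"
  using ext_type_twist[OF base_axioms t] by blast
 have KL: "is_subfield L" "is_subfield K" "K \<subseteq> L" using twist.L[OF T] twist.K[OF T] twist.K_L[OF T] E C by auto
 have "y : f ` L" using field_isoD(6)[OF f] adjoin_gen[of "{y}" "adjoin k {x}"] by auto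
 then obtain z where z: "z : L" "f z = y" by auto
 have fK: "f ` K = adjoin k {x}" using field_isoD(6)[OF g] fg by (metis image_cong)
 have "x : f ` K" unfolding fK using adjoin_gen by blast
 then obtain b where b: "b : K" "f b = x" by auto
 have "f (z ^ 3) = f b" using iso_power[OF f KL(1) z(1)] z(2) y(2) b by simp
 then have "z ^ 3 = b" using field_isoD(5)[OF f] z b KL subfield_power[OF KL(1) z(1)] by (meson inj_onD subsetD)
 have "f ` adjoin K {z} = adjoin (f ` K) (f ` {z})" using z KL by (intro iso_adjoin[OF f KL(1)]) auto
 also have "\<dots> = f ` L" using fK z field_isoD(6)[OF f] by simp
 finally have "f ` adjoin K {z} = f ` L" .
 moreover have "adjoin K {z} \<subseteq> L" using z KL by (intro adjoin_least) auto
 ultimately have "L = adjoin K {z}" using field_isoD(5)[OF f] by (metis inj_on_image_eq_iff order_refl)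
 then show "purely_cubic K L" unfolding purely_cubic_def using \<open>z ^ 3 = b\<close> b by blast
qed

lemma ext_type_bitwist:
 assumes y: "y \<notin> kb" "y ^ 3 = x" and t: "ext_type k C lam E"
 shows "E : bitwists k (adjoin k {x}, adjoin (adjoin k {x}) {y})"
proof -
 obtain th th' u where "twist k zt th th' lam u" "C = quad_pairs k th th'"
  "E = (twist_field k C lam (u ^ 3 / lam), twist_field k C lam u)"
  using ext_type_twist[OF base_axioms t] by blast
 then show ?thesis using twist.bitwist y by blast
qed

lemma galois_iff:
 assumes t: "ext_type k C lam (K, L)"
 shows "galois_ext K L \<longleftrightarrow> (zt, zt ^ 2) : C"
proof -
 obtain th th' u where "twist k zt th th' lam u" "C = quad_pairs k th th'"
  "(K, L) = (twist_field k C lam (u ^ 3 / lam), twist_field k C lam u)"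
  using ext_type_twist[OF base_axioms t] by blast
 then show ?thesis using twist.galois_if twist.galois_only_if by auto
qed

end

section \<open>Forms and regular maps\<close>

text \<open>Homogeneous polynomial functions generated by rules, equivalent to \<open>form\<close>
  by \<open>hform_form\<close> and \<open>form_hform\<close>. Induction, products and substitution
  then avoid exponent vectors; the zero function has every degree.\<close>

inductive hform :: "'a::field set => nat => ('a ^ 'n::finite => 'a) => bool" for F where
 zero: "hform F d (%_. 0)"
| const: "a : F ==> hform F 0 (%_. a)"
| add: "hform F d f ==> hform F d g ==> hform F d (%v. f v + g v)"
| var: "hform F d f ==> hform F (Suc d) (%v. v $ i * f v)"

lemma sum_fun_upd:
 fixes e :: "'n::finite => nat"
 shows "(\<Sum>j\<in>UNIV. (e(i := m)) j) = m + (\<Sum>j\<in>UNIV - {i}. e j)"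
proof -
 have "(\<Sum>j\<in>UNIV - {i}. (e(i := m)) j) = (\<Sum>j\<in>UNIV - {i}. e j)" by (rule sum.cong) auto
 then show ?thesis using sum.remove[of UNIV i "e(i := m)"] by simp
qed

lemma prod_fun_upd:
 fixes e :: "'n::finite => nat" and x :: "'n => 'a::comm_monoid_mult"
 shows "(\<Prod>j\<in>UNIV. x j ^ (e(i := m)) j) = x i ^ m * (\<Prod>j\<in>UNIV - {i}. x j ^ e j)"
proof -
 have "(\<Prod>j\<in>UNIV - {i}. x j ^ (e(i := m)) j) = (\<Prod>j\<in>UNIV - {i}. x j ^ e j)" by (rule prod.cong) auto
 then show ?thesis using prod.remove[of UNIV i "%j. x j ^ (e(i := m)) j"] by simp
qed

lemma hform_sum: "(!!i. i : I ==> hform F d (f i)) ==> hform F d (%v. \<Sum>i\<in>I. f i v)"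
proof (induction I rule: infinite_finite_induct)
 case (insert x I)
 have "hform F d (%v. f x v + (\<Sum>i\<in>I. f i v))" by (rule hform.add) (use insert in auto)
 then show ?case using insert by simp
qed (simp_all add: hform.zero)

lemma hform_monomial: "a : F ==> hform F (\<Sum>i\<in>UNIV. e i) (%v. a * (\<Prod>i\<in>UNIV. (v $ i) ^ e i))"
proof (induction "\<Sum>i\<in>UNIV. e i" arbitrary: e)
 case 0
 then have "e i = 0" for i by simp
 then show ?case using hform.const[OF 0(2)] by simp
next
 case (Suc n)
 then obtain i where i: "e i > 0" by (metis neq0_conv sum.neutral nat.distinct(1))
 define e' where "e' = e(i := e i - 1)"
 have s: "(\<Sum>j\<in>UNIV. e j) = Suc (\<Sum>j\<in>UNIV. e' j)"
  using i sum.remove[of UNIV i e] unfolding e'_def sum_fun_upd by simp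
 then have "n = (\<Sum>j\<in>UNIV. e' j)" using Suc(2) by simp
 from Suc(1)[OF this Suc(3)] have "hform F (Suc (\<Sum>j\<in>UNIV. e' j)) (%v. v $ i * (a * (\<Prod>j\<in>UNIV. (v $ j) ^ e' j)))"
  by (rule hform.var)
 moreover have "v $ i * (a * (\<Prod>j\<in>UNIV. (v $ j) ^ e' j)) = a * (\<Prod>j\<in>UNIV. (v $ j) ^ e j)" for v
 proof -
  have "(v $ i) ^ e i = v $ i * (v $ i) ^ (e i - 1)" using i by (simp add: power_eq_if)
  then show ?thesis
   unfolding e'_def prod_fun_upd using prod.remove[of UNIV i "%j. (v $ j) ^ e j"] by (simp add: mult_ac)
 qed
 ultimately show ?case using s by simp
qed

lemma hform_form:
 fixes c :: "('n::finite => nat) => 'a::field"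
 assumes c: "!!e. c e : F" shows "hform F d (form d c)"
proof -
 have "hform F d (%v. c e * (\<Prod>i\<in>UNIV. (v $ i) ^ e i))" if "(\<Sum>i\<in>UNIV. e i) = d" for e :: "'n => nat"
  using hform_monomial[OF c, of e] that by simp
 then have "hform F d (%v. \<Sum>e | (\<Sum>i\<in>UNIV. e i) = d. c e * (\<Prod>i\<in>UNIV. (v $ i) ^ e i))"
  by (intro hform_sum) auto
 then show ?thesis unfolding form_def[abs_def] .
qed

lemma finite_exponents: "finite {e :: 'n::finite => nat. (\<Sum>i\<in>UNIV. e i) = d}"
proof (rule finite_subset)
 show "{e :: 'n => nat. (\<Sum>i\<in>UNIV. e i) = d} \<subseteq> Pi\<^sub>E UNIV (%_. {..d})"
 proof
  fix e :: "'n => nat" assume "e : {e. (\<Sum>i\<in>UNIV. e i) = d}"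
  then have "e i \<le> d" for i using member_le_sum[of i UNIV e] by simp
  then show "e : Pi\<^sub>E UNIV (%_. {..d})" by (simp add: PiE_iff extensional_def)
 qed
 show "finite (Pi\<^sub>E (UNIV :: 'n set) (%_. {..d}))" by (rule finite_PiE) auto
qed

lemma form_hform:
 assumes F: "is_subfield F" and f: "hform F d f"
 shows "\<exists>c. (\<forall>e. c e : F) & f = form d c"
 using f
proof induction
 case (zero d)
 show ?case by (intro exI[of _ "%_. 0"]) (auto simp: form_def subfield_0[OF F])
next
 case (const a)
 have "{e :: 'b => nat. (\<Sum>i\<in>UNIV. e i) = 0} = {%_. 0}" by auto
 then have "form 0 (%_. a) v = a" for v :: "'a ^ 'b" unfolding form_def by simp
 then show ?case using const by (intro exI[of _ "%_. a"]) auto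
next
 case (add d f g)
 then obtain c c' where "\<forall>e. c e : F" "f = form d c" "\<forall>e. c' e : F" "g = form d c'" by blast
 then show ?case
  by (intro exI[of _ "%e. c e + c' e"]) (auto simp: form_def distrib_right sum.distrib subfield_add[OF F])
next
 case (var d f i)
 then obtain c where c: "\<forall>e. c e : F" "f = form d c" by blast
 \<comment> \<open>Multiplication by the coordinate i raises the i-th exponent by one; exponent
   vectors outside the image of this shift get coefficient 0.\<close>
 define c' where "c' e = (if e i > 0 then c (e(i := e i - 1)) else 0)" for e :: "'b => nat"
 have "v $ i * form d c v = form (Suc d) c' v" for v
 proof -
  let ?u = "%e :: 'b => nat. e(i := Suc (e i))"
  have inj: "inj_on ?u A" for A
  proof (rule inj_onI)
   fix e e' assume eq: "?u e = ?u e'"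
   show "e = e'"
   proof
    fix j show "e j = e' j" using fun_cong[OF eq, of j] by (cases "j = i") auto
   qed
  qed
  have su: "(\<Sum>j\<in>UNIV. ?u e j) = Suc (\<Sum>j\<in>UNIV. e j)" for e
   using sum.remove[of UNIV i e] unfolding sum_fun_upd by simp
  have im: "?u ` {e. (\<Sum>j\<in>UNIV. e j) = d} = {e. (\<Sum>j\<in>UNIV. e j) = Suc d & e i > 0}"
  proof
   show "?u ` {e. (\<Sum>j\<in>UNIV. e j) = d} \<subseteq> {e. (\<Sum>j\<in>UNIV. e j) = Suc d & e i > 0}" using su by auto
   show "{e. (\<Sum>j\<in>UNIV. e j) = Suc d & e i > 0} \<subseteq> ?u ` {e. (\<Sum>j\<in>UNIV. e j) = d}"
   proof
    fix e assume e: "e : {e. (\<Sum>j\<in>UNIV. e j) = Suc d & e i > 0}"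
    then have "e = ?u (e(i := e i - 1))" by auto
    moreover from this have "(\<Sum>j\<in>UNIV. (e(i := e i - 1)) j) = d" using su[of "e(i := e i - 1)"] e by auto
    ultimately show "e : ?u ` {e. (\<Sum>j\<in>UNIV. e j) = d}" by blast
   qed
  qed
  have pr: "(\<Prod>j\<in>UNIV. (v $ j) ^ (?u e) j) = v $ i * (\<Prod>j\<in>UNIV. (v $ j) ^ e j)" for e
   unfolding prod_fun_upd using prod.remove[of UNIV i "%j. (v $ j) ^ e j"] by (simp add: mult_ac)
  have "form (Suc d) c' v = (\<Sum>e | (\<Sum>j\<in>UNIV. e j) = Suc d & e i > 0. c' e * (\<Prod>j\<in>UNIV. (v $ j) ^ e j))"
   unfolding form_def by (rule sum.mono_neutral_right) (use finite_exponents in \<open>auto simp: c'_def\<close>)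
  also have "\<dots> = (\<Sum>e | (\<Sum>j\<in>UNIV. e j) = d. c' (?u e) * (\<Prod>j\<in>UNIV. (v $ j) ^ (?u e) j))"
   unfolding im[symmetric] by (subst sum.reindex[OF inj]) simp
  also have "\<dots> = v $ i * form d c v"
   unfolding form_def sum_distrib_left pr by (intro sum.cong) (auto simp: c'_def mult_ac)
  finally show ?thesis by simp
 qed
 then have "(%v. v $ i * f v) = form (Suc d) c'" using c(2) by (simp add: fun_eq_iff)
 moreover have "\<forall>e. c' e : F" using c(1) subfield_0[OF F] by (simp add: c'_def)
 ultimately show ?case by blast
qed

lemma hform_homogeneous: "hform F d f ==> f (c *s v) = c ^ d * f v"
 by (induction rule: hform.induct) (auto simp: algebra_simps)

lemma hform_zero_degree: "hform F d f ==> d = 0 ==> f v = f w"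
 using hform_homogeneous[of F 0 f 0 v] hform_homogeneous[of F 0 f 0 w] by simp

lemma hform_at_0: "hform F d f ==> d > 0 ==> f 0 = 0"
 using hform_homogeneous[of F d f 0 0] by (simp add: zero_power)

lemma hform_mono: "hform F d f ==> F \<subseteq> F' ==> hform F' d f"
 by (induction rule: hform.induct) (auto intro: hform.intros)

lemma hform_value: "hform F d f ==> is_subfield E ==> F \<subseteq> E ==> (!!i. v $ i : E) ==> f v : E"
 by (induction rule: hform.induct) (auto intro: subfield_intros)

context
 fixes F :: "'a::field set"
 assumes F: "is_subfield F"
begin

lemma hform_smult: "hform F d f ==> a : F ==> hform F d (%v. a * f v)"
proof (induction rule: hform.induct)
 case (add d f g)
 then show ?case using hform.add[of F d "%v. a * f v" "%v. a * g v"] by (simp add: distrib_left)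
next
 case (var d f i)
 then show ?case using hform.var[of F d "%v. a * f v" i] by (simp add: mult.left_commute)
qed (auto intro: hform.intros subfield_mult[OF F] simp: hform.zero)

lemma hform_mult: "hform F d f ==> hform F e g ==> hform F (d + e) (%v. f v * g v)"
proof (induction rule: hform.induct)
 case (zero d)
 then show ?case using hform.zero[of F] by simp
next
 case (const a)
 then show ?case using hform_smult by simp
next
 case (add d f f')
 then show ?case using hform.add[of F "d + e" "%v. f v * g v" "%v. f' v * g v"] by (simp add: distrib_right)
next
 case (var d f i)
 then show ?case using hform.var[of F "d + e" "%v. f v * g v" i] by (simp add: mult.assoc)
qed

lemma hform_uminus: "hform F d f ==> hform F d (%v. - f v)"
 using hform_smult[of d f "-1"] F by (simp add: subfield_uminus subfield_1)

lemma hform_diff: "hform F d f ==> hform F d g ==> hform F d (%v. f v - g v)"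
 using hform.add[of F d f "%v. - g v"] hform_uminus[of d g] by simp

lemma hform_coord: "hform F 1 (%v. v $ i)"
 using hform.var[OF hform.const[OF subfield_1[OF F]], of i] by simp

lemma hform_power: "hform F d f ==> hform F (n * d) (%v. f v ^ n)"
proof (induction n)
 case 0
 then show ?case using hform.const[OF subfield_1[OF F]] by simp
next
 case (Suc n)
 then show ?case using hform_mult[of d f "n * d" "%v. f v ^ n"] by (simp add: add.commute)
qed

lemma hform_linear: "(!!i. a i : F) ==> hform F 1 (%v. \<Sum>i\<in>UNIV. a i * v $ i)"
 by (intro hform_sum hform_smult hform_coord)

lemma hform_comp:
 assumes "hform F d f" "!!i. hform F e (%v. g v $ i)"
 shows "hform F (d * e) (%v. f (g v))"
 using assms(1)
proof (induction rule: hform.induct)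
 case (var d f i)
 then show ?case using hform_mult[OF assms(2)[of i], of "d * e" "%v. f (g v)"] by simp
qed (auto intro: hform.intros)

end

definition hmap :: "'a::field set => nat => ('a ^ 'm::finite => 'a ^ 'n::finite) => bool" where
 "hmap F d g \<longleftrightarrow> (\<forall>j. hform F d (%v. g v $ j))"

lemma hmap_homogeneous: "hmap F d g ==> g (c *s v) = c ^ d *s g v"
 unfolding hmap_def vec_eq_iff using hform_homogeneous[of F d "%v. g v $ _"] by simp

lemma hmap_at_0: "hmap F d g ==> d > 0 ==> g 0 = 0"
 unfolding hmap_def vec_eq_iff using hform_at_0[of F d "%v. g v $ _"] by simp

lemma hmap_mono: "hmap F d g ==> F \<subseteq> F' ==> hmap F' d g"
 unfolding hmap_def using hform_mono by blast

lemma hmap_forms_map: "(\<forall>j e. G j e : F) ==> hmap F d (forms_map d G)"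
 unfolding hmap_def forms_map_def by (auto intro: hform_form)

lemma forms_map_hmap:
 assumes F: "is_subfield F" and g: "hmap F d g" shows "\<exists>G. (\<forall>j e. G j e : F) & g = forms_map d G"
proof -
 have "\<forall>j. \<exists>c. (\<forall>e. c e : F) & (%v. g v $ j) = form d c" using form_hform[OF F] g unfolding hmap_def by blast
 then obtain G where "!!j. (\<forall>e. G j e : F) & (%v. g v $ j) = form d (G j)" by metis
 then show ?thesis by (intro exI[of _ G]) (auto simp: forms_map_def vec_eq_iff fun_eq_iff)
qed

lemma hmap_comp: "is_subfield F ==> hmap F d f ==> hmap F e g ==> hmap F (d * e) (%v. f (g v))"
 unfolding hmap_def using hform_comp[of F d _ e g] by blast

subsection \<open>Points\<close>

lemma pt_self: "v : pt v"
 unfolding pt_def by (intro CollectI exI[of _ 1]) simp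

lemma pt_scale: "c ~= 0 ==> pt (c *s v) = pt v"
proof -
 assume c: "c ~= 0"
 have "\<exists>e. d *s (c *s v) = e *s v & e ~= 0" if "d ~= 0" for d
  using that c by (intro exI[of _ "d * c"]) (simp add: vector_smult_assoc)
 moreover have "\<exists>e. d *s v = e *s (c *s v) & e ~= 0" if "d ~= 0" for d
  using that c by (intro exI[of _ "d / c"]) (simp add: vector_smult_assoc)
 ultimately show ?thesis unfolding pt_def by blast
qed

lemma pt_mem: "w : pt v \<longleftrightarrow> (\<exists>c. c ~= 0 & w = c *s v)"
 unfolding pt_def by blast

lemma pt_mem_eq: "w : pt v ==> pt w = pt v"
 using pt_scale by (auto simp: pt_mem)

lemma pt_eq_iff: "pt v = pt w \<longleftrightarrow> (\<exists>c. c ~= 0 & v = c *s w)"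
 using pt_self[of v] pt_mem[of v w] pt_scale by metis

lemma pt_nonzero: "w : pt v ==> w = 0 \<longleftrightarrow> v = 0"
 by (auto simp: pt_mem)

lemma proj_spaceE:
 assumes "P : proj_space" obtains v where "v ~= 0" "P = pt v"
 using assms unfolding proj_space_def by blast

lemma proj_spaceI: "v ~= 0 ==> pt v : proj_space"
 unfolding proj_space_def by blast

lemma proj_space_mem: "P : proj_space ==> v : P ==> v ~= 0 & P = pt v"
 by (metis proj_spaceE pt_nonzero pt_mem_eq)

lemma proj_eqI:
 fixes v w :: "'a::field ^ 'n::finite"
 assumes "v ~= 0" "w ~= 0" "!!i j. v $ i * w $ j = v $ j * w $ i"
 shows "pt v = pt w"
proof -
 obtain j where j: "w $ j ~= 0" using assms(2) by (auto simp: vec_eq_iff)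
 have v: "v = (v $ j / w $ j) *s w" using assms(3)[of _ j] j by (simp add: vec_eq_iff field_simps)
 then have "v $ j / w $ j ~= 0" using assms(1) by (metis vector_smult_lzero)
 then show ?thesis using v pt_eq_iff by blast
qed

lemma pt_eq_minors: "pt v = pt w ==> v $ i * w $ j = v $ j * w $ i"
 by (auto simp: pt_eq_iff mult_ac)

lemma induced_pt:
 assumes "hmap F d g" shows "induced g (pt v) = pt (g v)"
proof -
 have "pt (g w) = pt (g v)" if w: "w : pt v" for w
 proof -
  obtain c where "c ~= 0" "w = c *s v" using w by (auto simp: pt_mem)
  then show ?thesis using hmap_homogeneous[OF assms, of c v] pt_scale[of "c ^ d" "g v"] by simp
 qed
 then show ?thesis unfolding induced_def using pt_self by blast
qed

subsection \<open>Regular maps\<close>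

definition repr :: "('a::field, 'm::finite) ppoint set => ('a ^ 'm => 'a ^ 'n) =>
  (('a, 'm) ppoint => ('a, 'n::finite) ppoint) => bool" where
 "repr X g f \<longleftrightarrow> (\<forall>P\<in>X. \<forall>v\<in>P. g v ~= 0 --> f P = pt (g v))"

lemma regular_map_iff:
 assumes "is_subfield F"
 shows "regular_map F X Y f \<longleftrightarrow> f ` X \<subseteq> Y &
  (\<forall>P\<in>X. \<exists>d g. hmap F d g & repr X g f & (\<forall>v\<in>P. g v ~= 0))"
proof -
 have "(\<exists>d G. (\<forall>j e. G j e : F) & represents X d G f & (\<forall>v\<in>P. forms_map d G v ~= 0)) \<longleftrightarrow>
  (\<exists>d g. hmap F d g & repr X g f & (\<forall>v\<in>P. g v ~= 0))" for P
 proof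
  assume "\<exists>d G. (\<forall>j e. G j e : F) & represents X d G f & (\<forall>v\<in>P. forms_map d G v ~= 0)"
  then obtain d G where G: "\<forall>j e. G j e : F" "represents X d G f" "\<forall>v\<in>P. forms_map d G v ~= 0" by blast
  show "\<exists>d g. hmap F d g & repr X g f & (\<forall>v\<in>P. g v ~= 0)"
   by (intro exI[of _ d] exI[of _ "forms_map d G"] conjI G(3) hmap_forms_map[OF G(1)]
    G(2)[unfolded represents_def, folded repr_def])
 next
  assume "\<exists>d g. hmap F d g & repr X g f & (\<forall>v\<in>P. g v ~= 0)"
  then obtain d g where g: "hmap F d g" "repr X g f" "\<forall>v\<in>P. g v ~= 0" by blast
  obtain G where G: "\<forall>j e. G j e : F" "g = forms_map d G" using forms_map_hmap[OF assms g(1)] by blast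
  show "\<exists>d G. (\<forall>j e. G j e : F) & represents X d G f & (\<forall>v\<in>P. forms_map d G v ~= 0)"
   by (intro exI[of _ d] exI[of _ G] conjI G(1) g(2,3)[unfolded repr_def G(2), folded represents_def])
 qed
 then show ?thesis unfolding regular_map_def by simp
qed

lemma regular_map_in: "regular_map F X Y f ==> P : X ==> f P : Y"
 unfolding regular_map_def by blast

lemma regular_mapE:
 assumes "regular_map F X Y f" "is_subfield F" "P : X"
 obtains d g where "hmap F d g" "repr X g f" "\<forall>v\<in>P. g v ~= 0"
proof -
 have "\<exists>d g. hmap F d g & repr X g f & (\<forall>v\<in>P. g v ~= 0)"
  using assms(1,3) unfolding regular_map_iff[OF assms(2)] by simp
 then show thesis using that by blast
qed

lemma repr_comp:
 assumes G: "hmap F d G" "repr X G f" and H: "hmap F e H" "repr Y H g"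
  and X: "f ` X \<subseteq> Y" "Y \<subseteq> proj_space"
 shows "repr X (%v. H (G v)) (g \<circ> f)"
 unfolding repr_def
proof (intro ballI impI)
 fix R v assume R: "R : X" "v : R" and nz: "H (G v) ~= 0"
 have fR: "f R : Y" using X R by blast
 show "(g \<circ> f) R = pt (H (G v))"
 proof (cases "G v = 0")
  case False
  then have "f R = pt (G v)" using G(2) R unfolding repr_def by blast
  then show ?thesis using H(2) fR nz pt_self[of "G v"] unfolding repr_def by force
 next
  case True
  \<comment> \<open>A homogeneous map of positive degree vanishes at 0, so this case is only
    possible for constant \<open>H\<close>.\<close>
  then have e: "e = 0" using nz hmap_at_0[OF H(1)] by auto
  have c: "H w = H (G v)" for w using H(1) hform_zero_degree[OF _ e, of F] unfolding hmap_def vec_eq_iff by blast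
  obtain w where "w : f R" using fR X(2) by (metis proj_spaceE pt_self subsetD)
  then have "g (f R) = pt (H w)" using H(2) fR c[of w] nz unfolding repr_def by metis
  then show ?thesis using c[of w] by simp
 qed
qed

lemma regular_map_comp:
 assumes F: "is_subfield F" and f: "regular_map F X Y f" and g: "regular_map F Y Z g" and Y: "Y \<subseteq> proj_space"
 shows "regular_map F X Z (g \<circ> f)"
 unfolding regular_map_iff[OF F]
proof (intro conjI ballI)
 show "(g \<circ> f) ` X \<subseteq> Z" using regular_map_in[OF f] regular_map_in[OF g] by auto
 have fX: "f ` X \<subseteq> Y" using regular_map_in[OF f] by blast
 fix P assume P: "P : X"
 obtain d G where G: "hmap F d G" "repr X G f" "\<forall>v\<in>P. G v ~= 0" by (rule regular_mapE[OF f F P])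
 obtain e H where H: "hmap F e H" "repr Y H g" "\<forall>v\<in>f P. H v ~= 0"
  by (rule regular_mapE[OF g F regular_map_in[OF f P]])
 have "H (G v) ~= 0" if v: "v : P" for v
 proof -
  have "f P = pt (G v)" using G(2,3) P v unfolding repr_def by simp
  then show ?thesis using H(3) pt_self[of "G v"] by simp
 qed
 then show "\<exists>d g'. hmap F d g' & repr X g' (g \<circ> f) & (\<forall>v\<in>P. g' v ~= 0)"
  using hmap_comp[OF F H(1) G(1)] repr_comp[OF G(1,2) H(1,2) fX Y] by blast
qed

lemma regular_map_mono:
 assumes f: "regular_map F X Y f" and F: "F \<subseteq> F'" shows "regular_map F' X Y f"
 unfolding regular_map_def
proof (intro conjI ballI)
 show "f ` X \<subseteq> Y" using f unfolding regular_map_def by simp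
 fix P assume "P : X"
 then obtain d G where G: "\<forall>j e. G j e : F" "represents X d G f" "\<forall>v\<in>P. forms_map d G v ~= 0"
  using f unfolding regular_map_def by meson
 have "\<forall>j e. G j e : F'" using G(1) F by auto
 then show "\<exists>d G. (\<forall>j e. G j e : F') & represents X d G f & (\<forall>v\<in>P. forms_map d G v ~= 0)" using G(2,3) by auto
qed

lemma regular_map_global:
 assumes F: "is_subfield F" and g: "hmap F d g" and f: "!!P v. P : X ==> v : P ==> g v ~= 0 & f P = pt (g v)"
  and Y: "!!P. P : X ==> f P : Y"
 shows "regular_map F X Y f"
 unfolding regular_map_iff[OF F] repr_def
proof (intro conjI ballI)
 show "f ` X \<subseteq> Y" using Y by auto
 fix P assume "P : X"
 then show "\<exists>d g. hmap F d g & (\<forall>P\<in>X. \<forall>v\<in>P. g v ~= 0 --> f P = pt (g v)) & (\<forall>v\<in>P. g v ~= 0)"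
  using g f by (intro exI[of _ d] exI[of _ g]) auto
qed

lemma isomorphism_mono: "isomorphism F X Y f ==> F \<subseteq> F' ==> isomorphism F' X Y f"
 unfolding isomorphism_def using regular_map_mono[of F _ _ _ F'] by metis

lemma isomorphism_id:
 assumes F: "is_subfield F" and X: "X \<subseteq> proj_space" shows "isomorphism F X X id"
proof -
 have "hmap F 1 (%v. v)" unfolding hmap_def using hform_coord[OF F] by blast
 then have "regular_map F X X id" using X proj_space_mem
  by (intro regular_map_global[OF F, of 1 "%v. v"]) auto
 then show ?thesis unfolding isomorphism_def by (intro conjI exI[of _ id]) auto
qed

lemma isomorphism_comp:
 assumes F: "is_subfield F" and X: "X \<subseteq> proj_space" "Y \<subseteq> proj_space"
  and f: "isomorphism F X Y f" and g: "isomorphism F Y Z g"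
 shows "isomorphism F X Z (g \<circ> f)"
proof -
 obtain f' where f': "regular_map F Y X f'" "\<forall>P\<in>X. f' (f P) = P" "\<forall>P\<in>Y. f (f' P) = P"
  using f unfolding isomorphism_def by auto
 obtain g' where g': "regular_map F Z Y g'" "\<forall>P\<in>Y. g' (g P) = P" "\<forall>P\<in>Z. g (g' P) = P"
  using g unfolding isomorphism_def by auto
 have r: "regular_map F X Y f" "regular_map F Y Z g" using f g unfolding isomorphism_def by auto
 have "regular_map F X Z (g \<circ> f)" "regular_map F Z X (f' \<circ> g')"
  by (rule regular_map_comp[OF F r X(2)], rule regular_map_comp[OF F g'(1) f'(1) X(2)])
 then show ?thesis unfolding isomorphism_def
  using f' g' regular_map_in[OF r(1)] regular_map_in[OF g'(1)] by (intro conjI exI[of _ "f' \<circ> g'"]) auto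
qed

lemma isomorphism_inverse:
 assumes f: "isomorphism F X Y f"
 obtains g where "isomorphism F Y X g" "!!P. P : X ==> g (f P) = P" "!!P. P : Y ==> f (g P) = P"
proof -
 obtain g where g: "regular_map F Y X g" "\<forall>P\<in>X. g (f P) = P" "\<forall>P\<in>Y. f (g P) = P"
  using f unfolding isomorphism_def by auto
 have "isomorphism F Y X g" unfolding isomorphism_def
  using g f[unfolded isomorphism_def] by (intro conjI exI[of _ f]) simp_all
 then show thesis using that[of g] g by simp
qed

lemma isomorphism_bij:
 assumes f: "isomorphism F X Y f" shows "bij_betw f X Y"
proof -
 obtain g where g: "regular_map F Y X g" "\<forall>P\<in>X. g (f P) = P" "\<forall>P\<in>Y. f (g P) = P"
  using f unfolding isomorphism_def by auto
 have "regular_map F X Y f" using f unfolding isomorphism_def by simp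
 then have "f ` X \<subseteq> Y" "g ` Y \<subseteq> X" using regular_map_in[of F X Y f] regular_map_in[OF g(1)] by blast+
 then show ?thesis by (rule bij_betw_byWitness[OF g(2,3)])
qed

lemma rational_point_regular:
 assumes F: "is_subfield F" and f: "regular_map F X Y f" and P: "P : X" "rational_point F P"
 shows "rational_point F (f P)"
proof -
 obtain d g where g: "hmap F d g" "repr X g f" "\<forall>v\<in>P. g v ~= 0" by (rule regular_mapE[OF f F P(1)])
 obtain v where v: "v : P" "\<forall>i. v $ i : F" using P(2) unfolding rational_point_def by (elim bexE)
 have "f P = pt (g v)" using g(2,3) v(1) P(1) unfolding repr_def by simp
 moreover have "g v $ i : F" for i using hform_value[of F d "%v. g v $ i" F v] g(1) v(2) F unfolding hmap_def by simp
 ultimately show ?thesis unfolding rational_point_def using pt_self[of "g v"] by metis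
qed

section \<open>The projective line\<close>

lemma infinite_UNIV_alg_closed: "infinite (UNIV :: 'a::alg_closed_field set)"
proof
 assume fin: "finite (UNIV :: 'a set)"
 define p :: "'a poly" where "p = (\<Prod>a\<in>UNIV. [:-a, 1:])"
 have dp: "degree p = card (UNIV :: 'a set)" unfolding p_def by (subst degree_prod_sum_eq) auto
 have "card (UNIV :: 'a set) > 0" using fin by (simp add: card_gt_0_iff)
 then have "degree (p + 1) > 0" using dp by (simp add: degree_add_eq_left)
 then obtain x where "poly (p + 1) x = 0" using alg_closed_imp_poly_has_root by blast
 moreover have "poly p x = 0" unfolding p_def poly_prod using fin by (intro prod_zero) auto
 ultimately show False by simp
qed

lemma vector2_eta: "(v :: 'a::zero ^ 2) = vector [v $ 1, v $ 2]"
 by (simp add: vec_eq_iff forall_2)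

lemma vector2_eq_0: "(vector [a, b] :: 'a::zero ^ 2) = 0 \<longleftrightarrow> a = 0 & b = 0"
 by (simp add: vec_eq_iff forall_2)

lemma vec2_eqI: "v $ 1 = w $ 1 ==> v $ 2 = w $ 2 ==> v = (w :: 'a ^ 2)"
 by (simp add: vec_eq_iff forall_2)

lemma pt2_eqI:
 fixes v w :: "'a::field ^ 2"
 assumes "v ~= 0" "w ~= 0" "v $ 1 * w $ 2 = v $ 2 * w $ 1"
 shows "pt v = pt w"
proof (rule proj_eqI[OF assms(1,2)])
 fix i j :: 2
 show "v $ i * w $ j = v $ j * w $ i"
  using assms(3) exhaust_2[of i] exhaust_2[of j] by (auto simp: mult.commute)
qed

lemma hform_poly:
 assumes F: "is_subfield F" and f: "hform F d (f :: 'a::field ^ 2 => 'a)"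
 shows "\<exists>p\<in>polys_over F. \<forall>x. f (vector [x, 1]) = poly p x"
 using f
proof induction
 case (zero d) then show ?case using polys_over_0[OF F] by force
next
 case (const a) then show ?case using polys_over_0[OF F] polys_over_pCons_iff[OF F] by (intro bexI[of _ "[:a:]"]) auto
next
 case (add d f g)
 then obtain p q where "p : polys_over F" "\<forall>x. f (vector [x, 1]) = poly p x"
  "q : polys_over F" "\<forall>x. g (vector [x, 1]) = poly q x" by blast
 then show ?case using polys_over_add[OF F] by (intro bexI[of _ "p + q"]) auto
next
 case (var d f i)
 then obtain p where p: "p : polys_over F" "\<forall>x. f (vector [x, 1]) = poly p x" by blast
 show ?case
 proof (cases "i = 1")
  case True
  have "pCons 0 p : polys_over F" using polys_over_pCons_iff[OF F, of 0 p] subfield_0[OF F] p(1) by simp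
  then show ?thesis using True p(2) by (intro bexI[of _ "pCons 0 p"]) auto
 next
  case False
  then have "i = 2" using exhaust_2 by blast
  then show ?thesis using p by (intro bexI[of _ p]) auto
 qed
qed

lemma hform_poly_line:
 assumes f: "hform F d (f :: 'a::field ^ 2 => 'a)"
 shows "\<exists>p. \<forall>x. f (vector [s, x]) = poly p x"
 using f
proof induction
 case (zero d) then show ?case by (intro exI[of _ 0]) simp
next
 case (const a) then show ?case by (intro exI[of _ "[:a:]"]) simp
next
 case (add d f g)
 then obtain p q where "\<forall>x. f (vector [s, x]) = poly p x" "\<forall>x. g (vector [s, x]) = poly q x" by blast
 then show ?case by (intro exI[of _ "p + q"]) simp
next
 case (var d f i)
 then obtain p where p: "\<forall>x. f (vector [s, x]) = poly p x" by blast
 show ?case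
 proof (cases "i = 1")
  case True
  then show ?thesis using p by (intro exI[of _ "smult s p"]) auto
 next
  case False
  then have "i = 2" using exhaust_2 by blast
  then show ?thesis using p by (intro exI[of _ "pCons 0 p"]) auto
 qed
qed

text \<open>Homogeneity covers all vectors with nonzero second coordinate. The remaining ones follow
  because along a line the form is a polynomial with infinitely many zeros.\<close>

lemma hform_zero_affine:
 fixes f :: "'a::alg_closed_field ^ 2 => 'a"
 assumes f: "hform F d f" and z: "!!x. f (vector [x, 1]) = 0"
 shows "f v = 0"
proof -
 have a: "f (vector [s, t]) = 0" if "t ~= 0" for s t
 proof -
  have "vector [s, t] = t *s (vector [s / t, 1] :: 'a ^ 2)" using that by (intro vec2_eqI) auto
  then show ?thesis using hform_homogeneous[OF f] z by simp
 qed
 obtain p where p: "\<forall>x. f (vector [v $ 1, x]) = poly p x" using hform_poly_line[OF f] by blast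
 have "p = 0"
 proof (rule ccontr)
  assume "p ~= 0"
  then have "finite {x. poly p x = 0}" by (rule poly_roots_finite)
  moreover have "poly p x = 0" if "x ~= 0" for x using p a[OF that] by metis
  then have "UNIV - {0} \<subseteq> {x. poly p x = 0}" by blast
  ultimately have "finite (UNIV :: 'a set)" using finite_subset finite_Diff2[of "{0}" UNIV] by blast
  then show False using infinite_UNIV_alg_closed by blast
 qed
 then show ?thesis using p vector2_eta[of v] by (metis poly_0)
qed

lemma hform_generic_zero:
 fixes f :: "'a::alg_closed_field ^ 2 => 'a"
 assumes F: "is_subfield F" and y: "y \<notin> alg_cl F" and f: "hform F d f" and z: "f (vector [y, 1]) = 0"
 shows "f v = 0"
proof -
 obtain p where p: "p : polys_over F" "\<forall>x. f (vector [x, 1]) = poly p x" using hform_poly[OF F f] by blast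
 then have "p = 0" using transcendental_poly[OF F y p(1)] z by simp
 then show ?thesis using hform_zero_affine[OF f] p by simp
qed

lemma hform_generic_value:
 assumes F: "is_subfield F" and f: "hform F d (f :: 'a::field ^ 2 => 'a)"
 shows "f (vector [y, 1]) : adjoin F {y}"
proof (rule hform_value[OF f subfield_adjoin adjoin_subset])
 fix i :: 2
 show "vector [y, 1] $ i : adjoin F {y}"
  using exhaust_2[of i] adjoin_gen[of "{y}" F] subfield_1[OF subfield_adjoin] by auto
qed

text \<open>Evaluate at the generic point (y : 1). Its image (w : 1) satisfies F(w) = F(y), so w is
  a Moebius function of y, and an identity between forms at the generic point holds
  everywhere.\<close>

theorem P1_automorphism:
 fixes m :: "('a::alg_closed_field, 2) ppoint => ('a, 2) ppoint"
 assumes F: "is_subfield F" and y: "y \<notin> alg_cl F" and m: "isomorphism F P1 P1 m"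
 obtains a b c d where "a : F" "b : F" "c : F" "d : F" "a * d - b * c ~= 0"
  "!!v. v ~= 0 ==> m (pt v) = pt (vector [a * v $ 1 + b * v $ 2, c * v $ 1 + d * v $ 2])"
proof -
 define \<eta> where "\<eta> = (vector [y, 1] :: 'a ^ 2)"
 have e0: "\<eta> ~= 0" by (simp add: \<eta>_def vector2_eq_0)
 have eP: "pt \<eta> : P1" by (rule proj_spaceI[OF e0])
 obtain m' where m': "regular_map F P1 P1 m'" "m' (m (pt \<eta>)) = pt \<eta>"
  using m eP unfolding isomorphism_def by auto
 have rm: "regular_map F P1 P1 m" using m unfolding isomorphism_def by simp
 obtain d G where G: "hmap F d G" "repr P1 G m" "\<forall>v\<in>pt \<eta>. G v ~= 0" by (rule regular_mapE[OF rm F eP])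
 have mP: "m (pt \<eta>) : P1" by (rule regular_map_in[OF rm eP])
 obtain e H where H: "hmap F e H" "repr P1 H m'" "\<forall>v\<in>m (pt \<eta>). H v ~= 0" by (rule regular_mapE[OF m'(1) F mP])
 have Ge: "G \<eta> ~= 0" "m (pt \<eta>) = pt (G \<eta>)" using G(2,3) eP pt_self[of \<eta>] unfolding repr_def by auto
 have HG: "H (G \<eta>) ~= 0" "pt \<eta> = pt (H (G \<eta>))"
  using H(2,3) mP m'(2) pt_self[of "G \<eta>"] unfolding repr_def Ge(2) by auto
 have Gy: "G \<eta> $ i : adjoin F {y}" for i
  using hform_generic_value[OF F, of d "%v. G v $ i" y] G(1) unfolding hmap_def \<eta>_def by simp
 have yH: "y * H (G \<eta>) $ 2 = H (G \<eta>) $ 1"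
  using pt_eq_minors[OF HG(2), of 1 2] by (simp add: \<eta>_def)
 have yF: "y \<notin> F" using y alg_cl_subset[OF F] by blast
 have H2: "H (G \<eta>) $ 2 ~= 0"
 proof
  assume "H (G \<eta>) $ 2 = 0"
  then have "H (G \<eta>) = 0" using yH by (intro vec2_eqI) auto
  then show False using HG(1) by simp
 qed
 have y_eq: "y = H (G \<eta>) $ 1 / H (G \<eta>) $ 2" using yH H2 by (simp add: field_simps)
 \<comment> \<open>Otherwise the generic point would go to infinity, and the inverse map, defined
   over \<open>F\<close>, would return a point with coordinate in \<open>F\<close>.\<close>
 have G2: "G \<eta> $ 2 ~= 0"
 proof
  assume z: "G \<eta> $ 2 = 0"
  then have g: "G \<eta> = (G \<eta> $ 1) *s vector [1, 0]" by (intro vec2_eqI) auto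
  then have "H (G \<eta>) = (G \<eta> $ 1) ^ e *s H (vector [1, 0])" using hmap_homogeneous[OF H(1)] by metis
  moreover have "H (vector [1, 0]) $ i : F" for i
  proof (rule hform_value[of F e "%v. H v $ i" F "vector [1, 0]"])
   show "hform F e (%v. H v $ i)" using H(1) unfolding hmap_def by simp
   show "vector [1, 0] $ j : F" for j :: 2 using exhaust_2[of j] subfield_0[OF F] subfield_1[OF F] by auto
  qed (use F in auto)
  moreover have "G \<eta> $ 1 ~= 0" using Ge(1) z by (metis vec2_eqI zero_index)
  ultimately have "y = H (vector [1, 0]) $ 1 / H (vector [1, 0]) $ 2" using y_eq by simp
  then show False using yF \<open>!!i. H (vector [1, 0]) $ i : F\<close> F by (metis subfield_divide)
 qed
 define w where "w = G \<eta> $ 1 / G \<eta> $ 2"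
 have wF: "w : adjoin F {y}" unfolding w_def by (intro subfield_divide subfield_adjoin Gy)
 have Gw: "G \<eta> = (G \<eta> $ 2) *s vector [w, 1]" using G2 by (intro vec2_eqI) (auto simp: w_def)
 have yw: "y : adjoin F {w}"
 proof -
  have "H (G \<eta>) = (G \<eta> $ 2) ^ e *s H (vector [w, 1])" using hmap_homogeneous[OF H(1)] Gw by metis
  then have "y = H (vector [w, 1]) $ 1 / H (vector [w, 1]) $ 2" using y_eq G2 by simp
  moreover have "H (vector [w, 1]) $ i : adjoin F {w}" for i
   using hform_generic_value[OF F, of e "%v. H v $ i" w] H(1) unfolding hmap_def by simp
  ultimately show ?thesis by (metis subfield_divide subfield_adjoin)
 qed
 obtain a b c d where M: "a : F" "b : F" "c : F" "d : F" "a * d - b * c ~= 0" "c * y + d ~= 0"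
  "w = (a * y + b) / (c * y + d)"
  using rational_generator_moebius[OF F y wF yw] by blast
 have "m (pt v) = pt (vector [a * v $ 1 + b * v $ 2, c * v $ 1 + d * v $ 2])" if v: "v ~= 0" for v
 proof -
  have vP: "pt v : P1" by (rule proj_spaceI[OF v])
  obtain n K where K: "hmap F n K" "repr P1 K m" "\<forall>w\<in>pt v. K w ~= 0" by (rule regular_mapE[OF rm F vP])
  have Kv: "K v ~= 0" "m (pt v) = pt (K v)" using K(2,3) vP pt_self[of v] unfolding repr_def by auto
  have Kf: "hform F n (%v. K v $ i)" for i using K(1) unfolding hmap_def by simp
  have Ke: "K \<eta> ~= 0"
  proof
   assume "K \<eta> = 0"
   then have "K v $ i = 0" for i using hform_generic_zero[OF F y Kf[of i]] unfolding \<eta>_def by simp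
   then show False using Kv by (simp add: vec_eq_iff)
  qed
  then have "pt (K \<eta>) = pt (G \<eta>)" using K(2) eP pt_self[of \<eta>] Ge(2) unfolding repr_def by auto
  then have "K \<eta> $ 1 * G \<eta> $ 2 = K \<eta> $ 2 * G \<eta> $ 1" using pt_eq_minors by blast
  then have kw: "K \<eta> $ 1 = K \<eta> $ 2 * w" using G2 by (simp add: w_def field_simps)
  \<comment> \<open>The minor comparing a local expression of m with the Moebius map; it vanishes at
    the generic point and therefore identically.\<close>
  define f where "f v = K v $ 1 * (c * v $ 1 + d * v $ 2) - K v $ 2 * (a * v $ 1 + b * v $ 2)" for v :: "'a ^ 2"
  have lin: "hform F 1 (%v :: 'a ^ 2. p * v $ 1 + q * v $ 2)" if "p : F" "q : F" for p q
   by (intro hform.add hform_smult[OF F] hform_coord[OF F] that)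
  have "hform F (n + 1) f" unfolding f_def
   by (intro hform_diff[OF F] hform_mult[OF F] Kf lin M)
  moreover have "f (vector [y, 1]) = 0"
   using kw M(6,7) unfolding f_def \<eta>_def by (simp add: field_simps)
  ultimately have "f v = 0" using hform_generic_zero[OF F y] by blast
  then have min: "K v $ 1 * (c * v $ 1 + d * v $ 2) = K v $ 2 * (a * v $ 1 + b * v $ 2)" unfolding f_def by simp
  have nz: "vector [a * v $ 1 + b * v $ 2, c * v $ 1 + d * v $ 2] ~= (0 :: 'a ^ 2)"
  proof
   assume "vector [a * v $ 1 + b * v $ 2, c * v $ 1 + d * v $ 2] = (0 :: 'a ^ 2)"
   then have e: "a * v $ 1 + b * v $ 2 = 0" "c * v $ 1 + d * v $ 2 = 0" by (simp_all add: vector2_eq_0)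
   have "(a * d - b * c) * v $ 1 = d * (a * v $ 1 + b * v $ 2) - b * (c * v $ 1 + d * v $ 2)"
    "(a * d - b * c) * v $ 2 = a * (c * v $ 1 + d * v $ 2) - c * (a * v $ 1 + b * v $ 2)"
    by (simp_all add: algebra_simps)
   then have "v $ 1 = 0" "v $ 2 = 0" using e M(5) by simp_all
   then show False using v by (metis vec2_eqI zero_index)
  qed
  show ?thesis unfolding Kv(2) using min by (intro pt2_eqI Kv(1) nz) simp
 qed
 then show thesis using that M(1-5) by blast
qed

lemma P1_automorphism_fixing:
 fixes m :: "('a::alg_closed_field, 2) ppoint => ('a, 2) ppoint"
 assumes F: "is_subfield F" and y: "y \<notin> alg_cl F" and m: "isomorphism F P1 P1 m"
  and fx: "m ` {pt_zero, pt_infinity} = {pt_zero, pt_infinity}"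
 obtains c where "c : F" "c ~= 0" "!!v. v ~= 0 ==> m (pt v) = pt (vector [c * v $ 1, v $ 2])"
  | c where "c : F" "c ~= 0" "!!v. v ~= 0 ==> m (pt v) = pt (vector [c * v $ 2, v $ 1])"
proof -
 obtain a b c d where M: "a : F" "b : F" "c : F" "d : F" "a * d - b * c ~= 0"
  "!!v. v ~= 0 ==> m (pt v) = pt (vector [a * v $ 1 + b * v $ 2, c * v $ 1 + d * v $ 2])"
  using P1_automorphism[OF F y m] by blast
 have i: "m pt_zero = pt (vector [b, d])" "m pt_infinity = pt (vector [a, c])"
  unfolding pt_zero_def pt_infinity_def by (simp_all add: M(6) vector2_eq_0)
 have z: "b = 0" if "pt (vector [b, d]) = pt_zero" for b d :: 'a
  using pt_eq_minors[OF that[unfolded pt_zero_def], of 1 2] by simp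
 have n: "d = 0" if "pt (vector [b, d]) = pt_infinity" for b d :: 'a
  using pt_eq_minors[OF that[unfolded pt_infinity_def], of 1 2] by simp
 have zi: "(pt_zero :: ('a, 2) ppoint) ~= pt_infinity"
  using z[of 1 0] unfolding pt_infinity_def by auto
 have "m pt_zero ~= m pt_infinity"
 proof
  assume "m pt_zero = m pt_infinity"
  then have "card (m ` {pt_zero, pt_infinity}) = 1" by simp
  then show False using zi unfolding fx by simp
 qed
 then consider "m pt_zero = pt_zero" "m pt_infinity = pt_infinity"
  | "m pt_zero = pt_infinity" "m pt_infinity = pt_zero" using fx by auto
 then show thesis
 proof cases
  case 1
  then have bc: "b = 0" "c = 0" using z n i by metis+
  then have ad: "a ~= 0" "d ~= 0" using M(5) by auto
  have "m (pt v) = pt (vector [(a / d) * v $ 1, v $ 2])" if "v ~= 0" for v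
  proof -
   have "vector [a * v $ 1 + b * v $ 2, c * v $ 1 + d * v $ 2] = d *s (vector [(a / d) * v $ 1, v $ 2] :: 'a ^ 2)"
    using ad bc by (intro vec2_eqI) auto
   then show ?thesis using M(6)[OF that] pt_scale[OF ad(2)] by simp
  qed
  then show thesis using that(1)[of "a / d"] ad M F by (auto intro: subfield_divide)
 next
  case 2
  then have bc: "a = 0" "d = 0" using z n i by metis+
  then have ad: "b ~= 0" "c ~= 0" using M(5) by auto
  have "m (pt v) = pt (vector [(b / c) * v $ 2, v $ 1])" if "v ~= 0" for v
  proof -
   have "vector [a * v $ 1 + b * v $ 2, c * v $ 1 + d * v $ 2] = c *s (vector [(b / c) * v $ 2, v $ 1] :: 'a ^ 2)"
    using ad bc by (intro vec2_eqI) auto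
   then show ?thesis using M(6)[OF that] pt_scale[OF ad(2)] by simp
  qed
  then show thesis using that(2)[of "b / c"] ad M F by (auto intro: subfield_divide)
 qed
qed

section \<open>Conjugate pairs of forms\<close>

context quad
begin

abbreviation q where "q \<equiv> fst ` C"

lemma q: "is_subfield q"
 unfolding fst_C by (rule subfield_adjoin)

lemma q_I: "(a, a') : C ==> a : q" "(a, a') : C ==> a' : q"
 using C_swap by (force intro: image_eqI[of _ fst])+

lemma k_q: "k \<subseteq> q" and th_q: "th : q" "th' : q"
 using q_I C_const C_gen by blast+

text \<open>Forms with coefficients in the algebra, recorded by their two evaluations. In the
  nonsplit case \<open>f'\<close> is the conjugate of \<open>f\<close>; in the split case the two
  are independent forms over k.\<close>

definition cform :: "nat => ('a ^ 'n::finite => 'a) => ('a ^ 'n => 'a) => bool" where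
 "cform d f f' \<longleftrightarrow> (\<exists>a b. hform k d a & hform k d b & (\<forall>v. f v = a v + th * b v) & (\<forall>v. f' v = a v + th' * b v))"

lemma cformE:
 assumes "cform d f f'"
 obtains a b where "hform k d a" "hform k d b" "f = (%v. a v + th * b v)" "f' = (%v. a v + th' * b v)"
 using assms unfolding cform_def by (auto simp: fun_eq_iff[symmetric])

lemma cformI:
 "hform k d a ==> hform k d b ==> (!!v. f v = a v + th * b v) ==> (!!v. f' v = a v + th' * b v) ==> cform d f f'"
 unfolding cform_def by blast

lemma cform_of_k: "hform k d f ==> cform d f f"
 by (rule cformI[OF _ hform.zero]) auto

lemma cform_swap: "cform d f f' ==> cform d f' f"
proof (elim cformE)
 fix a b assume ab: "hform k d a" "hform k d b" "f = (%v. a v + th * b v)" "f' = (%v. a v + th' * b v)"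
 have 1: "hform k d (%v. a v + (th + th') * b v)" by (intro hform.add hform_smult[OF k] ab tr)
 have 2: "hform k d (%v. - b v)" by (intro hform_uminus[OF k] ab)
 show "cform d f' f" by (rule cformI[OF 1 2]) (simp_all add: ab algebra_simps)
qed

lemma cform_add: "cform d f f' ==> cform d g g' ==> cform d (%v. f v + g v) (%v. f' v + g' v)"
proof (elim cformE)
 fix a b c e assume ab: "hform k d a" "hform k d b" "f = (%v. a v + th * b v)" "f' = (%v. a v + th' * b v)"
  "hform k d c" "hform k d e" "g = (%v. c v + th * e v)" "g' = (%v. c v + th' * e v)"
 show "cform d (%v. f v + g v) (%v. f' v + g' v)"
  by (rule cformI[of d "%v. a v + c v" "%v. b v + e v"])
   (use ab in \<open>auto intro!: hform.add simp: algebra_simps\<close>)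
qed

lemma cform_mult: "cform d f f' ==> cform n g g' ==> cform (d + n) (%v. f v * g v) (%v. f' v * g' v)"
proof (elim cformE)
 fix a b c e assume ab: "hform k d a" "hform k d b" "f = (%v. a v + th * b v)" "f' = (%v. a v + th' * b v)"
  "hform k n c" "hform k n e" "g = (%v. c v + th * e v)" "g' = (%v. c v + th' * e v)"
 have m: "- (th * th') : k" by (intro subfield_uminus k nm)
 have 1: "hform k (d + n) (%v. a v * c v + - (th * th') * (b v * e v))"
  by (intro hform.add hform_smult[OF k] hform_mult[OF k] ab m)
 have 2: "hform k (d + n) (%v. a v * e v + b v * c v + (th + th') * (b v * e v))"
  by (intro hform.add hform_smult[OF k] hform_mult[OF k] ab tr)
 show "cform (d + n) (%v. f v * g v) (%v. f' v * g' v)"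
  by (rule cformI[OF 1 2]) (simp_all add: ab algebra_simps)
qed

lemma cform_const: "(a, a') : C ==> cform 0 (%_. a) (%_. a')"
proof (elim C_E)
 fix al bt assume "al : k" "bt : k" "a = al + bt * th" "a' = al + bt * th'"
 then show ?thesis by (intro cformI[OF hform.const[of al] hform.const[of bt]]) auto
qed

lemma cform_smult: "(a, a') : C ==> cform d f f' ==> cform d (%v. a * f v) (%v. a' * f' v)"
 using cform_mult[OF cform_const, of a a' d f f'] by simp

lemma cform_diff: "cform d f f' ==> cform d g g' ==> cform d (%v. f v - g v) (%v. f' v - g' v)"
 using cform_add[OF _ cform_smult[of "-1" "-1" d g g'], of f f'] C_const[of "-1"] k
 by (simp add: subfield_uminus subfield_1)

lemma cform_sum: "(!!i. i : S ==> cform d (f i) (f' i)) ==> cform d (%v. \<Sum>i\<in>S. f i v) (%v. \<Sum>i\<in>S. f' i v)"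
proof (induction S rule: infinite_finite_induct)
 case (insert x S)
 have "cform d (%v. f x v + (\<Sum>i\<in>S. f i v)) (%v. f' x v + (\<Sum>i\<in>S. f' i v))"
  by (rule cform_add) (use insert in auto)
 then show ?case using insert by simp
qed (simp_all add: cform_of_k hform.zero)

lemma cform_power: "cform d f f' ==> cform (n * d) (%v. f v ^ n) (%v. f' v ^ n)"
proof (induction n)
 case 0
 then show ?case using cform_const[OF C_const[OF subfield_1[OF k]]] by simp
next
 case (Suc n)
 then show ?case using cform_mult[of d f f' "n * d" "%v. f v ^ n" "%v. f' v ^ n"] by (simp add: add.commute)
qed

lemma cform_trace: "cform d f f' ==> hform k d (%v. f v + f' v)"
proof (elim cformE)
 fix a b assume ab: "hform k d a" "hform k d b" "f = (%v. a v + th * b v)" "f' = (%v. a v + th' * b v)"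
 have "hform k d (%v. a v + a v + (th + th') * b v)" by (intro hform.add hform_smult[OF k] ab tr)
 then show ?thesis unfolding ab by (simp add: algebra_simps)
qed

lemma cform_norm: "cform d f f' ==> hform k (d + d) (%v. f v * f' v)"
proof (elim cformE)
 fix a b assume ab: "hform k d a" "hform k d b" "f = (%v. a v + th * b v)" "f' = (%v. a v + th' * b v)"
 have "hform k (d + d) (%v. a v * a v + (th + th') * (a v * b v) + th * th' * (b v * b v))"
  by (intro hform.add hform_smult[OF k] hform_mult[OF k] ab tr nm)
 then show ?thesis unfolding ab by (simp add: algebra_simps)
qed

lemma cform_hform: "cform d f f' ==> hform q d f"
proof (elim cformE)
 fix a b assume ab: "hform k d a" "hform k d b" "f = (%v. a v + th * b v)" "f' = (%v. a v + th' * b v)"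
 show ?thesis unfolding ab using hform_mono[OF ab(1) k_q] hform_mono[OF ab(2) k_q]
  by (intro hform.add hform_smult[OF q] th_q)
qed

lemma cform_form:
 assumes "!!e. (c e, c' e) : C" shows "cform d (form d c) (form d c')"
proof -
 have "\<forall>e. \<exists>al bt. al : k & bt : k & c e = al + bt * th & c' e = al + bt * th'"
  by (rule allI, rule C_E[OF assms]) blast
 then obtain al bt where ab: "!!e. al e : k & bt e : k & c e = al e + bt e * th & c' e = al e + bt e * th'" by metis
 show ?thesis
  by (rule cformI[of d "form d al" "form d bt"])
   (use ab in \<open>auto intro: hform_form simp: form_def sum.distrib sum_distrib_left algebra_simps\<close>)
qed

end

text \<open>An identity p + th r = 0 with p and r over k forces p = r = 0 when th is outside k, and
  this also kills the conjugate p + th' r.\<close>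

lemma cform_zero:
 fixes f f' :: "'a::alg_closed_field ^ 2 => 'a"
 assumes quad: "quad k th th'" and t: "th \<notin> k" and f: "quad.cform k th th' d f f'"
  and z: "!!v. f v = 0"
 shows "f' v = 0"
proof -
 interpret quad k th th' by (rule quad)
 obtain a b where ab: "hform k d a" "hform k d b" "f = (%v. a v + th * b v)" "f' = (%v. a v + th' * b v)"
  using f by (rule cformE)
 obtain p r where p: "p : polys_over k" "\<forall>x. a (vector [x, 1]) = poly p x"
  and r: "r : polys_over k" "\<forall>x. b (vector [x, 1]) = poly r x"
  using hform_poly[OF k ab(1)] hform_poly[OF k ab(2)] by blast
 have "poly (p + smult th r) x = 0" for x using z[of "vector [x, 1]"] p r ab by simp
 then have "p + smult th r = 0" using infinite_UNIV_alg_closed poly_roots_finite[of "p + smult th r"] by auto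
 then have c: "coeff p i + th * coeff r i = 0" for i by (metis coeff_0 coeff_add coeff_smult)
 have "coeff r i = 0" for i
 proof (rule ccontr)
  assume n: "coeff r i ~= 0"
  have "th * coeff r i = - coeff p i" using c[of i] by (metis add_eq_0_iff)
  then have "th = - coeff p i / coeff r i" by (simp only: nonzero_eq_divide_eq[OF n])
  then show False using t coeff_polys_over[OF p(1)] coeff_polys_over[OF r(1)] k
   by (metis subfield_divide subfield_uminus)
 qed
 then have "r = 0" by (simp add: poly_eq_iff)
 moreover have "p = 0" using c \<open>r = 0\<close> by (simp add: poly_eq_iff)
 ultimately have "a v = 0" "b v = 0"
  using hform_zero_affine[OF ab(1)] hform_zero_affine[OF ab(2)] p r by simp_all
 then show ?thesis using ab by simp
qed

definition lin :: "'a::field ^ 'n::finite => 'a ^ 'n => 'a" where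
 "lin c v = (\<Sum>i\<in>UNIV. c $ i * v $ i)"

lemma lin_linear: "lin c (v + w) = lin c v + lin c w" "lin c (a *s v) = a * lin c v"
  "lin (a *s c) v = a * lin c v" "lin c 0 = 0"
 by (simp_all add: lin_def sum.distrib sum_distrib_left algebra_simps)

lemma hform_lin: "is_subfield F ==> (!!i. c $ i : F) ==> hform F 1 (lin c)"
 unfolding lin_def[abs_def] by (rule hform_linear)

lemma vecs_rational:
 assumes "pt v = pt w" "w $ j ~= 0" shows "v $ i / v $ j = w $ i / w $ j"
 using assms by (auto simp: pt_eq_iff)

context quad
begin

lemma cform_lin: "(!!i. (c $ i, c' $ i) : C) ==> cform 1 (lin c) (lin c')"
 unfolding lin_def[abs_def] by (rule cform_sum) (intro cform_smult cform_of_k hform_coord k)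

lemma C_zero_iff: "th \<notin> k ==> (a, a') : C ==> a = 0 \<longleftrightarrow> a' = 0"
 using C_graph unfolding field_graph_def by blast

lemma C_fixed: "th \<notin> k ==> (a, a') : C ==> a : k ==> a' = a"
 using C_zero_iff[OF _ C_diff[OF _ C_const], of a a' a] by simp

lemma C_inj: "th \<notin> k ==> (a, a') : C ==> (a, b) : C ==> b = a'"
 using C_zero_iff[OF _ C_diff, of a a' a b] by simp

lemma q_iff: "q = k \<longleftrightarrow> th : k"
proof
 show "q = k ==> th : k" using th_q by metis
 show "th : k ==> q = k" using C_split subfield_0[OF k] by (auto simp: fst_image_times)
qed

lemma nontrivial_aut_C:
 assumes s: "nontrivial_aut k q \<sigma>" and a: "(a, a') : C" shows "\<sigma> a = a'"
proof -
 have f: "field_iso k q q \<sigma>" and n: "\<exists>a\<in>q. \<sigma> a ~= a" using s unfolding nontrivial_aut_def by auto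
 note c = iso_C[OF f q th_q k_q]
 have "\<sigma> th ~= th" using n c(1) by auto
 then have "\<sigma> th = th'" using iso_quad[OF f q th_q] by blast
 then show ?thesis using c(2)[OF a] by blast
qed

lemma nontrivial_aut_notin: "nontrivial_aut k q \<sigma> ==> th \<notin> k"
 using q_iff field_isoD(2) unfolding nontrivial_aut_def by metis

text \<open>The automorphism is the conjugation read off from the pairs. Values outside
  \<open>q\<close> are pinned down by \<open>extensional\<close>, so uniqueness holds as an equation
  of functions.\<close>

lemma nontrivial_aut_unique:
 assumes "q ~= k" shows "\<exists>!\<sigma>. \<sigma> \<in> extensional q & nontrivial_aut k q \<sigma>"
proof
 have t: "th \<notin> k" using q_iff assms by blast
 define s where "s = restrict (%a. THE a'. (a, a') : C) q"
 have s: "s a = a'" if "(a, a') : C" for a a'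
  unfolding s_def using that q_I(1)[OF that] C_inj[OF t] by (auto intro: the_equality)
 have qE: "\<exists>a'. (a, a') : C" if "a : q" for a using that by auto
 have bij: "bij_betw s q q"
  by (rule bij_betw_byWitness[of q s s]) (use s C_swap q_I qE in \<open>force+\<close>)
 have "field_iso k q q s" unfolding field_iso_def
 proof (intro conjI ballI bij)
  show "s a = a" if "a : k" for a by (rule s[OF C_const[OF that]])
  fix a b assume "a : q" "b : q"
  then obtain a' b' where ab: "(a, a') : C" "(b, b') : C" using qE by blast
  show "s (a + b) = s a + s b" "s (a * b) = s a * s b"
   using s[OF C_add[OF ab]] s[OF C_mult[OF ab]] s[OF ab(1)] s[OF ab(2)] by simp_all
 qed
 then show "s : extensional q & nontrivial_aut k q s"
  using s[OF C_gen] ne th_q(1) unfolding nontrivial_aut_def by (intro conjI bexI[of _ th]) (simp_all add: s_def)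
 fix \<sigma> assume S: "\<sigma> : extensional q & nontrivial_aut k q \<sigma>"
 show "\<sigma> = s"
 proof (rule extensionalityI[of _ q])
  show "\<sigma> a = s a" if "a : q" for a
   using qE[OF that] nontrivial_aut_C[of \<sigma>] S s by metis
 qed (use S in \<open>auto simp: s_def\<close>)
qed

end

section \<open>Conics in diagonal coordinates\<close>

text \<open>Geometrically U = 0 and V = 0 are the tangents at p2 and p1, Z = 0 is the line joining
  these points, and r is where the tangents meet; (p1, p2, r) and (u, w, z) are dual bases. The
  first two members of each basis are conjugate, the third is rational.\<close>

locale conic_data = quad k th th' for k :: "'a::alg_closed_field set" and th th' +
 fixes lam :: 'a and p1 p2 r u w z :: "'a ^ 3" and Q :: "('a, 3) ppoint set" and D :: "('a, 3) ppoint multiset"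
 assumes lam: "lam : k" "lam ~= 0"
  and p: "!!i. (p1 $ i, p2 $ i) : C" and r: "!!i. r $ i : k"
  and uw: "!!i. (u $ i, w $ i) : C" and z: "!!i. z $ i : k"
  and dual: "lin u p1 = 1" "lin u p2 = 0" "lin u r = 0" "lin w p1 = 0" "lin w p2 = 1" "lin w r = 0"
   "lin z p1 = 0" "lin z p2 = 0" "lin z r = 1"
  and recon: "!!v. v = lin u v *s p1 + lin w v *s p2 + lin z v *s r"
  and Q: "Q = {pt v | v. v ~= 0 & lin u v * lin w v = lam * (lin z v)\<^sup>2}"
  and D: "D = {#pt p1, pt p2#}"
begin

abbreviation "U \<equiv> lin u"
abbreviation "V \<equiv> lin w"
abbreviation "Z \<equiv> lin z"

definition comb :: "'a => 'a => 'a => 'a ^ 3" where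
 "comb a b c = a *s p1 + b *s p2 + c *s r"

lemma comb [simp]: "U (comb a b c) = a" "V (comb a b c) = b" "Z (comb a b c) = c"
 unfolding comb_def by (simp_all add: lin_linear dual)

lemma comb_recon: "comb (U v) (V v) (Z v) = v"
 unfolding comb_def using recon[of v] by simp

lemma comb_scale: "d *s comb a b c = comb (d * a) (d * b) (d * c)"
 unfolding comb_def by (simp add: vec_eq_iff algebra_simps)

lemma comb_nth: "comb a b c $ i = a * p1 $ i + b * p2 $ i + c * r $ i"
 unfolding comb_def by simp

lemma coords_eqI: "U v = U v' ==> V v = V v' ==> Z v = Z v' ==> v = v'"
 by (metis comb_recon)

lemma coords_0: "U v = 0 ==> V v = 0 ==> Z v = 0 ==> v = 0"
 using coords_eqI[of v 0] by (simp add: lin_linear)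

lemma comb_eq_0: "comb a b c = 0 \<longleftrightarrow> a = 0 & b = 0 & c = 0"
proof
 show "comb a b c = 0 ==> a = 0 & b = 0 & c = 0" using comb[of a b c] by (metis lin_linear(4))
 show "a = 0 & b = 0 & c = 0 ==> comb a b c = 0" by (simp add: comb_def)
qed

definition on_Q :: "'a ^ 3 => bool" where
 "on_Q v \<longleftrightarrow> v ~= 0 & U v * V v = lam * (Z v)\<^sup>2"

lemma Q_pt: "on_Q v ==> pt v : Q"
 unfolding Q on_Q_def by blast

lemma Q_mem: assumes "P : Q" "v : P" shows "on_Q v" "P = pt v"
proof -
 obtain v' where v': "P = pt v'" "on_Q v'" using assms(1) unfolding Q on_Q_def by blast
 then obtain c where c: "c ~= 0" "v = c *s v'" using assms(2) by (auto simp: pt_mem)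
 show "on_Q v" using v'(2) c unfolding on_Q_def by (auto simp: lin_linear power2_eq_square)
 show "P = pt v" using pt_mem_eq[of v v'] assms(2) v'(1) by simp
qed

lemma Q_E: assumes "P : Q" obtains v where "on_Q v" "P = pt v"
 using assms unfolding Q on_Q_def by blast

lemma Q_proj: "Q \<subseteq> proj_space"
 by (auto elim!: Q_E intro: proj_spaceI simp: on_Q_def)

lemma cform_UV: "cform 1 U V" and hform_Z: "hform k 1 Z" and hform_U: "hform q 1 U" and hform_V: "hform q 1 V"
 using cform_lin[of u w] uw hform_lin[OF k, of z] z cform_hform cform_swap by blast+

lemma p_q: "p1 $ i : q" "p2 $ i : q" "r $ i : q"
 using q_I[OF p] k_q r by blast+

lemma p_nonzero: "p1 ~= 0" "p2 ~= 0"
 using dual by (auto simp: lin_linear)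

lemma pt_p_distinct: "pt p1 ~= pt p2"
 using dual by (auto simp: pt_eq_iff lin_linear)

lemma D_set: "set_mset D = {pt p1, pt p2}"
 by (simp add: D)

text \<open>Parametrization inverse to t = U / Z, with p2 at 0 and p1 at infinity. The factor
  \<open>lam\<close> at the second coordinate is what turns conjugation into t -> lam / t.\<close>

definition H :: "'a ^ 2 => 'a ^ 3" where
 "H v = comb ((v $ 1)\<^sup>2) (lam * (v $ 2)\<^sup>2) (v $ 1 * v $ 2)"

lemma H_nonzero: "v ~= 0 ==> H v ~= 0"
 unfolding H_def comb_eq_0 using lam by (auto simp: vec_eq_iff forall_2)

lemma H_on_Q: "v ~= 0 ==> on_Q (H v)"
 using H_nonzero[of v] unfolding on_Q_def by (simp add: H_def power2_eq_square)

lemma hmap_H: "hmap q 2 H"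
 unfolding hmap_def
proof
 fix j
 have sq: "hform q 2 (%v :: 'a ^ 2. v $ i * v $ i')" for i i'
  using hform_mult[OF q hform_coord[OF q] hform_coord[OF q], of i i'] by (simp add: numeral_2_eq_2)
 have "hform q 2 (%v :: 'a ^ 2. p1 $ j * (v $ 1 * v $ 1) + lam * p2 $ j * (v $ 2 * v $ 2) + r $ j * (v $ 1 * v $ 2))"
  using p_q lam k_q by (intro hform.add hform_smult[OF q] sq subfield_mult[OF q]) auto
 then show "hform q 2 (%v. H v $ j)" unfolding H_def comb_nth by (simp add: power2_eq_square algebra_simps)
qed

definition \<iota> where "\<iota> = induced H"

lemma iota_pt: "\<iota> (pt v) = pt (H v)"
 unfolding \<iota>_def by (rule induced_pt[OF hmap_H])

lemma iota_zero: "\<iota> pt_zero = pt p2" and iota_infinity: "\<iota> pt_infinity = pt p1"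
proof -
 have "H (vector [0, 1]) = lam *s p2" "H (vector [1, 0]) = p1"
  unfolding H_def comb_def by simp_all
 then show "\<iota> pt_zero = pt p2" "\<iota> pt_infinity = pt p1"
  unfolding pt_zero_def pt_infinity_def iota_pt using pt_scale[OF lam(2)] by simp_all
qed

lemma H_inj:
 assumes "v ~= 0" "v' ~= 0" "pt (H v) = pt (H v')" shows "pt v = pt v'"
proof -
 obtain c where "H v = c *s H v'" using assms(3) pt_eq_iff by metis
 then have "U (H v) = c * U (H v')" "V (H v) = c * V (H v')" "Z (H v) = c * Z (H v')"
  by (simp_all add: lin_linear)
 then have e: "(v $ 1)\<^sup>2 = c * (v' $ 1)\<^sup>2" "(v $ 2)\<^sup>2 = c * (v' $ 2)\<^sup>2" "v $ 1 * v $ 2 = c * (v' $ 1 * v' $ 2)"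
  using lam by (simp_all add: H_def)
 have "(v $ 1 * v' $ 2 - v $ 2 * v' $ 1)\<^sup>2 =
   (v $ 1)\<^sup>2 * (v' $ 2)\<^sup>2 - 2 * (v $ 1 * v $ 2) * (v' $ 1 * v' $ 2) + (v $ 2)\<^sup>2 * (v' $ 1)\<^sup>2"
  by (simp add: power2_eq_square algebra_simps)
 also have "\<dots> = 0" unfolding e by (simp add: power2_eq_square algebra_simps)
 finally show ?thesis using assms by (intro pt2_eqI) auto
qed

text \<open>The inverse of the parametrization has two expressions, (U : Z) and (lam Z : V); they
  cover \<open>Q\<close> because U and V have no common zero on it.\<close>

lemma chart1: assumes v: "on_Q v" and U: "U v ~= 0" shows "\<iota> (pt (vector [U v, Z v])) = pt v"
proof -
 have "H (vector [U v, Z v]) = U v *s comb (U v) (V v) (Z v)"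
  using v unfolding H_def comb_scale on_Q_def by (simp add: power2_eq_square)
 then show ?thesis unfolding iota_pt using U by (simp add: comb_recon pt_scale)
qed

lemma chart2: assumes v: "on_Q v" and V: "V v ~= 0" shows "\<iota> (pt (vector [lam * Z v, V v])) = pt v"
proof -
 have "(lam * Z v)\<^sup>2 = lam * (lam * (Z v)\<^sup>2)" by (simp add: power2_eq_square)
 also have "\<dots> = lam * (U v * V v)" using v unfolding on_Q_def by simp
 also have "\<dots> = lam * V v * U v" by (simp add: mult_ac)
 finally have a: "(lam * Z v)\<^sup>2 = lam * V v * U v" .
 have "H (vector [lam * Z v, V v]) = (lam * V v) *s comb (U v) (V v) (Z v)"
  unfolding H_def comb_scale vector_2 a by (simp add: power2_eq_square mult_ac)
 then show ?thesis unfolding iota_pt using V lam by (simp add: comb_recon pt_scale)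
qed

lemma on_Q_cases: assumes "on_Q v" obtains "U v ~= 0" | "V v ~= 0"
proof -
 have "Z v = 0" if "U v = 0" "V v = 0" using assms that lam by (simp add: on_Q_def)
 then show thesis using that assms coords_0[of v] unfolding on_Q_def by blast
qed

lemma iota_bij: "bij_betw \<iota> P1 Q"
 unfolding bij_betw_def
proof
 show "inj_on \<iota> P1"
 proof (rule inj_onI)
  fix x y :: "('a, 2) ppoint" assume "x : P1" "y : P1" and e: "\<iota> x = \<iota> y"
  then obtain v v' where "v ~= 0" "v' ~= 0" "x = pt v" "y = pt v'" by (metis proj_spaceE)
  then show "x = y" using H_inj[of v v'] e by (simp add: iota_pt)
 qed
 have "P : \<iota> ` P1" if P: "P : Q" for P
 proof -
  obtain v where v: "on_Q v" "P = pt v" by (rule Q_E[OF P])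
  show ?thesis
  proof (rule on_Q_cases[OF v(1)])
   assume "U v ~= 0"
   then show ?thesis using chart1[OF v(1)] v(2) proj_spaceI[of "vector [U v, Z v] :: 'a ^ 2"]
    by (metis image_eqI vector2_eq_0)
  next
   assume "V v ~= 0"
   then show ?thesis using chart2[OF v(1)] v(2) proj_spaceI[of "vector [lam * Z v, V v] :: 'a ^ 2"]
    by (metis image_eqI vector2_eq_0)
  qed
 qed
 then show "\<iota> ` P1 = Q" by (auto elim!: proj_spaceE simp: iota_pt Q_pt[OF H_on_Q])
qed

definition \<iota>' where "\<iota>' = inv_into P1 \<iota>"

lemma iota_inv: "R : P1 ==> \<iota>' (\<iota> R) = R" "P : Q ==> \<iota> (\<iota>' P) = P" "P : Q ==> \<iota>' P : P1" "R : P1 ==> \<iota> R : Q"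
 unfolding \<iota>'_def using iota_bij
 by (simp_all add: bij_betw_inv_into_left bij_betw_inv_into_right bij_betwE bij_betw_inv_into[THEN bij_betwE])

lemma iota_inv_charts:
 assumes v: "on_Q v"
 shows "U v ~= 0 ==> \<iota>' (pt v) = pt (vector [U v, Z v])" "V v ~= 0 ==> \<iota>' (pt v) = pt (vector [lam * Z v, V v])"
 using chart1[OF v] chart2[OF v] iota_inv(1)[of "pt (vector [_, _])"]
 by (metis proj_spaceI vector2_eq_0)+

lemma iota_isomorphism:
 assumes F: "is_subfield F" "q \<subseteq> F" shows "isomorphism F P1 Q \<iota>"
proof (rule isomorphism_mono[OF _ F(2)])
 have "regular_map q P1 Q \<iota>"
 proof (rule regular_map_global[OF q hmap_H])
  fix P :: "('a, 2) ppoint" and v assume "P : P1" "v : P"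
  then show "H v ~= 0 & \<iota> P = pt (H v)" using proj_space_mem[of P v] H_nonzero by (auto simp: iota_pt)
 qed (rule iota_inv(4))
 moreover have "regular_map q Q P1 \<iota>'"
  unfolding regular_map_iff[OF q]
 proof (intro conjI ballI)
  show "\<iota>' ` Q \<subseteq> P1" using iota_inv(3) by blast
  fix P assume P: "P : Q"
  obtain v where v: "on_Q v" "P = pt v" by (rule Q_E[OF P])
  define G1 G2 where "G1 v = (vector [U v, Z v] :: 'a ^ 2)" and "G2 v = (vector [lam * Z v, V v] :: 'a ^ 2)" for v
  have Zq: "hform q 1 Z" using hform_mono[OF hform_Z k_q] .
  have lq: "lam : q" using lam k_q by blast
  have G: "hmap q 1 G1" "hmap q 1 G2" unfolding hmap_def G1_def G2_def
   using hform_U hform_V Zq hform_smult[OF q Zq lq] by (auto simp: forall_2)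
  have z1: "G1 v = 0 \<longleftrightarrow> U v = 0" "G2 v = 0 \<longleftrightarrow> V v = 0" if "on_Q v" for v
   using that lam unfolding G1_def G2_def vector2_eq_0 on_Q_def by auto
  have R: "\<iota>' R = pt (G1 v)" if "R : Q" "v : R" "G1 v ~= 0" for R v
   using iota_inv_charts(1)[OF Q_mem(1)[OF that(1,2)]] z1(1)[OF Q_mem(1)[OF that(1,2)]] Q_mem(2)[OF that(1,2)] that(3)
   unfolding G1_def by simp
  have R': "\<iota>' R = pt (G2 v)" if "R : Q" "v : R" "G2 v ~= 0" for R v
   using iota_inv_charts(2)[OF Q_mem(1)[OF that(1,2)]] z1(2)[OF Q_mem(1)[OF that(1,2)]] Q_mem(2)[OF that(1,2)] that(3)
   unfolding G2_def by simp
  have RR: "repr Q G1 \<iota>'" "repr Q G2 \<iota>'" unfolding repr_def using R R' by simp_all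
  have "(\<forall>v\<in>P. G1 v ~= 0) \<or> (\<forall>v\<in>P. G2 v ~= 0)"
  proof (rule on_Q_cases[OF v(1)])
   assume "U v ~= 0"
   then have "\<forall>v\<in>P. U v ~= 0" unfolding v(2) by (auto simp: pt_mem lin_linear)
   then show ?thesis using z1 Q_mem[OF P] by blast
  next
   assume "V v ~= 0"
   then have "\<forall>v\<in>P. V v ~= 0" unfolding v(2) by (auto simp: pt_mem lin_linear)
   then show ?thesis using z1 Q_mem[OF P] by blast
  qed
  then show "\<exists>d g. hmap q d g & repr Q g \<iota>' & (\<forall>v\<in>P. g v ~= 0)" using G RR by blast
 qed
 ultimately show "isomorphism q P1 Q \<iota>" unfolding isomorphism_def using iota_inv by blast
qed

subsection \<open>The splitting field\<close>

lemma D_rational: assumes "P \<in># D" shows "rational_point q P"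
proof -
 have 1: "rational_point q (pt p1)" "rational_point q (pt p2)"
  unfolding rational_point_def using p_q by (intro bexI[OF _ pt_self] allI; simp)+
 have "P = pt p1 \<or> P = pt p2" using assms D_set by blast
 then show ?thesis using 1 by metis
qed

lemma splitting_field: "splitting_field k D = q"
proof
 show "splitting_field k D \<subseteq> q" unfolding splitting_field_def using q k_q D_rational by blast
 show "q \<subseteq> splitting_field k D" unfolding splitting_field_def fst_C
 proof (intro Inter_greatest)
  fix F assume "F : {F. is_subfield F & k \<subseteq> F & (\<forall>P\<in>#D. rational_point F P)}"
  then have F: "is_subfield F" "k \<subseteq> F" and "rational_point F (pt p1)" unfolding D by auto
  then obtain v where v: "v : pt p1" "!!i. v $ i : F" unfolding rational_point_def by blast
  have "th : F"
  proof (cases "th : k")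
   case False
   obtain j where j: "p1 $ j ~= 0" using p_nonzero by (auto simp: vec_eq_iff)
   have j': "p2 $ j ~= 0" using C_zero_iff[OF False p] j by blast
   have a: "p1 $ i / p1 $ j : F" for i
    using vecs_rational[OF pt_mem_eq[OF v(1)] j, of i] v(2) F by (metis subfield_divide)
   \<comment> \<open>If all coordinate ratios of p1 were in k, they would equal their conjugates and
     the two points would coincide. A ratio outside k generates k(th).\<close>
   have "\<exists>i. p1 $ i / p1 $ j \<notin> k"
   proof (rule ccontr)
    assume "\<not> ?thesis"
    then have "p2 $ i / p2 $ j = p1 $ i / p1 $ j" for i using C_fixed[OF False C_divide[OF p p]] by blast
    then have "p1 = (p1 $ j / p2 $ j) *s p2" using j j' by (simp add: vec_eq_iff field_simps)
    then have "pt p1 = pt p2" using j j' pt_scale[of "p1 $ j / p2 $ j" p2] by simp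
    then show False using pt_p_distinct by blast
   qed
   then obtain i where i: "p1 $ i / p1 $ j \<notin> k" by blast
   obtain al bt where ab: "al : k" "bt : k" "p1 $ i / p1 $ j = al + bt * th" by (rule C_E[OF C_divide[OF p p]])
   have b: "bt ~= 0" using i ab by auto
   have "th = (p1 $ i / p1 $ j - al) / bt" unfolding ab(3) using b by simp
   then show ?thesis using a[of i] ab F by (metis subfield_divide subfield_diff subsetD)
  qed (use F in blast)
  then show "adjoin k {th} \<subseteq> F" using F by (intro adjoin_least) auto
 qed
qed

subsection \<open>Change of parametrization\<close>

lemma conic_data_swap: "conic_data k th th' lam p2 p1 r w u z Q D"
proof (unfold_locales)
 show "v = lin w v *s p2 + lin u v *s p1 + lin z v *s r" for v using recon[of v] by (metis add.commute)
 show "Q = {pt v |v. v ~= 0 & lin w v * lin u v = lam * (lin z v)\<^sup>2}" unfolding Q by (simp add: mult.commute)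
 show "D = {#pt p2, pt p1#}" unfolding D by (simp add: add_mset_commute)
qed (use lam p r uw z dual C_swap in auto)

lemma conic_data_scale:
 assumes c: "(c, c') : C" "c ~= 0" "c' ~= 0"
 shows "conic_data k th th' (lam / (c * c')) (c *s p1) (c' *s p2) r ((1 / c) *s u) ((1 / c') *s w) z Q D"
proof (unfold_locales)
 show "lam / (c * c') : k" using lam C_norm[OF c(1)] k by (intro subfield_divide)
 have 1: "(1, 1) : C" using C_const subfield_1[OF k] by blast
 show "((c *s p1) $ i, (c' *s p2) $ i) : C" "(((1 / c) *s u) $ i, ((1 / c') *s w) $ i) : C" for i
  using C_mult[OF c(1) p[of i]] C_mult[OF C_divide[OF 1 c(1)] uw[of i]] by simp_all
 show "v = lin ((1 / c) *s u) v *s (c *s p1) + lin ((1 / c') *s w) v *s (c' *s p2) + lin z v *s r" for v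
  using recon[of v] c by (simp add: lin_linear vector_smult_assoc)
 show "Q = {pt v |v. v ~= 0 & lin ((1 / c) *s u) v * lin ((1 / c') *s w) v = lam / (c * c') * (lin z v)\<^sup>2}"
  unfolding Q using c by (simp add: lin_linear field_simps)
 show "D = {#pt (c *s p1), pt (c' *s p2)#}" unfolding D using c by (simp add: pt_scale)
qed (use lam c r z dual in \<open>auto simp: lin_linear\<close>)

end

section \<open>The map of degree three on a conic\<close>

lemma hform_monomial2: "is_subfield F ==> a : F ==> hform F n (%v :: 'a::field ^ 2. a * (v $ i) ^ n)"
 using hform_smult[of F n "%v. (v $ i) ^ n" a] hform_power[of F 1 "%v. v $ i" n] hform_coord[of F i] by simp

lemma phi0_pt: "phi0 lam (pt v) = pt (vector [(v $ 1) ^ 3, lam * (v $ 2) ^ 3])"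
 unfolding phi0_def
proof (rule induced_pt[of UNIV 3])
 show "hmap UNIV 3 (%v :: 'a ^ 2. vector [(v $ 1) ^ 3, lam * (v $ 2) ^ 3] :: 'a ^ 2)"
  using hform_monomial2[OF subfield_UNIV, of 1 3 1] hform_monomial2[OF subfield_UNIV, of lam 3 2]
  by (simp add: hmap_def forall_2)
qed

lemma alpha_pt: "alpha lam (pt v) = pt (vector [lam * v $ 2, v $ 1])"
 unfolding alpha_def
proof (rule induced_pt[of UNIV 1])
 show "hmap UNIV 1 (%v :: 'a ^ 2. vector [lam * v $ 2, v $ 1] :: 'a ^ 2)"
  using hform_monomial2[OF subfield_UNIV, of 1 1 1] hform_monomial2[OF subfield_UNIV, of lam 1 2]
  by (simp add: hmap_def forall_2)
qed

text \<open>Written without constants of the locale, so that one map \<open>j\<close> can be matched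
  with different normalized data for the same pair.\<close>

definition parametrizes :: "'a::field => 'a ^ 3 => 'a ^ 3 => 'a ^ 3 => (('a, 2) ppoint => ('a, 3) ppoint) => bool" where
 "parametrizes lam p1 p2 r j \<longleftrightarrow>
  (\<forall>x. x ~= 0 --> j (pt x) = pt ((x $ 1)\<^sup>2 *s p1 + (lam * (x $ 2)\<^sup>2) *s p2 + (x $ 1 * x $ 2) *s r))"

context conic_data
begin

definition \<Phi> :: "'a ^ 3 => 'a ^ 3" where
 "\<Phi> v = comb ((U v) ^ 3) ((V v) ^ 3) (lam * (Z v) ^ 3)"

lemma hmap_Phi: "hmap k 3 \<Phi>"
 unfolding hmap_def
proof
 fix j
 have UV: "cform 3 (%v. p1 $ j * (U v) ^ 3) (%v. p2 $ j * (V v) ^ 3)"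
  using cform_smult[OF p[of j] cform_power[OF cform_UV, of 3]] by simp
 have Z: "hform k 3 (%v. lam * r $ j * (Z v) ^ 3)"
  using hform_smult[OF k hform_power[OF k hform_Z], of "lam * r $ j" 3] lam r k by (simp add: subfield_mult)
 show "hform k 3 (%v. \<Phi> v $ j)"
  using hform.add[OF cform_trace[OF UV] Z] unfolding \<Phi>_def comb_nth by (simp add: algebra_simps)
qed

lemma Phi_on_Q: assumes "on_Q v" shows "on_Q (\<Phi> v)"
proof -
 have "(U v) ^ 3 * (V v) ^ 3 = (U v * V v) ^ 3" by (simp add: power_mult_distrib)
 also have "\<dots> = lam * (lam * (Z v) ^ 3)\<^sup>2"
  using assms unfolding on_Q_def by (simp add: power2_eq_square power3_eq_cube)
 finally show ?thesis using assms coords_0[of v] lam unfolding on_Q_def \<Phi>_def by (auto simp: comb_eq_0)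
qed

lemma Phi_H: "\<Phi> (H x) = H (vector [(x $ 1) ^ 3, lam * (x $ 2) ^ 3])"
 unfolding \<Phi>_def H_def by (simp add: power2_eq_square power3_eq_cube mult_ac)

lemma iota_parametrizes: "parametrizes lam p1 p2 r \<iota>"
 unfolding parametrizes_def by (simp add: iota_pt H_def comb_def)

lemma parametrizes_iff: "parametrizes lam p1 p2 r j \<longleftrightarrow> (\<forall>R\<in>P1. j R = \<iota> R)"
proof
 show "\<forall>R\<in>P1. j R = \<iota> R" if "parametrizes lam p1 p2 r j"
  using that iota_parametrizes unfolding parametrizes_def by (metis proj_spaceE)
 show "parametrizes lam p1 p2 r j" if "\<forall>R\<in>P1. j R = \<iota> R"
  using that iota_parametrizes proj_spaceI unfolding parametrizes_def by (metis)
qed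

lemma phi_pt:
 assumes j: "parametrizes lam p1 p2 r j" and v: "on_Q v" shows "phi j lam (pt v) = pt (\<Phi> v)"
proof -
 have e: "j R = \<iota> R" if "R : P1" for R using that j unfolding parametrizes_iff by blast
 have P: "pt v : Q" by (rule Q_pt[OF v])
 define R where "R = \<iota>' (pt v)"
 have R: "R : P1" "\<iota> R = pt v" using iota_inv(2,3)[OF P] by (simp_all add: R_def)
 have "inj_on j P1" using iota_bij e inj_on_cong[of P1 j \<iota>] unfolding bij_betw_def by blast
 then have i: "inv_into P1 j (pt v) = R" using inv_into_f_f[of j P1 R] R e by simp
 obtain x where x: "x ~= 0" "R = pt x" using R(1) by (rule proj_spaceE)
 define x3 where "x3 = (vector [(x $ 1) ^ 3, lam * (x $ 2) ^ 3] :: 'a ^ 2)"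
 have "x3 ~= 0" using x(1) lam unfolding x3_def vector2_eq_0 by (auto simp: vec_eq_iff forall_2)
 then have "phi j lam (pt v) = pt (H x3)"
  unfolding phi_def i x(2) phi0_pt x3_def[symmetric] using e[OF proj_spaceI] by (simp add: iota_pt)
 also have "H x3 = \<Phi> (H x)" unfolding x3_def Phi_H ..
 also have "pt (\<Phi> (H x)) = pt (\<Phi> v)"
 proof -
  obtain c where c: "c ~= 0" "v = c *s H x" using R(2) unfolding x(2) iota_pt by (metis pt_eq_iff)
  then show ?thesis using hmap_homogeneous[OF hmap_Phi, of c "H x"] pt_scale[of "c ^ 3" "\<Phi> (H x)"] by simp
 qed
 finally show ?thesis .
qed

lemma phi_regular:
 assumes j: "parametrizes lam p1 p2 r j" shows "regular_map k Q Q (phi j lam)"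
proof (rule regular_map_global[OF k hmap_Phi])
 fix P assume P: "P : Q"
 show "\<Phi> v ~= 0 & phi j lam P = pt (\<Phi> v)" if "v : P" for v
  using Phi_on_Q[OF Q_mem(1)[OF P that]] phi_pt[OF j Q_mem(1)[OF P that]] Q_mem(2)[OF P that]
  unfolding on_Q_def by simp
 show "phi j lam P : Q" using P phi_pt[OF j] Q_pt[OF Phi_on_Q] by (metis Q_E)
qed

lemma q_alg: "q \<subseteq> alg_cl k"
 using C_alg by auto

lemma phi_conjugate:
 assumes j: "parametrizes lam p1 p2 r j"
 shows "conjugate_over (alg_cl k) P1 (phi0 lam) Q (phi j lam)"
 unfolding conjugate_over_def
proof (intro exI[of _ \<iota>] conjI ballI)
 show "isomorphism (alg_cl k) P1 Q \<iota>" by (rule iota_isomorphism[OF subfield_alg_cl[OF k] q_alg])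
 fix P :: "('a, 2) ppoint" assume "P : P1"
 then obtain x where x: "x ~= 0" "P = pt x" by (rule proj_spaceE)
 show "phi j lam (\<iota> P) = \<iota> (phi0 lam P)"
  unfolding x(2) iota_pt phi0_pt phi_pt[OF j H_on_Q[OF x(1)]] Phi_H ..
qed

subsection \<open>Conjugation of the parametrization\<close>

text \<open>The conjugate of \<open>H\<close>, with p1 and p2 exchanged; by \<open>H_swap\<close> it
  is \<open>H\<close> after t -> lam / t, up to the factor lam.\<close>

definition Hc :: "'a ^ 2 => 'a ^ 3" where
 "Hc v = comb (lam * (v $ 2)\<^sup>2) ((v $ 1)\<^sup>2) (v $ 1 * v $ 2)"

lemma Hc_nonzero: "v ~= 0 ==> Hc v ~= 0"
 unfolding Hc_def comb_eq_0 using lam by (auto simp: vec_eq_iff forall_2)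

lemma H_swap: "H (vector [lam * v $ 2, v $ 1]) = lam *s Hc v"
 unfolding H_def Hc_def comb_scale by (simp add: power2_eq_square mult_ac)

lemma cform_H: "cform 2 (%v. H v $ j) (%v. Hc v $ j)"
proof -
 have sq: "cform 2 (%v :: 'a ^ 2. v $ i * v $ i') (%v. v $ i * v $ i')" for i i'
  using cform_of_k[OF hform_mult[OF k hform_coord[OF k] hform_coord[OF k]], of i i'] by (simp add: numeral_2_eq_2)
 have "cform 2 (%v :: 'a ^ 2. p1 $ j * (v $ 1 * v $ 1) + lam * p2 $ j * (v $ 2 * v $ 2) + r $ j * (v $ 1 * v $ 2))
   (%v :: 'a ^ 2. p2 $ j * (v $ 1 * v $ 1) + lam * p1 $ j * (v $ 2 * v $ 2) + r $ j * (v $ 1 * v $ 2))"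
  by (intro cform_add cform_smult sq p C_scale lam C_swap[OF p] C_const r)
 then show ?thesis unfolding H_def Hc_def comb_nth by (simp add: power2_eq_square algebra_simps)
qed

lemma conjugate_forms:
 assumes s: "nontrivial_aut k q \<sigma>" and G: "!!i e. G i e : q"
 shows "cform d (form d (G i)) (form d (%e. \<sigma> (G i e)))"
proof (rule cform_form)
 fix e
 obtain a' where "(G i e, a') : C" using G[of i e] by auto
 then show "(G i e, \<sigma> (G i e)) : C" using nontrivial_aut_C[OF s] by metis
qed

text \<open>Any forms representing \<open>j\<close> have vanishing minors against \<open>H\<close>.
  Conjugating these identities gives vanishing minors of the conjugated forms against
  \<open>Hc\<close>, which represents the composite with \<open>alpha\<close>.\<close>

lemma twist_parameter_iota:
 assumes j: "parametrizes lam p1 p2 r j" shows "twist_parameter k D j lam"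
 unfolding twist_parameter_def splitting_field conjugate_map_def
proof (intro conjI lam allI impI)
 fix \<sigma> d and G :: "3 => (2 => nat) => 'a"
 assume s: "nontrivial_aut k q \<sigma>" and "(\<forall>i e. G i e : q) & represents P1 d G j"
 then have G: "!!i e. G i e : q" "represents P1 d G j" by auto
 have t: "th \<notin> k" by (rule nontrivial_aut_notin[OF s])
 define g g' where "g i v = form d (G i) v" and "g' i v = form d (%e. \<sigma> (G i e)) v" for i v
 have cf: "cform d (g i) (g' i)" for i unfolding g_def[abs_def] g'_def[abs_def] by (rule conjugate_forms[OF s G(1)])
 have gH: "g i v * H v $ l - g l v * H v $ i = 0" for i l v
 proof (cases "v = 0 \<or> forms_map d G v = 0")
  case True
  then have "H v = 0 \<or> forms_map d G v = 0" by (auto simp: H_def comb_eq_0)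
  then show ?thesis by (auto simp: g_def forms_map_def vec_eq_iff)
 next
  case False
  then have "j (pt v) = pt (forms_map d G v)" using G(2) proj_spaceI[of v] pt_self unfolding represents_def by blast
  moreover have "j (pt v) = pt (H v)"
   using j False proj_spaceI[of v] unfolding parametrizes_iff by (simp add: iota_pt)
  ultimately have "forms_map d G v $ i * H v $ l = forms_map d G v $ l * H v $ i" by (intro pt_eq_minors) simp
  then show ?thesis by (simp add: g_def forms_map_def)
 qed
 have gH': "g' i v * Hc v $ l - g' l v * Hc v $ i = 0" for i l v
  by (rule cform_zero[OF quad_axioms t cform_diff[OF cform_mult[OF cf cform_H] cform_mult[OF cf cform_H]] gH])
 show "represents P1 d (%i e. \<sigma> (G i e)) (j \<circ> alpha lam)" unfolding represents_def
 proof (intro ballI impI)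
  fix P :: "('a, 2) ppoint" and v assume P: "P : P1" "v : P" and nz: "forms_map d (%i e. \<sigma> (G i e)) v ~= 0"
  have v: "v ~= 0" "P = pt v" using proj_space_mem[OF P] by auto
  have sw: "vector [lam * v $ 2, v $ 1] ~= (0 :: 'a ^ 2)" using v(1) lam by (auto simp: vec_eq_iff forall_2)
  have "(j \<circ> alpha lam) P = pt (Hc v)"
   using j proj_spaceI[OF sw] lam pt_scale[of lam] unfolding parametrizes_iff v(2)
   by (simp add: alpha_pt iota_pt H_swap)
  also have "\<dots> = pt (forms_map d (%i e. \<sigma> (G i e)) v)"
   using gH'[of _ v] by (intro proj_eqI Hc_nonzero v nz) (simp add: forms_map_def g'_def algebra_simps)
  finally show "(j \<circ> alpha lam) P = pt (forms_map d (%i e. \<sigma> (G i e)) v)" .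
 qed
qed

text \<open>Evaluate at t = 1. In the coordinates (U, V, Z), H(l, 1) is (l^2, lam, l) and Hc(1, 1)
  is (lam, 1, 1); proportionality in the last two coordinates gives l = lam.\<close>

lemma twist_parameter_unique:
 assumes t: "th \<notin> k" and j: "parametrizes lam p1 p2 r j" and l: "twist_parameter k D j l"
 shows "l = lam"
proof -
 obtain \<sigma> where s: "nontrivial_aut k q \<sigma>" using nontrivial_aut_unique q_iff t by blast
 obtain G where G: "\<forall>i e. G i e : q" "H = forms_map 2 G" using forms_map_hmap[OF q hmap_H] by blast
 have rep: "represents P1 2 G j" unfolding represents_def
 proof (intro ballI impI)
  fix P :: "('a, 2) ppoint" and v assume P: "P : P1" "v : P"
  show "j P = pt (forms_map 2 G v)"
   using j P proj_space_mem[OF P] unfolding parametrizes_iff G(2)[symmetric] by (metis iota_pt)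
 qed
 then have rep': "represents P1 2 (%i e. \<sigma> (G i e)) (j \<circ> alpha l)"
  using l s G(1) unfolding twist_parameter_def splitting_field conjugate_map_def by blast
 have "form 2 (%e. \<sigma> (G i e)) v = Hc v $ i" for i v
 proof -
  have "form 2 (G i) v - H v $ i = 0" for v unfolding G(2) by (simp add: forms_map_def)
  moreover have "cform 2 (%v. form 2 (G i) v - H v $ i) (%v. form 2 (%e. \<sigma> (G i e)) v - Hc v $ i)"
   by (rule cform_diff[OF conjugate_forms[OF s, of G] cform_H]) (use G(1) in blast)
  ultimately have "form 2 (%e. \<sigma> (G i e)) v - Hc v $ i = 0" using cform_zero[OF quad_axioms t] by blast
  then show ?thesis by simp
 qed
 then have Hc: "forms_map 2 (%i e. \<sigma> (G i e)) v = Hc v" for v by (simp add: forms_map_def vec_eq_iff)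
 define v where "v = (vector [1, 1] :: 'a ^ 2)"
 have v0: "v ~= 0" "vector [l, 1] ~= (0 :: 'a ^ 2)" by (simp_all add: v_def vector2_eq_0)
 have "(j \<circ> alpha l) (pt v) = pt (Hc v)"
  using rep' Hc_nonzero[OF v0(1)] proj_spaceI[OF v0(1)] pt_self[of v] unfolding represents_def Hc by blast
 moreover have "(j \<circ> alpha l) (pt v) = pt (H (vector [l, 1]))"
  using j proj_spaceI[OF v0(2)] unfolding parametrizes_iff by (simp add: alpha_pt v_def iota_pt)
 ultimately obtain c where "H (vector [l, 1]) = c *s Hc v" using pt_eq_iff by metis
 then have "V (H (vector [l, 1])) = c * V (Hc v)" "Z (H (vector [l, 1])) = c * Z (Hc v)" by (simp_all add: lin_linear)
 note e = this
 have "lam = c" using e(1) by (simp add: H_def Hc_def v_def)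
 moreover have "l = c" using e(2) by (simp add: H_def Hc_def v_def)
 ultimately show ?thesis by simp
qed

subsection \<open>All parametrizations\<close>

text \<open>The map \<open>j\<close> is the standard parametrization of other data for the same
  pair, with parameter changed by a norm. In the split case the parameter is arbitrary in the
  construction, so there it is required to hit a prescribed \<open>l\<close>.\<close>

definition reparam where
 "reparam l j \<longleftrightarrow> (\<exists>lam' p1' p2' u' w' c c'. conic_data k th th' lam' p1' p2' r u' w' z Q D &
  parametrizes lam' p1' p2' r j & (th : k --> lam' = l) & (c, c') : C & c ~= 0 & c' ~= 0 & lam' = c * c' * lam)"

lemma reparam_scale:
 assumes c: "c : q" "c ~= 0" and l: "th : k ==> l : k & l ~= 0"
  and j: "!!x. x ~= 0 ==> j (pt x) = pt ((c * x $ 1)\<^sup>2 *s p1 + (lam * (x $ 2)\<^sup>2) *s p2 + (c * x $ 1 * x $ 2) *s r)"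
 shows "reparam l j"
proof -
 \<comment> \<open>In the nonsplit case c' is the conjugate of c. In the split case it is free and
   is solved for from the prescribed parameter.\<close>
 obtain c' where c': "(c, c') : C" "c' ~= 0" "th : k --> lam / (c * c') = l"
 proof (cases "th : k")
  case True
  have "c : k" using c(1) q_iff True by blast
  then have "(c, lam / (c * l)) : C" using l[OF True] lam k by (intro C_split_I True subfield_divide subfield_mult) auto
  then show thesis using that[of "lam / (c * l)"] l[OF True] lam c by simp
 next
  case False
  obtain c' where "(c, c') : C" using c(1) by auto
  then show thesis using that[of c'] C_zero_iff[OF False] c(2) False by blast
 qed
 have "parametrizes (lam / (c * c')) (c *s p1) (c' *s p2) r j"
  unfolding parametrizes_def
 proof (intro allI impI)
  fix x :: "'a ^ 2" assume x: "x ~= 0"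
  have e: "(c * x $ 1)\<^sup>2 *s p1 + (lam * (x $ 2)\<^sup>2) *s p2 + (c * x $ 1 * x $ 2) *s r =
   c *s ((x $ 1)\<^sup>2 *s (c *s p1) + (lam / (c * c') * (x $ 2)\<^sup>2) *s (c' *s p2) + (x $ 1 * x $ 2) *s r)"
   using c(2) c'(2) by (simp add: vec_eq_iff power2_eq_square field_simps)
  show "j (pt x) = pt ((x $ 1)\<^sup>2 *s (c *s p1) + (lam / (c * c') * (x $ 2)\<^sup>2) *s (c' *s p2) + (x $ 1 * x $ 2) *s r)"
   unfolding j[OF x] e pt_scale[OF c(2)] ..
 qed
 moreover have "(1 / c, 1 / c') : C" using C_divide[OF C_const c'(1)] subfield_1[OF k] by blast
 ultimately show ?thesis unfolding reparam_def
  using conic_data_scale[OF c'(1) c(2) c'(2)] c(2) c'(2,3)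
  by (intro exI[of _ "lam / (c * c')"] exI[of _ "c *s p1"] exI[of _ "c' *s p2"] exI[of _ "(1 / c) *s u"]
    exI[of _ "(1 / c') *s w"] exI[of _ "1 / c"] exI[of _ "1 / c'"] conjI) simp_all
qed

text \<open>Two parametrizations differ by an automorphism of the line preserving 0 and infinity,
  thus by t -> c t or t -> c / t. The second kind becomes the first after exchanging p1 and
  p2.\<close>

lemma all_parametrizations:
 assumes y: "y \<notin> alg_cl k" and s: "splitting_iso k Q D j" and l: "th : k ==> l : k & l ~= 0"
 shows "reparam l j"
proof -
 have iso: "isomorphism q P1 Q j" and im: "j ` {pt_zero, pt_infinity} = {pt p1, pt p2}"
  using s unfolding splitting_iso_def splitting_field D_set by auto
 have yq: "y \<notin> alg_cl q" using y alg_cl_mono[OF q_alg] alg_cl_idem[OF k] by blast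
 obtain g where g: "isomorphism q Q P1 g" "!!R. R : P1 ==> g (\<iota> R) = R" "!!P. P : Q ==> \<iota> (g P) = P"
  using isomorphism_inverse[OF iota_isomorphism[OF q order_refl]] by blast
 have m: "isomorphism q P1 P1 (g \<circ> j)" by (rule isomorphism_comp[OF q order_refl Q_proj iso g(1)])
 have P01: "pt_zero : P1" "pt_infinity : P1"
  unfolding pt_zero_def pt_infinity_def by (auto intro!: proj_spaceI simp: vector2_eq_0)
 have "(g \<circ> j) ` {pt_zero, pt_infinity} = g ` {pt p1, pt p2}" unfolding image_comp[symmetric] im ..
 also have "\<dots> = {pt_zero, pt_infinity}"
  using g(2)[OF P01(1)] g(2)[OF P01(2)] unfolding iota_zero iota_infinity by auto
 finally have fx: "(g \<circ> j) ` {pt_zero, pt_infinity} = {pt_zero, pt_infinity}" .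
 have jg: "j (pt x) = \<iota> ((g \<circ> j) (pt x))" if "x ~= 0" for x
  using g(3) isomorphism_bij[OF iso] proj_spaceI[OF that] by (simp add: bij_betwE)
 have jc: "j (pt x) = \<iota> (pt v)" if "x ~= 0" "(g \<circ> j) (pt x) = pt v" for x v
  using jg[OF that(1)] unfolding that(2) .
 show ?thesis
 proof (rule P1_automorphism_fixing[OF q yq m fx])
  fix c assume c: "c : q" "c ~= 0" and gj: "!!x. x ~= 0 ==> (g \<circ> j) (pt x) = pt (vector [c * x $ 1, x $ 2])"
  show ?thesis
   by (rule reparam_scale[OF c l]) (simp_all add: jc[OF _ gj] iota_pt H_def comb_def)
 next
  fix c assume c: "c : q" "c ~= 0" and gj: "!!x. x ~= 0 ==> (g \<circ> j) (pt x) = pt (vector [c * x $ 2, x $ 1])"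
  interpret S: conic_data k th th' lam p2 p1 r w u z Q D by (rule conic_data_swap)
  have "S.reparam l j"
  proof (rule S.reparam_scale[OF _ _ l])
   have "lam : q" using lam k_q by blast
   then show "lam / c : q" "lam / c ~= 0" using c q lam by (auto intro: subfield_divide)
   fix x :: "'a ^ 2" assume x: "x ~= 0"
   have e: "(lam / c * x $ 1)\<^sup>2 *s p2 + (lam * (x $ 2)\<^sup>2) *s p1 + (lam / c * x $ 1 * x $ 2) *s r =
    (lam / c\<^sup>2) *s ((c * x $ 2)\<^sup>2 *s p1 + (lam * (x $ 1)\<^sup>2) *s p2 + (c * x $ 2 * x $ 1) *s r)"
    using c lam by (simp add: vec_eq_iff power2_eq_square field_simps)
   have f: "lam / c\<^sup>2 ~= 0" using c lam by simp
   show "j (pt x) = pt ((lam / c * x $ 1)\<^sup>2 *s p2 + (lam * (x $ 2)\<^sup>2) *s p1 + (lam / c * x $ 1 * x $ 2) *s r)"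
    unfolding e pt_scale[OF f] jc[OF x gj[OF x]] iota_pt H_def comb_def vector_2 ..
  qed
  then show ?thesis unfolding S.reparam_def reparam_def by blast
 qed
qed

end

section \<open>Ramification\<close>

definition quot :: "('a::field ^ 'n::finite => 'a) => ('a ^ 'n => 'a) => ('a, 'n) ppoint => 'a" where
 "quot a b R = (let v = SOME v. v : R in a v / b v)"

lemma quot_pt:
 assumes "hform F d a" "hform F d b" shows "quot a b (pt v) = a v / b v"
proof -
 have "(SOME w. w : pt v) : pt v" by (rule someI[of "%w. w : pt v", OF pt_self])
 then obtain c where "c ~= 0" "(SOME w. w : pt v) = c *s v" by (auto simp: pt_mem)
 then show ?thesis unfolding quot_def by (simp add: hform_homogeneous[OF assms(1)] hform_homogeneous[OF assms(2)])
qed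

lemma local_fun_quot:
 assumes X: "X \<subseteq> proj_space" and a: "hform UNIV d a" and b: "hform UNIV d b" and nz: "b v ~= 0"
 shows "local_fun X (pt v) (quot a b)"
proof -
 obtain al bt where ab: "a = form d al" "b = form d bt" using form_hform[OF subfield_UNIV] a b by metis
 show ?thesis unfolding local_fun_def
 proof (rule exI[of _ d], rule exI[of _ al], rule exI[of _ bt], intro conjI ballI impI)
  show "form d bt w ~= 0" if "w : pt v" for w
   using that nz hform_homogeneous[OF b] unfolding ab(2)[symmetric] by (auto simp: pt_mem)
  fix R w assume "R : X" "w : R"
  then have "R = pt w" using X proj_space_mem by blast
  then show "quot a b R = form d al w / form d bt w" using quot_pt[OF a b] ab by simp
 qed
qed

lemma max_ideal_quot:
 assumes "X \<subseteq> proj_space" "hform UNIV d a" "hform UNIV d b" "b v ~= 0" "a v = 0"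
 shows "quot a b : max_ideal X (pt v)"
 unfolding max_ideal_def using local_fun_quot[OF assms(1-4)] quot_pt[OF assms(2,3)] assms(5) by simp

lemma local_funE:
 assumes "local_fun X P h"
 obtains d a b where "hform UNIV d a" "hform UNIV d b" "!!v. v : P ==> b v ~= 0"
  "!!R v. R : X ==> v : R ==> b v ~= 0 ==> h R = a v / b v"
 using assms hform_form[of _ UNIV] unfolding local_fun_def by (metis UNIV_I)

lemma germ_eqI:
 assumes b: "hform UNIV d b" "b v ~= 0" and e: "!!R w. R : X ==> w : R ==> b w ~= 0 ==> g R = h R"
 shows "germ_eq X (pt v) g h"
proof -
 obtain bt where "b = form d bt" using form_hform[OF subfield_UNIV] b by metis
 then show ?thesis unfolding germ_eq_def using e b(2) hform_homogeneous[OF b(1)]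
  by (intro exI[of _ d] exI[of _ bt]) (auto simp: pt_mem)
qed

lemma germ_eqE:
 assumes "germ_eq X P g h"
 obtains d b where "hform UNIV d b" "\<forall>v\<in>P. b v ~= 0" "\<forall>R\<in>X. \<forall>v\<in>R. b v ~= 0 --> g R = h R"
 using assms hform_form[of _ UNIV] unfolding germ_eq_def by (metis UNIV_I)

lemma hform_curve:
 assumes f: "hform F d f" and gm: "!!i. \<exists>p. \<forall>s. gm s $ i = poly p s" shows "\<exists>p. \<forall>s. f (gm s) = poly p s"
 using f
proof induction
 case (zero d) then show ?case by (intro exI[of _ 0]) simp
next
 case (const a) then show ?case by (intro exI[of _ "[:a:]"]) simp
next
 case (add d f g)
 then obtain p q where "\<forall>s. f (gm s) = poly p s" "\<forall>s. g (gm s) = poly q s" by blast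
 then show ?case by (intro exI[of _ "p + q"]) simp
next
 case (var d f i)
 then obtain p where p: "\<forall>s. f (gm s) = poly p s" by blast
 obtain q where "\<forall>s. gm s $ i = poly q s" using gm by blast
 then show ?case using p by (intro exI[of _ "p * q"]) auto
qed

lemma poly_eqI_cofinite:
 fixes p q :: "'a::alg_closed_field poly"
 assumes b: "b ~= 0" and e: "!!s. poly b s ~= 0 ==> poly p s = poly q s" shows "p = q"
proof -
 have "poly ((p - q) * b) s = 0" for s using e[of s] by (cases "poly b s = 0") auto
 then have "(p - q) * b = 0"
  using infinite_UNIV_alg_closed poly_roots_finite[of "(p - q) * b"] by (cases "(p - q) * b = 0") auto
 then show ?thesis using b by simp
qed

text \<open>A zero of order at least two at \<open>t\<close>, for a function that is rational in the
  parameter away from the zeros of some denominator. It stands for membership in the square of the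
  maximal ideal along a parametrization.\<close>

definition order2_at :: "'a::field => ('a => 'a) => bool" where
 "order2_at t g \<longleftrightarrow> (\<exists>a b. [:-t, 1:] ^ 2 dvd a & poly b t ~= 0 & (\<forall>s. poly b s ~= 0 --> g s = poly a s / poly b s))"

lemma order2_at_mult:
 assumes "poly a t = 0" "poly a' t = 0" "poly b t ~= 0" "poly b' t ~= 0"
  "!!s. poly b s ~= 0 ==> g s = poly a s / poly b s" "!!s. poly b' s ~= 0 ==> g' s = poly a' s / poly b' s"
 shows "order2_at t (%s. g s * g' s)"
 unfolding order2_at_def
proof (rule exI[of _ "a * a'"], rule exI[of _ "b * b'"], intro conjI)
 show "[:-t, 1:] ^ 2 dvd a * a'"
  using assms(1,2) unfolding power2_eq_square by (intro mult_dvd_mono) (simp_all add: poly_eq_0_iff_dvd)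
qed (use assms in auto)

lemma order2_at_add:
 assumes "order2_at t g" "order2_at t h" shows "order2_at t (%s. g s + h s)"
proof -
 obtain a b a' b' where g: "[:-t, 1:] ^ 2 dvd a" "poly b t ~= 0" "\<forall>s. poly b s ~= 0 --> g s = poly a s / poly b s"
  and h: "[:-t, 1:] ^ 2 dvd a'" "poly b' t ~= 0" "\<forall>s. poly b' s ~= 0 --> h s = poly a' s / poly b' s"
  using assms unfolding order2_at_def by blast
 show ?thesis unfolding order2_at_def
  by (rule exI[of _ "a * b' + a' * b"], rule exI[of _ "b * b'"], intro conjI dvd_add dvd_mult2 g(1) h(1))
   (use g(2,3) h(2,3) in \<open>auto simp: field_simps\<close>)
qed

lemma order2_at_sum: "(!!i. i < n ==> order2_at t (g i)) ==> order2_at t (%s. \<Sum>i<(n::nat). g i s)"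
proof (induction n)
 case 0
 show ?case unfolding order2_at_def by (rule exI[of _ 0], rule exI[of _ 1]) simp
next
 case (Suc n)
 then show ?case using order2_at_add[of t "%s. \<Sum>i<n. g i s" "g n"] by simp
qed

text \<open>The factor lam (s^2 + s t + t^2) left after removing s - t takes the value 3 lam t^2 at
  t, so the zero is simple.\<close>

lemma not_order2_cubic:
 fixes lam t :: "'a::alg_closed_field"
 assumes "(3::'a) ~= 0" "lam ~= 0" "t ~= 0" "poly c t ~= 0"
  and g: "!!s. poly c s ~= 0 ==> g s = lam * s ^ 3 - lam * t ^ 3"
 shows "\<not> order2_at t g"
proof
 assume "order2_at t g"
 then obtain a b where ab: "[:-t, 1:] ^ 2 dvd a" "poly b t ~= 0" "!!s. poly b s ~= 0 ==> g s = poly a s / poly b s"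
  unfolding order2_at_def by blast
 define e where "e = smult lam [:t ^ 2, t, 1:]"
 have e: "poly ([:-t, 1:] * e) s = lam * s ^ 3 - lam * t ^ 3" for s
  by (simp add: e_def power2_eq_square power3_eq_cube algebra_simps)
 have "a = [:-t, 1:] * e * b"
 proof (rule poly_eqI_cofinite[of "b * c"])
  show "b * c ~= 0" using ab(2) assms(4) by auto
  fix s assume "poly (b * c) s ~= 0"
  then have "poly b s ~= 0" "poly a s / poly b s = lam * s ^ 3 - lam * t ^ 3" using ab(3) g by (simp, metis mult_eq_0_iff poly_mult)
  then show "poly a s = poly ([:-t, 1:] * e * b) s" unfolding poly_mult[of _ b] e by (simp add: field_simps)
 qed
 then have "[:-t, 1:] * [:-t, 1:] dvd [:-t, 1:] * (e * b)" using ab(1) by (simp only: power2_eq_square mult.assoc)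
 moreover have "[:-t, 1:] ~= 0" by simp
 ultimately have "[:-t, 1:] dvd e * b" using dvd_mult_cancel_left by blast
 then have "poly (e * b) t = 0" by (simp only: poly_eq_0_iff_dvd)
 moreover have "poly e t = 3 * lam * t ^ 2" by (simp add: e_def power2_eq_square algebra_simps)
 ultimately show False using assms(1-3) ab(2) by simp
qed

context conic_data
begin

lemma hform_UNIV: "hform UNIV 1 U" "hform UNIV 1 V" "hform UNIV 1 Z"
 by (rule hform_lin[OF subfield_UNIV], simp)+

text \<open>Modulo V and Z, which vanish at p1, every form is a multiple of a power of U. Degree 0
  is separated because there the cofactors cannot have degree d - 1.\<close>

lemma expand_at_p1:
 assumes "hform UNIV d f"
 shows "\<exists>c f1 f2. (d > 0 --> hform UNIV (d - 1) f1 & hform UNIV (d - 1) f2) & (d = 0 --> f1 = (%_. 0) & f2 = (%_. 0)) &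
  (\<forall>v. f v = c * (U v) ^ d + V v * f1 v + Z v * f2 v)"
 using assms
proof induction
 case (zero d)
 show ?case by (rule exI[of _ 0], rule exI[of _ "%_. 0"], rule exI[of _ "%_. 0"]) (auto intro: hform.zero)
next
 case (const a)
 show ?case by (intro exI[of _ a] exI[of _ "%_. 0"]) auto
next
 case (add d f g)
 then obtain c f1 f2 c' g1 g2 where 1: "d > 0 --> hform UNIV (d - 1) f1 & hform UNIV (d - 1) f2"
  "d = 0 --> f1 = (%_. 0) & f2 = (%_. 0)" "\<forall>v. f v = c * (U v) ^ d + V v * f1 v + Z v * f2 v"
  "d > 0 --> hform UNIV (d - 1) g1 & hform UNIV (d - 1) g2"
  "d = 0 --> g1 = (%_. 0) & g2 = (%_. 0)" "\<forall>v. g v = c' * (U v) ^ d + V v * g1 v + Z v * g2 v" by metis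
 show ?case
 proof (rule exI[of _ "c + c'"], rule exI[of _ "%v. f1 v + g1 v"], rule exI[of _ "%v. f2 v + g2 v"], intro conjI)
  show "d > 0 --> hform UNIV (d - 1) (%v. f1 v + g1 v) & hform UNIV (d - 1) (%v. f2 v + g2 v)"
   using 1 by (auto intro: hform.add)
 qed (use 1 in \<open>auto simp: algebra_simps\<close>)
next
 case (var d f i)
 then obtain c f1 f2 where 1: "d > 0 --> hform UNIV (d - 1) f1 & hform UNIV (d - 1) f2"
  "d = 0 --> f1 = (%_. 0) & f2 = (%_. 0)" "\<forall>v. f v = c * (U v) ^ d + V v * f1 v + Z v * f2 v" by metis
 have Uf: "hform UNIV d (%v. U v * g v)" if "d > 0 --> hform UNIV (d - 1) g" "d = 0 --> g = (%_. 0)" for g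
 proof (cases "d = 0")
  case True
  then show ?thesis using that hform.zero[of UNIV 0] by simp
 next
  case False
  then show ?thesis using hform_mult[OF subfield_UNIV hform_UNIV(1), of "d - 1" g] that by simp
 qed
 have "hform UNIV d (%v. p1 $ i * (U v * f1 v) + p2 $ i * f v)" "hform UNIV d (%v. p1 $ i * (U v * f2 v) + r $ i * f v)"
  by (rule hform.add[OF hform_smult[OF subfield_UNIV Uf UNIV_I] hform_smult[OF subfield_UNIV var(1) UNIV_I]],
   use 1 in blast, use 1 in blast)+
 note F12 = this
 have vi: "v $ i = U v * p1 $ i + V v * p2 $ i + Z v * r $ i" for v
  using comb_nth[of "U v" "V v" "Z v" i] by (simp add: comb_recon)
 have "(U v * p1 $ i + V v * p2 $ i + Z v * r $ i) * f v = (c * p1 $ i) * (U v) ^ Suc d + V v * (p1 $ i * (U v * f1 v) + p2 $ i * f v)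
   + Z v * (p1 $ i * (U v * f2 v) + r $ i * f v)" for v
  using 1(3)[rule_format, of v] by (simp add: algebra_simps)
 note E = this[folded vi]
 show ?case
 proof (rule exI[of _ "c * p1 $ i"], rule exI[of _ "%v. p1 $ i * (U v * f1 v) + p2 $ i * f v"],
   rule exI[of _ "%v. p1 $ i * (U v * f2 v) + r $ i * f v"], intro conjI impI allI)
  show "hform UNIV (Suc d - 1) (%v. p1 $ i * (U v * f1 v) + p2 $ i * f v)"
   "hform UNIV (Suc d - 1) (%v. p1 $ i * (U v * f2 v) + r $ i * f v)"
   unfolding diff_Suc_1 by (rule F12)+
 qed (simp, simp, rule E)
qed

lemma hform_Phi: "hform UNIV d f ==> hform UNIV (3 * d) (%v. f (\<Phi> v))"
 using hform_comp[OF subfield_UNIV, of d f 3 \<Phi>] hmap_mono[OF hmap_Phi subset_UNIV]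
 unfolding hmap_def by (simp add: mult.commute)

lemma ramified_p1:
 assumes f: "!!v. on_Q v ==> f (pt v) = pt (\<Phi> v)" shows "ramified_at Q Q f (pt p1)"
 unfolding ramified_at_def
proof
 have p1Q: "on_Q p1" using p_nonzero dual by (simp add: on_Q_def)
 have "\<Phi> p1 = p1" by (simp add: \<Phi>_def dual comb_def)
 then have fp: "f (pt p1) = pt p1" using f[OF p1Q] by simp
 fix h assume "h : max_ideal Q (f (pt p1))"
 then have "local_fun Q (pt p1) h" "h (pt p1) = 0" unfolding max_ideal_def fp by auto
 then obtain d a b where ab: "hform UNIV d a" "hform UNIV d b" "!!v. v : pt p1 ==> b v ~= 0"
  "!!R v. R : Q ==> v : R ==> b v ~= 0 ==> h R = a v / b v" by (auto elim!: local_funE)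
 have a0: "a p1 = 0"
  using ab(4)[OF Q_pt[OF p1Q] pt_self ab(3)[OF pt_self]] ab(3)[OF pt_self] \<open>h (pt p1) = 0\<close> by simp
 obtain c a1 a2 where e: "d > 0 --> hform UNIV (d - 1) a1 & hform UNIV (d - 1) a2"
  "d = 0 --> a1 = (%_. 0) & a2 = (%_. 0)" "\<forall>v. a v = c * (U v) ^ d + V v * a1 v + Z v * a2 v"
  using expand_at_p1[OF ab(1)] by metis
 have "c = 0" using a0 e(3) by (simp add: dual)
 then have aP: "a (\<Phi> v) = (V v) ^ 3 * a1 (\<Phi> v) + lam * (Z v) ^ 3 * a2 (\<Phi> v)" for v using e(3) by (simp add: \<Phi>_def)
 \<comment> \<open>One factor V or Z goes to the first function of each product, the square stays in
   the second. The extra U raises the degree to 3 d, so that quotients by \<open>B\<close> and by U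
   have degree zero.\<close>
 define A1 A2 where "A1 v = (V v)\<^sup>2 * U v * a1 (\<Phi> v)" and "A2 v = (Z v)\<^sup>2 * (lam * U v) * a2 (\<Phi> v)" for v
 define B where "B v = b (\<Phi> v)" for v
 have B: "hform UNIV (3 * d) B" unfolding B_def[abs_def] by (rule hform_Phi[OF ab(2)])
 have A: "hform UNIV (3 * d) A1" "hform UNIV (3 * d) A2"
 proof -
  have *: "hform UNIV (3 * d) (%v. (g v)\<^sup>2 * g' v * g'' (\<Phi> v))"
   if "hform UNIV 1 g" "hform UNIV 1 g'" "d > 0 --> hform UNIV (d - 1) g''" "d = 0 --> g'' = (%_. 0)" for g g' g''
  proof (cases "d = 0")
   case True
   then show ?thesis using that hform.zero[of UNIV 0] by simp
  next
   case False
   then have "hform UNIV (2 * 1 + 1 + 3 * (d - 1)) (%v. (g v)\<^sup>2 * g' v * g'' (\<Phi> v))"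
    using that by (intro hform_mult[OF subfield_UNIV] hform_power[OF subfield_UNIV] hform_Phi) auto
   moreover have "2 * 1 + 1 + 3 * (d - 1) = 3 * d" using False by simp
   ultimately show ?thesis by metis
  qed
  show "hform UNIV (3 * d) A1" "hform UNIV (3 * d) A2" unfolding A1_def[abs_def] A2_def[abs_def]
   using e(1,2) by (intro * hform_UNIV hform_smult[OF subfield_UNIV]; simp)+
 qed
 have Bp: "B p1 ~= 0" unfolding B_def \<open>\<Phi> p1 = p1\<close> using ab(3)[OF pt_self] .
 define us ws where "us i = (if i = 0 then quot V U else quot Z U)" and "ws i = (if i = 0 then quot A1 B else quot A2 B)" for i :: nat
 have M: "us i : max_ideal Q (pt p1) & ws i : max_ideal Q (pt p1)" for i
  using max_ideal_quot[OF Q_proj hform_UNIV(2,1), of p1] max_ideal_quot[OF Q_proj hform_UNIV(3,1), of p1]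
   max_ideal_quot[OF Q_proj A(1) B Bp] max_ideal_quot[OF Q_proj A(2) B Bp]
  unfolding us_def ws_def A1_def A2_def by (simp add: dual)
 have G: "germ_eq Q (pt p1) (h \<circ> f) (%R. \<Sum>i<2. us i R * ws i R)"
 proof (rule germ_eqI)
  show "hform UNIV (1 + 3 * d) (%v. U v * B v)" by (intro hform_mult[OF subfield_UNIV] hform_UNIV B)
  show "U p1 * B p1 ~= 0" using Bp by (simp add: dual)
  fix R v assume R: "R : Q" "v : R" and nz: "U v * B v ~= 0"
  note v = Q_mem[OF R]
  have "(h \<circ> f) R = a (\<Phi> v) / B v"
   using ab(4)[OF Q_pt[OF Phi_on_Q[OF v(1)]] pt_self] nz by (simp add: v(2) f[OF v(1)] B_def)
  also have "\<dots> = V v / U v * (A1 v / B v) + Z v / U v * (A2 v / B v)"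
   using nz unfolding aP A1_def A2_def by (simp add: field_simps power2_eq_square power3_eq_cube)
  also have "\<dots> = (\<Sum>i<2. us i R * ws i R)"
   unfolding us_def ws_def v(2) numeral_2_eq_2
   using quot_pt[OF hform_UNIV(2,1)] quot_pt[OF hform_UNIV(3,1)] quot_pt[OF A(1) B] quot_pt[OF A(2) B] by simp
  finally show "(h \<circ> f) R = (\<Sum>i<2. us i R * ws i R)" .
 qed
 show "\<exists>(n::nat) u w. (\<forall>i<n. u i : max_ideal Q (pt p1) & w i : max_ideal Q (pt p1)) &
   germ_eq Q (pt p1) (h \<circ> f) (%R. \<Sum>i<n. u i R * w i R)"
  by (rule exI[of _ 2], rule exI[of _ us], rule exI[of _ ws]) (rule conjI[OF allI[OF impI[OF M]] G])
qed

lemma ramified_p2: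
 assumes f: "!!v. on_Q v ==> f (pt v) = pt (\<Phi> v)" shows "ramified_at Q Q f (pt p2)"
proof -
 interpret S: conic_data k th th' lam p2 p1 r w u z Q D by (rule conic_data_swap)
 show ?thesis
 proof (rule S.ramified_p1)
  fix v assume "S.on_Q v"
  then have "on_Q v" unfolding S.on_Q_def on_Q_def by (simp add: mult.commute)
  moreover have "S.\<Phi> v = \<Phi> v" unfolding S.\<Phi>_def \<Phi>_def S.comb_def comb_def by simp
  ultimately show "f (pt v) = pt (S.\<Phi> v)" using f by simp
 qed
qed

text \<open>Along the curve s -> (1, lam s^2, s) a local parameter at the image point pulls back to
  lam s^3 - lam t^3, with a simple zero at t ~= 0, whereas sums of products from the maximal ideal
  have a double zero.\<close>

lemma unramified:
 assumes three: "(3::'a) ~= 0" and f: "!!v. on_Q v ==> f (pt v) = pt (\<Phi> v)"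
  and P: "P : Q" "P ~= pt p1" "P ~= pt p2"
 shows "\<not> ramified_at Q Q f P"
proof
 assume ram: "ramified_at Q Q f P"
 obtain v where v: "on_Q v" "P = pt v" by (rule Q_E[OF P(1)])
 have Uv: "U v ~= 0"
 proof
  assume U: "U v = 0"
  then have "Z v = 0" using v(1) lam by (simp add: on_Q_def)
  then have "v = V v *s p2" "V v ~= 0" using comb_recon[of v] U v(1) coords_0[of v]
   by (simp_all add: comb_def on_Q_def, metis)
  then show False using P(3) v(2) pt_scale by metis
 qed
 have Zv: "Z v ~= 0"
 proof
  assume Z: "Z v = 0"
  then have "V v = 0" using v(1) Uv by (simp add: on_Q_def)
  then have "v = U v *s p1" using comb_recon[of v] Z by (simp add: comb_def)
  then show False using P(2) v(2) pt_scale[OF Uv] by metis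
 qed
 define t where "t = Z v / U v"
 have t: "t ~= 0" using Uv Zv by (simp add: t_def)
 define gm where "gm s = comb 1 (lam * s\<^sup>2) s" for s
 have gQ: "on_Q (gm s)" for s unfolding on_Q_def gm_def by (simp add: comb_eq_0 power2_eq_square)
 have "V v = lam * t\<^sup>2 * U v" using v(1) Uv unfolding on_Q_def t_def by (simp add: field_simps power2_eq_square)
 then have "U v *s gm t = comb (U v) (V v) (Z v)" unfolding gm_def comb_scale using Uv by (simp add: t_def mult_ac)
 then have Pt: "P = pt (gm t)" using pt_scale[OF Uv, of "gm t"] v(2) by (simp add: comb_recon)
 have gp: "\<exists>p. \<forall>s. gm s $ i = poly p s" for i
  unfolding gm_def comb_nth by (intro exI[of _ "[:p1 $ i, r $ i, lam * p2 $ i:]"]) (simp add: power2_eq_square algebra_simps)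
 have loc: "\<exists>a b. poly a t = 0 & poly b t ~= 0 & (\<forall>s. poly b s ~= 0 --> g (pt (gm s)) = poly a s / poly b s)"
  if g: "g : max_ideal Q P" for g
 proof -
  have "local_fun Q P g" "g P = 0" using g unfolding max_ideal_def by auto
  then obtain d a b where ab: "hform UNIV d a" "hform UNIV d b" "!!v. v : P ==> b v ~= 0"
   "!!R v. R : Q ==> v : R ==> b v ~= 0 ==> g R = a v / b v" by (auto elim!: local_funE)
  obtain al bt where p: "\<forall>s. a (gm s) = poly al s" "\<forall>s. b (gm s) = poly bt s"
   using hform_curve[OF ab(1) gp] hform_curve[OF ab(2) gp] by blast
  have gs: "g (pt (gm s)) = poly al s / poly bt s" if "poly bt s ~= 0" for s
   using ab(4)[OF Q_pt[OF gQ] pt_self, of s] that p by simp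
  moreover have bt: "poly bt t ~= 0" using ab(3)[of "gm t"] pt_self p unfolding Pt by metis
  moreover have "poly al t = 0" using gs[OF bt] bt \<open>g P = 0\<close> by (simp add: Pt)
  ultimately show ?thesis by blast
 qed
 \<comment> \<open>With the denominator U this is the coordinate Z / U minus its value lam t^3 at
   the image of \<open>P\<close>.\<close>
 define N where "N v = Z v + (- (lam * t ^ 3)) * U v" for v
 have N: "hform UNIV 1 N" unfolding N_def[abs_def]
  by (intro hform.add hform_smult[OF subfield_UNIV] hform_UNIV) simp
 have fP: "f P = pt (\<Phi> (gm t))" unfolding Pt by (rule f[OF gQ])
 have "quot N U : max_ideal Q (f P)" unfolding fP
  by (rule max_ideal_quot[OF Q_proj N hform_UNIV(1)]) (simp_all add: N_def \<Phi>_def gm_def)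
 then obtain n us ws where uw: "\<forall>i<(n::nat). us i : max_ideal Q P & ws i : max_ideal Q P"
  "germ_eq Q P (quot N U \<circ> f) (%R. \<Sum>i<n. us i R * ws i R)" using ram unfolding ramified_at_def by blast
 obtain d b where b: "hform UNIV d b" "\<forall>v\<in>P. b v ~= 0"
  "\<forall>R\<in>Q. \<forall>v\<in>R. b v ~= 0 --> (quot N U \<circ> f) R = (\<Sum>i<n. us i R * ws i R)"
  by (rule germ_eqE[OF uw(2)])
 obtain c where c: "\<forall>s. b (gm s) = poly c s" using hform_curve[OF b(1) gp] by blast
 define g where "g s = (\<Sum>i<n. us i (pt (gm s)) * ws i (pt (gm s)))" for s
 have "order2_at t (%s. us i (pt (gm s)) * ws i (pt (gm s)))" if i: "i < n" for i
 proof -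
  have m: "us i : max_ideal Q P" "ws i : max_ideal Q P" using uw(1) i by auto
  obtain a b where 1: "poly a t = 0" "poly b t ~= 0" "\<forall>s. poly b s ~= 0 --> us i (pt (gm s)) = poly a s / poly b s"
   using loc[OF m(1)] by (elim exE conjE)
  obtain a' b' where 2: "poly a' t = 0" "poly b' t ~= 0" "\<forall>s. poly b' s ~= 0 --> ws i (pt (gm s)) = poly a' s / poly b' s"
   using loc[OF m(2)] by (elim exE conjE)
  show ?thesis
   by (rule order2_at_mult[of a t a' b b' "%s. us i (pt (gm s))" "%s. ws i (pt (gm s))",
     OF 1(1) 2(1) 1(2) 2(2) 1(3)[rule_format] 2(3)[rule_format]])
 qed
 then have "order2_at t g" unfolding g_def[abs_def] by (rule order2_at_sum)
 moreover have "poly c t ~= 0" using b(2) pt_self[of "gm t"] c unfolding Pt by metis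
 moreover have "g s = lam * s ^ 3 - lam * t ^ 3" if "poly c s ~= 0" for s
 proof -
  have "b (gm s) ~= 0" using that c by simp
  from b(3)[rule_format, OF Q_pt[OF gQ] pt_self this]
  have "g s = (quot N U \<circ> f) (pt (gm s))" unfolding g_def by (rule sym)
  also have "\<dots> = N (\<Phi> (gm s)) / U (\<Phi> (gm s))" using quot_pt[OF N hform_UNIV(1)] f[OF gQ] by simp
  finally show ?thesis by (simp add: N_def \<Phi>_def gm_def)
 qed
 ultimately show False using not_order2_cubic[OF three lam(2) t] by blast
qed

theorem ramification:
 assumes "(3::'a) ~= 0" and j: "parametrizes lam p1 p2 r j"
 shows "{P : Q. ramified_at Q Q (phi j lam) P} = set_mset D"
proof -
 have "pt p1 : Q" "pt p2 : Q" using p_nonzero dual by (auto intro!: Q_pt simp: on_Q_def)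
 then show ?thesis unfolding D_set
  using ramified_p1[OF phi_pt[OF j]] ramified_p2[OF phi_pt[OF j]] unramified[OF assms(1) phi_pt[OF j]] by blast
qed

end

section \<open>Generic points\<close>

lemma values_at_eq:
 assumes k: "is_subfield k"
 shows "values_at k (pt v) = {a v / b v | d a b. hform k d a & hform k d b & b v ~= 0}" (is "?A = ?B")
proof
 show "?A \<subseteq> ?B"
 proof
  fix s assume "s : ?A"
  then obtain d a b w where *: "s = form d a w / form d b w" "range a \<subseteq> k" "range b \<subseteq> k" "w : pt v" "form d b w ~= 0"
   unfolding values_at_def by blast
  have h: "hform k d (form d a)" "hform k d (form d b)" using *(2,3) by (auto intro!: hform_form)
  obtain c where c: "c ~= 0" "w = c *s v" using *(4) by (auto simp: pt_mem)
  have "s = form d a v / form d b v" "form d b v ~= 0"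
   using *(1,5) c by (simp_all add: hform_homogeneous[OF h(1)] hform_homogeneous[OF h(2)])
  then show "s : ?B" using h by blast
 qed
 show "?B \<subseteq> ?A"
 proof
  fix s assume "s : ?B"
  then obtain d a b where *: "s = a v / b v" "hform k d a" "hform k d b" "b v ~= 0" by blast
  obtain al bt where "\<forall>e. al e : k" "a = form d al" "\<forall>e. bt e : k" "b = form d bt" using form_hform[OF k] *(2,3) by metis
  note ab = this
  show "s : ?A" unfolding values_at_def mem_Collect_eq
   by (rule exI[of _ d], rule exI[of _ al], rule exI[of _ bt], rule exI[of _ v], intro conjI)
    (use ab * pt_self[of v] in auto)
 qed
qed

lemma values_at_I:
 assumes "is_subfield k" "hform k d a" "hform k d b" "b v ~= 0" shows "a v / b v : values_at k (pt v)"
 unfolding values_at_eq[OF assms(1)] using assms(2-) by blast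

lemma values_at_subset:
 assumes k: "is_subfield k" and E: "is_subfield E" "k \<subseteq> E" and v: "!!i. v $ i : E" shows "values_at k (pt v) \<subseteq> E"
proof
 fix s assume "s : values_at k (pt v)"
 then obtain d a b where *: "s = a v / b v" "hform k d a" "hform k d b" unfolding values_at_eq[OF k] by blast
 then show "s : E" using hform_value[OF _ E v] subfield_divide[OF E(1)] by metis
qed

lemma values_at_subfield:
 assumes k: "is_subfield k" shows "is_subfield (values_at k (pt v))" "k \<subseteq> values_at k (pt v)"
proof -
 have c: "a : values_at k (pt v)" if "a : k" for a
  using values_at_I[OF k hform.const[OF that] hform.const[OF subfield_1[OF k]]] by simp
 then show "k \<subseteq> values_at k (pt v)" by blast
 show "is_subfield (values_at k (pt v))"
 proof (rule is_subfieldI)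
  show "0 : values_at k (pt v)" "1 : values_at k (pt v)" using c subfield_0[OF k] subfield_1[OF k] by blast+
  fix s assume "s : values_at k (pt v)"
  then obtain d a b where s: "s = a v / b v" "hform k d a" "hform k d b" "b v ~= 0" unfolding values_at_eq[OF k] by blast
  show "inverse s : values_at k (pt v)"
  proof (cases "a v = 0")
   case True
   then show ?thesis using s(1) c[OF subfield_0[OF k]] by simp
  next
   case False
   then show ?thesis using values_at_I[OF k s(3,2)] s(1) by simp
  qed
  fix t assume "t : values_at k (pt v)"
  then obtain e a' b' where t: "t = a' v / b' v" "hform k e a'" "hform k e b'" "b' v ~= 0" unfolding values_at_eq[OF k] by blast
  note B = hform_mult[OF k s(3) t(3)]
  have B': "hform k (d + e) (%v. b v * a' v)" by (rule hform_mult[OF k s(3) t(2)])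
  have nz: "b v * b' v ~= 0" using s t by simp
  note V = values_at_I[OF k _ B nz]
  show "s + t : values_at k (pt v)"
   using V[OF hform.add[OF hform_mult[OF k s(2) t(3)] B']] s(1,4) t(1,4) by (simp add: add_frac_eq mult.commute)
  show "s - t : values_at k (pt v)"
   using V[OF hform_diff[OF k hform_mult[OF k s(2) t(3)] B']] s(1,4) t(1,4) by (simp add: diff_frac_eq mult.commute)
  show "s * t : values_at k (pt v)"
   using V[OF hform_mult[OF k s(2) t(2)]] s(1) t(1) by simp
 qed
qed

section \<open>The function field of a normalized conic\<close>

context conic_data
begin

text \<open>The image of (y : 1) is generic: a form over k vanishing there pulls back to a form on
  the line over k(th) with a transcendental zero.\<close>

lemma generic_exists:
 assumes y: "y \<notin> alg_cl k" shows "\<exists>\<xi>. generic_point k Q \<xi>"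
proof (intro exI)
 have yq: "y \<notin> alg_cl q" using y alg_cl_mono[OF q_alg] alg_cl_idem[OF k] by blast
 define \<eta> where "\<eta> = (vector [y, 1] :: 'a ^ 2)"
 have e0: "\<eta> ~= 0" by (simp add: \<eta>_def vector2_eq_0)
 show "generic_point k Q (pt (H \<eta>))" unfolding generic_point_def
 proof (intro conjI allI impI ballI)
  show "pt (H \<eta>) : Q" by (rule Q_pt[OF H_on_Q[OF e0]])
  fix d c P v assume c: "range c \<subseteq> k & (\<forall>v\<in>pt (H \<eta>). form d c v = 0)" and P: "P : Q" "v : P"
  have "c e : q" for e using c k_q rangeI[of c e] by blast
  then have cq: "hform q d (form d c)" by (rule hform_form)
  have f: "hform q (d * 2) (%x. form d c (H x))"
   using hform_comp[OF q cq, of 2 H] hmap_H unfolding hmap_def by blast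
  have "form d c (H (vector [y, 1])) = 0" using c pt_self[of "H \<eta>"] unfolding \<eta>_def by blast
  then have z: "form d c (H x) = 0" for x using hform_generic_zero[OF q yq f] by blast
  obtain x where x: "\<iota>' P = pt x" using iota_inv(3)[OF P(1)] by (metis proj_spaceE)
  have "P = pt (H x)" using iota_inv(2)[OF P(1)] unfolding x iota_pt by simp
  then obtain e where "v = e *s H x" using P(2) by (auto simp: pt_mem)
  then show "form d c v = 0" using hform_homogeneous[OF cq] z by simp
 qed
qed

lemma generic_coordinate:
 assumes y: "y \<notin> alg_cl k" and g: "generic_point k Q \<xi>"
 obtains v where "on_Q v" "\<xi> = pt v" "Z v = 1" "U v \<notin> alg_cl k"
proof -
 have gen: "f v = 0" if f: "hform k d f" "f v' = 0" "v' : \<xi>" and v: "on_Q v" for f d v v'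
 proof -
  obtain c where c: "\<forall>e. c e : k" "f = form d c" using form_hform[OF k f(1)] by blast
  have "form d c w = 0" if w: "w : \<xi>" for w
  proof -
   have "\<xi> : Q" using g unfolding generic_point_def by simp
   then obtain e where "w = e *s v'" using w Q_mem(2)[OF _ f(3)] by (auto simp: pt_mem)
   then show ?thesis using f(2) hform_homogeneous[OF f(1)] unfolding c(2) by simp
  qed
  then show ?thesis using g Q_pt[OF v] pt_self[of v] c unfolding generic_point_def by blast
 qed
 obtain v0 where v0: "on_Q v0" "\<xi> = pt v0" using g unfolding generic_point_def by (metis Q_E)
 have Z0: "Z v0 ~= 0"
 proof
  assume "Z v0 = 0"
  then have "Z (H (vector [1, 1])) = 0"
   by (rule gen[OF hform_Z _ _ H_on_Q]) (simp_all add: v0(2) pt_self vector2_eq_0)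
  then show False by (simp add: H_def)
 qed
 define v where "v = (1 / Z v0) *s v0"
 have v: "\<xi> = pt v" "Z v = 1" using Z0 v0(2) pt_scale[of "1 / Z v0" v0] by (simp_all add: v_def lin_linear)
 have vQ: "on_Q v" using g v(1) Q_mem(1)[of \<xi> v] pt_self[of v] unfolding generic_point_def by simp
 have "U v \<notin> alg_cl k"
 proof
  assume "U v : alg_cl k"
  then obtain p where p: "p : polys_over k" "p ~= 0" "poly p (U v) = 0"
   unfolding alg_cl_def mem_Collect_eq algebraic_over_iff[OF k] by blast
  define n where "n = degree p"
  define F where "F X v = (\<Sum>i\<le>n. coeff p i * (X v ^ i * Z v ^ (n - i)))" for X :: "'a ^ 3 => 'a" and v
  have "cform n (F U) (F V)" unfolding F_def
  proof (rule cform_sum)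
   fix i assume "i : {..n}"
   then have e: "i * 1 + (n - i) * 1 = n" by simp
   have "(coeff p i, coeff p i) : C" by (rule C_const[OF coeff_polys_over[OF p(1)]])
   from cform_smult[OF this cform_mult[OF cform_power[OF cform_UV] cform_of_k[OF hform_power[OF k hform_Z]]], of i "n - i"]
   show "cform n (%v. coeff p i * (U v ^ i * Z v ^ (n - i))) (%v. coeff p i * (V v ^ i * Z v ^ (n - i)))"
    unfolding e .
  qed
  \<comment> \<open>The homogenized relation \<open>F U\<close> is defined only over k(th), while
    genericity tests forms over k; its norm is over k. At the point H(y, 1) the norm is y^(2 n) p(y)
    p(lam / y), which is not zero.\<close>
  then have N: "hform k (n + n) (%v. F U v * F V v)" by (rule cform_norm)
  have "F U v = 0" using p(3) unfolding F_def v(2) poly_altdef n_def by simp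
  then have z: "F U (H (vector [y, 1])) * F V (H (vector [y, 1])) = 0"
   by (intro gen[OF N _ _ H_on_Q, of v]) (simp_all add: v(1) pt_self vector2_eq_0)
  have y0: "y ~= 0" by (rule transcendental_nonzero[OF k y])
  have "y ^ (2 * i) * y ^ (n - i) = y ^ n * y ^ i" if "i \<le> n" for i
  proof -
   have "2 * i + (n - i) = n + i" using that by simp
   then show ?thesis by (metis power_add)
  qed
  then have 1: "F U (H (vector [y, 1])) = y ^ n * poly p y"
   unfolding F_def poly_altdef n_def[symmetric] sum_distrib_left
   by (intro sum.cong) (simp_all add: H_def flip: power_mult)
  have "lam ^ i * y ^ (n - i) = y ^ n * (lam / y) ^ i" if "i \<le> n" for i
   using that y0 by (simp add: power_divide power_diff field_simps)
  then have 2: "F V (H (vector [y, 1])) = y ^ n * poly p (lam / y)"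
   unfolding F_def poly_altdef n_def[symmetric] sum_distrib_left
   by (intro sum.cong) (simp_all add: H_def)
  have "lam : alg_cl k" using lam alg_cl_subset[OF k] by blast
  then have "lam / y \<notin> alg_cl k" using transcendental_scale(2)[OF k y] lam by blast
  then have "poly p y ~= 0" "poly p (lam / y) ~= 0"
   using transcendental_poly[OF k _ p(1)] y p(2) by blast+
  then show False using z 1 2 y0 by simp
 qed
 then show thesis using that vQ v by blast
qed

text \<open>With Z = 1 the coordinates of v are themselves traces p1 U + p2 lam / U plus elements of
  k; conversely each trace is a linear form over k divided by Z.\<close>

lemma values_at_twist_field:
 assumes v: "on_Q v" "Z v = 1" shows "values_at k (pt v) = twist_field k C lam (U v)"
proof
 have UV: "U v * V v = lam" using v by (simp add: on_Q_def)
 then have U0: "U v ~= 0" using lam by auto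
 have V: "V v = lam / U v" using UV U0 by (simp add: field_simps)
 let ?T = "twist_field k C lam (U v)"
 have T: "is_subfield ?T" "k \<subseteq> ?T" unfolding twist_field_def by (rule subfield_adjoin, rule adjoin_subset)
 have gen: "a * U v + a' * lam / U v : ?T" if "(a, a') : C" for a a'
  unfolding twist_field_def by (rule subsetD[OF adjoin_gen]) (use that in blast)
 show "values_at k (pt v) \<subseteq> ?T"
 proof (rule values_at_subset[OF k T])
  fix i
  have "v $ i = U v * p1 $ i + V v * p2 $ i + r $ i"
   using comb_nth[of "U v" "V v" "Z v" i] unfolding comb_recon by (simp add: v(2))
  then have "v $ i = (p1 $ i * U v + p2 $ i * lam / U v) + r $ i" by (simp add: V)
  then show "v $ i : ?T" using subfield_add[OF T(1) gen[OF p]] r T(2) by auto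
 qed
 show "?T \<subseteq> values_at k (pt v)" unfolding twist_field_def
 proof (rule adjoin_least)
  show "is_subfield (values_at k (pt v))" "k \<subseteq> values_at k (pt v)" by (rule values_at_subfield[OF k])+
  have "a * U v + a' * lam / U v : values_at k (pt v)" if "(a, a') : C" for a a'
   using values_at_I[OF k cform_trace[OF cform_smult[OF that cform_UV]] hform_Z, of v] v(2) by (simp add: V)
  then show "{a * U v + a' * lam / U v |a a'. (a, a') : C} \<subseteq> values_at k (pt v)" by blast
 qed
qed

lemma pullback_type:
 assumes y: "y \<notin> alg_cl k" and j: "parametrizes lam p1 p2 r j" and g: "generic_point k Q \<xi>"
 shows "ext_type k C lam (pullback_ext k (phi j lam) \<xi>)"
proof -
 obtain v where v: "on_Q v" "\<xi> = pt v" "Z v = 1" "U v \<notin> alg_cl k" by (rule generic_coordinate[OF y g])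
 \<comment> \<open>Rescaled to Z = 1; its U coordinate becomes U^3 / lam, the coordinate w of the
   base field.\<close>
 define v' where "v' = (1 / lam) *s \<Phi> v"
 have l: "1 / lam ~= 0" using lam by simp
 have P: "phi j lam \<xi> = pt v'" unfolding v(2) phi_pt[OF j v(1)] v'_def pt_scale[OF l] ..
 have "v' : pt (\<Phi> v)" unfolding pt_mem v'_def using l by (intro exI[of _ "1 / lam"]) simp
 then have "on_Q v'" by (rule Q_mem(1)[OF Q_pt[OF Phi_on_Q[OF v(1)]]])
 moreover have "Z v' = 1" "U v' = (U v) ^ 3 / lam" using lam v(3) by (simp_all add: v'_def lin_linear \<Phi>_def)
 ultimately have "values_at k (phi j lam \<xi>) = twist_field k C lam ((U v) ^ 3 / lam)"
  unfolding P using values_at_twist_field[of v'] by simp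
 moreover have "values_at k \<xi> = twist_field k C lam (U v)" unfolding v(2) by (rule values_at_twist_field[OF v(1,3)])
 ultimately show ?thesis unfolding ext_type_def pullback_ext_def twist_data_def
  using v(4) lam quad_axioms by blast
qed

lemma twist_parameter_data:
 assumes y: "y \<notin> alg_cl k" and s: "splitting_iso k Q D j" and l: "twist_parameter k D j l"
 shows "\<exists>p1' p2' u' w' c c'. conic_data k th th' l p1' p2' r u' w' z Q D & parametrizes l p1' p2' r j &
  (c, c') : C & c ~= 0 & c' ~= 0 & l = c * c' * lam"
proof -
 have l0: "l : k" "l ~= 0" using l unfolding twist_parameter_def by auto
 obtain lam' p1' p2' u' w' c c' where d: "conic_data k th th' lam' p1' p2' r u' w' z Q D" "parametrizes lam' p1' p2' r j"
  "th : k --> lam' = l" and c: "(c, c') : C" "c ~= 0" "c' ~= 0" "lam' = c * c' * lam"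
  using all_parametrizations[OF y s, of l] l0 unfolding reparam_def by blast
 have "lam' = l" using d(3) conic_data.twist_parameter_unique[OF d(1) _ d(2) l] by blast
 then show ?thesis using d(1,2) c by blast
qed

lemma iota_splitting: "splitting_iso k Q D \<iota>"
 unfolding splitting_iso_def splitting_field D_set using iota_isomorphism[OF q order_refl] iota_zero iota_infinity by auto

lemma constructed_type:
 assumes b: "base k zt" and y: "y \<notin> alg_cl k" and E: "constructed_ext k Q D E" shows "ext_type k C lam E"
proof -
 obtain j l \<xi> where j: "splitting_iso k Q D j" "twist_parameter k D j l" "generic_point k Q \<xi>"
  "E = pullback_ext k (phi j l) \<xi>" using E unfolding constructed_ext_def by blast
 obtain p1' p2' u' w' c c' where d: "conic_data k th th' l p1' p2' r u' w' z Q D" "parametrizes l p1' p2' r j"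
  "(c, c') : C" "c ~= 0" "c' ~= 0" "l = c * c' * lam" using twist_parameter_data[OF y j(1,2)] by blast
 have 1: "ext_type k C l E" unfolding j(4) by (rule conic_data.pullback_type[OF d(1) y d(2) j(3)])
 have "(1 / c, 1 / c') : C" using C_divide[OF C_const d(3)] subfield_1[OF k] by blast
 from base.ext_type_scale[OF b 1 this] show ?thesis using d(4-6) by simp
qed

lemma exists_constructed:
 assumes y: "y \<notin> alg_cl k" shows "\<exists>E. constructed_ext k Q D E & ext_type k C lam E"
 using iota_splitting twist_parameter_iota[OF iota_parametrizes] generic_exists[OF y]
  pullback_type[OF y iota_parametrizes] unfolding constructed_ext_def by blast

theorem pair_properties:
 assumes b: "base k zt" and y: "y \<notin> alg_cl k" "y ^ 3 = x"
 shows "let q = splitting_field k D in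
    (\<forall>P\<in>#D. rational_point q P) &
    (q ~= k --> (\<exists>!\<sigma>. \<sigma> \<in> extensional q & nontrivial_aut k q \<sigma>)) &
    (\<exists>\<iota>. splitting_iso k Q D \<iota>) &
    (\<exists>\<xi>. generic_point k Q \<xi>) &
    (\<forall>\<iota>. splitting_iso k Q D \<iota> -->
      (\<exists>lam. twist_parameter k D \<iota> lam) &
      (\<forall>lam. twist_parameter k D \<iota> lam -->
       regular_map k Q Q (phi \<iota> lam) &
       conjugate_over (alg_cl k) P1 (phi0 lam) Q (phi \<iota> lam) &
       {P\<in>Q. ramified_at Q Q (phi \<iota> lam) P} = set_mset D &
       (\<forall>\<xi>. generic_point k Q \<xi> --> pullback_ext k (phi \<iota> lam) \<xi> \<in>
        bitwists k (adjoin k {x}, adjoin (adjoin k {x}) {y}))))"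
 unfolding Let_def splitting_field
proof (intro conjI)
 show "\<forall>P\<in>#D. rational_point q P" using D_rational by blast
 show "q ~= k --> (\<exists>!\<sigma>. \<sigma> \<in> extensional q & nontrivial_aut k q \<sigma>)" using nontrivial_aut_unique by blast
 show "\<exists>\<iota>. splitting_iso k Q D \<iota>" using iota_splitting by blast
 show "\<exists>\<xi>. generic_point k Q \<xi>" by (rule generic_exists[OF y(1)])
next
 have three: "(3::'a) ~= 0" using b unfolding base_def by simp
 show "\<forall>\<iota>. splitting_iso k Q D \<iota> --> (\<exists>lam. twist_parameter k D \<iota> lam) &
      (\<forall>lam. twist_parameter k D \<iota> lam -->
       regular_map k Q Q (phi \<iota> lam) &
       conjugate_over (alg_cl k) P1 (phi0 lam) Q (phi \<iota> lam) &
       {P\<in>Q. ramified_at Q Q (phi \<iota> lam) P} = set_mset D &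
       (\<forall>\<xi>. generic_point k Q \<xi> --> pullback_ext k (phi \<iota> lam) \<xi> \<in>
        bitwists k (adjoin k {x}, adjoin (adjoin k {x}) {y})))"
 proof (intro allI impI)
  fix j assume s: "splitting_iso k Q D j"
  have "reparam lam j" by (rule all_parametrizations[OF y(1) s]) (use lam in simp)
  then obtain l p1' p2' u' w' where "conic_data k th th' l p1' p2' r u' w' z Q D" "parametrizes l p1' p2' r j"
   unfolding reparam_def by blast
  then have 1: "\<exists>lam. twist_parameter k D j lam" using conic_data.twist_parameter_iota by blast
  have 2: "regular_map k Q Q (phi j l) & conjugate_over (alg_cl k) P1 (phi0 l) Q (phi j l) &
    {P\<in>Q. ramified_at Q Q (phi j l) P} = set_mset D &
    (\<forall>\<xi>. generic_point k Q \<xi> --> pullback_ext k (phi j l) \<xi> : bitwists k (adjoin k {x}, adjoin (adjoin k {x}) {y}))"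
   if l: "twist_parameter k D j l" for l
  proof -
   obtain p1' p2' u' w' where d: "conic_data k th th' l p1' p2' r u' w' z Q D" "parametrizes l p1' p2' r j"
    using twist_parameter_data[OF y(1) s l] by blast
   show ?thesis
    using conic_data.phi_regular[OF d] conic_data.phi_conjugate[OF d] conic_data.ramification[OF d(1) three d(2)]
     base.ext_type_bitwist[OF b y conic_data.pullback_type[OF d(1) y(1) d(2)]] by blast
  qed
  show "(\<exists>lam. twist_parameter k D j lam) &
      (\<forall>lam. twist_parameter k D j lam -->
       regular_map k Q Q (phi j lam) &
       conjugate_over (alg_cl k) P1 (phi0 lam) Q (phi j lam) &
       {P\<in>Q. ramified_at Q Q (phi j lam) P} = set_mset D &
       (\<forall>\<xi>. generic_point k Q \<xi> --> pullback_ext k (phi j lam) \<xi> \<in>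
        bitwists k (adjoin k {x}, adjoin (adjoin k {x}) {y})))"
   using 1 2 by blast
 qed
qed

end

section \<open>Ternary quadratic forms\<close>

definition cross :: "'a::field ^ 3 => 'a ^ 3 => 'a ^ 3" where
 "cross a b = vector [a $ 2 * b $ 3 - a $ 3 * b $ 2, a $ 3 * b $ 1 - a $ 1 * b $ 3, a $ 1 * b $ 2 - a $ 2 * b $ 1]"

lemma lin_3: "lin c (v :: 'a::field ^ 3) = c $ 1 * v $ 1 + c $ 2 * v $ 2 + c $ 3 * v $ 3"
 by (simp add: lin_def sum_3)

lemma lin_comm: "lin c v = lin v c"
 by (simp add: lin_def mult.commute)

lemma lin_cross: "lin a (cross a b) = 0" "lin b (cross a b) = 0"
 by (simp_all add: lin_3 cross_def algebra_simps)

lemma cross_orthogonal: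
 assumes n: "cross a b ~= 0" and x: "lin x a = 0" "lin x b = 0" shows "\<exists>g. x = g *s cross a b"
proof -
 have e: "x $ 2 * cross a b $ 3 - x $ 3 * cross a b $ 2 = a $ 1 * lin x b - b $ 1 * lin x a"
  "x $ 3 * cross a b $ 1 - x $ 1 * cross a b $ 3 = a $ 2 * lin x b - b $ 2 * lin x a"
  "x $ 1 * cross a b $ 2 - x $ 2 * cross a b $ 1 = a $ 3 * lin x b - b $ 3 * lin x a"
  by (simp_all add: lin_3 cross_def algebra_simps)
 have m: "x $ i * cross a b $ j = x $ j * cross a b $ i" for i j
  using exhaust_3[of i] exhaust_3[of j] e x by (auto simp: algebra_simps)
 obtain j where j: "cross a b $ j ~= 0" using n by (auto simp: vec_eq_iff)
 then have "x = (x $ j / cross a b $ j) *s cross a b"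
  using m[of _ j] by (simp add: vec_eq_iff field_simps)
 then show ?thesis by blast
qed

lemma cross_cross: "lin (cross a b) (cross c d) = lin c a * lin d b - lin d a * lin c b"
 by (simp add: lin_3 cross_def algebra_simps)

lemma cross_eq_0:
 assumes "cross a b = 0" "a ~= 0" "b ~= 0" shows "pt a = pt b"
proof (rule proj_eqI[OF assms(2,3)])
 fix i j :: 3
 show "a $ i * b $ j = a $ j * b $ i"
  using assms(1) exhaust_3[of i] exhaust_3[of j] by (auto simp: cross_def vec_eq_iff forall_3 algebra_simps)
qed

locale ternary =
 fixes a b c d e f :: "'a::field"
begin

definition qf :: "'a ^ 3 => 'a" where
 "qf v = a * (v$1)^2 + b * (v$2)^2 + c * (v$3)^2 + d * v$1 * v$2 + e * v$1 * v$3 + f * v$2 * v$3"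

definition grad :: "'a ^ 3 => 'a ^ 3" where
 "grad v = vector [2 * a * v$1 + d * v$2 + e * v$3, 2 * b * v$2 + d * v$1 + f * v$3, 2 * c * v$3 + e * v$1 + f * v$2]"

lemma grad_linear: "grad (v + w) = grad v + grad w" "grad (t *s v) = t *s grad v"
 by (simp_all add: grad_def vec_eq_iff forall_3 algebra_simps)

lemma grad_sym: "lin (grad v) w = lin (grad w) v"
 by (simp add: grad_def lin_3 algebra_simps)

lemma grad_self: "lin (grad v) v = 2 * qf v"
 by (simp add: grad_def lin_3 qf_def power2_eq_square algebra_simps)

lemma qf_add: "qf (v + w) = qf v + qf w + lin (grad v) w"
 by (simp add: grad_def lin_3 qf_def power2_eq_square algebra_simps)

lemma qf_scale: "qf (t *s v) = t\<^sup>2 * qf v"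
 by (simp add: qf_def power2_eq_square algebra_simps)

text \<open>If p1 and p2 were orthogonal for the polar form, both gradients would be multiples of
  the cross product of the points, and a combination of the points would be a singular point of the
  conic.\<close>

lemma polar_nonzero:
 assumes smooth: "\<forall>v. v ~= 0 & qf v = 0 --> grad v ~= 0"
  and p: "qf p1 = 0" "qf p2 = 0" "p1 ~= 0" "p2 ~= 0" "pt p1 ~= pt p2"
 shows "lin (grad p1) p2 ~= 0"
proof
 assume m: "lin (grad p1) p2 = 0"
 have m': "lin (grad p2) p1 = 0" using m grad_sym by metis
 have n: "cross p1 p2 ~= 0" using cross_eq_0 p by blast
 have s: "lin (grad p1) p1 = 0" "lin (grad p2) p2 = 0" using grad_self p(1,2) by simp_all
 obtain g1 where g1: "grad p1 = g1 *s cross p1 p2" using cross_orthogonal[OF n s(1) m] by (elim exE)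
 obtain g2 where g2: "grad p2 = g2 *s cross p1 p2" using cross_orthogonal[OF n m' s(2)] by (elim exE)
 note g = g1 g2
 have "grad p1 ~= 0" using smooth p(1,3) by blast
 then have "g1 ~= 0" using g1 by auto
 define v where "v = g2 *s p1 + (- g1) *s p2"
 have "grad v = g2 *s (g1 *s cross p1 p2) + (- g1) *s (g2 *s cross p1 p2)"
  unfolding v_def grad_linear using g by simp
 also have "\<dots> = 0" by (simp add: vec_eq_iff)
 finally have "grad v = 0" .
 moreover have "qf v = 0" unfolding v_def qf_add qf_scale grad_linear p(1,2) lin_linear m by simp
 moreover have "v ~= 0"
 proof
  assume "v = 0"
  then have "p2 = (g2 / g1) *s p1" using \<open>g1 ~= 0\<close> by (simp add: v_def vec_eq_iff field_simps)
  moreover from this have "g2 / g1 ~= 0" using p(4) by auto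
  ultimately show False using p(5) pt_scale[of "g2 / g1" p1] by simp
 qed
 ultimately show False using smooth by blast
qed

text \<open>The forms \<open>u\<close> and \<open>w\<close> are the normalized tangents at p2 and
  p1, \<open>z\<close> is the chord and \<open>r\<close> the intersection of the tangents. The free
  factor \<delta> is there to absorb the sign that cross products pick up when the points are
  exchanged.\<close>

lemma diagonalization:
 assumes smooth: "\<forall>v. v ~= 0 & qf v = 0 --> grad v ~= 0"
  and p: "qf p1 = 0" "qf p2 = 0" "p1 ~= 0" "p2 ~= 0" "pt p1 ~= pt p2" and \<delta>: "\<delta> ~= 0"
 defines "m \<equiv> lin (grad p1) p2"
 defines "u \<equiv> (1 / m) *s grad p2" and "w \<equiv> (1 / m) *s grad p1" and "z \<equiv> (1 / \<delta>) *s cross p1 p2"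
 defines "r \<equiv> \<delta> *s cross u w"
 defines "lam \<equiv> - qf r / m"
 shows "lin u p1 = 1" "lin u p2 = 0" "lin u r = 0" "lin w p1 = 0" "lin w p2 = 1" "lin w r = 0"
   "lin z p1 = 0" "lin z p2 = 0" "lin z r = 1" "!!v. v = lin u v *s p1 + lin w v *s p2 + lin z v *s r"
  "m ~= 0" "!!v. qf v = m * (lin u v * lin w v - lam * (lin z v)\<^sup>2)" "lam ~= 0"
proof -
 show m: "m ~= 0" unfolding m_def by (rule polar_nonzero[OF smooth p])
 have s: "lin (grad p1) p1 = 0" "lin (grad p2) p2 = 0" using grad_self p(1,2) by simp_all
 show 1: "lin u p1 = 1" "lin u p2 = 0" "lin w p1 = 0" "lin w p2 = 1"
  using m s grad_sym[of p2 p1] unfolding u_def w_def lin_linear by (simp_all add: m_def)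
 show 2: "lin u r = 0" "lin w r = 0" unfolding r_def lin_linear lin_cross by simp_all
 show 3: "lin z p1 = 0" "lin z p2 = 0"
  unfolding z_def lin_linear lin_comm[of "cross p1 p2"] lin_cross by simp_all
 have cc: "lin (cross p1 p2) (cross u w) = 1" unfolding cross_cross 1 by simp
 then show 4: "lin z r = 1" unfolding z_def r_def lin_linear using \<delta> by simp
 have uw: "cross u w ~= 0" using cc by (auto simp: lin_linear)
 show recon: "v = lin u v *s p1 + lin w v *s p2 + lin z v *s r" for v
 proof -
  define x where "x = v + (-1) *s (lin u v *s p1 + lin w v *s p2 + lin z v *s r)"
  have x: "lin u x = 0" "lin w x = 0" "lin z x = 0"
   unfolding x_def lin_linear using 1 2 3 4 by simp_all
  obtain g where g: "x = g *s cross u w" using cross_orthogonal[OF uw] x(1,2) lin_comm by metis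
  have "lin (cross p1 p2) x = 0" using x(3) \<delta> unfolding z_def lin_linear by simp
  then have "g = 0" unfolding g lin_linear cc by simp
  then have "x = 0" using g by simp
  moreover have "v = x + (lin u v *s p1 + lin w v *s p2 + lin z v *s r)" unfolding x_def by (simp add: vec_eq_iff)
  ultimately show ?thesis by simp
 qed
 have gp: "lin (grad p1) v = m * lin w v" "lin (grad p2) v = m * lin u v" for v
  unfolding w_def u_def lin_linear using m by simp_all
 show F: "qf v = m * (lin u v * lin w v - lam * (lin z v)\<^sup>2)" for v
 proof -
  have "qf v = qf (lin u v *s p1 + lin w v *s p2 + lin z v *s r)" using recon[of v] by simp
  also have "\<dots> = (lin z v)\<^sup>2 * qf r + lin u v * lin w v * m"
   unfolding qf_add qf_scale grad_linear lin_linear p(1,2) gp 2 1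
   by (simp add: lin_comm[of "_ + _"] lin_linear lin_comm[of "_ *s _"] lin_comm[of r] gp 1 2 mult_ac)
  finally show ?thesis using m unfolding lam_def by (simp add: algebra_simps)
 qed
 \<comment> \<open>With lam = 0 the point r would lie on the conic and be orthogonal to the whole
   basis, hence singular.\<close>
 show "lam ~= 0"
 proof
  assume "lam = 0"
  then have q0: "qf r = 0" using m unfolding lam_def by simp
  have r0: "r ~= 0" using 4 by (auto simp: lin_linear)
  have g: "lin (grad r) p1 = 0" "lin (grad r) p2 = 0" "lin (grad r) r = 0"
   using gp[of r] 2 q0 grad_sym[of r p1] grad_sym[of r p2] grad_self[of r] by simp_all
  have "lin (grad r) v = 0" for v
   by (subst recon[of v]) (simp add: lin_comm[of "grad r"] lin_linear g[unfolded lin_comm[of "grad r"]])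
  then have "lin (grad r) (axis i 1) = 0" for i by blast
  then have "grad r = 0" by (simp add: vec_eq_iff lin_def axis_def if_distrib cong: if_cong)
  then show False using smooth r0 q0 by blast
 qed
qed

end

section \<open>Galois descent for pairs\<close>

text \<open>The predicate \<open>t\<close> tells which automorphisms exchange; \<open>R\<close>
  collects the pairs behaving accordingly. Since \<open>R\<close> is closed under field operations,
  whole formulas descend at once, and \<open>R a a\<close> means that a lies in k.\<close>

locale galois_pairs = base k zt for k :: "'a::alg_closed_field set" and zt +
 fixes t :: "('a => 'a) => bool"
begin

definition R where
 "R a a' \<longleftrightarrow> a : kb & a' : kb & (\<forall>\<sigma>. galois_aut k \<sigma> --> \<sigma> a = (if t \<sigma> then a' else a) & \<sigma> a' = (if t \<sigma> then a else a'))"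

lemma R_swap: "R a a' ==> R a' a"
 unfolding R_def by auto

lemma R_const: "a : k ==> R a a"
 unfolding R_def using alg_cl_subset[OF k] field_isoD(2) by (metis subsetD)

lemma R_ops:
 assumes "R a a'" "R b b'"
 shows "R (a + b) (a' + b')" "R (a - b) (a' - b')" "R (a * b) (a' * b')" "R (a / b) (a' / b')"
proof -
 have kb': "a : kb" "a' : kb" "b : kb" "b' : kb" using assms unfolding R_def by auto
 have s: "\<sigma> a = (if t \<sigma> then a' else a)" "\<sigma> a' = (if t \<sigma> then a else a')"
  "\<sigma> b = (if t \<sigma> then b' else b)" "\<sigma> b' = (if t \<sigma> then b else b')" if "galois_aut k \<sigma>" for \<sigma>
  using assms that unfolding R_def by blast+
 show "R (a + b) (a' + b')" "R (a - b) (a' - b')" "R (a * b) (a' * b')" "R (a / b) (a' / b')"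
  unfolding R_def using kb'
  by (simp_all add: subfield_intros[OF kb] subfield_divide[OF kb] field_isoD(3,4) iso_diff[OF _ kb] iso_divide[OF _ kb] s)
qed

lemma R_fixed: "R a a ==> a : k"
 using constants_fixed[OF k k order_refl perf, of a] unfolding R_def by auto

lemma R_quad:
 assumes R: "R th th'" "th ~= th'" shows "quad k th th'"
proof
 show "th + th' : k" "th * th' : k"
  using R_ops(1,3)[OF R(1) R_swap[OF R(1)]] R_fixed by (metis add.commute, metis mult.commute)
qed (use k R in auto)

lemma R_C:
 assumes R: "R th th'" "th ~= th'" and a: "R a a'" shows "(a, a') : quad_pairs k th th'"
proof -
 define bt where "bt = (a - a') / (th - th')"
 have "R ((a - a') / (th - th')) ((a' - a) / (th' - th))" by (intro R_ops(2,4) a R R_swap)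
 moreover have "(a' - a) / (th' - th) = bt" unfolding bt_def by (metis minus_diff_eq minus_divide_divide)
 ultimately have b: "R bt bt" unfolding bt_def by simp
 have e: "bt * (th - th') = a - a'" using R(2) by (simp add: bt_def)
 have "R (a - bt * th) (a' - bt * th')" by (intro R_ops(2,3) a R b)
 moreover have "a' - bt * th' = a - bt * th" using e by (simp add: algebra_simps)
 ultimately have "a - bt * th : k" "bt : k" using R_fixed b by simp_all
 moreover have "a' = a - bt * th + bt * th'" using e by (simp add: algebra_simps)
 ultimately show ?thesis by (intro quad.C_I[OF R_quad[OF R], of "a - bt * th" bt]) simp_all
qed

lemma R_lin: "(!!i. R (c $ i) (c' $ i)) ==> (!!i. R (v $ i) (v' $ i)) ==> R (lin c v) (lin c' (v' :: 'a ^ 3))"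
 unfolding lin_3 by (intro R_ops(1,3))

lemma R_cross: "(!!i. R (a $ i) (a' $ i)) ==> (!!i. R (b $ i) (b' $ i)) ==> R (cross a b $ i) (cross a' b' $ i)"
 using exhaust_3[of i] by (auto simp: cross_def intro!: R_ops(2,3))

theorem conic_data_of_points:
 fixes Q :: "('a, 3) ppoint set"
 assumes co: "{a, b, c, d, e, f} \<subseteq> k"
  and smooth: "\<forall>v. v ~= 0 & ternary.qf a b c d e f v = 0 --> ternary.grad a b c d e f v ~= 0"
  and Q: "Q = {pt v | v. v ~= 0 & ternary.qf a b c d e f v = 0}"
  and p: "p1 ~= 0" "p2 ~= 0" "pt p1 ~= pt p2" "ternary.qf a b c d e f p1 = 0" "ternary.qf a b c d e f p2 = 0"
  and Rp: "!!i. R (p1 $ i) (p2 $ i)" and th: "R th th'" "th ~= th'"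
 shows "\<exists>lam r u w z. conic_data k th th' lam p1 p2 r u w z Q {#pt p1, pt p2#}"
proof -
 interpret T: ternary a b c d e f .
 \<comment> \<open>An element that changes sign under exchange, like the cross products; so
   \<open>z\<close> and \<open>r\<close> become invariant. In characteristic two the sign is
   harmless and \<delta> is still nonzero.\<close>
 define \<delta> where "\<delta> = th - th'"
 have d0: "\<delta> ~= 0" using th by (simp add: \<delta>_def)
 have Rd: "R \<delta> (- \<delta>)" using R_ops(2)[OF th(1) R_swap[OF th(1)]] by (simp add: \<delta>_def)
 define m where "m = lin (T.grad p1) p2"
 define u w z where "u = (1 / m) *s T.grad p2" and "w = (1 / m) *s T.grad p1" and "z = (1 / \<delta>) *s cross p1 p2"
 define r where "r = \<delta> *s cross u w"
 define lam where "lam = - T.qf r / m"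
 note D = T.diagonalization[OF smooth p(4,5,1-3) d0, folded m_def, folded u_def w_def z_def, folded r_def, folded lam_def]
 have cR: "R a a" "R b b" "R c c" "R d d" "R e e" "R f f" using co by (auto intro: R_const)
 have two: "R 2 2" using R_ops(1)[OF R_const R_const] subfield_1[OF k] by (metis one_add_one)
 have one: "R 1 1" by (rule R_const[OF subfield_1[OF k]])
 have gR: "R (T.grad v $ i) (T.grad v' $ i)" if v: "!!i. R (v $ i) (v' $ i)" for v v' i
  using exhaust_3[of i] by (auto simp: T.grad_def intro!: R_ops(1,3) cR two v)
 have Rp': "R (p2 $ i) (p1 $ i)" for i by (rule R_swap[OF Rp])
 have "R m (lin (T.grad p2) p1)" unfolding m_def by (rule R_lin[OF gR[OF Rp] Rp'])
 then have mR: "R m m" unfolding m_def using T.grad_sym by metis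
 have uw: "R (u $ i) (w $ i)" for i
  unfolding u_def w_def vector_smult_component by (intro R_ops(3,4) one mR gR Rp')
 have zi: "R (z $ i) (z $ i)" for i
 proof -
  have "R (1 / \<delta> * cross p1 p2 $ i) (1 / (- \<delta>) * cross p2 p1 $ i)" by (intro R_ops(3,4) one Rd R_cross Rp Rp')
  moreover have "1 / (- \<delta>) * cross p2 p1 $ i = 1 / \<delta> * cross p1 p2 $ i"
   using exhaust_3[of i] d0 by (auto simp: cross_def field_simps)
  ultimately show ?thesis by (simp add: z_def)
 qed
 have ri: "R (r $ i) (r $ i)" for i
 proof -
  have "R (\<delta> * cross u w $ i) ((- \<delta>) * cross w u $ i)" by (intro R_ops(3) Rd R_cross uw R_swap[OF uw])
  moreover have "(- \<delta>) * cross w u $ i = \<delta> * cross u w $ i"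
   using exhaust_3[of i] by (auto simp: cross_def algebra_simps)
  ultimately show ?thesis by (simp add: r_def)
 qed
 have "R (T.qf r) (T.qf r)" unfolding T.qf_def power2_eq_square by (intro R_ops(1,3) cR ri)
 then have "R (0 - T.qf r / m) (0 - T.qf r / m)" 
  by (intro R_ops(2)[OF R_const[OF subfield_0[OF k]]] R_ops(4) mR)
 then have lamk: "lam : k" unfolding lam_def using R_fixed[of "0 - T.qf r / m"] by simp
 interpret q: quad k th th' by (rule R_quad[OF th])
 have "conic_data k th th' lam p1 p2 r u w z Q {#pt p1, pt p2#}"
 proof
  show "lam : k" "lam ~= 0" by (rule lamk, rule D)
  show "(p1 $ i, p2 $ i) : q.C" "(u $ i, w $ i) : q.C" for i by (rule R_C[OF th Rp], rule R_C[OF th uw])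
  show "r $ i : k" "z $ i : k" for i by (rule R_fixed[OF ri], rule R_fixed[OF zi])
  have "T.qf v = 0 \<longleftrightarrow> lin u v * lin w v = lam * (lin z v)\<^sup>2" for v unfolding D(12)[of v] using D(11) by simp
  then show "Q = {pt v |v. v ~= 0 & lin u v * lin w v = lam * (lin z v)\<^sup>2}" unfolding Q by simp
 qed (rule D refl)+
 then show ?thesis by blast
qed

end

lemma conj_point_pt:
 assumes b: "base k zt" and s: "galois_aut k \<sigma>" and v: "v ~= 0" "!!i. v $ i : alg_cl k"
 shows "conj_point (alg_cl k) \<sigma> (pt v) = pt (\<chi> i. \<sigma> (v $ i))"
proof -
 interpret base k zt by (rule b)
 have "pt (\<chi> i. \<sigma> (w $ i)) = pt (\<chi> i. \<sigma> (v $ i))" if w: "w : pt v" "\<forall>i. w $ i : kb" for w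
 proof -
  obtain c where c: "c ~= 0" "w = c *s v" using w(1) by (auto simp: pt_mem)
  obtain j where j: "v $ j ~= 0" using v(1) by (auto simp: vec_eq_iff)
  have "c = w $ j / v $ j" using c j by simp
  then have ck: "c : kb" using w(2) v(2) subfield_divide[OF kb] by metis
  have "(\<chi> i. \<sigma> (w $ i)) = \<sigma> c *s (\<chi> i. \<sigma> (v $ i))"
   by (simp add: vec_eq_iff c(2) field_isoD(4)[OF s ck v(2)])
  moreover have "\<sigma> c ~= 0"
   using c(1) iso_eq_0_iff[OF s kb ck] by simp
  ultimately show ?thesis by (simp add: pt_scale)
 qed
 then show ?thesis unfolding conj_point_def using pt_self[of v] v(2) by (intro SUP_eq_const) blast+
qed

section \<open>Pairs and their types\<close>

lemma rational_pt:
 assumes "rational_point F P" "P = pt v" "v ~= 0" obtains w where "P = pt w" "w ~= 0" "\<forall>i. w $ i : F"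
proof -
 obtain w where w: "w : P" "\<forall>i. w $ i : F" using assms(1) unfolding rational_point_def by blast
 then show thesis using that[of w] pt_mem_eq[of w v] pt_nonzero[of w v] assms(2,3) by auto
qed

theorem conic_pairs_data:
 fixes k :: "'a::alg_closed_field set"
 assumes b: "base k zt" and QD: "(Q, D) : conic_pairs k"
 shows "\<exists>th th' lam p1 p2 r u w z. conic_data k th th' lam p1 p2 r u w z Q D"
proof -
 interpret base k zt by (rule b)
 have QD': "conic k Q" "set_mset D \<subseteq> Q" "size D = 2" "\<forall>P. count D P \<le> 1" "\<forall>P\<in>#D. rational_point kb P"
  "\<forall>\<sigma>. galois_aut k \<sigma> --> image_mset (conj_point kb \<sigma>) D = D" using QD unfolding conic_pairs_def by auto
 obtain PA M where M: "D = add_mset PA M" "size M = 1"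
  using size_eq_Suc_imp_eq_union[of D 1] QD'(3) by fastforce
 obtain PB where "M = {#PB#}" using size_1_singleton_mset[OF M(2)] by blast
 then have D: "D = {#PA, PB#}" using M(1) by simp
 have ne: "PA ~= PB"
 proof
  assume "PA = PB"
  then have "count D PA = 2" unfolding D by simp
  then show False using QD'(4) by (metis numeral_le_one_iff semiring_norm(69))
 qed
 have "\<exists>a b c d e f. {a, b, c, d, e, f} \<subseteq> k &
   (\<forall>v. v ~= 0 & ternary.qf a b c d e f v = 0 --> ternary.grad a b c d e f v ~= 0) &
   Q = {pt v | v. v ~= 0 & ternary.qf a b c d e f v = 0}"
 proof -
  have g: "ternary.grad a b c d e f v ~= 0 \<longleftrightarrow> \<not> (2 * a * v$1 + d * v$2 + e * v$3 = 0 &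
    2 * b * v$2 + d * v$1 + f * v$3 = 0 & 2 * c * v$3 + e * v$1 + f * v$2 = 0)" for a b c d e f and v :: "'a ^ 3"
   by (simp add: ternary.grad_def vec_eq_iff forall_3)
  show ?thesis using QD'(1) unfolding conic_def Let_def g ternary.qf_def .
 qed
 then obtain a b c d e f where co: "{a, b, c, d, e, f} \<subseteq> k"
  and sm: "\<forall>v. v ~= 0 & ternary.qf a b c d e f v = 0 --> ternary.grad a b c d e f v ~= 0"
  and Q: "Q = {pt v | v. v ~= 0 & ternary.qf a b c d e f v = 0}" by (elim exE conjE)
 have PQ: "PA : Q" "PB : Q" and Pr: "rational_point kb PA" "rational_point kb PB"
  using QD'(2,5) unfolding D by auto
 have qpt: "ternary.qf a b c d e f v = 0" if vQ: "pt v : Q" for v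
 proof -
  obtain v' where v': "pt v = pt v'" "ternary.qf a b c d e f v' = 0" using vQ unfolding Q by blast
  obtain t where "v = t *s v'" using v'(1) unfolding pt_eq_iff by blast
  then show ?thesis using v'(2) by (simp add: ternary.qf_scale)
 qed
 obtain v1 where v1: "PA = pt v1" "v1 ~= 0" "\<forall>i. v1 $ i : kb" using PQ(1) rational_pt[OF Pr(1)] unfolding Q by blast
 obtain v2 where v2: "PB = pt v2" "v2 ~= 0" "\<forall>i. v2 $ i : kb" using PQ(2) rational_pt[OF Pr(2)] unfolding Q by blast
 \<comment> \<open>Normalizing both vectors at a common coordinate makes automorphisms permute the
   vectors and not only their points. If no common nonzero coordinate exists, the supports are
   disjoint and no automorphism can exchange the points.\<close>
 obtain j1 j2 where j: "v1 $ j1 ~= 0" "v2 $ j2 ~= 0" "j1 = j2 \<or> (\<forall>j. v1 $ j = 0 \<or> v2 $ j = 0)"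
 proof (cases "\<exists>j. v1 $ j ~= 0 & v2 $ j ~= 0")
  case True
  then show thesis using that by blast
 next
  case False
  obtain j1 j2 where "v1 $ j1 ~= 0" "v2 $ j2 ~= 0" using v1(2) v2(2) by (auto simp: vec_eq_iff)
  then show thesis using that False by blast
 qed
 define p1 p2 where "p1 = (1 / v1 $ j1) *s v1" and "p2 = (1 / v2 $ j2) *s v2"
 have p1: "PA = pt p1" "p1 ~= 0" "p1 $ j1 = 1" "p1 $ i : kb" for i
  using v1 j(1) pt_scale[of "1 / v1 $ j1" v1] subfield_divide[OF kb] subfield_1[OF kb] by (auto simp: p1_def)
 have p2: "PB = pt p2" "p2 ~= 0" "p2 $ j2 = 1" "p2 $ i : kb" for i
  using v2 j(2) pt_scale[of "1 / v2 $ j2" v2] subfield_divide[OF kb] subfield_1[OF kb] by (auto simp: p2_def)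
 have supp: "j1 = j2 \<or> (\<forall>j. p1 $ j = 0 \<or> p2 $ j = 0)" using j by (auto simp: p1_def p2_def)
 have act: "((\<forall>i. \<sigma> (p1 $ i) = p1 $ i) & (\<forall>i. \<sigma> (p2 $ i) = p2 $ i)) \<or> ((\<forall>i. \<sigma> (p1 $ i) = p2 $ i) & (\<forall>i. \<sigma> (p2 $ i) = p1 $ i))"
  if s: "galois_aut k \<sigma>" for \<sigma>
 proof -
  define s1 s2 where "s1 = (\<chi> i. \<sigma> (p1 $ i))" and "s2 = (\<chi> i. \<sigma> (p2 $ i))"
  have s1j: "s1 $ j1 = 1" "s2 $ j2 = 1" unfolding s1_def s2_def using p1(3) p2(3) iso_1[OF s kb] by simp_all
  have im: "image_mset (conj_point kb \<sigma>) D = D" using QD'(6) s by blast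
  have "set_mset (image_mset (conj_point kb \<sigma>) D) = {pt s1, pt s2}"
   unfolding D p1(1) p2(1) s1_def s2_def using conj_point_pt[OF b s p1(2,4)] conj_point_pt[OF b s p2(2,4)] by simp
  then have "{pt s1, pt s2} = {pt p1, pt p2}" unfolding im by (simp add: D p1(1) p2(1))
  then have "pt s1 = pt p1 & pt s2 = pt p2 \<or> pt s1 = pt p2 & pt s2 = pt p1" by (simp only: doubleton_eq_iff)
  then show ?thesis
  proof
   assume "pt s1 = pt p1 & pt s2 = pt p2"
   then obtain c c' where c: "s1 = c *s p1" "s2 = c' *s p2" unfolding pt_eq_iff by blast
   then have "c = 1" "c' = 1" using s1j p1(3) p2(3) by simp_all
   then have "s1 = p1" "s2 = p2" using c by simp_all
   then show ?thesis unfolding s1_def s2_def vec_eq_iff by simp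
  next
   assume "pt s1 = pt p2 & pt s2 = pt p1"
   then obtain c c' where c: "s1 = c *s p2" "s2 = c' *s p1" unfolding pt_eq_iff by blast
   have n: "p2 $ j1 ~= 0" "p1 $ j2 ~= 0" using s1j c by auto
   then have "j1 = j2" using supp p1(3) p2(3) by force
   then have "c = 1" "c' = 1" using s1j c p1(3) p2(3) by simp_all
   then have "s1 = p2" "s2 = p1" using c by simp_all
   then show ?thesis unfolding s1_def s2_def vec_eq_iff by simp
  qed
 qed
 define t where "t \<sigma> \<longleftrightarrow> (\<exists>i. \<sigma> (p1 $ i) ~= p1 $ i)" for \<sigma> :: "'a => 'a"
 interpret G: galois_pairs k zt t by unfold_locales
 have Rp: "G.R (p1 $ i) (p2 $ i)" for i
  unfolding G.R_def
 proof (intro conjI allI impI p1(4) p2(4))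
  fix \<sigma> assume s: "galois_aut k \<sigma>"
  show "\<sigma> (p1 $ i) = (if t \<sigma> then p2 $ i else p1 $ i)" "\<sigma> (p2 $ i) = (if t \<sigma> then p1 $ i else p2 $ i)"
  proof -
   have "t \<sigma> ==> \<sigma> (p1 $ i) = p2 $ i & \<sigma> (p2 $ i) = p1 $ i" using act[OF s] unfolding t_def by blast
   moreover have "\<sigma> (p1 $ i) = p1 $ i & \<sigma> (p2 $ i) = p2 $ i" if "\<not> t \<sigma>"
   proof -
    have fix1: "\<forall>i. \<sigma> (p1 $ i) = p1 $ i" using that unfolding t_def by blast
    have "\<not> (\<forall>i. \<sigma> (p1 $ i) = p2 $ i)"
    proof
     assume "\<forall>i. \<sigma> (p1 $ i) = p2 $ i"
     then have "p1 = p2" using fix1 by (simp add: vec_eq_iff)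
     then show False using ne p1(1) p2(1) by simp
    qed
    then show ?thesis using act[OF s] fix1 by blast
   qed
   ultimately show "\<sigma> (p1 $ i) = (if t \<sigma> then p2 $ i else p1 $ i)" "\<sigma> (p2 $ i) = (if t \<sigma> then p1 $ i else p2 $ i)" by auto
  qed
 qed
 \<comment> \<open>If some automorphism exchanges the points, a coordinate in which they differ
   generates the algebra; otherwise the pair (1, 0) generates the split one.\<close>
 obtain th th' where th: "G.R th th'" "th ~= th'"
 proof (cases "\<exists>\<sigma>. galois_aut k \<sigma> & t \<sigma>")
  case True
  have "\<exists>i. p1 $ i ~= p2 $ i" using ne p1(1) p2(1) by (metis vec_eq_iff)
  then show thesis using that Rp by blast
 next
  case False
  have "G.R 1 0" unfolding G.R_def using False iso_0[OF _ kb] iso_1[OF _ kb] subfield_0[OF kb] subfield_1[OF kb] by auto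
  then show thesis using that by simp
 qed
 have pp: "pt p1 ~= pt p2" using ne p1(1) p2(1) by simp
 have "\<exists>lam r u w z. conic_data k th th' lam p1 p2 r u w z Q {#pt p1, pt p2#}"
  by (rule G.conic_data_of_points[OF co sm Q p1(2) p2(2) pp qpt qpt Rp th]) (use PQ p1(1) p2(1) in simp_all)
 then show ?thesis unfolding D p1(1) p2(1) by blast
qed

definition pair_type where
 "pair_type k C lam Q D \<longleftrightarrow>
  (\<exists>th th' p1 p2 r u w z. C = quad_pairs k th th' & conic_data k th th' lam p1 p2 r u w z Q D)"

lemma conic_data_cong:
 assumes "conic_data k \<eta> \<eta>' lam p1 p2 r u w z Q D" "quad k th th'" "quad_pairs k th th' = quad_pairs k \<eta> \<eta>'"
 shows "conic_data k th th' lam p1 p2 r u w z Q D"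
 using assms unfolding conic_data_def conic_data_axioms_def by simp

text \<open>The field k(th) determines the pairs: all pairs over k if it equals k, and otherwise the
  graph of its nontrivial automorphism.\<close>

lemma quad_pairs_unique:
 assumes 1: "quad k th th'" and 2: "quad k \<eta> \<eta>'" and q: "fst ` quad_pairs k th th' = fst ` quad_pairs k \<eta> \<eta>'"
 shows "quad_pairs k th th' = quad_pairs k \<eta> \<eta>'"
proof (cases "fst ` quad_pairs k th th' = k")
 case True
 then have "th : k" "\<eta> : k" using quad.q_iff[OF 1] quad.q_iff[OF 2] q by auto
 then show ?thesis using quad.C_split[OF 1] quad.C_split[OF 2] by simp
next
 case False
 then obtain \<sigma> where s: "nontrivial_aut k (fst ` quad_pairs k th th') \<sigma>" using quad.nontrivial_aut_unique[OF 1] by blast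
 have "(a, a') : quad_pairs k \<eta> \<eta>'" if a: "(a, a') : quad_pairs k th th'"
  and 1: "quad k th th'" "quad k \<eta> \<eta>'" and q: "fst ` quad_pairs k th th' = fst ` quad_pairs k \<eta> \<eta>'"
  and s: "nontrivial_aut k (fst ` quad_pairs k th th') \<sigma>" for a a' th th' \<eta> \<eta>'
 proof -
  have "a : fst ` quad_pairs k \<eta> \<eta>'" using a q by force
  then obtain b where b: "(a, b) : quad_pairs k \<eta> \<eta>'" by auto
  have "\<sigma> a = b" using quad.nontrivial_aut_C[OF 1(2) s[unfolded q] b] .
  moreover have "\<sigma> a = a'" by (rule quad.nontrivial_aut_C[OF 1(1) s a])
  ultimately show ?thesis using b by simp
 qed
 note sub = this
 show ?thesis
 proof (intro equalityI subrelI)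
  show "(a, a') : quad_pairs k \<eta> \<eta>'" if "(a, a') : quad_pairs k th th'" for a a'
   by (rule sub[OF that 1 2 q s])
  show "(a, a') : quad_pairs k th th'" if "(a, a') : quad_pairs k \<eta> \<eta>'" for a a'
   by (rule sub[OF that 2 1 q[symmetric] s[unfolded q]])
 qed
qed

context conic_data
begin

lemma pair_type: "pair_type k C lam Q D"
 unfolding pair_type_def using conic_data_axioms by blast

lemma divisor_conjugate:
 assumes b: "base k zt" and s: "galois_aut k \<sigma>"
 shows "image_mset (conj_point (alg_cl k) \<sigma>) D = D"
proof -
 have kb: "is_subfield (alg_cl k)" by (rule subfield_alg_cl[OF k])
 note th = subsetD[OF q_alg th_q(1)] subsetD[OF q_alg th_q(2)]
 have pk: "p1 $ i : alg_cl k" "p2 $ i : alg_cl k" for i using p_q q_alg by blast+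
 have c: "conj_point (alg_cl k) \<sigma> (pt p1) = pt (\<chi> i. \<sigma> (p1 $ i))" "conj_point (alg_cl k) \<sigma> (pt p2) = pt (\<chi> i. \<sigma> (p2 $ i))"
  by (rule conj_point_pt[OF b s p_nonzero(1) pk(1)], rule conj_point_pt[OF b s p_nonzero(2) pk(2)])
 note i = iso_C[OF s kb th alg_cl_subset[OF k] p]
 consider "\<sigma> th = th" | "\<sigma> th = th'" using iso_quad[OF s kb th] by blast
 then show ?thesis
 proof cases
  case 1
  then have "(\<chi> i. \<sigma> (p1 $ i)) = p1" "(\<chi> i. \<sigma> (p2 $ i)) = p2" using i(1) by (simp_all add: vec_eq_iff)
  then show ?thesis unfolding D using c by simp
 next
  case 2
  then have "(\<chi> i. \<sigma> (p1 $ i)) = p2" "(\<chi> i. \<sigma> (p2 $ i)) = p1" using i(2) by (simp_all add: vec_eq_iff)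
  then show ?thesis unfolding D using c by (simp add: add_mset_commute)
 qed
qed

lemma conic_pairsI:
 assumes b: "base k zt" and Q': "conic k Q" shows "(Q, D) : conic_pairs k"
 unfolding conic_pairs_def
proof (intro CollectI case_prodI conjI allI impI ballI Q')
 show "set_mset D \<subseteq> Q" unfolding D_set using p_nonzero dual by (auto intro!: Q_pt simp: on_Q_def)
 show "size D = 2" "count D P \<le> 1" for P using pt_p_distinct by (auto simp: D)
 fix P assume "P \<in># D"
 then show "rational_point (alg_cl k) P" using D_rational q_alg unfolding rational_point_def by blast
qed (rule divisor_conjugate[OF b])

lemma hmap_comb:
 assumes "!!i. (a $ i, a' $ i) : C" "!!i. c $ i : k"
 shows "hmap k 1 (%v. U v *s a + V v *s a' + Z v *s c)"
 unfolding hmap_def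
proof
 fix i
 have "hform k 1 (%v. (a $ i * U v + a' $ i * V v) + c $ i * Z v)"
  by (intro hform.add[OF cform_trace[OF cform_smult[OF assms(1) cform_UV]]] hform_smult[OF k hform_Z] assms(2))
 then show "hform k 1 (%v. (U v *s a + V v *s a' + Z v *s c) $ i)" by (simp add: mult.commute)
qed

text \<open>The linear map matching the coordinates U, V, Z respects equations and divisors; its
  entries are traces plus rational terms, so it is defined over k.\<close>

lemma same_type_isomorphic:
 assumes d: "conic_data k th th' lam PA PB R1 u' w' z' Q' D'"
 shows "\<exists>f. isomorphism k Q Q' f & image_mset f D = D'"
proof -
 interpret B: conic_data k th th' lam PA PB R1 u' w' z' Q' D' by (rule d)
 define M where "M v = B.comb (U v) (V v) (Z v)" for v
 define N where "N v = comb (B.U v) (B.V v) (B.Z v)" for v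
 have h: "hmap k 1 M" "hmap k 1 N"
  unfolding M_def[abs_def] N_def[abs_def] B.comb_def comb_def
  using hmap_comb[OF B.p B.r] B.hmap_comb[OF p r] by auto
 have inv: "N (M v) = v" "M (N v) = v" for v unfolding M_def N_def by (simp_all add: comb_recon B.comb_recon)
 have nz: "M v ~= 0 & B.on_Q (M v)" if "on_Q v" for v
 proof -
  have "M v ~= 0" using that coords_0[of v] unfolding M_def B.comb_eq_0 on_Q_def by blast
  then show ?thesis using that unfolding on_Q_def B.on_Q_def M_def by simp
 qed
 have nz': "N v ~= 0 & on_Q (N v)" if "B.on_Q v" for v
 proof -
  have "N v ~= 0" using that B.coords_0[of v] unfolding N_def comb_eq_0 B.on_Q_def by blast
  then show ?thesis using that unfolding on_Q_def B.on_Q_def N_def by simp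
 qed
 have pM: "induced M (pt v) = pt (M v)" "induced N (pt v) = pt (N v)" for v by (rule induced_pt[OF h(1)], rule induced_pt[OF h(2)])
 have "regular_map k Q Q' (induced M)"
 proof (rule regular_map_global[OF k h(1)])
  fix P assume P: "P : Q"
  show "M v ~= 0 & induced M P = pt (M v)" if "v : P" for v
   using nz[OF Q_mem(1)[OF P that]] Q_mem(2)[OF P that] pM by simp
  obtain v where "on_Q v" "P = pt v" by (rule Q_E[OF P])
  then show "induced M P : Q'" using nz B.Q_pt pM by simp
 qed
 moreover have "regular_map k Q' Q (induced N)"
 proof (rule regular_map_global[OF k h(2)])
  fix P assume P: "P : Q'"
  show "N v ~= 0 & induced N P = pt (N v)" if "v : P" for v
   using nz'[OF B.Q_mem(1)[OF P that]] B.Q_mem(2)[OF P that] pM by simp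
  obtain v where "B.on_Q v" "P = pt v" by (rule B.Q_E[OF P])
  then show "induced N P : Q" using nz' Q_pt pM by simp
 qed
 moreover have "induced N (induced M P) = P" if "P : Q" for P using Q_E[OF that] by (metis pM inv(1))
 moreover have "induced M (induced N P) = P" if "P : Q'" for P using B.Q_E[OF that] by (metis pM inv(2))
 ultimately have "isomorphism k Q Q' (induced M)" unfolding isomorphism_def by blast
 moreover have "M p1 = PA" "M p2 = PB" unfolding M_def dual B.comb_def by simp_all
 then have "image_mset (induced M) D = D'" unfolding D B.D by (simp add: pM)
 ultimately show ?thesis by blast
qed

end

lemma same_pair_type_isomorphic:
 assumes "pair_type k C lam Q D" "pair_type k C lam Q' D'"
 shows "\<exists>f. isomorphism k Q Q' f & image_mset f D = D'"
proof -
 obtain th th' p1 p2 r u w z where 1: "C = quad_pairs k th th'" "conic_data k th th' lam p1 p2 r u w z Q D"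
  using assms(1) unfolding pair_type_def by blast
 obtain \<eta> \<eta>' PA PB R u' w' z' where 2: "C = quad_pairs k \<eta> \<eta>'" "conic_data k \<eta> \<eta>' lam PA PB R u' w' z' Q' D'"
  using assms(2) unfolding pair_type_def by blast
 have "quad k th th'" using 1(2) unfolding conic_data_def by blast
 then show ?thesis using conic_data.same_type_isomorphic[OF 1(2)] conic_data_cong[OF 2(2)] 1(1) 2(1) by metis
qed

lemma pair_type_scale:
 assumes t: "pair_type k C lam Q D" and c: "(c, c') : C" "c ~= 0" "c' ~= 0"
 shows "pair_type k C (c * c' * lam) Q D"
proof -
 obtain th th' p1 p2 r u w z where 1: "C = quad_pairs k th th'" "conic_data k th th' lam p1 p2 r u w z Q D"
  using t unfolding pair_type_def by blast
 interpret conic_data k th th' lam p1 p2 r u w z Q D by (rule 1)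
 have "(1 / c, 1 / c') : quad_pairs k th th'" using c(1) C_divide[OF C_const] subfield_1[OF k] unfolding 1(1) by blast
 from conic_data.pair_type[OF conic_data_scale[OF this]] show ?thesis using c 1(1) by (simp add: mult.commute)
qed

lemma pair_type_data:
 assumes "pair_type k C lam Q D" shows "twist_data k C lam"
 using assms unfolding pair_type_def twist_data_def conic_data_def conic_data_axioms_def by blast

lemma pair_type_splitting: "pair_type k C lam Q D ==> splitting_field k D = fst ` C"
 unfolding pair_type_def using conic_data.splitting_field by blast

lemma pair_type_unique:
 assumes y: "y \<notin> alg_cl k" and t: "pair_type k C lam Q D" "pair_type k C' lam' Q D"
 shows "C' = C & (\<exists>c c'. (c, c') : C & c ~= 0 & c' ~= 0 & lam' = c * c' * lam)"
proof -
 obtain th th' p1 p2 r u w z where 1: "C = quad_pairs k th th'" "conic_data k th th' lam p1 p2 r u w z Q D"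
  using t(1) unfolding pair_type_def by blast
 obtain \<eta> \<eta>' PA PB R u' w' z' where 2: "C' = quad_pairs k \<eta> \<eta>'" "conic_data k \<eta> \<eta>' lam' PA PB R u' w' z' Q D"
  using t(2) unfolding pair_type_def by blast
 interpret A: conic_data k th th' lam p1 p2 r u w z Q D by (rule 1)
 interpret B: conic_data k \<eta> \<eta>' lam' PA PB R u' w' z' Q D by (rule 2)
 have "C' = C" unfolding 1 2
  by (rule quad_pairs_unique[OF B.quad_axioms A.quad_axioms]) (use A.splitting_field B.splitting_field in simp)
 moreover have "\<exists>c c'. (c, c') : C & c ~= 0 & c' ~= 0 & lam' = c * c' * lam" unfolding 1(1)
  using A.twist_parameter_data[OF y B.iota_splitting B.twist_parameter_iota[OF B.iota_parametrizes]] by blast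
 ultimately show ?thesis by blast
qed

lemma pair_type_exists:
 fixes k :: "'a::alg_closed_field set"
 assumes b: "base k zt" and t: "twist_data k C lam"
 shows "\<exists>Q D. (Q, D) : conic_pairs k & pair_type k C lam Q D"
proof -
 obtain th th' where qd: "quad k th th'" "C = quad_pairs k th th'" and lam: "lam : k" "lam ~= 0"
  using t unfolding twist_data_def by blast
 interpret quad k th th' by (rule qd)
 define \<delta> where "\<delta> = th - th'"
 have d: "\<delta> ~= 0" using ne by (simp add: \<delta>_def)
 \<comment> \<open>The conic is N(v1 + th v2) = lam v3^2 with N the norm of the algebra; its two
   factors are \<open>u\<close> and \<open>w\<close>, and p1, p2, r form the dual basis.\<close>
 define p1 p2 r u w z :: "'a ^ 3" where "p1 = vector [- th' / \<delta>, 1 / \<delta>, 0]" and "p2 = vector [- th / (- \<delta>), 1 / (- \<delta>), 0]"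
  and "r = vector [0, 0, 1]" and "u = vector [1, th, 0]" and "w = vector [1, th', 0]" and "z = vector [0, 0, 1]"
 define Q where "Q = {pt v | v. v ~= 0 & lin u v * lin w v = lam * (lin z v)\<^sup>2}"
 have k01: "0 : k" "1 : k" using k by (auto intro: subfield_0 subfield_1)
 have dC: "(\<delta>, - \<delta>) : quad_pairs k th th'" using C_diff[OF C_gen C_swap[OF C_gen]] by (simp add: \<delta>_def)
 have tC: "(- th', - th) : quad_pairs k th th'" using C_diff[OF C_const[OF k01(1)] C_swap[OF C_gen]] by simp
 have dd: "th / \<delta> - th' / \<delta> = 1" using d by (simp add: \<delta>_def flip: diff_divide_distrib)
 have data: "conic_data k th th' lam p1 p2 r u w z Q {#pt p1, pt p2#}"
 proof
  show "(p1 $ i, p2 $ i) : quad_pairs k th th'" for i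
   using exhaust_3[of i] C_divide[OF tC dC] C_divide[OF C_const[OF k01(2)] dC] C_const[OF k01(1)]
   by (auto simp: p1_def p2_def)
  show "(u $ i, w $ i) : quad_pairs k th th'" for i
   using exhaust_3[of i] C_const[OF k01(1)] C_const[OF k01(2)] C_gen by (auto simp: u_def w_def)
  show "r $ i : k" "z $ i : k" for i using exhaust_3[of i] k01 by (auto simp: r_def z_def)
  show 1: "lin u p1 = 1" "lin u p2 = 0" "lin u r = 0" "lin w p1 = 0" "lin w p2 = 1" "lin w r = 0"
   "lin z p1 = 0" "lin z p2 = 0" "lin z r = 1"
   using dd d by (simp_all add: lin_3 p1_def p2_def r_def u_def w_def z_def)
  fix v :: "'a ^ 3"
  have e: "v $ 1 = (th * (v $ 1 + th' * v $ 2) - th' * (v $ 1 + th * v $ 2)) / \<delta>"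
   "v $ 2 = ((v $ 1 + th * v $ 2) - (v $ 1 + th' * v $ 2)) / \<delta>"
   using d by (simp_all add: \<delta>_def field_simps)
  show "v = lin u v *s p1 + lin w v *s p2 + lin z v *s r"
  proof -
   have c: "(a *s p1 + b *s p2 + c *s r) $ 1 = (th * b - th' * a) / \<delta>" "(a *s p1 + b *s p2 + c *s r) $ 2 = (a - b) / \<delta>"
    "(a *s p1 + b *s p2 + c *s r) $ 3 = c" for a b c
    by (simp_all add: p1_def p2_def r_def diff_divide_distrib mult.commute)
   have l: "lin u v = v $ 1 + th * v $ 2" "lin w v = v $ 1 + th' * v $ 2" "lin z v = v $ 3"
    by (simp_all add: lin_3 u_def w_def z_def)
   show ?thesis unfolding vec_eq_iff forall_3 c unfolding l using e by simp
  qed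
 qed (use lam Q_def in auto)
 interpret conic_data k th th' lam p1 p2 r u w z Q "{#pt p1, pt p2#}" by (rule data)
 have "conic k Q" unfolding conic_def Let_def
 proof (rule exI[of _ 1], rule exI[of _ "th * th'"], rule exI[of _ "- lam"], rule exI[of _ "th + th'"],
   rule exI[of _ 0], rule exI[of _ 0], intro conjI)
  show "{1, th * th', - lam, th + th', 0, 0} \<subseteq> k" using k01 nm tr lam k by (auto intro: subfield_uminus)
  have F: "1 * (v$1)^2 + th * th' * (v$2)^2 + - lam * (v$3)^2 + (th + th') * v$1 * v$2 + 0 * v$1 * v$3 + 0 * v$2 * v$3
    = lin u v * lin w v - lam * (lin z v)\<^sup>2" for v :: "'a ^ 3"
   by (simp add: lin_3 u_def w_def z_def power2_eq_square algebra_simps)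
  show "Q = {pt v |v. v ~= 0 & 1 * (v$1)^2 + th * th' * (v$2)^2 + - lam * (v$3)^2 + (th + th') * v$1 * v$2 + 0 * v$1 * v$3 + 0 * v$2 * v$3 = 0}"
   unfolding F Q_def by simp
  show "\<forall>v :: 'a ^ 3. v ~= 0 & 1 * (v$1)^2 + th * th' * (v$2)^2 + - lam * (v$3)^2 + (th + th') * v$1 * v$2 + 0 * v$1 * v$3 + 0 * v$2 * v$3 = 0 -->
   \<not> (2 * 1 * v$1 + (th + th') * v$2 + 0 * v$3 = 0 & 2 * (th * th') * v$2 + (th + th') * v$1 + 0 * v$3 = 0 &
    2 * - lam * v$3 + 0 * v$1 + 0 * v$2 = 0)"
   unfolding F
  proof (intro allI impI notI)
   fix v :: "'a ^ 3"
   assume v: "v ~= 0 & lin u v * lin w v - lam * (lin z v)\<^sup>2 = 0"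
    and g: "2 * 1 * v$1 + (th + th') * v$2 + 0 * v$3 = 0 & 2 * (th * th') * v$2 + (th + th') * v$1 + 0 * v$3 = 0 &
     2 * - lam * v$3 + 0 * v$1 + 0 * v$2 = 0"
   have g1: "2 * v$1 + (th + th') * v$2 = 0" and g2: "2 * (th * th') * v$2 + (th + th') * v$1 = 0" using g by simp_all
   \<comment> \<open>Elimination between the two partial derivatives leaves the discriminant
     \<delta>^2 of the algebra, which is nonzero in every characteristic.\<close>
   have "\<delta> * \<delta> * v$2 = (th + th') * (2 * v$1 + (th + th') * v$2) - 2 * (2 * (th * th') * v$2 + (th + th') * v$1)"
    by (simp add: \<delta>_def algebra_simps)
   then have v2: "v $ 2 = 0" unfolding g1 g2 using d by simp
   have "\<delta> * \<delta> * v$1 = (th + th') * (2 * (th * th') * v$2 + (th + th') * v$1) - 2 * (th * th') * (2 * v$1 + (th + th') * v$2)"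
    by (simp add: \<delta>_def algebra_simps)
   then have v1: "v $ 1 = 0" unfolding g1 g2 using d by simp
   have "v $ 3 = 0" using v v1 v2 lam by (simp add: lin_3 u_def w_def z_def)
   then show False using v v1 v2 by (simp add: vec_eq_iff forall_3)
  qed
 qed
 then show ?thesis using conic_pairsI[OF b] pair_type qd(2) by blast
qed

section \<open>Isomorphic pairs have the same types\<close>

lemma values_at_regular:
 assumes k: "is_subfield k" and X: "X \<subseteq> proj_space" and f: "regular_map k X Y f" and P: "P : X"
 shows "values_at k (f P) \<subseteq> values_at k P"
proof
 fix s assume s: "s : values_at k (f P)"
 obtain v where v: "v ~= 0" "P = pt v" using X P by (metis proj_spaceE subsetD)
 obtain d g where g: "hmap k d g" "repr X g f" "\<forall>v\<in>P. g v ~= 0" by (rule regular_mapE[OF f k P])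
 have fP: "f P = pt (g v)" using g(2,3) P pt_self[of v] unfolding repr_def v(2) by simp
 obtain e a b where ab: "s = a (g v) / b (g v)" "hform k e a" "hform k e b" "b (g v) ~= 0"
  using s unfolding fP values_at_eq[OF k] by blast
 have gf: "hform k d (%v. g v $ i)" for i using g(1) unfolding hmap_def by blast
 show "s : values_at k P"
  using values_at_I[OF k hform_comp[OF k ab(2) gf] hform_comp[OF k ab(3) gf], of v] ab(1,4) unfolding v(2) by simp
qed

lemma isomorphism_left_inverse:
 assumes f: "isomorphism F X Y f" shows "\<exists>g. isomorphism F Y X g & (\<forall>P\<in>X. g (f P) = P)"
proof (rule isomorphism_inverse[OF f])
 fix g assume "isomorphism F Y X g" "!!P. P : X ==> g (f P) = P"
 then show ?thesis by (intro exI[of _ g]) simp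
qed

lemma values_at_isomorphism:
 assumes k: "is_subfield k" and X: "X \<subseteq> proj_space" "Y \<subseteq> proj_space" and f: "isomorphism k X Y f" and P: "P : X"
 shows "values_at k (f P) = values_at k P"
proof -
 have rf: "regular_map k X Y f" using f unfolding isomorphism_def by simp
 obtain g where g': "isomorphism k Y X g" "\<forall>P\<in>X. g (f P) = P" using isomorphism_left_inverse[OF f] by (elim exE conjE)
 have g: "regular_map k Y X g" "g (f P) = P" using g' P unfolding isomorphism_def by simp_all
 show ?thesis
  using values_at_regular[OF k X(1) rf P] values_at_regular[OF k X(2) g(1) regular_map_in[OF rf P]] g(2) by auto
qed

lemma splitting_field_subset:
 assumes f: "isomorphism k Q Q' f" and D: "set_mset D \<subseteq> Q"
 shows "splitting_field k (image_mset f D) \<subseteq> splitting_field k D"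
proof -
 have "rational_point F (f P)" if F: "is_subfield F" "k \<subseteq> F" "\<forall>P\<in>#D. rational_point F P" and P: "P \<in># D" for F P
 proof -
  have "regular_map k Q Q' f" using f unfolding isomorphism_def by simp
  then show ?thesis
   by (rule rational_point_regular[OF F(1) regular_map_mono[OF _ F(2)], of Q Q' f P]) (use F(3) P D in auto)
 qed
 then show ?thesis unfolding splitting_field_def by auto
qed

lemma image_mset_inverse: "(!!P. P \<in># D ==> g (f P) = P) ==> image_mset g (image_mset f D) = D"
 by (induction D) auto

lemma splitting_field_isomorphism:
 assumes f: "isomorphism k Q Q' f" and D: "set_mset D \<subseteq> Q"
 shows "splitting_field k (image_mset f D) = splitting_field k D"
proof
 show "splitting_field k (image_mset f D) \<subseteq> splitting_field k D" by (rule splitting_field_subset[OF f D])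
 obtain g where g: "isomorphism k Q' Q g" "\<forall>P\<in>Q. g (f P) = P" using isomorphism_left_inverse[OF f] by (elim exE conjE)
 have "image_mset g (image_mset f D) = D" using g(2) D by (intro image_mset_inverse) auto
 moreover have "set_mset (image_mset f D) \<subseteq> Q'" using D isomorphism_bij[OF f] by (auto simp: bij_betw_def)
 ultimately show "splitting_field k D \<subseteq> splitting_field k (image_mset f D)"
  using splitting_field_subset[OF g(1), of "image_mset f D"] by simp
qed

text \<open>The difference of two traces with the same coordinate is (lam - lam') / y. If it is
  nonzero it puts y, and then th, into \<open>L\<close>, against exactness of constants.\<close>

lemma twist_field_parameter:
 assumes t: "twist k zt th th' lam y" and t': "twist k zt th th' lam' y" and n: "th \<notin> k"
  and e: "twist_field k (quad_pairs k th th') lam y = twist_field k (quad_pairs k th th') lam' y"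
 shows "lam' = lam"
proof (rule ccontr)
 assume nl: "lam' ~= lam"
 interpret twist k zt th th' lam y by (rule t)
 have gen: "a * y + a' * l / y : L" if "(a, a') : C" "l = lam \<or> l = lam'" for a a' l
 proof -
  have "a * y + a' * l / y : twist_field k C l y"
   unfolding twist_field_def by (rule subsetD[OF adjoin_gen]) (use that(1) in blast)
  then show ?thesis using that(2) e by auto
 qed
 note [simp] = transcendental_nonzero[OF k u]
 have cl: "c : L" if "c : k" for c using that k_L by blast
 have C1: "(1, 1) : C" by (rule C_const[OF subfield_1[OF k]])
 have s1: "y + lam / y : L" "y + lam' / y : L" using gen[OF C1, of lam] gen[OF C1, of lam'] by simp_all
 have lk': "lam' : k" using t' unfolding twist_def twist_axioms_def by blast
 have "(y + lam / y) - (y + lam' / y) = (lam - lam') / y" by (simp add: diff_divide_distrib)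
 then have d1: "(lam - lam') / y : L" using subfield_diff[OF L s1] by simp
 have d2: "lam - lam' : L" by (rule subfield_diff[OF L cl[OF lam(1)] cl[OF lk']])
 have "(lam - lam') / ((lam - lam') / y) : L" by (rule subfield_divide[OF L d2 d1])
 then have yL: "y : L" using nl by simp
 have ly: "lam / y : L" by (rule subfield_divide[OF L cl[OF lam(1)] yL])
 have "th * y + th' * lam / y : L" by (rule gen[OF C_gen]) simp
 moreover have "(th + th') * (lam / y) : L" by (rule subfield_mult[OF L cl[OF tr] ly])
 ultimately have "th * y + th' * lam / y - (th + th') * (lam / y) : L" by (rule subfield_diff[OF L])
 moreover have "th * y + th' * lam / y - (th + th') * (lam / y) = th * (y - lam / y)" by (simp add: field_simps)
 ultimately have 1: "th * (y - lam / y) : L" by simp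
 have 2: "y - lam / y ~= 0"
 proof
  assume "y - lam / y = 0"
  then have "y ^ 2 = lam" by (simp add: field_simps power2_eq_square)
  then show False using transcendental_power[OF k u, of 2] lam alg_cl_subset[OF k] by auto
 qed
 have "th * (y - lam / y) / (y - lam / y) : L" by (rule subfield_divide[OF L 1 subfield_diff[OF L yL ly]])
 then have "th : L" using 2 by simp
 moreover have "th : alg_cl k" using C_alg(1)[OF C_gen] .
 ultimately show False using const n by blast
qed

text \<open>Composing a parametrization with \<open>f\<close> yields one of \<open>Q'\<close>, which
  gives normalized data with some parameter l over the same algebra. In the split case l can be
  prescribed; otherwise l is compared through function fields.\<close>

lemma isomorphic_pair_type:
 assumes b: "base k zt" and y: "y \<notin> alg_cl k" and t: "pair_type k C lam Q D"
  and QD': "(Q', D') : conic_pairs k" and f: "isomorphism k Q Q' f" "image_mset f D = D'"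
 shows "pair_type k C lam Q' D'"
proof -
 obtain th th' p1 p2 r u w z where 1: "C = quad_pairs k th th'" "conic_data k th th' lam p1 p2 r u w z Q D"
  using t unfolding pair_type_def by blast
 obtain \<eta> \<eta>' lam0 q1 q2 r' u' w' z' where 2: "conic_data k \<eta> \<eta>' lam0 q1 q2 r' u' w' z' Q' D'"
  using conic_pairs_data[OF b QD'] by blast
 interpret A: conic_data k th th' lam p1 p2 r u w z Q D by (rule 1)
 interpret B: conic_data k \<eta> \<eta>' lam0 q1 q2 r' u' w' z' Q' D' by (rule 2)
 have DQ: "set_mset D \<subseteq> Q"
  unfolding A.D_set using A.p_nonzero A.dual by (auto intro!: A.Q_pt simp: A.on_Q_def)
 have sf: "splitting_field k D' = A.q" using splitting_field_isomorphism[OF f(1) DQ] f(2) A.splitting_field by simp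
 have C: "B.C = A.C" by (rule quad_pairs_unique[OF B.quad_axioms A.quad_axioms]) (use sf B.splitting_field in simp)
 have fq: "isomorphism A.q Q Q' f" by (rule isomorphism_mono[OF f(1) A.k_q])
 have s: "splitting_iso k Q' D' (f \<circ> A.\<iota>)"
  unfolding splitting_iso_def sf
 proof
  show "isomorphism A.q proj_space Q' (f \<circ> A.\<iota>)"
   by (rule isomorphism_comp[OF A.q order_refl A.Q_proj A.iota_isomorphism[OF A.q order_refl] fq])
  show "(f \<circ> A.\<iota>) ` {pt_zero, pt_infinity} = set_mset D'"
   unfolding f(2)[symmetric] by (auto simp: A.iota_zero A.iota_infinity A.D_set)
 qed
 have "B.reparam lam (f \<circ> A.\<iota>)" by (rule B.all_parametrizations[OF y s]) (use A.lam in simp)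
 then obtain l P1' P2' U' W' where d: "conic_data k \<eta> \<eta>' l P1' P2' r' U' W' z' Q' D'"
  "parametrizes l P1' P2' r' (f \<circ> A.\<iota>)" "\<eta> : k --> l = lam" unfolding B.reparam_def by blast
 interpret E: conic_data k \<eta> \<eta>' l P1' P2' r' U' W' z' Q' D' by (rule d)
 have "l = lam"
 proof (cases "\<eta> : k")
  case False
  \<comment> \<open>At this point both conics have the coordinate y in common, so equal function
    fields are twist fields with the same y and must have the same parameter.\<close>
  define x where "x = (vector [y, 1] :: 'a ^ 2)"
  have x0: "x ~= 0" by (simp add: x_def vector2_eq_0)
  have y0: "y ~= 0" by (rule transcendental_nonzero[OF A.k y])
  have PQ: "A.\<iota> (pt x) : Q" by (rule A.iota_inv(4)[OF proj_spaceI[OF x0]])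
  have fP: "f (A.\<iota> (pt x)) = E.\<iota> (pt x)" using d(2) proj_spaceI[OF x0] unfolding E.parametrizes_iff by simp
  have 1: "values_at k (A.\<iota> (pt x)) = twist_field k A.C lam y"
  proof -
   have "A.\<iota> (pt x) = pt ((1 / y) *s A.H x)" unfolding A.iota_pt using y0 by (intro pt_scale[symmetric]) simp
   moreover have e: "(1 / y) *s A.H x = A.comb y (lam / y) 1"
    using y0 by (simp add: A.H_def A.comb_scale x_def power2_eq_square)
   moreover have "A.on_Q (A.comb y (lam / y) 1)" using y0 by (simp add: A.on_Q_def A.comb_eq_0)
   ultimately show ?thesis using A.values_at_twist_field[of "A.comb y (lam / y) 1"] by simp
  qed
  have 2: "values_at k (E.\<iota> (pt x)) = twist_field k B.C l y"
  proof -
   have "E.\<iota> (pt x) = pt ((1 / y) *s E.H x)" unfolding E.iota_pt using y0 by (intro pt_scale[symmetric]) simp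
   moreover have e: "(1 / y) *s E.H x = E.comb y (l / y) 1"
    using y0 by (simp add: E.H_def E.comb_scale x_def power2_eq_square)
   moreover have "E.on_Q (E.comb y (l / y) 1)" using y0 by (simp add: E.on_Q_def E.comb_eq_0)
   ultimately show ?thesis using E.values_at_twist_field[of "E.comb y (l / y) 1"] by simp
  qed
  have "twist_field k B.C l y = twist_field k B.C lam y"
   using values_at_isomorphism[OF A.k A.Q_proj B.Q_proj f(1) PQ] unfolding fP 1 2 C .
  then show ?thesis
   using twist_field_parameter[of k zt \<eta> \<eta>' l y lam] False b B.quad_axioms E.lam A.lam y
   unfolding twist_def twist_axioms_def by simp
 qed (use d(3) in blast)
 then show ?thesis using E.pair_type unfolding 1(1) C by simp
qed

section \<open>The correspondence\<close>

text \<open>The relation \<open>T\<close> need not be functional in either direction. Compatibility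
  with both equivalences makes the partners of a class form exactly one class.\<close>

lemma quotient_bij:
 assumes r: "equiv A r" and s: "equiv B s" and T: "!!x e. T x e ==> x : A & e : B"
  and ex: "!!x. x : A ==> \<exists>e. T x e" "!!e. e : B ==> \<exists>x. T x e"
  and rel: "!!x x' e e'. T x e ==> T x' e' ==> (x, x') : r \<longleftrightarrow> (e, e') : s"
 shows "bij_betw (%X. {e. \<exists>x\<in>X. T x e}) (A // r) (B // s)"
proof -
 define F where "F X = {e. \<exists>x\<in>X. T x e}" for X
 have F: "F (r `` {x}) = s `` {e}" if t: "T x e" for x e
 proof (intro equalityI subsetI)
  fix e' assume "e' : F (r `` {x})"
  then obtain x' where "(x, x') : r" "T x' e'" unfolding F_def by blast
  then show "e' : s `` {e}" using rel[OF t] by blast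
 next
  fix e' assume e: "e' : s `` {e}"
  then have "e' : B" using s unfolding equiv_def by blast
  then obtain x' where x': "T x' e'" using ex(2) by blast
  then have "(x, x') : r" using rel[OF t x'] e by blast
  then show "e' : F (r `` {x})" using x' unfolding F_def by blast
 qed
 have "bij_betw F (A // r) (B // s)"
  unfolding bij_betw_def
 proof
  show "inj_on F (A // r)"
  proof (rule inj_onI)
   fix X X' assume "X : A // r" "X' : A // r" and eq: "F X = F X'"
   then obtain x x' where x: "x : A" "X = r `` {x}" "x' : A" "X' = r `` {x'}" by (auto elim!: quotientE)
   obtain e e' where t: "T x e" "T x' e'" using ex(1) x by blast
   have "s `` {e} = s `` {e'}" using eq F[OF t(1)] F[OF t(2)] x by simp
   then have "(e, e') : s" using eq_equiv_class[OF _ s, of e e'] T[OF t(2)] by blast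
   then have "(x, x') : r" using rel[OF t] by blast
   then show "X = X'" unfolding x using equiv_class_eq[OF r] by blast
  qed
  show "F ` (A // r) = B // s"
  proof (intro equalityI subsetI)
   fix Y assume "Y : F ` (A // r)"
   then obtain x where x: "x : A" "Y = F (r `` {x})" by (auto elim!: quotientE)
   obtain e where t: "T x e" using ex(1) x by blast
   show "Y : B // s" unfolding x(2) F[OF t] using T[OF t] by (intro quotientI) blast
  next
   fix Y assume "Y : B // s"
   then obtain e where e: "e : B" "Y = s `` {e}" by (auto elim!: quotientE)
   obtain x where t: "T x e" using ex(2) e by blast
   have "r `` {x} : A // r" using T[OF t] by (intro quotientI) blast
   then show "Y : F ` (A // r)" unfolding e(2) F[OF t, symmetric] by (rule imageI)
  qed
 qed
 then show ?thesis unfolding F_def[abs_def] .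
qed

lemma equiv_conic_pairs:
 assumes b: "base k zt" shows "equiv (conic_pairs k) (conic_pair_rel k)"
proof -
 have k: "is_subfield k" using b unfolding base_def by simp
 have proj: "Q \<subseteq> proj_space" "set_mset D \<subseteq> Q" if QD: "(Q, D) : conic_pairs k" for Q D
  using QD unfolding conic_pairs_def conic_def Let_def by (auto intro!: proj_spaceI)
 show ?thesis
 proof (rule equivI)
  show "conic_pair_rel k \<subseteq> conic_pairs k \<times> conic_pairs k" unfolding conic_pair_rel_def by auto
  show "refl_on (conic_pairs k) (conic_pair_rel k)"
  proof (rule refl_onI)
   fix x assume x: "x : conic_pairs k"
   obtain Q D where QD: "x = (Q, D)" by (cases x)
   show "(x, x) : conic_pair_rel k" unfolding QD conic_pair_rel_def
    using x isomorphism_id[OF k proj(1)[of Q D]] unfolding QD by (auto intro!: exI[of _ id])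
  qed
  show "sym (conic_pair_rel k)"
  proof (rule symI)
   fix x x' assume "(x, x') : conic_pair_rel k"
   then obtain Q D Q' D' f where x: "x = (Q, D)" "x' = (Q', D')" "(Q, D) : conic_pairs k" "(Q', D') : conic_pairs k"
    "isomorphism k Q Q' f" "image_mset f D = D'" unfolding conic_pair_rel_def by auto
   obtain g where g: "isomorphism k Q' Q g" "\<forall>P\<in>Q. g (f P) = P"
    using isomorphism_left_inverse[OF x(5)] by (elim exE conjE)
   have "image_mset g D' = D" unfolding x(6)[symmetric] using g(2) proj(2)[OF x(3)] by (intro image_mset_inverse) auto
   then show "(x', x) : conic_pair_rel k" unfolding x(1,2) conic_pair_rel_def using x(3,4) g(1) by auto
  qed
  show "trans (conic_pair_rel k)"
  proof (rule transI)
   fix x x' x'' assume "(x, x') : conic_pair_rel k" "(x', x'') : conic_pair_rel k"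
   then obtain Q D Q' D' Q'' D'' f g where x: "x = (Q, D)" "x'' = (Q'', D'')" "(Q, D) : conic_pairs k" "(Q', D') : conic_pairs k"
    "(Q'', D'') : conic_pairs k" "isomorphism k Q Q' f" "image_mset f D = D'" "isomorphism k Q' Q'' g" "image_mset g D' = D''"
    unfolding conic_pair_rel_def by auto
   have "isomorphism k Q Q'' (g \<circ> f)"
    by (rule isomorphism_comp[OF k proj(1)[OF x(3)] proj(1)[OF x(4)] x(6,8)])
   moreover have "image_mset (g \<circ> f) D = D''" unfolding x(9)[symmetric] x(7)[symmetric] by (simp add: multiset.map_comp)
   ultimately show "(x, x'') : conic_pair_rel k" unfolding x(1,2) conic_pair_rel_def using x(3,5) by auto
  qed
 qed
qed

context base
begin

text \<open>Symmetry and transitivity are read off from types, which bi-isomorphisms transport,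
  without inverting or composing squares of isomorphisms.\<close>

lemma equiv_bitwists:
 assumes y: "y \<notin> kb" "y ^ 3 = x"
 shows "equiv (bitwists k (adjoin k {x}, adjoin (adjoin k {x}) {y})) (bitwist_rel k (adjoin k {x}, adjoin (adjoin k {x}) {y}))"
  (is "equiv ?B ?s")
proof (rule equivI)
 note ty = bitwist_ext_type[OF y]
 show "?s \<subseteq> ?B \<times> ?B" unfolding bitwist_rel_def by auto
 show "refl_on ?B ?s"
 proof (rule refl_onI)
  fix e assume e: "e : ?B"
  then obtain C lam where "ext_type k C lam e" using ty by blast
  then show "(e, e) : ?s" unfolding bitwist_rel_def using e ext_type_bi_isomorphic by blast
 qed
 show "sym ?s"
 proof (rule symI)
  fix e e' assume "(e, e') : ?s"
  then have e: "e : ?B" "e' : ?B" "bi_isomorphic k e e'" unfolding bitwist_rel_def by auto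
  then obtain C lam where t: "ext_type k C lam e" using ty by blast
  then show "(e', e) : ?s" unfolding bitwist_rel_def
   using e ext_type_bi_isomorphic[OF ext_type_transport[OF t e(3)] t] by blast
 qed
 show "trans ?s"
 proof (rule transI)
  fix e e' e'' assume "(e, e') : ?s" "(e', e'') : ?s"
  then have e: "e : ?B" "e'' : ?B" "bi_isomorphic k e e'" "bi_isomorphic k e' e''" unfolding bitwist_rel_def by auto
  then obtain C lam where t: "ext_type k C lam e" using ty by blast
  have "ext_type k C lam e''" by (rule ext_type_transport[OF ext_type_transport[OF t e(3)] e(4)])
  then show "(e, e'') : ?s" unfolding bitwist_rel_def using e ext_type_bi_isomorphic[OF t] by blast
 qed
qed

text \<open>Both sides say that the algebra is the one generated by (zt, zt^2). The case of zt in k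
  is covered: it is then the split algebra.\<close>

lemma splitting_field_galois:
 assumes t: "pair_type k C lam Q D"
 shows "(zt, zt ^ 2) : C \<longleftrightarrow> splitting_field k D = adjoin k {zt}"
proof -
 obtain th th' where qd: "quad k th th'" and C: "C = quad_pairs k th th'"
  using pair_type_data[OF t] unfolding twist_data_def by blast
 interpret quad k th th' by (rule qd)
 have S: "splitting_field k D = adjoin k {th}" using pair_type_splitting[OF t] unfolding C fst_C .
 have "(zt - 1) * (zt ^ 2 + zt + 1) = zt ^ 3 - 1" by (simp add: power2_eq_square power3_eq_cube algebra_simps)
 then have z: "zt ^ 2 + zt + 1 = 0" using z3 z1 by simp
 have z0: "zt ~= 0" using z3 by auto
 have zz: "zt ^ 2 ~= zt"
 proof
  assume "zt ^ 2 = zt"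
  then have "zt * (zt - 1) = 0" by (simp add: power2_eq_square algebra_simps)
  then show False using z0 z1 by simp
 qed
 show ?thesis
 proof
  assume "(zt, zt ^ 2) : C"
  then obtain al bt where ab: "al : k" "bt : k" "zt = al + bt * th" "zt ^ 2 = al + bt * th'" unfolding C by (rule C_E)
  have b: "bt ~= 0" using ab(3,4) zz by auto
  have kz: "k \<subseteq> adjoin k {w}" for w by (rule adjoin_subset)
  have "zt : adjoin k {th}" unfolding ab(3)
   using ab(1,2) kz adjoin_gen[of "{th}" k] by (intro subfield_add subfield_mult subfield_adjoin) auto
  moreover have "(zt - al) / bt : adjoin k {zt}"
   using ab(1,2) kz adjoin_gen[of "{zt}" k] by (intro subfield_divide subfield_diff subfield_adjoin) auto
  then have "th : adjoin k {zt}" using ab(3) b by simp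
  ultimately have "adjoin k {th} = adjoin k {zt}" by (intro adjoin_transform)
  then show "splitting_field k D = adjoin k {zt}" unfolding S .
 next
  assume e: "splitting_field k D = adjoin k {zt}"
  have "zt + zt ^ 2 = - 1" using z by (simp add: eq_neg_iff_add_eq_0 algebra_simps)
  then have Z: "quad k zt (zt ^ 2)"
   using k zz z3 subfield_1[OF k] subfield_uminus[OF k] by unfold_locales (auto simp: power2_eq_square power3_eq_cube mult.assoc)
  interpret Z: quad k zt "zt ^ 2" by (rule Z)
  have "C = Z.C" unfolding C by (rule quad_pairs_unique[OF qd Z]) (use S e fst_C Z.fst_C in simp)
  then show "(zt, zt ^ 2) : C" using Z.C_gen by simp
 qed
qed

end

context base
begin

lemma types_bi_isomorphic:
 assumes y: "y \<notin> kb" and x: "x : conic_pairs k" "x' : conic_pairs k"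
  and t: "pair_type k C lam (fst x) (snd x)" "ext_type k C lam e"
  and t': "pair_type k C' lam' (fst x') (snd x')" "ext_type k C' lam' e'"
 shows "(x, x') : conic_pair_rel k \<longleftrightarrow> bi_isomorphic k e e'"
proof
 assume "(x, x') : conic_pair_rel k"
 then obtain f where f: "isomorphism k (fst x) (fst x') f" "image_mset f (snd x) = snd x'"
  unfolding conic_pair_rel_def by auto
 have "pair_type k C lam (fst x') (snd x')"
  by (rule isomorphic_pair_type[OF base_axioms y t(1) _ f]) (use x in simp)
 then obtain c c' where c: "C' = C" "(c, c') : C" "c ~= 0" "c' ~= 0" "lam' = c * c' * lam"
  using pair_type_unique[OF y _ t'(1)] by blast
 have "ext_type k C' lam' e" unfolding c(1,5) by (rule ext_type_scale[OF t(2) c(2-4)])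
 then show "bi_isomorphic k e e'" using ext_type_bi_isomorphic t'(2) by blast
next
 assume "bi_isomorphic k e e'"
 then have "ext_type k C lam e'" by (rule ext_type_transport[OF t(2)])
 then obtain c c' where c: "C' = C" "(c, c') : C" "c ~= 0" "c' ~= 0" "lam' = c * c' * lam"
  using ext_type_unique t'(2) by blast
 have "pair_type k C' lam' (fst x) (snd x)" unfolding c(1,5) by (rule pair_type_scale[OF t(1) c(2-4)])
 then show "(x, x') : conic_pair_rel k"
  using same_pair_type_isomorphic[OF _ t'(1)] x unfolding conic_pair_rel_def by (auto simp: case_prod_beta)
qed

end

theorem theorem3p4:
  fixes k :: "'a::alg_closed_field set" and x y \<zeta> :: 'a
  assumes "is_subfield k" and "perfect_subfield k" and "CHAR('a) \<noteq> 3"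
    and "\<not> algebraic_over k x" and "y ^ 3 = x"
    and "\<zeta> ^ 3 = 1" and "\<zeta> \<noteq> 1"
  shows
    "let K = adjoin k {x}; E = (K, adjoin K {y}) in
     cubic_extension k K (adjoin K {y}) \<and>
     (\<forall>(Q, D) \<in> conic_pairs k. let q = splitting_field k D in
        (\<forall>P\<in>#D. rational_point q P) \<and>
        (q \<noteq> k \<longrightarrow> (\<exists>!\<sigma>. \<sigma> \<in> extensional q \<and> nontrivial_aut k q \<sigma>)) \<and>
        (\<exists>\<iota>. splitting_iso k Q D \<iota>) \<and>
        (\<exists>\<xi>. generic_point k Q \<xi>) \<and>
        (\<forall>\<iota>. splitting_iso k Q D \<iota> \<longrightarrow>
           (\<exists>lam. twist_parameter k D \<iota> lam) \<and>
           (\<forall>lam. twist_parameter k D \<iota> lam \<longrightarrow>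
              regular_map k Q Q (phi \<iota> lam) \<and>
              conjugate_over (alg_cl k) P1 (phi0 lam) Q (phi \<iota> lam) \<and>
              {P\<in>Q. ramified_at Q Q (phi \<iota> lam) P} = set_mset D \<and>
              (\<forall>\<xi>. generic_point k Q \<xi> \<longrightarrow> pullback_ext k (phi \<iota> lam) \<xi> \<in> bitwists k E)))) \<and>
     equiv (conic_pairs k) (conic_pair_rel k) \<and>
     equiv (bitwists k E) (bitwist_rel k E) \<and>
     (\<exists>\<Phi>. bij_betw \<Phi> (conic_pairs k // conic_pair_rel k) (bitwists k E // bitwist_rel k E) \<and>
        (\<forall>(Q, D) \<in> conic_pairs k.
           (\<forall>E'. constructed_ext k Q D E' \<longrightarrow> E' \<in> \<Phi> (conic_pair_rel k `` {(Q, D)})) \<and>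
           (\<forall>(K', L') \<in> \<Phi> (conic_pair_rel k `` {(Q, D)}).
              galois_ext K' L' \<longleftrightarrow> splitting_field k D = adjoin k {\<zeta>}))) \<and>
     E \<in> bitwists k E \<and>
     (\<forall>(K', L') \<in> bitwists k E. purely_cubic K' L' \<longleftrightarrow> bi_isomorphic k (K', L') E)"
proof -
 have three: "(3::'a) ~= 0"
 proof
  assume "(3::'a) = 0"
  then have d: "CHAR('a) dvd 3" using of_nat_eq_0_iff_char_dvd[where 'a = 'a, of 3] by simp
  have "CHAR('a) ~= 1" using of_nat_eq_0_iff_char_dvd[where 'a = 'a, of 1] by simp
  moreover have "CHAR('a) ~= 0" using d by (metis dvd_0_left_iff zero_neq_numeral)
  moreover have "CHAR('a) ~= 2" using d by auto
  moreover have "CHAR('a) \<le> 3" using d by (rule dvd_imp_le) simp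
  ultimately show False using assms(3) by linarith
 qed
 interpret base k \<zeta> by unfold_locales (use assms three in auto)
 have y: "y \<notin> kb"
 proof
  assume "y : kb"
  then have "x : kb" using subfield_power[OF kb, of y 3] assms(5) by simp
  then show False using assms(4) by (simp add: alg_cl_def)
 qed
 define E where "E = (adjoin k {x}, adjoin (adjoin k {x}) {y})"
 have EB: "E : bitwists k E"
  unfolding E_def by (rule ext_type_bitwist[OF y assms(5) trivial_type[OF y assms(5)]])
 then have cubic: "cubic_extension k (adjoin k {x}) (adjoin (adjoin k {x}) {y})"
  unfolding bitwists_def by (simp add: E_def)
 note type = bitwist_ext_type[OF y assms(5), folded E_def] and bitwist = ext_type_bitwist[OF y assms(5), folded E_def]
 \<comment> \<open>Partners are a pair and a bi-twist sharing some representative of the invariant;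
   this makes the correspondence independent of all choices in the construction.\<close>
 define T where "T x e \<longleftrightarrow> x : conic_pairs k & e : bitwists k E &
   (\<exists>C lam. pair_type k C lam (fst x) (snd x) & ext_type k C lam e)" for x :: "('a, 3) ppoint set \<times> ('a, 3) ppoint multiset" and e
 define \<Phi> where "\<Phi> X = {e. \<exists>x\<in>X. T x e}" for X
 have pt: "\<exists>C lam. pair_type k C lam (fst x) (snd x)" if "x : conic_pairs k" for x
  using conic_pairs_data[OF base_axioms, of "fst x" "snd x"] that unfolding pair_type_def by (metis prod.collapse)
 have bij: "bij_betw \<Phi> (conic_pairs k // conic_pair_rel k) (bitwists k E // bitwist_rel k E)"
  unfolding \<Phi>_def[abs_def]
 proof (rule quotient_bij)
  show "equiv (conic_pairs k) (conic_pair_rel k)" by (rule equiv_conic_pairs[OF base_axioms])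
  show "equiv (bitwists k E) (bitwist_rel k E)" unfolding E_def by (rule equiv_bitwists[OF y assms(5)])
  show "x : conic_pairs k & e : bitwists k E" if "T x e" for x e using that unfolding T_def by simp
  show "\<exists>e. T x e" if x: "x : conic_pairs k" for x
  proof -
   obtain C lam where p: "pair_type k C lam (fst x) (snd x)" using pt[OF x] by blast
   then obtain e where e: "ext_type k C lam e"
    unfolding pair_type_def using conic_data.exists_constructed[OF _ y] by metis
   show ?thesis unfolding T_def using x p e bitwist[OF e] by blast
  qed
  show "\<exists>x. T x e" if e: "e : bitwists k E" for e
  proof -
   obtain C lam where t: "ext_type k C lam e" using type[OF e] by blast
   then have "twist_data k C lam" unfolding ext_type_def by simp
   then obtain Q D where "(Q, D) : conic_pairs k" "pair_type k C lam Q D"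
    using pair_type_exists[OF base_axioms] by blast
   then have "T (Q, D) e" unfolding T_def using t e by auto
   then show ?thesis by blast
  qed
  show "(x, x') : conic_pair_rel k \<longleftrightarrow> (e, e') : bitwist_rel k E" if t: "T x e" "T x' e'" for x x' e e'
   using types_bi_isomorphic[OF y] t unfolding T_def bitwist_rel_def by blast
 qed
 have constructed: "E' : \<Phi> (conic_pair_rel k `` {(Q, D)})"
  if QD: "(Q, D) : conic_pairs k" and E': "constructed_ext k Q D E'" for Q D E'
 proof -
  obtain C lam where p: "pair_type k C lam Q D" using pt[OF QD] by auto
  have t: "ext_type k C lam E'" using p conic_data.constructed_type[OF _ base_axioms y E'] unfolding pair_type_def by blast
  have "T (Q, D) E'" unfolding T_def using QD p t bitwist[OF t] by auto
  moreover have "((Q, D), (Q, D)) : conic_pair_rel k"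
   using equiv_conic_pairs[OF base_axioms] QD unfolding equiv_def by (metis refl_onD)
  ultimately show ?thesis unfolding \<Phi>_def by blast
 qed
 have galois: "galois_ext K' L' \<longleftrightarrow> splitting_field k D = adjoin k {\<zeta>}"
  if QD: "(Q, D) : conic_pairs k" and KL: "(K', L') : \<Phi> (conic_pair_rel k `` {(Q, D)})" for Q D K' L'
 proof -
  obtain Q' D' where r: "((Q, D), (Q', D')) : conic_pair_rel k" and T: "T (Q', D') (K', L')"
   using KL unfolding \<Phi>_def by auto
  obtain C lam where p: "pair_type k C lam Q' D'" and t: "ext_type k C lam (K', L')" using T unfolding T_def by auto
  have sm: "sym (conic_pair_rel k)" using equiv_conic_pairs[OF base_axioms] unfolding equiv_def by simp
  have "((Q', D'), (Q, D)) : conic_pair_rel k" by (rule symD[OF sm r])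
  then have "\<exists>g. isomorphism k Q' Q g & image_mset g D' = D" unfolding conic_pair_rel_def by simp
  then obtain g where g: "isomorphism k Q' Q g" "image_mset g D' = D" by (elim exE conjE)
  have "pair_type k C lam Q D" by (rule isomorphic_pair_type[OF base_axioms y p QD g])
  then show ?thesis using splitting_field_galois galois_iff[OF t] by blast
 qed
 have pairs: "\<forall>(Q, D) \<in> conic_pairs k. let q = splitting_field k D in
    (\<forall>P\<in>#D. rational_point q P) &
    (q ~= k --> (\<exists>!\<sigma>. \<sigma> \<in> extensional q & nontrivial_aut k q \<sigma>)) &
    (\<exists>\<iota>. splitting_iso k Q D \<iota>) &
    (\<exists>\<xi>. generic_point k Q \<xi>) &
    (\<forall>\<iota>. splitting_iso k Q D \<iota> -->
      (\<exists>lam. twist_parameter k D \<iota> lam) &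
      (\<forall>lam. twist_parameter k D \<iota> lam -->
       regular_map k Q Q (phi \<iota> lam) &
       conjugate_over (alg_cl k) P1 (phi0 lam) Q (phi \<iota> lam) &
       {P\<in>Q. ramified_at Q Q (phi \<iota> lam) P} = set_mset D &
       (\<forall>\<xi>. generic_point k Q \<xi> --> pullback_ext k (phi \<iota> lam) \<xi> \<in> bitwists k E)))"
 proof (intro ballI, clarify)
  fix Q D assume "(Q, D) : conic_pairs k"
  then obtain th th' lam p1 p2 r u w z where d: "conic_data k th th' lam p1 p2 r u w z Q D"
   using conic_pairs_data[OF base_axioms] by blast
  show "let q = splitting_field k D in
    (\<forall>P\<in>#D. rational_point q P) &
    (q ~= k --> (\<exists>!\<sigma>. \<sigma> \<in> extensional q & nontrivial_aut k q \<sigma>)) &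
    (\<exists>\<iota>. splitting_iso k Q D \<iota>) &
    (\<exists>\<xi>. generic_point k Q \<xi>) &
    (\<forall>\<iota>. splitting_iso k Q D \<iota> -->
      (\<exists>lam. twist_parameter k D \<iota> lam) &
      (\<forall>lam. twist_parameter k D \<iota> lam -->
       regular_map k Q Q (phi \<iota> lam) &
       conjugate_over (alg_cl k) P1 (phi0 lam) Q (phi \<iota> lam) &
       {P\<in>Q. ramified_at Q Q (phi \<iota> lam) P} = set_mset D &
       (\<forall>\<xi>. generic_point k Q \<xi> --> pullback_ext k (phi \<iota> lam) \<xi> \<in> bitwists k E)))"
   by (rule conic_data.pair_properties[OF d base_axioms y assms(5), folded E_def])
 qed
 have purely: "\<forall>(K', L') \<in> bitwists k E. purely_cubic K' L' \<longleftrightarrow> bi_isomorphic k (K', L') E"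
  using type purely_cubic_iff[OF y assms(5), folded E_def] by blast
 have corr: "\<exists>\<Phi>. bij_betw \<Phi> (conic_pairs k // conic_pair_rel k) (bitwists k E // bitwist_rel k E) &
    (\<forall>(Q, D) \<in> conic_pairs k.
      (\<forall>E'. constructed_ext k Q D E' --> E' : \<Phi> (conic_pair_rel k `` {(Q, D)})) &
      (\<forall>(K', L') \<in> \<Phi> (conic_pair_rel k `` {(Q, D)}).
       galois_ext K' L' \<longleftrightarrow> splitting_field k D = adjoin k {\<zeta>}))"
  using constructed galois by (intro exI[of _ \<Phi>] conjI bij) blast
 show ?thesis
  unfolding Let_def[of "adjoin k {x}"] E_def[symmetric] Let_def[of E]
  by (intro conjI cubic pairs corr EB purely equiv_conic_pairs[OF base_axioms]
    equiv_bitwists[OF y assms(5), folded E_def])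
qed

end
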